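(* Let $N\ge1$, $\alpha\in(0,1]$, and let $(r_n)_{n\ge0}$ satisfy $0\le r_n<1$ and $\lim_{n\to\infty}n^\gamma r_n=c>0$ for some $\gamma\in(\tfrac12,1]$. Let $Z_n(i)\in[0,1]$ ($i=1,\dots,N$, $n\ge0$) evolve by $Z_{n+1}(i)=(1-r_n)Z_n(i)+r_n I_{n+1}(i)$, where, with $\mathcal F_n=\sigma(Z_k(i):\,1\le i\le N,\ 0\le k\le n)$ and $Z_n=\frac1N\sum_{i=1}^N Z_n(i)$, the $I_{n+1}(1),\dots,I_{n+1}(N)\in\{0,1\}$ are conditionally independent given $\mathcal F_n$ with $P(I_{n+1}(i)=1\mid\mathcal F_n)=(1-\alpha)Z_n(i)+\alpha Z_n$. Assume the law of $(Z_0(1),\dots,Z_0(N))$ is permutation invariant, $E[Z_0(i)]=\tfrac12$ and $E[Z_0(1-Z_0)]>0$. Let $Z$ be the almost sure limit of $Z_n$. Then $P(Z\in\{0,1\})<1$ and $P(Z=z)=0$ for all $z\in(0,1)$. Moreover \[\Big(t^{2\gamma-1}n^{\gamma-\frac12}(Z_{\lfloor nt\rfloor}-Z)\Big)_{t\ge0}\xrightarrow{d}(W_{V_t})_{t\ge0},\qquad V_t=\frac{c^2}{N(2\gamma-1)}Z(1-Z)t^{2\gamma-1},\] where $W=(W_t)_{t\ge0}$ is a Wiener process independent of $V=(V_t)_{t\ge0}$, and convergence in distribution is with respect to the Skorohod topology on $D[0,+\infty)$.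
   Context: This is the interacting model with $\rho=1$ (pure reinforcement, no drift towards a fixed $q$). The almost sure limit $Z$ of $Z_n$ exists since $(Z_n)$ is then a bounded martingale. *)

theory Defs
  imports "HOL-Probability.Probability" "HOL-Combinatorics.Permutations"
begin

section \<open>The Skorohod space D[0,+oo) with the Skorohod (J1) metric (Ethier--Kurtz, Sec. 3.5)\<close>

text \<open>Paths are functions real to real; only their values on [0,+oo) matter.\<close>

definition cadlag :: "(real \<Rightarrow> real) \<Rightarrow> bool" where
  "cadlag x \<longleftrightarrow> (\<forall>t\<ge>0. continuous (at_right t) x) \<and> (\<forall>t>0. \<exists>l. (x \<longlongrightarrow> l) (at_left t))"

definition skD :: "(real \<Rightarrow> real) set" where
  "skD = {x. cadlag x}"

definition sk_Lambda :: "(real \<Rightarrow> real) set" where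
  "sk_Lambda = {l. strict_mono_on {0..} l \<and> continuous_on {0..} l \<and> l ` {0..} = {0..} \<and>
     bdd_above ((\<lambda>(s,t). \<bar>ln ((l s - l t) / (s - t))\<bar>) ` {(s,t). 0 \<le> t \<and> t < s})}"

definition sk_gamma :: "(real \<Rightarrow> real) \<Rightarrow> real" where
  "sk_gamma l = (SUP (s,t)\<in>{(s,t). 0 \<le> t \<and> t < (s::real)}. \<bar>ln ((l s - l t) / (s - t))\<bar>)"

definition sk_dist_u :: "(real \<Rightarrow> real) \<Rightarrow> (real \<Rightarrow> real) \<Rightarrow> (real \<Rightarrow> real) \<Rightarrow> real \<Rightarrow> real" where
  "sk_dist_u x y l u = (SUP t\<in>{0..}. min 1 \<bar>x (min t u) - y (min (l t) u)\<bar>)"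

definition sk_dist :: "(real \<Rightarrow> real) \<Rightarrow> (real \<Rightarrow> real) \<Rightarrow> real" where
  "sk_dist x y = (INF l\<in>sk_Lambda. max (sk_gamma l)
       (enn2real (\<integral>\<^sup>+ u. ennreal (exp (- u) * sk_dist_u x y l u) * indicator {0..} u \<partial>lborel)))"

definition sk_continuous :: "((real \<Rightarrow> real) \<Rightarrow> real) \<Rightarrow> bool" where
  "sk_continuous f \<longleftrightarrow> (\<forall>x\<in>skD. \<forall>e>0. \<exists>d>0. \<forall>y\<in>skD. sk_dist x y < d \<longrightarrow> \<bar>f y - f x\<bar> < e)"

definition conv_distr_skorohod ::
  "'a measure \<Rightarrow> (nat \<Rightarrow> 'a \<Rightarrow> real \<Rightarrow> real) \<Rightarrow> 'b measure \<Rightarrow> ('b \<Rightarrow> real \<Rightarrow> real) \<Rightarrow> bool" where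
  "conv_distr_skorohod M X M' Y \<longleftrightarrow>
     (\<forall>f. sk_continuous f \<and> (\<exists>B. \<forall>x\<in>skD. \<bar>f x\<bar> \<le> B) \<longrightarrow>
        (\<lambda>n. integral\<^sup>L M (\<lambda>\<omega>. f (X n \<omega>))) \<longlonglongrightarrow> integral\<^sup>L M' (\<lambda>\<omega>. f (Y \<omega>)))"

definition wiener_process :: "'b measure \<Rightarrow> (real \<Rightarrow> 'b \<Rightarrow> real) \<Rightarrow> bool" where
  "wiener_process M W \<longleftrightarrow>
     (\<forall>t. W t \<in> borel_measurable M) \<and>
     (\<forall>\<omega>\<in>space M. W 0 \<omega> = 0 \<and> continuous_on {0..} (\<lambda>t. W t \<omega>)) \<and>
     (\<forall>s t. 0 \<le> s \<and> s < t \<longrightarrow>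
        distributed M lborel (\<lambda>\<omega>. W t \<omega> - W s \<omega>) (\<lambda>x. ennreal (normal_density 0 (sqrt (t - s)) x))) \<and>
     (\<forall>(k::nat) ts. (\<forall>j<k. 0 \<le> ts j \<and> ts j < ts (Suc j)) \<longrightarrow>
        prob_space.indep_vars M (\<lambda>_. borel) (\<lambda>j \<omega>. W (ts (Suc j)) \<omega> - W (ts j) \<omega>) {..<k})"

text \<open>Urns are indexed by i in {..<N} (0-based). Z n i w is Z_n(i+1).\<close>

definition avgZ :: "nat \<Rightarrow> (nat \<Rightarrow> nat \<Rightarrow> 'a \<Rightarrow> real) \<Rightarrow> nat \<Rightarrow> 'a \<Rightarrow> real" where
  "avgZ N Z n \<omega> = (\<Sum>i<N. Z n i \<omega>) / real N"

definition nat_filtration :: "'a measure \<Rightarrow> nat \<Rightarrow> (nat \<Rightarrow> nat \<Rightarrow> 'a \<Rightarrow> real) \<Rightarrow> nat \<Rightarrow> 'a measure" where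
  "nat_filtration M N Z n = sigma (space M)
     (\<Union>k\<in>{..n}. \<Union>i\<in>{..<N}. {Z k i -` A \<inter> space M | A. A \<in> sets borel})"

end

theory Submission
  imports Defs "HOL-Real_Asymp.Real_Asymp"
begin

text \<open>
  The average \<open>Z\<^sub>n\<close> is a bounded martingale with increments of size at most \<open>r\<^sub>n\<close>, and the individual urns
  synchronise with it in \<open>L\<^sup>2\<close>, so that its conditional variances are asymptotic to \<open>r\<^sub>n\<^sup>2 Z (1 - Z) / N\<close>.
  Since \<open>E[Z\<^sub>n (1 - Z\<^sub>n)]\<close> shrinks at most by the factor \<open>1 - r\<^sub>n\<^sup>2\<close> and \<open>\<Sum>n. r\<^sub>n\<^sup>2\<close> converges, \<open>Z\<close> is not
  concentrated on \<open>{0, 1}\<close>. Exchanging increments for Gaussian factors one at a time gives a central limit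
  theorem for the tails \<open>Z\<^sub>n - Z\<close>, jointly with bounded functions of the past. Tested against a Fejer
  kernel it excludes atoms in \<open>(0, 1)\<close>; applied to linear combinations it identifies the finite-dimensional
  limits, the factor \<open>t\<^bsup>2\<gamma>-1\<^esup>\<close> being a time inversion of Brownian motion. Fourth moments and Doob's
  inequality bound the oscillation of the rescaled paths, and as the limit is continuous, this suffices
  for convergence in the Skorohod topology.
\<close>

section \<open>Locally uniform distance on path space\<close>

text \<open>The limit is a mixture of Gaussians, and its variance is random and known only at
  infinity. For this reason the central limit theorem carries factors that depend on the past, and
  it asserts that a difference vanishes: the variance is replaced by a value already known at a late
  time \<open>m\<close>, at small distance in L1 from the limiting one. The bounds on \<gamma> act
  separately: \<gamma> > 1/2 makes the squares of \<open>r\<close> summable, so that the tails have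
  order n^(1/2 - \<gamma>), while \<gamma> \<le> 1 makes \<open>r\<close> itself non-summable, which
  forces the urns together. The prefactor in t can be read off from covariances: for s < t the tails
  at ns and nt share the part after nt, whose variance is proportional to t^(1 - 2\<gamma>); the two
  prefactors turn this into s^(2\<gamma> - 1), the covariance of Brownian motion run at that clock.
  Oscillations are bounded by a union over about K cells of width 1/K. Second moments would give a
  bad probability of order 1/K per cell, which is too much; fourth moments give order 1/K^2.\<close>

text \<open>
  Every test functional that is continuous for the Skorohod metric is continuous for \<open>ud\<close>, because the
  identity is an admissible time change; hence convergence can be proved for locally uniform
  convergence of paths. Note that integrals of non-measurable functions are \<open>0\<close> by convention, so
  measurability of the functionals along the paths is needed as well.
\<close>

definition ud :: "(real \<Rightarrow> real) \<Rightarrow> (real \<Rightarrow> real) \<Rightarrow> real" where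
  "ud x y = (SUP t\<in>{0..}. exp (- t) * min 1 \<bar>x t - y t\<bar>)"

lemma ud_bdd: "bdd_above ((\<lambda>t. exp (- t) * min 1 \<bar>x t - y t\<bar>) ` {0::real..})"
proof (rule bdd_aboveI2)
  fix t :: real assume "t \<in> {0..}"
  then show "exp (- t) * min 1 \<bar>x t - y t\<bar> \<le> 1 * 1"
    by (intro mult_mono) auto
qed

lemma ud_upper: "0 \<le> t \<Longrightarrow> exp (- t) * min 1 \<bar>x t - y t\<bar> \<le> ud x y"
  unfolding ud_def by (intro cSUP_upper ud_bdd) auto

lemma ud_leI: "(\<And>t. 0 \<le> t \<Longrightarrow> exp (- t) * min 1 \<bar>x t - y t\<bar> \<le> e) \<Longrightarrow> ud x y \<le> e"
  unfolding ud_def by (intro cSUP_least) auto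

lemma ud_nonneg: "0 \<le> ud x y"
proof -
  have "0 \<le> exp (- 0) * min 1 \<bar>x 0 - y 0\<bar>" by simp
  also have "\<dots> \<le> ud x y" by (rule ud_upper) simp
  finally show ?thesis .
qed

lemma ud_refl [simp]: "ud x x = 0"
  by (rule antisym[OF ud_leI ud_nonneg]) simp

lemma ud_commute: "ud x y = ud y x"
  unfolding ud_def by (simp add: abs_minus_commute)

lemma ud_triangle: "ud x z \<le> ud x y + ud y z"
proof (rule ud_leI)
  fix t :: real assume t: "0 \<le> t"
  have "exp (- t) * min 1 \<bar>x t - z t\<bar> \<le> exp (- t) * (min 1 \<bar>x t - y t\<bar> + min 1 \<bar>y t - z t\<bar>)"
    by (intro mult_left_mono) auto
  also have "\<dots> \<le> ud x y + ud y z"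
    unfolding distrib_left by (intro add_mono ud_upper t)
  finally show "exp (- t) * min 1 \<bar>x t - z t\<bar> \<le> ud x y + ud y z" .
qed

lemma ud_le_uniform:
  assumes "\<And>t. 0 \<le> t \<Longrightarrow> t < T \<Longrightarrow> \<bar>x t - y t\<bar> \<le> e" and "0 \<le> e"
  shows "ud x y \<le> e + exp (- T)"
proof (rule ud_leI)
  fix t :: real assume t: "0 \<le> t"
  show "exp (- t) * min 1 \<bar>x t - y t\<bar> \<le> e + exp (- T)"
  proof (cases "t < T")
    case True
    have "exp (- t) * min 1 \<bar>x t - y t\<bar> \<le> 1 * \<bar>x t - y t\<bar>"
      using t by (intro mult_mono) auto
    with assms(1)[OF t True] show ?thesis
      by (smt (verit) exp_gt_zero)
  next
    case False
    have "exp (- t) * min 1 \<bar>x t - y t\<bar> \<le> exp (- t) * 1"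
      by (intro mult_left_mono) auto
    also have "\<dots> \<le> exp (- T)" using False by simp
    finally show ?thesis using assms(2) by simp
  qed
qed

text \<open>The side condition \<open>exp T * d \<le> 1\<close> keeps the truncated difference
  strictly below 1, so on [0, T] the truncation is inactive and the difference itself is
  controlled.\<close>

lemma ud_less_imp_close:
  assumes "ud x y < d" "0 \<le> t" "t \<le> T" "exp T * d \<le> 1"
  shows "\<bar>x t - y t\<bar> \<le> exp T * d"
proof -
  have "exp (- t) * min 1 \<bar>x t - y t\<bar> < d"
    using ud_upper[OF assms(2), of x y] assms(1) by simp
  then have "min 1 \<bar>x t - y t\<bar> < exp t * d"
    by (simp add: exp_minus field_simps)
  also have "\<dots> \<le> exp T * d"
    using assms(1,3) ud_nonneg[of x y] by (intro mult_right_mono) auto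
  finally show ?thesis using assms(4) by auto
qed

lemma id_in_sk_Lambda: "(\<lambda>t. t) \<in> sk_Lambda"
proof -
  have "bdd_above ((\<lambda>(s,t). \<bar>ln ((s - t) / (s - t))\<bar>) ` {(s,t). 0 \<le> t \<and> t < (s::real)})"
    by (rule bdd_aboveI2[where M=0]) auto
  then show ?thesis
    by (auto simp: sk_Lambda_def strict_mono_on_def)
qed

lemma sk_gamma_id: "sk_gamma (\<lambda>t. t) = 0"
proof -
  have "(SUP (s,t)\<in>{(s,t). 0 \<le> t \<and> t < (s::real)}. \<bar>ln ((s - t) / (s - t))\<bar>)
      = (SUP p\<in>{(s,t). 0 \<le> t \<and> t < (s::real)}. 0)"
    by (rule SUP_cong) auto
  also have "\<dots> = (0::real)"
  proof (rule cSUP_const)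
    have "(1, 0) \<in> {(s,t). 0 \<le> t \<and> t < (s::real)}" by simp
    then show "{(s,t). 0 \<le> t \<and> t < (s::real)} \<noteq> {}" by blast
  qed
  finally show ?thesis by (simp add: sk_gamma_def)
qed

lemma nn_integral_exp_tail:
  assumes "0 \<le> (T::real)"
  shows "(\<integral>\<^sup>+ u. ennreal (exp (- u)) * indicator {T..} u \<partial>lborel) = ennreal (exp (- T))"
proof -
  have "(\<integral>\<^sup>+ u. ennreal (exp (- u)) * indicator {T..} u \<partial>lborel) = ennreal (0 - (- exp (- T)))"
  proof (rule nn_integral_FTC_atLeast)
    show "((\<lambda>x::real. - exp (- x)) \<longlongrightarrow> 0) at_top"
      using tendsto_minus[OF filterlim_compose[OF exp_at_bot filterlim_uminus_at_bot_at_top]] by simp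
  qed (auto intro!: derivative_eq_intros)
  then show ?thesis by simp
qed

text \<open>The identity time change has \<open>sk_gamma\<close> equal to 0. In the integral over
  the cut-off u, the values u < T contribute through the uniform bound e on the stopped paths; for u
  \<ge> T the truncation at 1 leaves at most the exponential tail.\<close>

lemma sk_dist_le_uniform:
  assumes close: "\<And>t. 0 \<le> t \<Longrightarrow> t \<le> T \<Longrightarrow> \<bar>x t - y t\<bar> \<le> e" and e: "0 \<le> e" and T: "0 \<le> T"
  shows "sk_dist x y \<le> e + exp (- T)"
proof -
  have close_u: "sk_dist_u x y (\<lambda>t. t) u \<le> e" if "0 \<le> u" "u \<le> T" for u
    unfolding sk_dist_u_def
  proof (rule cSUP_least)
    fix t :: real assume "t \<in> {0..}"
    then have "\<bar>x (min t u) - y (min t u)\<bar> \<le> e"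
      using that by (intro close) auto
    then show "min 1 \<bar>x (min t u) - y (min t u)\<bar> \<le> e" by simp
  qed simp
  have le1: "sk_dist_u x y (\<lambda>t. t) u \<le> 1" for u
    unfolding sk_dist_u_def by (rule cSUP_least) auto
  have "(\<integral>\<^sup>+ u. ennreal (exp (- u) * sk_dist_u x y (\<lambda>t. t) u) * indicator {0..} u \<partial>lborel)
     \<le> (\<integral>\<^sup>+ u. ennreal e * (ennreal (exp (- u)) * indicator {0..} u)
            + ennreal (exp (- u)) * indicator {T..} u \<partial>lborel)"
  proof (rule nn_integral_mono)
    fix u :: real
    show "ennreal (exp (- u) * sk_dist_u x y (\<lambda>t. t) u) * indicator {0..} u
      \<le> ennreal e * (ennreal (exp (- u)) * indicator {0..} u) + ennreal (exp (- u)) * indicator {T..} u"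
    proof (cases "u < 0")
      case False
      show ?thesis
      proof (cases "u < T")
        case True
        have "exp (- u) * sk_dist_u x y (\<lambda>t. t) u \<le> e * exp (- u)"
          using mult_left_mono[OF close_u[of u], of "exp (- u)"] False True by (simp add: mult.commute)
        then show ?thesis using False True e
          by (auto simp: indicator_def ennreal_mult[symmetric] intro: ennreal_leI)
      next
        case uT: False
        have "exp (- u) * sk_dist_u x y (\<lambda>t. t) u \<le> e * exp (- u) + exp (- u)"
          using mult_left_mono[OF le1[of u], of "exp (- u)"] e
          by (smt (verit) exp_ge_zero mult.right_neutral mult_nonneg_nonneg)
        then show ?thesis using False uT e
          by (auto simp: indicator_def ennreal_mult[symmetric] ennreal_plus[symmetric] simp del: ennreal_plus intro: ennreal_leI)
      qed
    qed simp
  qed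
  also have "\<dots> = ennreal e * (\<integral>\<^sup>+ u. ennreal (exp (- u)) * indicator {0..} u \<partial>lborel)
        + (\<integral>\<^sup>+ u. ennreal (exp (- u)) * indicator {T..} u \<partial>lborel)"
    by (subst nn_integral_add) (auto intro!: nn_integral_cmult)
  also have "\<dots> = ennreal (e + exp (- T))"
    using e by (simp add: nn_integral_exp_tail T)
  finally have int: "enn2real (\<integral>\<^sup>+ u. ennreal (exp (- u) * sk_dist_u x y (\<lambda>t. t) u) * indicator {0..} u \<partial>lborel)
      \<le> e + exp (- T)"
    using e by (simp add: enn2real_leI)
  have "sk_dist x y \<le> max (sk_gamma (\<lambda>t. t))
     (enn2real (\<integral>\<^sup>+ u. ennreal (exp (- u) * sk_dist_u x y (\<lambda>t. t) u) * indicator {0..} u \<partial>lborel))"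
    unfolding sk_dist_def
    by (rule cINF_lower[OF bdd_belowI2[where m=0] id_in_sk_Lambda]) (simp add: le_max_iff_disj)
  also have "\<dots> \<le> e + exp (- T)"
    using int e by (simp add: sk_gamma_id)
  finally show ?thesis .
qed

section \<open>Continuous and Lipschitz functionals for the locally uniform distance\<close>

definition ud_continuous :: "((real \<Rightarrow> real) \<Rightarrow> real) \<Rightarrow> bool" where
  "ud_continuous f \<longleftrightarrow> (\<forall>x\<in>skD. \<forall>e>0. \<exists>d>0. \<forall>y\<in>skD. ud x y < d \<longrightarrow> \<bar>f y - f x\<bar> < e)"

lemma sk_continuous_imp_ud_continuous:
  assumes "sk_continuous f"
  shows "ud_continuous f"
  unfolding ud_continuous_def
proof (intro ballI allI impI)
  fix x e assume x: "x \<in> skD" and "0 < (e::real)"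
  with assms obtain d where d: "d > 0" "\<And>y. y \<in> skD \<Longrightarrow> sk_dist x y < d \<Longrightarrow> \<bar>f y - f x\<bar> < e"
    unfolding sk_continuous_def by blast
  define T where "T = max 0 (- ln (d / 2))"
  have T: "0 \<le> T" "exp (- T) \<le> d / 2"
  proof -
    have "- T \<le> ln (d / 2)" by (simp add: T_def)
    then show "exp (- T) \<le> d / 2" using d(1)
      by (metis exp_le_cancel_iff exp_ln half_gt_zero)
  qed (simp add: T_def)
  \<comment> \<open>The uniform part d / 3 and the tail d / 2 together stay below d; the minimum
    with 1 meets the side condition of \<open>ud_less_imp_close\<close>.\<close>
  define d' where "d' = min 1 (d / 3) / exp T"
  have d': "d' > 0" "exp T * d' \<le> 1" "exp T * d' \<le> d / 3"
    using d(1) by (auto simp: d'_def)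
  show "\<exists>d>0. \<forall>y\<in>skD. ud x y < d \<longrightarrow> \<bar>f y - f x\<bar> < e"
  proof (intro exI[of _ d'] conjI ballI impI d(2))
    fix y assume "ud x y < d'"
    then have "sk_dist x y \<le> exp T * d' + exp (- T)"
      using d' T by (intro sk_dist_le_uniform ud_less_imp_close) auto
    also have "\<dots> < d" using T d' d(1) by linarith
    finally show "sk_dist x y < d" .
  qed (use d' in auto)
qed

lemma ud_continuousD:
  assumes "ud_continuous f" "x \<in> skD" "\<And>k. y k \<in> skD" "(\<lambda>k. ud x (y k)) \<longlonglongrightarrow> 0"
  shows "(\<lambda>k::nat. f (y k)) \<longlonglongrightarrow> f x"
proof (rule LIMSEQ_I)
  fix e :: real assume "0 < e"
  then obtain d where d: "d > 0" "\<And>y. y \<in> skD \<Longrightarrow> ud x y < d \<Longrightarrow> \<bar>f y - f x\<bar> < e"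
    using assms(1,2) unfolding ud_continuous_def by blast
  from LIMSEQ_D[OF assms(4) d(1)] obtain k0 where "\<And>k. k \<ge> k0 \<Longrightarrow> ud x (y k) < d"
    using ud_nonneg by auto
  then show "\<exists>k0. \<forall>k\<ge>k0. norm (f (y k) - f x) < e"
    using d(2)[OF assms(3)] by auto
qed

definition ud_lipschitz :: "real \<Rightarrow> ((real \<Rightarrow> real) \<Rightarrow> real) \<Rightarrow> bool" where
  "ud_lipschitz L f \<longleftrightarrow> (\<forall>x\<in>skD. \<forall>y\<in>skD. \<bar>f x - f y\<bar> \<le> L * ud x y)"

lemma ud_lipschitz_imp_ud_continuous:
  assumes "ud_lipschitz L f"
  shows "ud_continuous f"
  unfolding ud_continuous_def
proof (intro ballI allI impI)
  fix x e assume x: "x \<in> skD" and e: "0 < (e::real)"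
  show "\<exists>d>0. \<forall>y\<in>skD. ud x y < d \<longrightarrow> \<bar>f y - f x\<bar> < e"
  proof (intro exI[of _ "e / (\<bar>L\<bar> + 1)"] conjI ballI impI)
    fix y assume y: "y \<in> skD" "ud x y < e / (\<bar>L\<bar> + 1)"
    have "\<bar>f y - f x\<bar> \<le> L * ud y x" using assms x y by (auto simp: ud_lipschitz_def)
    also have "\<dots> \<le> (\<bar>L\<bar> + 1) * ud x y"
      unfolding ud_commute[of y] by (intro mult_right_mono ud_nonneg) auto
    also have "\<dots> < e" using y(2) by (simp add: field_simps)
    finally show "\<bar>f y - f x\<bar> < e" .
  qed (use e in auto)
qed

text \<open>
  The inf-convolutions are Lipschitz and increase to a bounded continuous \<open>f\<close>; applied to \<open>f\<close> and \<open>- f\<close>,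
  they reduce weak convergence to Lipschitz functionals.
\<close>

definition inf_conv :: "((real \<Rightarrow> real) \<Rightarrow> real) \<Rightarrow> real \<Rightarrow> (real \<Rightarrow> real) \<Rightarrow> real" where
  "inf_conv f k x = (INF y\<in>skD. f y + k * ud x y)"

lemma zero_in_skD: "(\<lambda>_. 0) \<in> skD"
  by (auto simp: skD_def cadlag_def intro!: exI[of _ 0])

lemma skD_nonempty: "skD \<noteq> {}"
  using zero_in_skD by auto

context
  fixes f :: "(real \<Rightarrow> real) \<Rightarrow> real" and B k :: real
  assumes B: "\<And>x. x \<in> skD \<Longrightarrow> \<bar>f x\<bar> \<le> B" and k: "0 \<le> k"
begin

lemma inf_conv_bdd: "bdd_below ((\<lambda>y. f y + k * ud x y) ` skD)"
proof (rule bdd_belowI2[where m="- B"])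
  fix y assume "y \<in> skD"
  then show "- B \<le> f y + k * ud x y"
    using B[of y] mult_nonneg_nonneg[OF k ud_nonneg[of x y]] by simp
qed

lemma inf_conv_le: "x \<in> skD \<Longrightarrow> inf_conv f k x \<le> f x"
  unfolding inf_conv_def by (rule cINF_lower2[OF inf_conv_bdd]) auto

lemma inf_conv_ge: "- B \<le> inf_conv f k x"
  unfolding inf_conv_def
proof (rule cINF_greatest[OF skD_nonempty])
  fix y assume "y \<in> skD"
  then show "- B \<le> f y + k * ud x y"
    using B[of y] mult_nonneg_nonneg[OF k ud_nonneg[of x y]] by simp
qed

lemma inf_conv_bound: "x \<in> skD \<Longrightarrow> \<bar>inf_conv f k x\<bar> \<le> B"
  using inf_conv_le[of x] inf_conv_ge[of x] B[of x] by simp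

lemma inf_conv_le_add: "inf_conv f k x \<le> inf_conv f k x' + k * ud x x'"
proof -
  have "inf_conv f k x - k * ud x x' \<le> (INF y\<in>skD. f y + k * ud x' y)"
  proof (rule cINF_greatest[OF skD_nonempty])
    fix y assume y: "y \<in> skD"
    have "inf_conv f k x \<le> f y + k * ud x y"
      unfolding inf_conv_def by (rule cINF_lower[OF inf_conv_bdd y])
    also have "\<dots> \<le> f y + k * (ud x x' + ud x' y)"
      by (intro add_left_mono mult_left_mono ud_triangle k)
    finally show "inf_conv f k x - k * ud x x' \<le> f y + k * ud x' y"
      by (simp add: algebra_simps)
  qed
  then show ?thesis by (simp add: inf_conv_def)
qed

lemma inf_conv_lipschitz: "ud_lipschitz k (inf_conv f k)"
  unfolding ud_lipschitz_def
proof (intro ballI)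
  fix x y
  show "\<bar>inf_conv f k x - inf_conv f k y\<bar> \<le> k * ud x y"
    using inf_conv_le_add[of x y] inf_conv_le_add[of y x] ud_commute[of x y] by (auto simp: abs_le_iff)
qed

end

text \<open>Competitors at distance at least d from x pay a penalty of at least k * d \<ge> 2 * B
  and cannot undercut f x; those within distance d have values close to f x by continuity.\<close>

lemma inf_conv_tendsto:
  assumes B: "\<And>x. x \<in> skD \<Longrightarrow> \<bar>f x\<bar> \<le> B" and f: "ud_continuous f" and x: "x \<in> skD"
  shows "(\<lambda>k::nat. inf_conv f (real k) x) \<longlonglongrightarrow> f x"
proof (rule LIMSEQ_I)
  fix e :: real assume e: "0 < e"
  then have "0 < e / 2" by simp
  with f x obtain d where d: "d > 0" "\<And>y. y \<in> skD \<Longrightarrow> ud x y < d \<Longrightarrow> \<bar>f y - f x\<bar> < e / 2"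
    unfolding ud_continuous_def by blast
  obtain k0 :: nat where k0: "2 * B / d \<le> k0" using real_arch_simple by blast
  have "norm (inf_conv f (real k) x - f x) < e" if "k \<ge> k0" for k
  proof -
    have "f x - e / 2 \<le> inf_conv f (real k) x"
      unfolding inf_conv_def
    proof (rule cINF_greatest[OF skD_nonempty])
      fix y assume y: "y \<in> skD"
      show "f x - e / 2 \<le> f y + real k * ud x y"
      proof (cases "ud x y < d")
        case True
        then have "f x - e / 2 \<le> f y" using d(2)[OF y True] unfolding abs_less_iff by linarith
        then show ?thesis using mult_nonneg_nonneg[OF _ ud_nonneg, of "real k" x y] by simp
      next
        case False
        have "2 * B / d \<le> real k" using k0 that by linarith
        then have "2 * B \<le> real k * d" using d(1) by (simp add: field_simps)
        also have "\<dots> \<le> real k * ud x y" using False by (intro mult_left_mono) auto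
        finally show ?thesis using B[OF x] B[OF y] e by (auto simp: abs_le_iff)
      qed
    qed
    moreover have "inf_conv f (real k) x \<le> f x" using B x by (intro inf_conv_le[where B=B]) auto
    ultimately show ?thesis using e by (simp add: abs_le_iff)
  qed
  then show "\<exists>k0. \<forall>k\<ge>k0. norm (inf_conv f (real k) x - f x) < e" by blast
qed

section \<open>Closure properties of cadlag paths and measurability of functionals along random
  paths\<close>

lemma cadlag_mult: "cadlag x \<Longrightarrow> cadlag y \<Longrightarrow> cadlag (\<lambda>t. x t * y t)"
  unfolding cadlag_def by (auto intro!: continuous_mult) (blast intro: tendsto_mult)

lemma cadlag_const: "cadlag (\<lambda>_. c)"
  by (auto simp: cadlag_def)

lemma cadlag_add: "cadlag x \<Longrightarrow> cadlag y \<Longrightarrow> cadlag (\<lambda>t. x t + y t)"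
  unfolding cadlag_def by (auto intro!: continuous_add) (blast intro: tendsto_add)

lemma cadlag_sum: "(\<And>k. k \<in> A \<Longrightarrow> cadlag (f k)) \<Longrightarrow> cadlag (\<lambda>t. \<Sum>k\<in>A. f k t)"
  by (induction A rule: infinite_finite_induct) (auto intro: cadlag_const cadlag_add)

lemma cadlag_continuous: "continuous_on {0..} x \<Longrightarrow> cadlag x"
  unfolding cadlag_def
proof (intro conjI allI impI)
  fix t :: real assume x: "continuous_on {0..} x" and t: "0 \<le> t"
  have "continuous (at t within {0..}) x" using x t by (simp add: continuous_on_eq_continuous_within)
  then show "continuous (at_right t) x" using t by (auto intro: continuous_within_subset)
next
  fix t :: real assume x: "continuous_on {0..} x" and t: "0 < t"
  have "continuous (at t within {0..}) x" using x t by (simp add: continuous_on_eq_continuous_within)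
  moreover have "at t within {0..} = at t" using t by (intro at_within_interior) simp
  ultimately have "isCont x t" by simp
  then show "\<exists>l. (x \<longlongrightarrow> l) (at_left t)"
    by (auto simp: isCont_def intro: filterlim_at_split[THEN iffD1, THEN conjunct1])
qed

lemma cadlag_indicator: "cadlag (indicator {a..<b})"
proof -
  have r: "eventually (\<lambda>s. indicator {a..<b} s = (indicator {a..<b} t :: real)) (at_right t)" for t
  proof (cases "t < a")
    case True
    then show ?thesis by (auto simp: eventually_at_right_field indicator_def intro!: exI[of _ a])
  next
    case ta: False
    show ?thesis
    proof (cases "t < b")
      case True
      then show ?thesis using ta by (auto simp: eventually_at_right_field indicator_def intro!: exI[of _ b])
    next
      case False
      then show ?thesis by (auto simp: eventually_at_right_field indicator_def intro!: exI[of _ "t + 1"])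
    qed
  qed
  have l: "\<exists>l. eventually (\<lambda>s. indicator {a..<b} s = (l::real)) (at_left t)" for t
  proof (cases "t \<le> a")
    case True
    then show ?thesis by (intro exI[of _ 0]) (auto simp: eventually_at_left_field indicator_def intro!: exI[of _ "t - 1"])
  next
    case ta: False
    show ?thesis
    proof (cases "t \<le> b")
      case True
      then show ?thesis using ta by (intro exI[of _ 1]) (auto simp: eventually_at_left_field indicator_def intro!: exI[of _ a])
    next
      case False
      then show ?thesis by (intro exI[of _ 0]) (auto simp: eventually_at_left_field indicator_def intro!: exI[of _ b])
    qed
  qed
  show ?thesis unfolding cadlag_def
  proof (intro conjI allI impI)
    fix t show "continuous (at_right t) (indicator {a..<b} :: real \<Rightarrow> real)"
      unfolding continuous_within by (rule tendsto_eventually[OF r])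
  next
    fix t show "\<exists>c. ((indicator {a..<b} :: real \<Rightarrow> real) \<longlongrightarrow> c) (at_left t)"
      using l[of t] tendsto_eventually by blast
  qed
qed

text \<open>The path is determined by finitely many real coefficients. Since the profiles \<psi> are
  bounded, convergence of the coefficients gives uniform convergence of the paths, so the functional
  is a continuous function on the coefficient space and hence Borel. In this way no sigma-algebra on
  path space is ever introduced.\<close>

lemma ud_continuous_finite_measurable:
  fixes G :: "(real \<Rightarrow> real) \<Rightarrow> real" and S :: "nat \<Rightarrow> 'a \<Rightarrow> real"
  assumes G: "ud_continuous G"
    and psi: "\<And>k. k < m \<Longrightarrow> cadlag (\<psi> k)" "\<And>k t. k < m \<Longrightarrow> 0 \<le> t \<Longrightarrow> \<bar>\<psi> k t\<bar> \<le> C"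
    and S: "\<And>k. k < m \<Longrightarrow> S k \<in> borel_measurable M"
  shows "(\<lambda>\<omega>. G (\<lambda>t. \<Sum>k<m. \<psi> k t * S k \<omega>)) \<in> borel_measurable M"
proof -
  define p where "p s = (\<lambda>t. \<Sum>k<m. \<psi> k t * s k)" for s :: "nat \<Rightarrow> real"
  have p: "p s \<in> skD" for s
    unfolding skD_def p_def by (auto intro!: cadlag_sum cadlag_mult cadlag_const psi)
  have "continuous_on UNIV (\<lambda>s. G (p s))"
    unfolding continuous_on_sequentially
  proof (intro allI ballI impI, elim conjE)
    fix x :: "nat \<Rightarrow> nat \<Rightarrow> real" and a assume x: "x \<longlonglongrightarrow> a"
    have xa: "(\<lambda>n. x n k) \<longlonglongrightarrow> a k" for k
      using continuous_on_tendsto_compose[OF continuous_on_product_coordinates x] by simp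
    have "(\<lambda>n. \<Sum>k<m. \<bar>C\<bar> * \<bar>x n k - a k\<bar>) \<longlonglongrightarrow> (\<Sum>k<m. \<bar>C\<bar> * \<bar>a k - a k\<bar>)"
      by (intro tendsto_intros xa)
    then have lim: "(\<lambda>n. \<Sum>k<m. \<bar>C\<bar> * \<bar>x n k - a k\<bar>) \<longlonglongrightarrow> 0" by simp
    have le: "ud (p a) (p (x n)) \<le> (\<Sum>k<m. \<bar>C\<bar> * \<bar>x n k - a k\<bar>)" for n
    proof (rule ud_leI)
      fix t :: real assume t: "0 \<le> t"
      have "\<bar>p a t - p (x n) t\<bar> = \<bar>\<Sum>k<m. \<psi> k t * (x n k - a k)\<bar>"
        by (simp add: p_def sum_subtractf algebra_simps)
      also have "\<dots> \<le> (\<Sum>k<m. \<bar>\<psi> k t\<bar> * \<bar>x n k - a k\<bar>)"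
        by (rule order_trans[OF sum_abs]) (simp add: abs_mult)
      also have "\<dots> \<le> (\<Sum>k<m. \<bar>C\<bar> * \<bar>x n k - a k\<bar>)"
        using psi(2) t by (intro sum_mono mult_right_mono) force+
      finally have "\<bar>p a t - p (x n) t\<bar> \<le> (\<Sum>k<m. \<bar>C\<bar> * \<bar>x n k - a k\<bar>)" .
      moreover have "exp (- t) * min 1 \<bar>p a t - p (x n) t\<bar> \<le> 1 * \<bar>p a t - p (x n) t\<bar>"
        using t by (intro mult_mono) auto
      ultimately show "exp (- t) * min 1 \<bar>p a t - p (x n) t\<bar> \<le> (\<Sum>k<m. \<bar>C\<bar> * \<bar>x n k - a k\<bar>)" by simp
    qed
    have "(\<lambda>n. ud (p a) (p (x n))) \<longlonglongrightarrow> 0"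
      by (rule tendsto_sandwich[OF _ _ tendsto_const lim]) (auto simp: ud_nonneg le)
    then show "((\<lambda>s. G (p s)) \<circ> x) \<longlonglongrightarrow> G (p a)"
      unfolding comp_def by (intro ud_continuousD[OF G p p])
  qed
  then have 1: "(\<lambda>s. G (p s)) \<in> borel_measurable borel"
    by (rule borel_measurable_continuous_onI)
  \<comment> \<open>The coefficient space is the product over all indices, so the coordinates from m
    on, about which nothing is assumed, are set to 0.\<close>
  have 2: "(\<lambda>\<omega> k. if k < m then S k \<omega> else 0) \<in> borel_measurable M"
  proof (rule measurable_coordinatewise_then_product)
    fix k show "(\<lambda>\<omega>. if k < m then S k \<omega> else 0) \<in> borel_measurable M"
      by (cases "k < m") (auto simp: S)
  qed
  have "(\<lambda>\<omega>. G (p (\<lambda>k. if k < m then S k \<omega> else 0))) \<in> borel_measurable M"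
    using measurable_compose[OF 2 1] .
  also have "(\<lambda>\<omega>. G (p (\<lambda>k. if k < m then S k \<omega> else 0))) = (\<lambda>\<omega>. G (\<lambda>t. \<Sum>k<m. \<psi> k t * S k \<omega>))"
    by (simp add: p_def)
  finally show ?thesis .
qed

lemma ud_continuous_measurable_lim:
  assumes G: "ud_continuous G"
    and X: "\<And>\<omega>. \<omega> \<in> space M \<Longrightarrow> X \<omega> \<in> skD"
    and Xk: "\<And>k \<omega>. \<omega> \<in> space M \<Longrightarrow> Xk k \<omega> \<in> skD"
    and meas: "\<And>k::nat. (\<lambda>\<omega>. G (Xk k \<omega>)) \<in> borel_measurable M"
    and lim: "\<And>\<omega>. \<omega> \<in> space M \<Longrightarrow> (\<lambda>k. ud (X \<omega>) (Xk k \<omega>)) \<longlonglongrightarrow> 0"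
  shows "(\<lambda>\<omega>. G (X \<omega>)) \<in> borel_measurable M"
proof (rule borel_measurable_LIMSEQ_real[OF _ meas])
  fix \<omega> assume w: "\<omega> \<in> space M"
  show "(\<lambda>k. G (Xk k \<omega>)) \<longlonglongrightarrow> G (X \<omega>)"
    by (rule ud_continuousD[OF G X[OF w] Xk[OF w] lim[OF w]])
qed

section \<open>A multidimensional continuity theorem\<close>

lemma (in prob_space) integrable_bounded:
  fixes f :: "'a \<Rightarrow> real"
  assumes "f \<in> borel_measurable M" "\<And>\<omega>. \<omega> \<in> space M \<Longrightarrow> \<bar>f \<omega>\<bar> \<le> B"
  shows "integrable M f"
  using assms by (intro integrable_const_bound[where B=B]) auto

text \<open>Measurability is not assumed: for a non-integrable f the integral is 0 by convention,
  and 0 \<le> B covers this case.\<close>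

lemma (in prob_space) expectation_bounded:
  fixes f :: "'a \<Rightarrow> real"
  assumes "\<And>\<omega>. \<omega> \<in> space M \<Longrightarrow> \<bar>f \<omega>\<bar> \<le> B" "0 \<le> B"
  shows "\<bar>expectation f\<bar> \<le> B"
proof (cases "integrable M f")
  case True
  have "\<bar>expectation f\<bar> \<le> expectation (\<lambda>\<omega>. \<bar>f \<omega>\<bar>)" by (rule integral_abs_bound)
  also have "\<dots> \<le> expectation (\<lambda>_. B)" using True assms by (intro integral_mono) auto
  finally show ?thesis by (simp add: prob_space)
qed (simp add: not_integrable_integral_eq assms)

text \<open>The sine is written as a cosine with phase - pi / 2, so that one family of cosine limits
  with arbitrary phase supplies both the real and the imaginary part of the characteristic
  function.\<close>

lemma (in prob_space) char_weighted:
  fixes X :: "'a \<Rightarrow> real"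
  assumes [measurable]: "X \<in> borel_measurable M" "u \<in> borel_measurable M"
    and u: "\<And>\<omega>. \<omega> \<in> space M \<Longrightarrow> 0 \<le> u \<omega>" "\<And>\<omega>. \<omega> \<in> space M \<Longrightarrow> u \<omega> \<le> C"
  shows "char (distr (density M (\<lambda>\<omega>. ennreal (u \<omega>))) borel X) \<theta>
       = Complex (expectation (\<lambda>\<omega>. u \<omega> * cos (\<theta> * X \<omega> + 0))) (expectation (\<lambda>\<omega>. u \<omega> * cos (\<theta> * X \<omega> + - (pi / 2))))"
proof -
  have int1: "integrable M (\<lambda>\<omega>. u \<omega> * cos (\<theta> * X \<omega>))" and int2: "integrable M (\<lambda>\<omega>. u \<omega> * sin (\<theta> * X \<omega>))"
    using u by (auto intro!: integrable_bounded[where B=C] simp: abs_mult)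
       (smt (verit, best) abs_cos_le_one abs_sin_le_one mult_left_le u)+
  have "char (distr (density M (\<lambda>\<omega>. ennreal (u \<omega>))) borel X) \<theta>
      = (CLINT \<omega>|M. u \<omega> *\<^sub>R iexp (\<theta> * X \<omega>))"
    unfolding char_def using u by (subst integral_distr) (auto simp: integral_density)
  also have "\<dots> = (CLINT \<omega>|M. complex_of_real (u \<omega> * cos (\<theta> * X \<omega>)) + \<i> * complex_of_real (u \<omega> * sin (\<theta> * X \<omega>)))"
    by (intro Bochner_Integration.integral_cong) (auto simp: complex_eq_iff Re_exp Im_exp)
  also have "\<dots> = complex_of_real (expectation (\<lambda>\<omega>. u \<omega> * cos (\<theta> * X \<omega>)))
       + \<i> * complex_of_real (expectation (\<lambda>\<omega>. u \<omega> * sin (\<theta> * X \<omega>)))"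
    using int1 int2 by (subst Bochner_Integration.integral_add) (auto simp del: of_real_mult)
  also have "\<dots> = Complex (expectation (\<lambda>\<omega>. u \<omega> * cos (\<theta> * X \<omega> + 0))) (expectation (\<lambda>\<omega>. u \<omega> * cos (\<theta> * X \<omega> + - (pi / 2))))"
    by (simp add: complex_eq_iff cos_diff)
  finally show ?thesis .
qed

text \<open>
  The one-dimensional continuity theorem is applied to the law of \<open>X n\<close> under the density \<open>u n\<close>, normalised.
\<close>

lemma weighted_levy_pos:
  fixes M :: "'a measure" and M' :: "'b measure" and X :: "nat \<Rightarrow> 'a \<Rightarrow> real" and Y :: "'b \<Rightarrow> real"
  assumes "prob_space M" "prob_space M'"
    and [measurable]: "\<And>n. X n \<in> borel_measurable M" "Y \<in> borel_measurable M'"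
      "\<And>n. u n \<in> borel_measurable M" "v \<in> borel_measurable M'"
    and u: "\<And>n \<omega>. \<omega> \<in> space M \<Longrightarrow> 1 \<le> u n \<omega>" "\<And>n \<omega>. \<omega> \<in> space M \<Longrightarrow> u n \<omega> \<le> C"
    and v: "\<And>\<omega>. \<omega> \<in> space M' \<Longrightarrow> 1 \<le> v \<omega>" "\<And>\<omega>. \<omega> \<in> space M' \<Longrightarrow> v \<omega> \<le> C"
    and conv: "\<And>\<theta> \<phi>. (\<lambda>n. \<integral>\<omega>. u n \<omega> * cos (\<theta> * X n \<omega> + \<phi>) \<partial>M) \<longlonglongrightarrow> (\<integral>\<omega>. v \<omega> * cos (\<theta> * Y \<omega> + \<phi>) \<partial>M')"
    and g: "\<And>x. isCont g x" "\<And>x. \<bar>g x\<bar> \<le> (B::real)"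
  shows "(\<lambda>n. \<integral>\<omega>. u n \<omega> * g (X n \<omega>) \<partial>M) \<longlonglongrightarrow> (\<integral>\<omega>. v \<omega> * g (Y \<omega>) \<partial>M')"
proof -
  interpret M: prob_space M by fact
  interpret M': prob_space M' by fact
  have [measurable]: "g \<in> borel_measurable borel"
    using g(1) by (intro borel_measurable_continuous_onI continuous_at_imp_continuous_on) auto
  define c where "c n = M.expectation (u n)" for n
  define c' where "c' = M'.expectation v"
  have int_u: "integrable M (u n)" for n
    using u[of _ n] by (intro M.integrable_bounded[where B=C]) (auto simp: abs_le_iff, fastforce+)
  have int_v: "integrable M' v"
    using v by (intro M'.integrable_bounded[where B=C]) (auto simp: abs_le_iff, fastforce+)
  have c1: "1 \<le> c n" for n
    using integral_mono[of M "\<lambda>_. 1" "u n"] u(1) int_u by (simp add: c_def M.prob_space)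
  have c'1: "1 \<le> c'"
    using integral_mono[of M' "\<lambda>_. 1" v] v(1) int_v by (simp add: c'_def M'.prob_space)
  \<comment> \<open>Frequency and phase 0 in the hypothesis give convergence of the total weights;
    the bound 1 from below keeps them away from 0 when normalising.\<close>
  have c_lim: "c \<longlonglongrightarrow> c'"
    using conv[of 0 0] by (simp add: c_def[abs_def] c'_def)
  have C: "1 \<le> C" using u[of _ 0] M.not_empty by (meson all_not_in_conv order_trans)
  define un where "un n \<omega> = u n \<omega> / c n" for n \<omega>
  define vn where "vn \<omega> = v \<omega> / c'" for \<omega>
  have [measurable]: "un n \<in> borel_measurable M" "vn \<in> borel_measurable M'" for n
    by (auto simp: un_def[abs_def] vn_def[abs_def])
  have un: "0 \<le> un n \<omega>" "un n \<omega> \<le> C" if "\<omega> \<in> space M" for n \<omega>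
  proof -
    have "u n \<omega> / c n \<le> C / 1" using u[OF that, of n] c1[of n] C by (intro frac_le) auto
    then show "0 \<le> un n \<omega>" "un n \<omega> \<le> C"
      using u[OF that, of n] c1[of n] by (auto simp: un_def)
  qed
  have vn: "0 \<le> vn \<omega>" "vn \<omega> \<le> C" if "\<omega> \<in> space M'" for \<omega>
  proof -
    have "v \<omega> / c' \<le> C / 1" using v[OF that] c'1 C by (intro frac_le) auto
    then show "0 \<le> vn \<omega>" "vn \<omega> \<le> C"
      using v[OF that] c'1 by (auto simp: vn_def)
  qed
  define \<mu> where "\<mu> n = distr (density M (\<lambda>\<omega>. ennreal (un n \<omega>))) borel (X n)" for n
  define \<nu> where "\<nu> = distr (density M' (\<lambda>\<omega>. ennreal (vn \<omega>))) borel Y"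
  have \<mu>: "real_distribution (\<mu> n)" for n
  proof -
    have "(\<integral>\<^sup>+ \<omega>. ennreal (un n \<omega>) \<partial>M) = ennreal (M.expectation (un n))"
      using un int_u by (intro nn_integral_eq_integral) (auto simp: un_def[abs_def] c_def)
    also have "M.expectation (un n) = 1" using c1[of n] by (simp add: un_def[abs_def] c_def)
    finally have "prob_space (density M (\<lambda>\<omega>. ennreal (un n \<omega>)))"
      by (intro prob_spaceI) (simp add: emeasure_density)
    then interpret prob_space "density M (\<lambda>\<omega>. ennreal (un n \<omega>))" .
    show ?thesis unfolding \<mu>_def by (rule real_distribution_distr) auto
  qed
  have \<nu>: "real_distribution \<nu>"
  proof -
    have "(\<integral>\<^sup>+ \<omega>. ennreal (vn \<omega>) \<partial>M') = ennreal (M'.expectation vn)"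
      using vn int_v by (intro nn_integral_eq_integral) (auto simp: vn_def[abs_def])
    also have "M'.expectation vn = 1" using c'1 by (simp add: vn_def[abs_def] c'_def)
    finally have "prob_space (density M' (\<lambda>\<omega>. ennreal (vn \<omega>)))"
      by (intro prob_spaceI) (simp add: emeasure_density)
    then interpret prob_space "density M' (\<lambda>\<omega>. ennreal (vn \<omega>))" .
    show ?thesis unfolding \<nu>_def by (rule real_distribution_distr) auto
  qed
  have conv': "(\<lambda>n. M.expectation (\<lambda>\<omega>. un n \<omega> * cos (\<theta> * X n \<omega> + \<phi>))) \<longlonglongrightarrow> M'.expectation (\<lambda>\<omega>. vn \<omega> * cos (\<theta> * Y \<omega> + \<phi>))" for \<theta> \<phi>
  proof -
    have "(\<lambda>n. (\<integral>\<omega>. u n \<omega> * cos (\<theta> * X n \<omega> + \<phi>) \<partial>M) / c n) \<longlonglongrightarrow> (\<integral>\<omega>. v \<omega> * cos (\<theta> * Y \<omega> + \<phi>) \<partial>M') / c'"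
      using c'1 by (intro tendsto_divide conv c_lim) auto
    then show ?thesis by (simp add: un_def vn_def)
  qed
  have "weak_conv_m \<mu> \<nu>"
  proof (rule levy_continuity[OF \<mu> \<nu>])
    fix t show "(\<lambda>n. char (\<mu> n) t) \<longlonglongrightarrow> char \<nu> t"
      unfolding \<mu>_def \<nu>_def
      by (subst M.char_weighted[where C=C], (use un in auto)[4], subst M'.char_weighted[where C=C], (use vn in auto)[4])
        (intro tendsto_Complex conv')
  qed
  from weak_conv_imp_integral_bdd_continuous_conv[OF \<mu> \<nu> this, of g B] g
  have "(\<lambda>n. integral\<^sup>L (\<mu> n) g) \<longlonglongrightarrow> integral\<^sup>L \<nu> g" by auto
  moreover have "integral\<^sup>L (\<mu> n) g = (\<integral>\<omega>. u n \<omega> * g (X n \<omega>) \<partial>M) / c n" for n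
    unfolding \<mu>_def using un[of _ n] by (subst integral_distr) (auto simp: integral_density un_def)
  moreover have "integral\<^sup>L \<nu> g = (\<integral>\<omega>. v \<omega> * g (Y \<omega>) \<partial>M') / c'"
    unfolding \<nu>_def using vn by (subst integral_distr) (auto simp: integral_density vn_def)
  ultimately have "(\<lambda>n. (\<integral>\<omega>. u n \<omega> * g (X n \<omega>) \<partial>M) / c n * c n) \<longlonglongrightarrow> (\<integral>\<omega>. v \<omega> * g (Y \<omega>) \<partial>M') / c' * c'"
    using c_lim by (intro tendsto_mult) auto
  moreover have "c n \<noteq> 0" for n using c1[of n] by auto
  ultimately show ?thesis using c'1 by auto
qed

text \<open>A signed weight bounded by C becomes a weight of size at least 1 after adding C + 1. The
  unweighted case, again an instance of \<open>weighted_levy_pos\<close>, is then subtracted with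
  factor C + 1.\<close>

lemma weighted_levy:
  fixes M :: "'a measure" and M' :: "'b measure" and X :: "nat \<Rightarrow> 'a \<Rightarrow> real" and Y :: "'b \<Rightarrow> real"
  assumes "prob_space M" "prob_space M'"
    and [measurable]: "\<And>n. X n \<in> borel_measurable M" "Y \<in> borel_measurable M'"
      "\<And>n. u n \<in> borel_measurable M" "v \<in> borel_measurable M'"
    and u: "\<And>n \<omega>. \<omega> \<in> space M \<Longrightarrow> \<bar>u n \<omega>\<bar> \<le> C"
    and v: "\<And>\<omega>. \<omega> \<in> space M' \<Longrightarrow> \<bar>v \<omega>\<bar> \<le> C"
    and conv1: "\<And>\<theta> \<phi>. (\<lambda>n. \<integral>\<omega>. cos (\<theta> * X n \<omega> + \<phi>) \<partial>M) \<longlonglongrightarrow> (\<integral>\<omega>. cos (\<theta> * Y \<omega> + \<phi>) \<partial>M')"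
    and conv: "\<And>\<theta> \<phi>. (\<lambda>n. \<integral>\<omega>. u n \<omega> * cos (\<theta> * X n \<omega> + \<phi>) \<partial>M) \<longlonglongrightarrow> (\<integral>\<omega>. v \<omega> * cos (\<theta> * Y \<omega> + \<phi>) \<partial>M')"
    and g: "\<And>x. isCont g x" "\<And>x. \<bar>g x\<bar> \<le> (B::real)"
  shows "(\<lambda>n. \<integral>\<omega>. u n \<omega> * g (X n \<omega>) \<partial>M) \<longlonglongrightarrow> (\<integral>\<omega>. v \<omega> * g (Y \<omega>) \<partial>M')"
proof -
  interpret M: prob_space M by fact
  interpret M': prob_space M' by fact
  have [measurable]: "g \<in> borel_measurable borel"
    using g(1) by (intro borel_measurable_continuous_onI continuous_at_imp_continuous_on) auto
  have C: "0 \<le> C" using u M.not_empty by (metis abs_ge_zero all_not_in_conv order_trans)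
  have u': "0 \<le> C + u n \<omega>" "u n \<omega> \<le> C" if "\<omega> \<in> space M" for n \<omega>
    using u[OF that, of n] by auto
  have v': "0 \<le> C + v \<omega>" "v \<omega> \<le> C" if "\<omega> \<in> space M'" for \<omega>
    using v[OF that] by auto
  have split: "(\<integral>\<omega>. (C + 1 + u n \<omega>) * h (X n \<omega>) \<partial>M) = (C + 1) * (\<integral>\<omega>. h (X n \<omega>) \<partial>M) + (\<integral>\<omega>. u n \<omega> * h (X n \<omega>) \<partial>M)"
    if [measurable]: "h \<in> borel_measurable borel" and h: "\<And>x. \<bar>h x\<bar> \<le> (D::real)" for h D n
  proof -
    have "integrable M (\<lambda>\<omega>. h (X n \<omega>))" by (rule M.integrable_bounded[of _ D]) (auto simp: h)
    moreover have "integrable M (\<lambda>\<omega>. u n \<omega> * h (X n \<omega>))"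
      using u h by (intro M.integrable_bounded[of _ "C * D"]) (auto simp: abs_mult intro!: mult_mono C)
    ultimately show ?thesis by (simp add: distrib_right)
  qed
  have split': "(\<integral>\<omega>. (C + 1 + v \<omega>) * h (Y \<omega>) \<partial>M') = (C + 1) * (\<integral>\<omega>. h (Y \<omega>) \<partial>M') + (\<integral>\<omega>. v \<omega> * h (Y \<omega>) \<partial>M')"
    if [measurable]: "h \<in> borel_measurable borel" and h: "\<And>x. \<bar>h x\<bar> \<le> (D::real)" for h D
  proof -
    have "integrable M' (\<lambda>\<omega>. h (Y \<omega>))" by (rule M'.integrable_bounded[of _ D]) (auto simp: h)
    moreover have "integrable M' (\<lambda>\<omega>. v \<omega> * h (Y \<omega>))"
      using v h by (intro M'.integrable_bounded[of _ "C * D"]) (auto simp: abs_mult intro!: mult_mono C)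
    ultimately show ?thesis by (simp add: distrib_right)
  qed
  have A: "(\<lambda>n. \<integral>\<omega>. (C + 1 + u n \<omega>) * g (X n \<omega>) \<partial>M) \<longlonglongrightarrow> (\<integral>\<omega>. (C + 1 + v \<omega>) * g (Y \<omega>) \<partial>M')"
  proof (rule weighted_levy_pos[where C="2 * C + 1" and B=B and u="\<lambda>n \<omega>. C + 1 + u n \<omega>" and v="\<lambda>\<omega>. C + 1 + v \<omega>" and X=X and Y=Y and g=g])
    fix \<theta> \<phi>
    have "(\<lambda>n. (C + 1) * (\<integral>\<omega>. cos (\<theta> * X n \<omega> + \<phi>) \<partial>M) + (\<integral>\<omega>. u n \<omega> * cos (\<theta> * X n \<omega> + \<phi>) \<partial>M))
       \<longlonglongrightarrow> (C + 1) * (\<integral>\<omega>. cos (\<theta> * Y \<omega> + \<phi>) \<partial>M') + (\<integral>\<omega>. v \<omega> * cos (\<theta> * Y \<omega> + \<phi>) \<partial>M')"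
      by (intro tendsto_intros conv conv1)
    then show "(\<lambda>n. \<integral>\<omega>. (C + 1 + u n \<omega>) * cos (\<theta> * X n \<omega> + \<phi>) \<partial>M) \<longlonglongrightarrow> (\<integral>\<omega>. (C + 1 + v \<omega>) * cos (\<theta> * Y \<omega> + \<phi>) \<partial>M')"
      using split[of "\<lambda>x. cos (\<theta> * x + \<phi>)" 1] split'[of "\<lambda>x. cos (\<theta> * x + \<phi>)" 1] by simp
  qed (use u' v' g in \<open>auto intro: assms(1,2)\<close>)
  have Bq: "(\<lambda>n. \<integral>\<omega>. 1 * g (X n \<omega>) \<partial>M) \<longlonglongrightarrow> (\<integral>\<omega>. 1 * g (Y \<omega>) \<partial>M')"
    by (rule weighted_levy_pos[where C=1 and B=B and u="\<lambda>_ _. 1" and v="\<lambda>_. 1" and X=X and Y=Y and g=g]) (use g conv1 in \<open>auto intro: assms(1,2)\<close>)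
  have "(\<lambda>n. (\<integral>\<omega>. (C + 1 + u n \<omega>) * g (X n \<omega>) \<partial>M) - (C + 1) * (\<integral>\<omega>. 1 * g (X n \<omega>) \<partial>M))
     \<longlonglongrightarrow> (\<integral>\<omega>. (C + 1 + v \<omega>) * g (Y \<omega>) \<partial>M') - (C + 1) * (\<integral>\<omega>. 1 * g (Y \<omega>) \<partial>M')"
    by (intro tendsto_intros A Bq)
  then show ?thesis using g(2) by (simp add: split[of g B] split'[of g B])
qed

text \<open>Packages the comparison of \<open>a n\<close> with \<open>b n\<close>, of
  \<open>b n\<close> with its limit, and of that limit with a'. The error may depend on n and need
  only be small in the limit, which is the situation when it is itself controlled through a
  convergence in law.\<close>

lemma LIMSEQ_approx:
  fixes a :: "nat \<Rightarrow> real"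
  assumes "\<And>\<epsilon>. 0 < \<epsilon> \<Longrightarrow> \<exists>b b' e e'. (\<forall>\<^sub>F n in sequentially. \<bar>a n - b n\<bar> \<le> e n) \<and> \<bar>a' - b'\<bar> \<le> e' \<and> b \<longlonglongrightarrow> b' \<and> e \<longlonglongrightarrow> e' \<and> e' \<le> \<epsilon>"
  shows "a \<longlonglongrightarrow> a'"
proof (rule tendstoI)
  fix \<epsilon> :: real assume "0 < \<epsilon>"
  then obtain b b' e e' where *: "\<forall>\<^sub>F n in sequentially. \<bar>a n - b n\<bar> \<le> e n" "\<bar>a' - b'\<bar> \<le> e'" "b \<longlonglongrightarrow> b'" "e \<longlonglongrightarrow> e'" "e' \<le> \<epsilon> / 5"
    using assms[of "\<epsilon> / 5"] by auto
  have "\<forall>\<^sub>F n in sequentially. dist (b n) b' < \<epsilon> / 5" "\<forall>\<^sub>F n in sequentially. dist (e n) e' < \<epsilon> / 5"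
    using \<open>0 < \<epsilon>\<close> tendstoD[OF *(3), of "\<epsilon> / 5"] tendstoD[OF *(4), of "\<epsilon> / 5"] by auto
  with *(1) show "\<forall>\<^sub>F n in sequentially. dist (a n) a' < \<epsilon>"
  proof eventually_elim
    case (elim n)
    then show ?case using *(2,5) unfolding dist_real_def by linarith
  qed
qed

text \<open>A Lipschitz bound in the first J coordinates makes g continuous in the product topology
  and independent of the other coordinates, which may therefore be replaced by 0.\<close>

lemma coordinate_lipschitz_measurable:
  fixes g :: "(nat \<Rightarrow> real) \<Rightarrow> real"
  assumes g: "\<And>x y. \<bar>g x - g y\<bar> \<le> L * (\<Sum>j<J. \<bar>x j - y j\<bar>)"
    and U: "\<And>j. j < J \<Longrightarrow> (\<lambda>\<omega>. U \<omega> j) \<in> borel_measurable M"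
  shows "(\<lambda>\<omega>. g (U \<omega>)) \<in> borel_measurable M"
proof -
  have "continuous_on UNIV g"
    unfolding continuous_on_sequentially
  proof (intro allI ballI impI, elim conjE)
    fix x :: "nat \<Rightarrow> nat \<Rightarrow> real" and a assume x: "x \<longlonglongrightarrow> a"
    have xa: "(\<lambda>n. x n k) \<longlonglongrightarrow> a k" for k
      using continuous_on_tendsto_compose[OF continuous_on_product_coordinates x] by simp
    have "(\<lambda>n. L * (\<Sum>j<J. \<bar>x n j - a j\<bar>)) \<longlonglongrightarrow> L * (\<Sum>j<J. \<bar>a j - a j\<bar>)"
      by (intro tendsto_intros xa)
    then have "(\<lambda>n. L * (\<Sum>j<J. \<bar>x n j - a j\<bar>)) \<longlonglongrightarrow> 0" by simp
    then have "(\<lambda>n. g (x n) - g a) \<longlonglongrightarrow> 0"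
      by (rule Lim_null_comparison[rotated]) (use g in auto)
    then show "(g \<circ> x) \<longlonglongrightarrow> g a" unfolding comp_def by (rule LIM_zero_cancel)
  qed
  then have 1: "g \<in> borel_measurable borel" by (rule borel_measurable_continuous_onI)
  have 2: "(\<lambda>\<omega> k. if k < J then U \<omega> k else 0) \<in> borel_measurable M"
  proof (rule measurable_coordinatewise_then_product)
    fix k show "(\<lambda>\<omega>. if k < J then U \<omega> k else 0) \<in> borel_measurable M"
      by (cases "k < J") (auto simp: U)
  qed
  have "g (\<lambda>k. if k < J then U \<omega> k else 0) = g (U \<omega>)" for \<omega>
    using g[of "\<lambda>k. if k < J then U \<omega> k else 0" "U \<omega>"] by simp
  then show ?thesis using measurable_compose[OF 2 1] by simp
qed

text \<open>
  The bumps are a partition of unity of mesh \<open>\<delta>\<close> on a large interval, written as a telescoping sum of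
  ramps. They allow the continuity theorem to be transferred to functions of several variables one
  coordinate at a time.
\<close>

definition ramp :: "real \<Rightarrow> nat \<Rightarrow> nat \<Rightarrow> real \<Rightarrow> real" where
  "ramp \<delta> m i y = max 0 (min 1 (y / \<delta> + real m - real i))"

definition bump :: "real \<Rightarrow> nat \<Rightarrow> nat \<Rightarrow> real \<Rightarrow> real" where
  "bump \<delta> m i y = ramp \<delta> m i y - ramp \<delta> m (Suc i) y"

definition plateau :: "real \<Rightarrow> nat \<Rightarrow> real \<Rightarrow> real" where
  "plateau \<delta> m y = ramp \<delta> m 0 y - ramp \<delta> m (2 * m) y"

lemma sum_bump: "(\<Sum>i<2 * m. bump \<delta> m i y) = plateau \<delta> m y"
  unfolding bump_def plateau_def by (rule sum_lessThan_telescope')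

lemma bump_nonneg: "0 \<le> bump \<delta> m i y" and bump_le_one: "bump \<delta> m i y \<le> 1"
  by (auto simp: bump_def ramp_def)

lemma plateau_nonneg: "0 \<le> plateau \<delta> m y" and plateau_le_one: "plateau \<delta> m y \<le> 1"
  by (auto simp: plateau_def ramp_def)

text \<open>The function \<open>bump\<close> is a tent that starts at \<delta> * (i - m), peaks one
  mesh later and ends two meshes later. The distance is measured from the left end, hence the factor
  2.\<close>

lemma bump_support: "0 < \<delta> \<Longrightarrow> bump \<delta> m i y \<noteq> 0 \<Longrightarrow> \<bar>y - \<delta> * (real i - real m)\<bar> \<le> 2 * \<delta>"
  by (auto simp: bump_def ramp_def max_def min_def field_simps abs_le_iff split: if_splits)

lemma isCont_bump: "0 < \<delta> \<Longrightarrow> isCont (bump \<delta> m i) y"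
  unfolding bump_def ramp_def by (intro continuous_intros) auto

lemma isCont_plateau: "0 < \<delta> \<Longrightarrow> isCont (plateau \<delta> m) y"
  unfolding plateau_def ramp_def by (intro continuous_intros) auto

lemma plateau_eq_one: "0 < \<delta> \<Longrightarrow> real m \<ge> \<bar>y\<bar> / \<delta> + 1 \<Longrightarrow> plateau \<delta> m y = 1"
  by (auto simp: plateau_def ramp_def max_def min_def field_simps abs_if split: if_splits)

lemma multidim_levy:
  fixes M :: "'a measure" and M' :: "'b measure"
    and U :: "nat \<Rightarrow> 'a \<Rightarrow> nat \<Rightarrow> real" and V :: "'b \<Rightarrow> nat \<Rightarrow> real"
  assumes "prob_space M" "prob_space M'"
    and U: "\<And>n j. j < J \<Longrightarrow> (\<lambda>\<omega>. U n \<omega> j) \<in> borel_measurable M"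
    and V: "\<And>j. j < J \<Longrightarrow> (\<lambda>\<omega>. V \<omega> j) \<in> borel_measurable M'"
    and conv: "\<And>\<theta> \<phi>. (\<lambda>n. \<integral>\<omega>. cos ((\<Sum>j<J. \<theta> j * U n \<omega> j) + \<phi>) \<partial>M) \<longlonglongrightarrow> (\<integral>\<omega>. cos ((\<Sum>j<J. \<theta> j * V \<omega> j) + \<phi>) \<partial>M')"
    and g: "\<And>x. \<bar>g x\<bar> \<le> B" "\<And>x y. \<bar>g x - g y\<bar> \<le> L * (\<Sum>j<J. \<bar>x j - y j\<bar>)"
  shows "(\<lambda>n. \<integral>\<omega>. g (U n \<omega>) \<partial>M) \<longlonglongrightarrow> (\<integral>\<omega>. g (V \<omega>) \<partial>M')"
proof -
  interpret M: prob_space M by fact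
  interpret M': prob_space M' by fact
  define cU where "cU l \<theta> \<phi> n \<omega> = cos ((\<Sum>j\<in>{l..<J}. \<theta> j * U n \<omega> j) + \<phi>)" for l \<theta> \<phi> n \<omega>
  define cV where "cV l \<theta> \<phi> \<omega> = cos ((\<Sum>j\<in>{l..<J}. \<theta> j * V \<omega> j) + \<phi>)" for l \<theta> \<phi> \<omega>
  have cU_meas [measurable]: "cU l \<theta> \<phi> n \<in> borel_measurable M" and cV_meas [measurable]: "cV l \<theta> \<phi> \<in> borel_measurable M'" for l \<theta> \<phi> n
    unfolding cU_def[abs_def] cV_def[abs_def]
    by (auto intro!: borel_measurable_continuous_on[where f=cos] borel_measurable_add borel_measurable_sum borel_measurable_times U V continuous_on_cos continuous_on_id)
  have cU_le: "\<bar>cU l \<theta> \<phi> n \<omega>\<bar> \<le> 1" and cV_le: "\<bar>cV l \<theta> \<phi> \<omega>'\<bar> \<le> 1" for l \<theta> \<phi> n \<omega> \<omega>'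
    by (auto simp: cU_def cV_def)
  have "(\<lambda>n. \<integral>\<omega>. g (U n \<omega>) * cU l \<theta> \<phi> n \<omega> \<partial>M) \<longlonglongrightarrow> (\<integral>\<omega>. g (V \<omega>) * cV l \<theta> \<phi> \<omega> \<partial>M')"
    if "l \<le> J" "\<And>x. \<bar>g x\<bar> \<le> B" "\<And>x y. \<bar>g x - g y\<bar> \<le> L * (\<Sum>j<l. \<bar>x j - y j\<bar>)" for l g B L \<theta> \<phi>
    using that
  proof (induction l arbitrary: g B L \<theta> \<phi>)
    case 0
    have "g x = g (\<lambda>_. 0)" for x using 0(3)[of x "\<lambda>_. 0"] by simp
    then have gc: "g = (\<lambda>_. g (\<lambda>_. 0))" by blast
    have "(\<lambda>n. g (\<lambda>_. 0) * (\<integral>\<omega>. cU 0 \<theta> \<phi> n \<omega> \<partial>M)) \<longlonglongrightarrow> g (\<lambda>_. 0) * (\<integral>\<omega>. cV 0 \<theta> \<phi> \<omega> \<partial>M')"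
      using conv[of \<theta> \<phi>] unfolding cU_def cV_def atLeast0LessThan by (intro tendsto_intros)
    then show ?case by (subst (1 2) gc) simp
  next
    case (Suc l)
    note gB = Suc.prems(2) and gL = Suc.prems(3)
    have lJ: "l < J" using Suc.prems(1) by simp
    have B: "0 \<le> B" using gB[of undefined] by linarith
    have gU [measurable]: "(\<lambda>\<omega>. g (U n \<omega>)) \<in> borel_measurable M" and gV [measurable]: "(\<lambda>\<omega>. g (V \<omega>)) \<in> borel_measurable M'" for n
      using Suc.prems(1) by (auto intro!: coordinate_lipschitz_measurable[OF gL] U V)
    have Ul [measurable]: "(\<lambda>\<omega>. U n \<omega> l) \<in> borel_measurable M" and Vl [measurable]: "(\<lambda>\<omega>. V \<omega> l) \<in> borel_measurable M'" for n
      using lJ U V by auto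
    \<comment> \<open>Freezing coordinate l at y leaves a function of the first l coordinates with
      the same bounds, to which the induction hypothesis applies.\<close>
    define gi where "gi y x = g (x(l := y))" for y x
    have giB: "\<bar>gi y x\<bar> \<le> B" for y x by (simp add: gi_def gB)
    have giL: "\<bar>gi y x - gi y x'\<bar> \<le> L * (\<Sum>j<l. \<bar>x j - x' j\<bar>)" for y x x'
    proof -
      have "(\<Sum>j<Suc l. \<bar>(x(l := y)) j - (x'(l := y)) j\<bar>) = (\<Sum>j<l. \<bar>x j - x' j\<bar>)" by simp
      with gL[of "x(l := y)" "x'(l := y)"] show ?thesis unfolding gi_def by (simp only:)
    qed
    have giU [measurable]: "(\<lambda>\<omega>. gi y (U n \<omega>)) \<in> borel_measurable M" and giV [measurable]: "(\<lambda>\<omega>. gi y (V \<omega>)) \<in> borel_measurable M'" for y n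
      using Suc.prems(1) by (auto intro!: coordinate_lipschitz_measurable[OF giL] U V)
    have sum_split: "(\<Sum>j\<in>{l..<J}. (\<theta>(l := t)) j * x j) = t * x l + (\<Sum>j\<in>{Suc l..<J}. \<theta> j * x j)" for t x
      using lJ by (simp add: sum.atLeast_Suc_lessThan)
    \<comment> \<open>Product-to-sum formula: a cosine in coordinate l merges with the cosine of the
      later coordinates into two cosines with frequencies t and - t at l. This is why the induction
      runs over all frequencies and phases.\<close>
    have prodU: "h * cU (Suc l) \<theta> \<phi> n \<omega> * cos (t * U n \<omega> l + \<psi>)
        = (h * cU l (\<theta>(l := t)) (\<phi> + \<psi>) n \<omega> + h * cU l (\<theta>(l := - t)) (\<phi> - \<psi>) n \<omega>) / 2" for t \<psi> n \<omega> h
      unfolding cU_def sum_split cos_times_cos mult.assoc by (simp add: algebra_simps)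
    have prodV: "h * cV (Suc l) \<theta> \<phi> \<omega> * cos (t * V \<omega> l + \<psi>)
        = (h * cV l (\<theta>(l := t)) (\<phi> + \<psi>) \<omega> + h * cV l (\<theta>(l := - t)) (\<phi> - \<psi>) \<omega>) / 2" for t \<psi> \<omega> h
      unfolding cV_def sum_split cos_times_cos mult.assoc by (simp add: algebra_simps)
    have conv1: "(\<lambda>n. \<integral>\<omega>. cos (t * U n \<omega> l + \<psi>) \<partial>M) \<longlonglongrightarrow> (\<integral>\<omega>. cos (t * V \<omega> l + \<psi>) \<partial>M')" for t \<psi>
    proof -
      have "(\<Sum>j<J. (if j = l then t else 0) * x j) = t * x l" for x :: "nat \<Rightarrow> real"
      proof -
        have "(\<Sum>j<J. (if j = l then t else 0) * x j) = (\<Sum>j<J. if j = l then t * x j else 0)"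
          by (intro sum.cong) auto
        then show ?thesis using lJ by simp
      qed
      then show ?thesis using conv[of "\<lambda>j. if j = l then t else 0" \<psi>] by simp
    qed
    have intU: "integrable M (\<lambda>\<omega>. gi y (U n \<omega>) * cU k \<theta> \<phi> n \<omega>)" and intV: "integrable M' (\<lambda>\<omega>. gi y (V \<omega>) * cV k \<theta> \<phi> \<omega>)" for y n k \<theta> \<phi>
      using giB cU_le cV_le
      by (auto intro!: M.integrable_bounded[where B="B * 1"] M'.integrable_bounded[where B="B * 1"] mult_mono B simp del: mult_1_right simp: abs_mult)
    have conv2: "(\<lambda>n. \<integral>\<omega>. gi y (U n \<omega>) * cU (Suc l) \<theta> \<phi> n \<omega> * cos (t * U n \<omega> l + \<psi>) \<partial>M)
        \<longlonglongrightarrow> (\<integral>\<omega>. gi y (V \<omega>) * cV (Suc l) \<theta> \<phi> \<omega> * cos (t * V \<omega> l + \<psi>) \<partial>M')" for t \<psi> y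
    proof -
      have IH: "(\<lambda>n. \<integral>\<omega>. gi y (U n \<omega>) * cU l \<theta> \<phi> n \<omega> \<partial>M) \<longlonglongrightarrow> (\<integral>\<omega>. gi y (V \<omega>) * cV l \<theta> \<phi> \<omega> \<partial>M')" for \<theta> \<phi>
        using lJ by (intro Suc.IH[of "gi y" B L] giB giL) auto
      show ?thesis
        unfolding prodU prodV using intU intV by (auto intro!: tendsto_intros IH)
    qed
    have conv3: "(\<lambda>n. \<integral>\<omega>. gi y (U n \<omega>) * cU (Suc l) \<theta> \<phi> n \<omega> * h (U n \<omega> l) \<partial>M)
        \<longlonglongrightarrow> (\<integral>\<omega>. gi y (V \<omega>) * cV (Suc l) \<theta> \<phi> \<omega> * h (V \<omega> l) \<partial>M')"
      if "\<And>x. isCont h x" "\<And>x. \<bar>h x\<bar> \<le> 1" for h y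
    proof (rule weighted_levy[OF assms(1,2), where X="\<lambda>n \<omega>. U n \<omega> l" and Y="\<lambda>\<omega>. V \<omega> l" and C="B * 1" and B=1 and g=h
          and u="\<lambda>n \<omega>. gi y (U n \<omega>) * cU (Suc l) \<theta> \<phi> n \<omega>" and v="\<lambda>\<omega>. gi y (V \<omega>) * cV (Suc l) \<theta> \<phi> \<omega>"])
      show "\<bar>gi y (U n \<omega>) * cU (Suc l) \<theta> \<phi> n \<omega>\<bar> \<le> B * 1" for n \<omega>
        unfolding abs_mult by (intro mult_mono giB cU_le B) auto
      show "\<bar>gi y (V \<omega>) * cV (Suc l) \<theta> \<phi> \<omega>\<bar> \<le> B * 1" for \<omega>
        unfolding abs_mult by (intro mult_mono giB cV_le B) auto
    qed (use conv1 conv2 that in auto)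
    have conv4: "(\<lambda>n. \<integral>\<omega>. 1 * h (U n \<omega> l) \<partial>M) \<longlonglongrightarrow> (\<integral>\<omega>. 1 * h (V \<omega> l) \<partial>M')"
      if "\<And>x. isCont h x" "\<And>x. \<bar>h x\<bar> \<le> 1" for h :: "real \<Rightarrow> real"
      by (rule weighted_levy[OF assms(1,2), where X="\<lambda>n \<omega>. U n \<omega> l" and Y="\<lambda>\<omega>. V \<omega> l" and C="1" and B=1 and g=h
          and u="\<lambda>n \<omega>. 1" and v="\<lambda>\<omega>. 1"]) (use conv1 that in auto)
    show ?case
    proof (rule LIMSEQ_approx)
      fix \<epsilon> :: real assume eps: "0 < \<epsilon>"
      define \<delta> where "\<delta> = \<epsilon> / (4 * (\<bar>L\<bar> + 1))"
      have \<delta>: "0 < \<delta>" "\<bar>L\<bar> * (2 * \<delta>) \<le> \<epsilon> / 2"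
        using eps by (auto simp: \<delta>_def field_simps)
      have [measurable]: "bump \<delta> m i \<in> borel_measurable borel" "plateau \<delta> m \<in> borel_measurable borel" for m i
        using isCont_bump[OF \<delta>(1)] isCont_plateau[OF \<delta>(1)]
        by (auto intro!: borel_measurable_continuous_onI continuous_at_imp_continuous_on)
      have "(\<lambda>m. \<integral>\<omega>. plateau \<delta> m (V \<omega> l) \<partial>M') \<longlonglongrightarrow> (\<integral>\<omega>. 1 \<partial>M')"
      proof (rule integral_dominated_convergence[where w="\<lambda>_. 1"])
        show "AE \<omega> in M'. (\<lambda>m. plateau \<delta> m (V \<omega> l)) \<longlonglongrightarrow> 1"
        proof (rule AE_I2)
          fix \<omega>
          obtain m0 :: nat where "\<bar>V \<omega> l\<bar> / \<delta> + 1 \<le> m0" using real_arch_simple by blast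
          then have "\<forall>\<^sub>F m in sequentially. plateau \<delta> m (V \<omega> l) = 1"
            using \<delta>(1) by (intro eventually_sequentiallyI[of m0] plateau_eq_one) auto
          then show "(\<lambda>m. plateau \<delta> m (V \<omega> l)) \<longlonglongrightarrow> 1" by (rule tendsto_eventually)
        qed
      qed (auto simp: plateau_nonneg plateau_le_one)
      \<comment> \<open>The cut-off m is chosen from the limit law alone; for the laws of
        \<open>U n\<close> the mass outside the plateau is then small only in the limit, through
        \<open>conv4\<close>.\<close>
      then have "(\<lambda>m. B * (1 - (\<integral>\<omega>. plateau \<delta> m (V \<omega> l) \<partial>M'))) \<longlonglongrightarrow> B * (1 - 1)"
        by (intro tendsto_intros) (simp add: M'.prob_space)
      from LIMSEQ_D[OF this, of "\<epsilon> / 2"] eps obtain m where m: "\<bar>B * (1 - (\<integral>\<omega>. plateau \<delta> m (V \<omega> l) \<partial>M'))\<bar> < \<epsilon> / 2"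
        by auto
      define ga where "ga x = (\<Sum>i<2 * m. gi (\<delta> * (real i - real m)) x * bump \<delta> m i (x l))" for x
      have ga: "\<bar>g x - ga x\<bar> \<le> B * (1 - plateau \<delta> m (x l)) + \<epsilon> / 2" for x
      proof -
        have "g x - ga x = g x * (1 - plateau \<delta> m (x l)) + (\<Sum>i<2 * m. (g x - gi (\<delta> * (real i - real m)) x) * bump \<delta> m i (x l))"
          unfolding sum_bump[symmetric] ga_def by (simp add: algebra_simps sum_subtractf sum_distrib_left)
        also have "\<bar>\<dots>\<bar> \<le> \<bar>g x\<bar> * (1 - plateau \<delta> m (x l)) + (\<Sum>i<2 * m. \<bar>(g x - gi (\<delta> * (real i - real m)) x)\<bar> * bump \<delta> m i (x l))"
        proof (rule order_trans[OF abs_triangle_ineq], rule add_mono)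
          show "\<bar>\<Sum>i<2 * m. (g x - gi (\<delta> * (real i - real m)) x) * bump \<delta> m i (x l)\<bar>
             \<le> (\<Sum>i<2 * m. \<bar>(g x - gi (\<delta> * (real i - real m)) x)\<bar> * bump \<delta> m i (x l))"
            by (rule order_trans[OF sum_abs]) (simp add: abs_mult bump_nonneg)
        qed (simp add: abs_mult plateau_le_one)
        also have "\<dots> \<le> B * (1 - plateau \<delta> m (x l)) + (\<Sum>i<2 * m. \<epsilon> / 2 * bump \<delta> m i (x l))"
        proof (rule add_mono[OF mult_right_mono[OF gB] sum_mono])
          fix i
          show "\<bar>g x - gi (\<delta> * (real i - real m)) x\<bar> * bump \<delta> m i (x l) \<le> \<epsilon> / 2 * bump \<delta> m i (x l)"
          proof (cases "bump \<delta> m i (x l) = 0")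
            case False
            have "\<bar>g x - gi (\<delta> * (real i - real m)) x\<bar> \<le> L * \<bar>x l - \<delta> * (real i - real m)\<bar>"
            proof -
              have "(\<Sum>j<Suc l. \<bar>x j - (x(l := \<delta> * (real i - real m))) j\<bar>) = \<bar>x l - \<delta> * (real i - real m)\<bar>" by simp
              with gL[of x "x(l := \<delta> * (real i - real m))"] show ?thesis unfolding gi_def by (simp only:)
            qed
            also have "\<dots> \<le> \<bar>L\<bar> * (2 * \<delta>)"
              using bump_support[OF \<delta>(1) False] by (intro mult_mono) auto
            finally show ?thesis using \<delta>(2) by (intro mult_right_mono bump_nonneg) auto
          qed simp
        qed (simp add: plateau_le_one)
        also have "(\<Sum>i<2 * m. \<epsilon> / 2 * bump \<delta> m i (x l)) = \<epsilon> / 2 * plateau \<delta> m (x l)"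
          by (simp add: sum_distrib_left sum_bump[symmetric])
        also have "\<dots> \<le> \<epsilon> / 2 * 1" using eps plateau_le_one by (intro mult_left_mono) auto
        finally show ?thesis by simp
      qed
      have gaU [measurable]: "(\<lambda>\<omega>. ga (U n \<omega>)) \<in> borel_measurable M" and gaV [measurable]: "(\<lambda>\<omega>. ga (V \<omega>)) \<in> borel_measurable M'" for n
        unfolding ga_def by measurable
      have ga_bd: "\<bar>ga x\<bar> \<le> B + B + \<epsilon> / 2" for x
      proof -
        have "B * (1 - plateau \<delta> m (x l)) \<le> B * 1" by (intro mult_left_mono B) (simp add: plateau_nonneg)
        then show ?thesis using ga[of x] gB[of x] by linarith
      qed
      have errU: "\<bar>(\<integral>\<omega>. g (U n \<omega>) * cU (Suc l) \<theta> \<phi> n \<omega> \<partial>M) - (\<integral>\<omega>. ga (U n \<omega>) * cU (Suc l) \<theta> \<phi> n \<omega> \<partial>M)\<bar>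
          \<le> B * (1 - (\<integral>\<omega>. 1 * plateau \<delta> m (U n \<omega> l) \<partial>M)) + \<epsilon> / 2" for n
      proof -
        have p: "integrable M (\<lambda>\<omega>. plateau \<delta> m (U n \<omega> l))"
          by (rule M.integrable_bounded[where B=1]) (auto simp: plateau_nonneg plateau_le_one)
        have 1: "integrable M (\<lambda>\<omega>. g (U n \<omega>) * cU (Suc l) \<theta> \<phi> n \<omega>)"
          using gB cU_le by (intro M.integrable_bounded[where B="B * 1"]) (auto simp: abs_mult intro!: mult_mono B simp del: mult_1_right)
        have 2: "integrable M (\<lambda>\<omega>. ga (U n \<omega>) * cU (Suc l) \<theta> \<phi> n \<omega>)"
          using ga_bd cU_le B eps by (intro M.integrable_bounded[where B="(B + B + \<epsilon> / 2) * 1"]) (auto simp: abs_mult intro!: mult_mono simp del: mult_1_right)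
        have "\<bar>(\<integral>\<omega>. g (U n \<omega>) * cU (Suc l) \<theta> \<phi> n \<omega> \<partial>M) - (\<integral>\<omega>. ga (U n \<omega>) * cU (Suc l) \<theta> \<phi> n \<omega> \<partial>M)\<bar>
          = \<bar>\<integral>\<omega>. (g (U n \<omega>) - ga (U n \<omega>)) * cU (Suc l) \<theta> \<phi> n \<omega> \<partial>M\<bar>"
          using 1 2 by (simp add: left_diff_distrib)
        also have "\<dots> \<le> (\<integral>\<omega>. \<bar>(g (U n \<omega>) - ga (U n \<omega>)) * cU (Suc l) \<theta> \<phi> n \<omega>\<bar> \<partial>M)" by (rule integral_abs_bound)
        also have "\<dots> \<le> (\<integral>\<omega>. B * (1 - plateau \<delta> m (U n \<omega> l)) + \<epsilon> / 2 \<partial>M)"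
        proof (rule integral_mono)
          show "integrable M (\<lambda>\<omega>. \<bar>(g (U n \<omega>) - ga (U n \<omega>)) * cU (Suc l) \<theta> \<phi> n \<omega>\<bar>)"
            using 1 2 by (simp add: left_diff_distrib)
          fix \<omega>
          have "\<bar>(g (U n \<omega>) - ga (U n \<omega>)) * cU (Suc l) \<theta> \<phi> n \<omega>\<bar> \<le> \<bar>g (U n \<omega>) - ga (U n \<omega>)\<bar> * 1"
            unfolding abs_mult by (intro mult_left_mono cU_le) auto
          also have "\<dots> \<le> B * (1 - plateau \<delta> m (U n \<omega> l)) + \<epsilon> / 2" using ga[of "U n \<omega>"] by simp
          finally show "\<bar>(g (U n \<omega>) - ga (U n \<omega>)) * cU (Suc l) \<theta> \<phi> n \<omega>\<bar> \<le> B * (1 - plateau \<delta> m (U n \<omega> l)) + \<epsilon> / 2" .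
        qed (use p in simp)
        also have "\<dots> = B * (1 - (\<integral>\<omega>. 1 * plateau \<delta> m (U n \<omega> l) \<partial>M)) + \<epsilon> / 2"
          using p by (simp add: M.prob_space)
        finally show ?thesis .
      qed
      have errV: "\<bar>(\<integral>\<omega>. g (V \<omega>) * cV (Suc l) \<theta> \<phi> \<omega> \<partial>M') - (\<integral>\<omega>. ga (V \<omega>) * cV (Suc l) \<theta> \<phi> \<omega> \<partial>M')\<bar>
          \<le> B * (1 - (\<integral>\<omega>. 1 * plateau \<delta> m (V \<omega> l) \<partial>M')) + \<epsilon> / 2"
      proof -
        have p: "integrable M' (\<lambda>\<omega>. plateau \<delta> m (V \<omega> l))"
          by (rule M'.integrable_bounded[where B=1]) (auto simp: plateau_nonneg plateau_le_one)
        have 1: "integrable M' (\<lambda>\<omega>. g (V \<omega>) * cV (Suc l) \<theta> \<phi> \<omega>)"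
          using gB cV_le by (intro M'.integrable_bounded[where B="B * 1"]) (auto simp: abs_mult intro!: mult_mono B simp del: mult_1_right)
        have 2: "integrable M' (\<lambda>\<omega>. ga (V \<omega>) * cV (Suc l) \<theta> \<phi> \<omega>)"
          using ga_bd cV_le B eps by (intro M'.integrable_bounded[where B="(B + B + \<epsilon> / 2) * 1"]) (auto simp: abs_mult intro!: mult_mono simp del: mult_1_right)
        have "\<bar>(\<integral>\<omega>. g (V \<omega>) * cV (Suc l) \<theta> \<phi> \<omega> \<partial>M') - (\<integral>\<omega>. ga (V \<omega>) * cV (Suc l) \<theta> \<phi> \<omega> \<partial>M')\<bar>
          = \<bar>\<integral>\<omega>. (g (V \<omega>) - ga (V \<omega>)) * cV (Suc l) \<theta> \<phi> \<omega> \<partial>M'\<bar>"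
          using 1 2 by (simp add: left_diff_distrib)
        also have "\<dots> \<le> (\<integral>\<omega>. \<bar>(g (V \<omega>) - ga (V \<omega>)) * cV (Suc l) \<theta> \<phi> \<omega>\<bar> \<partial>M')" by (rule integral_abs_bound)
        also have "\<dots> \<le> (\<integral>\<omega>. B * (1 - plateau \<delta> m (V \<omega> l)) + \<epsilon> / 2 \<partial>M')"
        proof (rule integral_mono)
          show "integrable M' (\<lambda>\<omega>. \<bar>(g (V \<omega>) - ga (V \<omega>)) * cV (Suc l) \<theta> \<phi> \<omega>\<bar>)"
            using 1 2 by (simp add: left_diff_distrib)
          fix \<omega>
          have "\<bar>(g (V \<omega>) - ga (V \<omega>)) * cV (Suc l) \<theta> \<phi> \<omega>\<bar> \<le> \<bar>g (V \<omega>) - ga (V \<omega>)\<bar> * 1"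
            unfolding abs_mult by (intro mult_left_mono cV_le) auto
          also have "\<dots> \<le> B * (1 - plateau \<delta> m (V \<omega> l)) + \<epsilon> / 2" using ga[of "V \<omega>"] by simp
          finally show "\<bar>(g (V \<omega>) - ga (V \<omega>)) * cV (Suc l) \<theta> \<phi> \<omega>\<bar> \<le> B * (1 - plateau \<delta> m (V \<omega> l)) + \<epsilon> / 2" .
        qed (use p in simp)
        also have "\<dots> = B * (1 - (\<integral>\<omega>. 1 * plateau \<delta> m (V \<omega> l) \<partial>M')) + \<epsilon> / 2"
          using p by (simp add: M'.prob_space)
        finally show ?thesis .
      qed
      have main: "(\<lambda>n. \<integral>\<omega>. ga (U n \<omega>) * cU (Suc l) \<theta> \<phi> n \<omega> \<partial>M) \<longlonglongrightarrow> (\<integral>\<omega>. ga (V \<omega>) * cV (Suc l) \<theta> \<phi> \<omega> \<partial>M')"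
      proof -
        have bump1: "\<bar>bump \<delta> m i y\<bar> \<le> 1" for i y by (simp add: bump_nonneg bump_le_one)
        have iU: "integrable M (\<lambda>\<omega>. gi y (U n \<omega>) * cU (Suc l) \<theta> \<phi> n \<omega> * bump \<delta> m i (U n \<omega> l))" for y n i
          by (rule M.integrable_bounded[where B="B * 1 * 1"], measurable)
            (unfold abs_mult, intro mult_mono mult_nonneg_nonneg giB cU_le bump1 B, auto simp: B)
        have iV: "integrable M' (\<lambda>\<omega>. gi y (V \<omega>) * cV (Suc l) \<theta> \<phi> \<omega> * bump \<delta> m i (V \<omega> l))" for y i
          by (rule M'.integrable_bounded[where B="B * 1 * 1"], measurable)
            (unfold abs_mult, intro mult_mono mult_nonneg_nonneg giB cV_le bump1 B, auto simp: B)
        have eU: "ga (U n \<omega>) * cU (Suc l) \<theta> \<phi> n \<omega>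
          = (\<Sum>i<2 * m. gi (\<delta> * (real i - real m)) (U n \<omega>) * cU (Suc l) \<theta> \<phi> n \<omega> * bump \<delta> m i (U n \<omega> l))" for n \<omega>
          unfolding ga_def sum_distrib_right by (intro sum.cong refl) (simp add: mult_ac)
        have eV: "ga (V \<omega>) * cV (Suc l) \<theta> \<phi> \<omega>
          = (\<Sum>i<2 * m. gi (\<delta> * (real i - real m)) (V \<omega>) * cV (Suc l) \<theta> \<phi> \<omega> * bump \<delta> m i (V \<omega> l))" for \<omega>
          unfolding ga_def sum_distrib_right by (intro sum.cong refl) (simp add: mult_ac)
        show ?thesis
          unfolding eU eV using iU iV
          by (simp only: Bochner_Integration.integral_sum)
            (intro tendsto_sum conv3 isCont_bump \<delta>(1) bump1)
      qed
      have elim: "(\<lambda>n. B * (1 - (\<integral>\<omega>. 1 * plateau \<delta> m (U n \<omega> l) \<partial>M)) + \<epsilon> / 2)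
          \<longlonglongrightarrow> B * (1 - (\<integral>\<omega>. 1 * plateau \<delta> m (V \<omega> l) \<partial>M')) + \<epsilon> / 2"
        by (intro tendsto_intros conv4 isCont_plateau \<delta>(1)) (auto simp: plateau_nonneg plateau_le_one)
      show "\<exists>b b' e e'. (\<forall>\<^sub>F n in sequentially. \<bar>(\<integral>\<omega>. g (U n \<omega>) * cU (Suc l) \<theta> \<phi> n \<omega> \<partial>M) - b n\<bar> \<le> e n)
          \<and> \<bar>(\<integral>\<omega>. g (V \<omega>) * cV (Suc l) \<theta> \<phi> \<omega> \<partial>M') - b'\<bar> \<le> e' \<and> b \<longlonglongrightarrow> b' \<and> e \<longlonglongrightarrow> e' \<and> e' \<le> \<epsilon>"
      proof (intro exI conjI)
        show "B * (1 - (\<integral>\<omega>. 1 * plateau \<delta> m (V \<omega> l) \<partial>M')) + \<epsilon> / 2 \<le> \<epsilon>" using m by simp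
      qed (rule always_eventually[OF allI[OF errU]] errV main elim)+
    qed
  qed
  \<comment> \<open>For l = J the trigonometric factor has an empty sum and phase 0, so it equals
    1.\<close>
  from this[of J g B L "\<lambda>_. 0" 0] g show ?thesis
    by (simp add: cU_def cV_def)
qed

section \<open>A criterion for convergence in distribution\<close>

definition step_path :: "nat \<Rightarrow> nat \<Rightarrow> (nat \<Rightarrow> real) \<Rightarrow> real \<Rightarrow> real" where
  "step_path K J u t = (\<Sum>j<J. indicator {real j / real K..<real (Suc j) / real K} t * u j)"

lemma step_in_skD: "step_path K J u \<in> skD"
  unfolding skD_def step_path_def[abs_def]
  by (rule CollectI) (intro cadlag_sum cadlag_mult cadlag_const cadlag_indicator)

lemma step_eq:
  assumes K: "0 < K" and t: "0 \<le> t" "t < real J / real K"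
  shows "step_path K J u t = u (nat \<lfloor>real K * t\<rfloor>)"
proof -
  define i where "i = nat \<lfloor>real K * t\<rfloor>"
  have i: "real i \<le> real K * t" "real K * t < real i + 1"
    using t K by (auto simp: i_def)
  have "real K * t < real J" using t K by (simp add: field_simps)
  then have "i < J" using i by linarith
  have eq: "t \<in> {real j / real K..<real (Suc j) / real K} \<longleftrightarrow> j = i" for j
  proof -
    have "t \<in> {real j / real K..<real (Suc j) / real K} \<longleftrightarrow> real j \<le> real K * t \<and> real K * t < real j + 1"
      using K by (auto simp: field_simps)
    also have "\<dots> \<longleftrightarrow> j = i" using i by auto
    finally show ?thesis .
  qed
  have "step_path K J u t = (\<Sum>j<J. if j = i then u j else 0)"
    unfolding step_path_def by (intro sum.cong refl) (simp only: indicator_def eq, simp)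
  also have "\<dots> = u i" using \<open>i < J\<close> by simp
  finally show ?thesis by (simp add: i_def)
qed

lemma ud_step_le: "ud (step_path K J u) (step_path K J v) \<le> (\<Sum>j<J. \<bar>u j - v j\<bar>)"
proof (rule ud_leI)
  fix t :: real assume t: "0 \<le> t"
  have "exp (- t) * min 1 \<bar>step_path K J u t - step_path K J v t\<bar> \<le> 1 * \<bar>step_path K J u t - step_path K J v t\<bar>"
    using t by (intro mult_mono) auto
  also have "\<dots> = \<bar>\<Sum>j<J. indicator {real j / real K..<real (Suc j) / real K} t * (u j - v j)\<bar>"
    by (simp add: step_path_def sum_subtractf right_diff_distrib)
  also have "\<dots> \<le> (\<Sum>j<J. \<bar>u j - v j\<bar>)"
    by (rule order_trans[OF sum_abs]) (auto intro!: sum_mono simp: indicator_def)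
  finally show "exp (- t) * min 1 \<bar>step_path K J u t - step_path K J v t\<bar> \<le> (\<Sum>j<J. \<bar>u j - v j\<bar>)" .
qed

lemma grid_point_bounds:
  assumes "0 < K" "0 \<le> t"
  shows "real (nat \<lfloor>real K * t\<rfloor>) / real K \<le> t" "t < real (nat \<lfloor>real K * t\<rfloor>) / real K + 1 / real K"
proof -
  have i: "real (nat \<lfloor>real K * t\<rfloor>) \<le> real K * t" "real K * t < real (nat \<lfloor>real K * t\<rfloor>) + 1"
    using assms by auto
  have "real (nat \<lfloor>real K * t\<rfloor>) / real K \<le> real K * t / real K"
    using i(1) by (rule divide_right_mono) simp
  then show "real (nat \<lfloor>real K * t\<rfloor>) / real K \<le> t" using assms by simp
  have "real K * t / real K < (real (nat \<lfloor>real K * t\<rfloor>) + 1) / real K"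
    using i(2) assms by (intro divide_strict_right_mono) auto
  then show "t < real (nat \<lfloor>real K * t\<rfloor>) / real K + 1 / real K"
    using assms by (simp add: add_divide_distrib)
qed

text \<open>With K * K cells of width 1 / K a single index both refines the mesh and pushes the
  horizon to K. Uniform continuity on [0, T] handles the near part, the exponential weight the
  rest.\<close>

lemma step_tendsto_continuous:
  assumes "continuous_on {0..} y"
  shows "(\<lambda>K. ud y (step_path K (K * K) (\<lambda>j. y (real j / real K)))) \<longlonglongrightarrow> 0"
proof (rule LIMSEQ_I)
  fix \<epsilon> :: real assume eps: "0 < \<epsilon>"
  obtain T :: real where T: "0 < T" "exp (- T) < \<epsilon> / 2"
  proof
    show "0 < max 1 (1 - ln (\<epsilon> / 2))" by simp
    have "- max 1 (1 - ln (\<epsilon> / 2)) < ln (\<epsilon> / 2)" by linarith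
    then show "exp (- max 1 (1 - ln (\<epsilon> / 2))) < \<epsilon> / 2"
      using eps by (metis exp_less_cancel_iff exp_ln half_gt_zero)
  qed
  have "uniformly_continuous_on {0..T} y"
    using assms by (intro compact_uniformly_continuous) (auto intro: continuous_on_subset)
  then obtain d where d: "d > 0" "\<And>s t. s \<in> {0..T} \<Longrightarrow> t \<in> {0..T} \<Longrightarrow> dist t s < d \<Longrightarrow> dist (y t) (y s) < \<epsilon> / 2"
    using eps unfolding uniformly_continuous_on_def by (metis half_gt_zero)
  obtain K0 :: nat where K0: "max T (1 / d + 1) \<le> K0" using real_arch_simple by blast
  have "norm (ud y (step_path K (K * K) (\<lambda>j. y (real j / real K))) - 0) < \<epsilon>" if "K \<ge> K0" for K
  proof -
    have K: "T \<le> K" "1 / d < K" using K0 that by auto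
    then have K': "0 < K" "1 / real K < d" using T(1) d(1) by (auto simp: field_simps)
    have "ud y (step_path K (K * K) (\<lambda>j. y (real j / real K))) \<le> \<epsilon> / 2 + exp (- T)"
    proof (rule ud_le_uniform)
      fix t assume t: "0 \<le> t" "t < T"
      have s: "step_path K (K * K) (\<lambda>j. y (real j / real K)) t = y (real (nat \<lfloor>real K * t\<rfloor>) / real K)"
        using t K K' by (intro step_eq) auto
      note grid_point_bounds[OF K'(1) t(1)]
      then have "dist (y t) (y (real (nat \<lfloor>real K * t\<rfloor>) / real K)) < \<epsilon> / 2"
        using t K'(2) by (intro d(2)) (auto simp: dist_real_def)
      then show "\<bar>y t - step_path K (K * K) (\<lambda>j. y (real j / real K)) t\<bar> \<le> \<epsilon> / 2"
        unfolding s dist_real_def by simp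
    qed (use eps in simp)
    also have "\<dots> < \<epsilon>" using T(2) by simp
    finally show ?thesis using ud_nonneg by simp
  qed
  then show "\<exists>K0. \<forall>K\<ge>K0. norm (ud y (step_path K (K * K) (\<lambda>j. y (real j / real K))) - 0) < \<epsilon>" by blast
qed

lemma ud_continuous_continuous_measurable:
  assumes G: "ud_continuous G"
    and Ycont: "\<And>\<omega>. \<omega> \<in> space M' \<Longrightarrow> continuous_on {0..} (Y \<omega>)"
    and Ymeas: "\<And>t. 0 \<le> t \<Longrightarrow> (\<lambda>\<omega>. Y \<omega> t) \<in> borel_measurable M'"
  shows "(\<lambda>\<omega>. G (Y \<omega>)) \<in> borel_measurable M'"
proof (rule ud_continuous_measurable_lim[OF G])
  show "Y \<omega> \<in> skD" if "\<omega> \<in> space M'" for \<omega>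
    using Ycont[OF that] by (simp add: skD_def cadlag_continuous)
  show "(\<lambda>\<omega>. G (step_path K (K * K) (\<lambda>j. Y \<omega> (real j / real K)))) \<in> borel_measurable M'" for K
    unfolding step_path_def[abs_def]
    by (rule ud_continuous_finite_measurable[OF G, where C=1]) (rule cadlag_indicator, simp add: indicator_def, rule Ymeas, simp)
qed (auto intro: step_in_skD step_tendsto_continuous Ycont)

text \<open>Outside an event of small probability the path is uniformly close to its step
  interpolation on a grid of mesh 1 / K, and a Lipschitz functional of that interpolation is a
  Lipschitz function of finitely many values, to which \<open>multidim_levy\<close> applies.
  Continuity of Y makes the same interpolation accurate for the limit, so the oscillation bound
  takes the place of a compactness argument.\<close>

theorem conv_distr_skorohod_criterion:
  fixes M :: "'a measure" and M' :: "'b measure"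
  assumes "prob_space M" "prob_space M'"
    and X: "\<And>n \<omega>. \<omega> \<in> space M \<Longrightarrow> X n \<omega> \<in> skD"
    and Xmeas: "\<And>n t. 0 \<le> t \<Longrightarrow> (\<lambda>\<omega>. X n \<omega> t) \<in> borel_measurable M"
    and XG: "\<And>G n. ud_continuous G \<Longrightarrow> (\<lambda>\<omega>. G (X n \<omega>)) \<in> borel_measurable M"
    and Ycont: "\<And>\<omega>. \<omega> \<in> space M' \<Longrightarrow> continuous_on {0..} (Y \<omega>)"
    and Ymeas: "\<And>t. 0 \<le> t \<Longrightarrow> (\<lambda>\<omega>. Y \<omega> t) \<in> borel_measurable M'"
    and fdd: "\<And>K J \<theta> \<phi>. 0 < K \<Longrightarrow>
        (\<lambda>n. \<integral>\<omega>. cos ((\<Sum>j<J. \<theta> j * X n \<omega> (real j / real K)) + \<phi>) \<partial>M)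
        \<longlonglongrightarrow> (\<integral>\<omega>. cos ((\<Sum>j<J. \<theta> j * Y \<omega> (real j / real K)) + \<phi>) \<partial>M')"
    and osc: "\<And>T \<eta> \<epsilon>. 0 < T \<Longrightarrow> 0 < \<eta> \<Longrightarrow> 0 < \<epsilon> \<Longrightarrow> \<forall>\<^sub>F K in sequentially. \<forall>\<^sub>F n in sequentially.
        \<exists>A\<in>sets M. measure M A \<le> \<epsilon> \<and> (\<forall>\<omega>\<in>space M - A. \<forall>t. 0 \<le> t \<and> t < T \<longrightarrow>
           \<bar>X n \<omega> t - X n \<omega> (real (nat \<lfloor>real K * t\<rfloor>) / real K)\<bar> \<le> \<eta>)"
  shows "conv_distr_skorohod M X M' Y"
proof -
  interpret M: prob_space M by fact
  interpret M': prob_space M' by fact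
  have Y: "Y \<omega> \<in> skD" if "\<omega> \<in> space M'" for \<omega>
    using Ycont[OF that] by (simp add: skD_def cadlag_continuous)
  have YG: "(\<lambda>\<omega>. G (Y \<omega>)) \<in> borel_measurable M'" if "ud_continuous G" for G
    using that Ycont Ymeas by (rule ud_continuous_continuous_measurable)
  define sX where "sX K n \<omega> = step_path K (K * K) (\<lambda>j. X n \<omega> (real j / real K))" for K n \<omega>
  define sY where "sY K \<omega> = step_path K (K * K) (\<lambda>j. Y \<omega> (real j / real K))" for K \<omega>
  have sXY: "sX K n \<omega> \<in> skD" "sY K \<omega>' \<in> skD" for K n \<omega> \<omega>'
    by (auto simp: sX_def sY_def step_in_skD)
  have sYG: "(\<lambda>\<omega>. G (sY K \<omega>)) \<in> borel_measurable M'" if "ud_continuous G" for G K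
    unfolding sY_def step_path_def[abs_def]
    by (rule ud_continuous_finite_measurable[OF that, where C=1]) (rule cadlag_indicator, simp add: indicator_def, rule Ymeas, simp)
  have sXG: "(\<lambda>\<omega>. G (sX K n \<omega>)) \<in> borel_measurable M" if "ud_continuous G" for G K n
    unfolding sX_def step_path_def[abs_def]
    by (rule ud_continuous_finite_measurable[OF that, where C=1]) (rule cadlag_indicator, simp add: indicator_def, rule Xmeas, simp)
  have lip: "(\<lambda>n. \<integral>\<omega>. G (X n \<omega>) \<partial>M) \<longlonglongrightarrow> (\<integral>\<omega>. G (Y \<omega>) \<partial>M')"
    if L: "0 \<le> L" "ud_lipschitz L G" and B: "\<And>x. x \<in> skD \<Longrightarrow> \<bar>G x\<bar> \<le> B" for G L B
  proof -
    note Gc = ud_lipschitz_imp_ud_continuous[OF L(2)]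
    have B0: "0 \<le> B" using B[OF zero_in_skD] by simp
    have GL: "\<bar>G x - G y\<bar> \<le> L * ud x y" if "x \<in> skD" "y \<in> skD" for x y
      using L(2) that by (auto simp: ud_lipschitz_def)
    note [measurable] = XG[OF Gc] YG[OF Gc] sXG[OF Gc] sYG[OF Gc]
    have sY_lim: "(\<lambda>K. \<integral>\<omega>. G (sY K \<omega>) \<partial>M') \<longlonglongrightarrow> (\<integral>\<omega>. G (Y \<omega>) \<partial>M')"
    proof (rule integral_dominated_convergence[where w="\<lambda>_. B"])
      show "AE \<omega> in M'. (\<lambda>K. G (sY K \<omega>)) \<longlonglongrightarrow> G (Y \<omega>)"
        using ud_continuousD[OF Gc Y sXY(2)] step_tendsto_continuous[OF Ycont] unfolding sY_def
        by (intro AE_I2) auto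
    qed (auto simp: B sXY)
    show ?thesis
    proof (rule LIMSEQ_approx)
      fix \<epsilon> :: real assume eps: "0 < \<epsilon>"
      \<comment> \<open>The choices give 2 * L * \<eta> \<le> \<epsilon> / 2 and 2 * B * \<epsilon>'
        \<le> \<epsilon> / 2; below, T is taken so large that the exponential tail also costs at
        most \<eta>, whence the factor 2 in front of L.\<close>
      define \<eta> where "\<eta> = \<epsilon> / (4 * (L + 1))"
      define \<epsilon>' where "\<epsilon>' = \<epsilon> / (4 * (B + 1))"
      have pos: "0 < \<eta>" "0 < \<epsilon>'" using eps L(1) B0 by (auto simp: \<eta>_def \<epsilon>'_def)
      define T where "T = max 1 (- ln \<eta>)"
      have "- T \<le> ln \<eta>" by (simp add: T_def)
      then have T: "exp (- T) \<le> \<eta>" "0 < T"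
        using pos(1) exp_le_cancel_iff[of "- T" "ln \<eta>"] by (simp_all add: T_def)
      have K1: "\<forall>\<^sub>F K in sequentially. \<bar>(\<integral>\<omega>. G (Y \<omega>) \<partial>M') - (\<integral>\<omega>. G (sY K \<omega>) \<partial>M')\<bar> \<le> \<epsilon>"
        using tendstoD[OF sY_lim eps] by eventually_elim (simp add: dist_real_def)
      \<comment> \<open>T \<le> K ensures that the K * K cells of width 1 / K cover [0, T).\<close>
      have K2: "\<forall>\<^sub>F K in sequentially. 0 < K \<and> T \<le> real K"
      proof -
        obtain K0 :: nat where "T \<le> K0" using real_arch_simple by blast
        then show ?thesis using T(2) by (intro eventually_sequentiallyI[of K0]) auto
      qed
      obtain K where K: "\<bar>(\<integral>\<omega>. G (Y \<omega>) \<partial>M') - (\<integral>\<omega>. G (sY K \<omega>) \<partial>M')\<bar> \<le> \<epsilon>" "0 < K" "T \<le> real K"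
        and ev: "\<forall>\<^sub>F n in sequentially. \<exists>A\<in>sets M. measure M A \<le> \<epsilon>' \<and> (\<forall>\<omega>\<in>space M - A. \<forall>t. 0 \<le> t \<and> t < T \<longrightarrow>
           \<bar>X n \<omega> t - X n \<omega> (real (nat \<lfloor>real K * t\<rfloor>) / real K)\<bar> \<le> \<eta>)"
        using eventually_happens[OF eventually_conj[OF K1 eventually_conj[OF K2 osc[OF T(2) pos]]]] by auto
      have "\<forall>\<^sub>F n in sequentially. \<bar>(\<integral>\<omega>. G (X n \<omega>) \<partial>M) - (\<integral>\<omega>. G (sX K n \<omega>) \<partial>M)\<bar> \<le> \<epsilon>"
        using ev
      proof eventually_elim
        case (elim n)
        then obtain A where [measurable]: "A \<in> sets M" and A: "measure M A \<le> \<epsilon>'"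
          "\<And>\<omega> t. \<omega> \<in> space M - A \<Longrightarrow> 0 \<le> t \<Longrightarrow> t < T \<Longrightarrow> \<bar>X n \<omega> t - X n \<omega> (real (nat \<lfloor>real K * t\<rfloor>) / real K)\<bar> \<le> \<eta>"
          by blast
        have int: "integrable M (\<lambda>\<omega>. G (X n \<omega>))" "integrable M (\<lambda>\<omega>. G (sX K n \<omega>))"
          by (auto intro!: M.integrable_bounded[where B=B] B X sXY)
        have bd: "\<bar>G (X n \<omega>) - G (sX K n \<omega>)\<bar> \<le> 2 * L * \<eta> + 2 * B * indicator A \<omega>" if w: "\<omega> \<in> space M" for \<omega>
        proof (cases "\<omega> \<in> A")
          case True
          have "\<bar>G (X n \<omega>) - G (sX K n \<omega>)\<bar> \<le> 2 * B"
            using B[OF X[OF w, of n]] B[OF sXY(1)[of K n \<omega>]] by linarith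
          then show ?thesis using True mult_nonneg_nonneg[OF L(1), of "2 * \<eta>"] pos by simp
        next
          case False
          have "ud (X n \<omega>) (sX K n \<omega>) \<le> \<eta> + exp (- T)"
          proof (rule ud_le_uniform)
            fix t assume t: "0 \<le> t" "t < T"
            have "sX K n \<omega> t = X n \<omega> (real (nat \<lfloor>real K * t\<rfloor>) / real K)"
              unfolding sX_def using t K by (intro step_eq) auto
            with A(2)[of \<omega> t] w False t show "\<bar>X n \<omega> t - sX K n \<omega> t\<bar> \<le> \<eta>" by simp
          qed (use pos in simp)
          then have "ud (X n \<omega>) (sX K n \<omega>) \<le> 2 * \<eta>" using T by simp
          then have "L * ud (X n \<omega>) (sX K n \<omega>) \<le> L * (2 * \<eta>)" using L(1) by (intro mult_left_mono) auto
          with GL[OF X[OF w, of n] sXY(1)[of K n \<omega>]] False show ?thesis by simp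
        qed
        have iA: "integrable M (indicat_real A)"
          by (rule M.integrable_bounded[where B=1]) (auto simp: indicator_def)
        have "\<bar>(\<integral>\<omega>. G (X n \<omega>) \<partial>M) - (\<integral>\<omega>. G (sX K n \<omega>) \<partial>M)\<bar> = \<bar>\<integral>\<omega>. G (X n \<omega>) - G (sX K n \<omega>) \<partial>M\<bar>"
          using int by simp
        also have "\<dots> \<le> (\<integral>\<omega>. \<bar>G (X n \<omega>) - G (sX K n \<omega>)\<bar> \<partial>M)" by (rule integral_abs_bound)
        also have "\<dots> \<le> (\<integral>\<omega>. 2 * L * \<eta> + 2 * B * indicator A \<omega> \<partial>M)"
          using int bd iA by (intro integral_mono) auto
        also have "\<dots> = 2 * L * \<eta> + 2 * B * measure M A" using iA by (simp add: M.prob_space)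
        also have "\<dots> \<le> 2 * L * \<eta> + 2 * B * \<epsilon>'" using A(1) B0 by (intro add_left_mono mult_left_mono) auto
        also have "\<dots> \<le> \<epsilon> / 2 + \<epsilon> / 2"
          using eps L(1) B0 by (intro add_mono) (auto simp: \<eta>_def \<epsilon>'_def field_simps)
        finally show ?case by simp
      qed
      moreover have "(\<lambda>n. \<integral>\<omega>. G (sX K n \<omega>) \<partial>M) \<longlonglongrightarrow> (\<integral>\<omega>. G (sY K \<omega>) \<partial>M')"
        unfolding sX_def sY_def
      proof (rule multidim_levy[OF assms(1,2), where J="K * K" and B=B and L=L and g="\<lambda>u. G (step_path K (K * K) u)"
            and U="\<lambda>n \<omega> j. X n \<omega> (real j / real K)" and V="\<lambda>\<omega> j. Y \<omega> (real j / real K)"])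
        fix u v :: "nat \<Rightarrow> real"
        have "\<bar>G (step_path K (K * K) u) - G (step_path K (K * K) v)\<bar> \<le> L * ud (step_path K (K * K) u) (step_path K (K * K) v)"
          by (rule GL) (auto intro: step_in_skD)
        also have "\<dots> \<le> L * (\<Sum>j<K * K. \<bar>u j - v j\<bar>)"
          by (intro mult_left_mono ud_step_le L)
        finally show "\<bar>G (step_path K (K * K) u) - G (step_path K (K * K) v)\<bar> \<le> L * (\<Sum>j<K * K. \<bar>u j - v j\<bar>)" .
      qed (auto intro: Xmeas Ymeas B step_in_skD fdd K)
      ultimately show "\<exists>b b' e e'. (\<forall>\<^sub>F n in sequentially. \<bar>(\<integral>\<omega>. G (X n \<omega>) \<partial>M) - b n\<bar> \<le> e n)
          \<and> \<bar>(\<integral>\<omega>. G (Y \<omega>) \<partial>M') - b'\<bar> \<le> e' \<and> b \<longlonglongrightarrow> b' \<and> e \<longlonglongrightarrow> e' \<and> e' \<le> \<epsilon>"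
        using K(1) by (intro exI[of _ "\<lambda>n. \<integral>\<omega>. G (sX K n \<omega>) \<partial>M"] exI[of _ "\<integral>\<omega>. G (sY K \<omega>) \<partial>M'"]
           exI[of _ "\<lambda>_. \<epsilon>"] exI[of _ \<epsilon>]) auto
    qed
  qed
  \<comment> \<open>Inf-convolutions lie below f, so their convergence bounds the integrals of f
    from below only; the same bound for - f supplies the other side.\<close>
  have lower: "\<forall>\<^sub>F n in sequentially. (\<integral>\<omega>. f (Y \<omega>) \<partial>M') - \<epsilon> < (\<integral>\<omega>. f (X n \<omega>) \<partial>M)"
    if f: "ud_continuous f" and B: "\<And>x. x \<in> skD \<Longrightarrow> \<bar>f x\<bar> \<le> B" and eps: "0 < \<epsilon>" for f B \<epsilon>
  proof -
    note conts = ud_lipschitz_imp_ud_continuous[OF inf_conv_lipschitz[of f B, OF B of_nat_0_le_iff]]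
    have "(\<lambda>k::nat. \<integral>\<omega>. inf_conv f (real k) (Y \<omega>) \<partial>M') \<longlonglongrightarrow> (\<integral>\<omega>. f (Y \<omega>) \<partial>M')"
    proof (rule integral_dominated_convergence[where w="\<lambda>_. B"])
      show "AE \<omega> in M'. (\<lambda>k. inf_conv f (real k) (Y \<omega>)) \<longlonglongrightarrow> f (Y \<omega>)"
        using inf_conv_tendsto[OF B f Y] by (intro AE_I2) auto
    qed (auto intro!: AE_I2 YG f conts inf_conv_bound Y B)
    from LIMSEQ_D[OF this, of "\<epsilon> / 2"] eps obtain k :: nat where
      k: "\<bar>(\<integral>\<omega>. inf_conv f (real k) (Y \<omega>) \<partial>M') - (\<integral>\<omega>. f (Y \<omega>) \<partial>M')\<bar> < \<epsilon> / 2" by auto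
    have "(\<lambda>n. \<integral>\<omega>. inf_conv f (real k) (X n \<omega>) \<partial>M) \<longlonglongrightarrow> (\<integral>\<omega>. inf_conv f (real k) (Y \<omega>) \<partial>M')"
      by (rule lip[of "real k" _ B]) (auto intro!: inf_conv_lipschitz inf_conv_bound B)
    from tendstoD[OF this, of "\<epsilon> / 2"] eps
    have "\<forall>\<^sub>F n in sequentially. \<bar>(\<integral>\<omega>. inf_conv f (real k) (X n \<omega>) \<partial>M) - (\<integral>\<omega>. inf_conv f (real k) (Y \<omega>) \<partial>M')\<bar> < \<epsilon> / 2"
      by (simp add: dist_real_def)
    then show ?thesis
    proof eventually_elim
      case (elim n)
      have "(\<integral>\<omega>. inf_conv f (real k) (X n \<omega>) \<partial>M) \<le> (\<integral>\<omega>. f (X n \<omega>) \<partial>M)"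
        by (intro integral_mono M.integrable_bounded[where B=B] XG f conts inf_conv_bound inf_conv_le[where B=B] X B) auto
      then show ?case using elim k by linarith
    qed
  qed
  show ?thesis
    unfolding conv_distr_skorohod_def
  proof (intro allI impI, elim conjE exE)
    fix f B assume f: "sk_continuous f" and B: "\<forall>x\<in>skD. \<bar>f x\<bar> \<le> B"
    have 1: "ud_continuous f" by (rule sk_continuous_imp_ud_continuous[OF f])
    then have 2: "ud_continuous (\<lambda>x. - f x)"
      by (simp add: ud_continuous_def abs_minus_commute)
    show "(\<lambda>n. \<integral>\<omega>. f (X n \<omega>) \<partial>M) \<longlonglongrightarrow> (\<integral>\<omega>. f (Y \<omega>) \<partial>M')"
    proof (rule tendstoI)
      fix \<epsilon> :: real assume eps: "0 < \<epsilon>"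
      have "\<forall>\<^sub>F n in sequentially. (\<integral>\<omega>. f (Y \<omega>) \<partial>M') - \<epsilon> < (\<integral>\<omega>. f (X n \<omega>) \<partial>M)"
        using B eps by (intro lower[OF 1, of B]) auto
      moreover have "\<forall>\<^sub>F n in sequentially. (\<integral>\<omega>. - f (Y \<omega>) \<partial>M') - \<epsilon> < (\<integral>\<omega>. - f (X n \<omega>) \<partial>M)"
        using B eps by (intro lower[OF 2, of B]) auto
      ultimately show "\<forall>\<^sub>F n in sequentially. dist (\<integral>\<omega>. f (X n \<omega>) \<partial>M) (\<integral>\<omega>. f (Y \<omega>) \<partial>M') < \<epsilon>"
        by eventually_elim (auto simp: dist_real_def abs_less_iff)
    qed
  qed
qed

section \<open>The interacting urns\<close>

text \<open>Bounded measurable functions form an algebra, and on a probability space all of them are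
  integrable. Membership is discharged by the rules \<open>bdm_intros\<close>, which thereby settle
  nearly all integrability side conditions; used relative to \<open>F n\<close>, the same predicate
  says that a variable depends on the past.\<close>

definition bdm :: "'a measure \<Rightarrow> ('a \<Rightarrow> real) \<Rightarrow> bool" where
  "bdm M f \<longleftrightarrow> f \<in> borel_measurable M \<and> (\<exists>B. \<forall>\<omega>\<in>space M. \<bar>f \<omega>\<bar> \<le> B)"

named_theorems bdm_intros

lemma bdmI: "f \<in> borel_measurable M \<Longrightarrow> (\<And>\<omega>. \<omega> \<in> space M \<Longrightarrow> \<bar>f \<omega>\<bar> \<le> B) \<Longrightarrow> bdm M f"
  by (auto simp: bdm_def)

lemma bdmE:
  assumes "bdm M f"
  obtains B where "0 < B" "\<And>\<omega>. \<omega> \<in> space M \<Longrightarrow> \<bar>f \<omega>\<bar> \<le> B"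
proof -
  obtain B where "\<And>\<omega>. \<omega> \<in> space M \<Longrightarrow> \<bar>f \<omega>\<bar> \<le> B" using assms by (auto simp: bdm_def)
  then show thesis by (intro that[of "max 1 B"]) (auto simp: le_max_iff_disj)
qed

lemma bdm_measurable: "bdm M f \<Longrightarrow> f \<in> borel_measurable M"
  by (simp add: bdm_def)

lemma bdm_const [bdm_intros]: "bdm M (\<lambda>_. c)"
  by (rule bdmI[where B="\<bar>c\<bar>"]) auto

lemma bdm_add [bdm_intros]:
  assumes "bdm M f" "bdm M g" shows "bdm M (\<lambda>\<omega>. f \<omega> + g \<omega>)"
proof -
  obtain B where B: "\<And>\<omega>. \<omega> \<in> space M \<Longrightarrow> \<bar>f \<omega>\<bar> \<le> B" using assms(1) by (rule bdmE) blast
  obtain C where C: "\<And>\<omega>. \<omega> \<in> space M \<Longrightarrow> \<bar>g \<omega>\<bar> \<le> C" using assms(2) by (rule bdmE) blast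
  have "\<bar>f \<omega> + g \<omega>\<bar> \<le> B + C" if "\<omega> \<in> space M" for \<omega> using B[OF that] C[OF that] by linarith
  then show ?thesis
    using borel_measurable_add[OF bdm_measurable[OF assms(1)] bdm_measurable[OF assms(2)]] by (rule bdmI[rotated])
qed

lemma bdm_mult [bdm_intros]:
  assumes "bdm M f" "bdm M g" shows "bdm M (\<lambda>\<omega>. f \<omega> * g \<omega>)"
proof -
  obtain B where B: "0 < B" "\<And>\<omega>. \<omega> \<in> space M \<Longrightarrow> \<bar>f \<omega>\<bar> \<le> B" using assms(1) by (rule bdmE) blast
  obtain C where C: "0 < C" "\<And>\<omega>. \<omega> \<in> space M \<Longrightarrow> \<bar>g \<omega>\<bar> \<le> C" using assms(2) by (rule bdmE) blast
  have "\<bar>f \<omega> * g \<omega>\<bar> \<le> B * C" if "\<omega> \<in> space M" for \<omega>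
    unfolding abs_mult using B C that by (intro mult_mono) auto
  then show ?thesis
    using borel_measurable_times[OF bdm_measurable[OF assms(1)] bdm_measurable[OF assms(2)]] by (rule bdmI[rotated])
qed

lemma bdm_uminus [bdm_intros]: "bdm M f \<Longrightarrow> bdm M (\<lambda>\<omega>. - f \<omega>)"
  using bdm_mult[OF bdm_const[of M "- 1"], of f] by simp

lemma bdm_diff [bdm_intros]: "bdm M f \<Longrightarrow> bdm M g \<Longrightarrow> bdm M (\<lambda>\<omega>. f \<omega> - g \<omega>)"
  using bdm_add[OF _ bdm_uminus, of M f g] by simp

lemma bdm_divide [bdm_intros]: "bdm M f \<Longrightarrow> bdm M (\<lambda>\<omega>. f \<omega> / c)"
  using bdm_mult[OF _ bdm_const[of M "inverse c"], of f] by (simp add: divide_inverse)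

lemma bdm_power [bdm_intros]: "bdm M f \<Longrightarrow> bdm M (\<lambda>\<omega>. f \<omega> ^ k)"
  by (induction k) (simp_all add: bdm_const bdm_mult)

lemma bdm_sum [bdm_intros]: "(\<And>i. i \<in> S \<Longrightarrow> bdm M (f i)) \<Longrightarrow> bdm M (\<lambda>\<omega>. \<Sum>i\<in>S. f i \<omega>)"
  by (induction S rule: infinite_finite_induct) (simp_all add: bdm_const bdm_add)

lemma bdm_abs [bdm_intros]: "bdm M f \<Longrightarrow> bdm M (\<lambda>\<omega>. \<bar>f \<omega>\<bar>)"
  by (auto simp: bdm_def)

lemma bdm_cos [bdm_intros]: "f \<in> borel_measurable M \<Longrightarrow> bdm M (\<lambda>\<omega>. cos (f \<omega>))"
  by (rule bdmI[where B=1]) auto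

lemma bdm_sin [bdm_intros]: "f \<in> borel_measurable M \<Longrightarrow> bdm M (\<lambda>\<omega>. sin (f \<omega>))"
  by (rule bdmI[where B=1]) auto

lemma bdm_indicator [bdm_intros]: "S \<in> sets M \<Longrightarrow> bdm M (indicator S)"
  by (rule bdmI[where B=1]) (auto simp: indicator_def)

lemma bdm_exp_minus:
  "f \<in> borel_measurable M \<Longrightarrow> (\<And>\<omega>. \<omega> \<in> space M \<Longrightarrow> 0 \<le> f \<omega>) \<Longrightarrow> bdm M (\<lambda>\<omega>. exp (- f \<omega>))"
  by (rule bdmI[where B=1]) auto

lemma (in prob_space) bdm_integrable: "bdm M f \<Longrightarrow> integrable M f"
  by (auto simp: bdm_def intro: integrable_bounded)

lemma (in prob_space) expectation_bdm_sum:
  "(\<And>i. i \<in> S \<Longrightarrow> bdm M (f i)) \<Longrightarrow> expectation (\<lambda>\<omega>. \<Sum>i\<in>S. f i \<omega>) = (\<Sum>i\<in>S. expectation (f i))"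
  by (rule Bochner_Integration.integral_sum) (rule bdm_integrable)

text \<open>The assumption \<open>cond_law\<close> encodes conditional independence together with
  the conditional marginals: for variables with values 0 and 1, the conditional probabilities that
  all variables in S equal 1, for every S, determine the joint conditional law by inclusion and
  exclusion.\<close>

locale urns = prob_space M for M :: "'a measure" +
  fixes N :: nat and \<alpha> \<gamma> c :: real and r :: "nat \<Rightarrow> real"
    and Z :: "nat \<Rightarrow> nat \<Rightarrow> 'a \<Rightarrow> real" and I :: "nat \<Rightarrow> nat \<Rightarrow> 'a \<Rightarrow> real"
    and Zlim :: "'a \<Rightarrow> real"
  assumes N: "N \<ge> 1"
    and alpha: "0 < \<alpha>" "\<alpha> \<le> 1"
    and gamma: "1/2 < \<gamma>" "\<gamma> \<le> 1"
    and r_bounds: "\<And>n. 0 \<le> r n \<and> r n < 1"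
    and r_lim: "(\<lambda>n. real n powr \<gamma> * r n) \<longlonglongrightarrow> c" and c_pos: "c > 0"
    and Z_meas: "\<And>n i. i < N \<Longrightarrow> Z n i \<in> borel_measurable M"
    and I_meas: "\<And>n i. i < N \<Longrightarrow> I n i \<in> borel_measurable M"
    and Z_range: "\<And>n i \<omega>. i < N \<Longrightarrow> \<omega> \<in> space M \<Longrightarrow> Z n i \<omega> \<in> {0..1}"
    and I_range: "\<And>n i \<omega>. i < N \<Longrightarrow> \<omega> \<in> space M \<Longrightarrow> I (Suc n) i \<omega> \<in> {0, 1}"
    and dyn: "\<And>n i \<omega>. i < N \<Longrightarrow> \<omega> \<in> space M \<Longrightarrow>
                Z (Suc n) i \<omega> = (1 - r n) * Z n i \<omega> + r n * I (Suc n) i \<omega>"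
    and cond_law: "\<And>n S. S \<subseteq> {..<N} \<Longrightarrow>
          AE \<omega> in M. real_cond_exp M (nat_filtration M N Z n)
                 (indicator {\<omega>\<in>space M. \<forall>i\<in>S. I (Suc n) i \<omega> = 1}) \<omega>
               = (\<Prod>i\<in>S. (1 - \<alpha>) * Z n i \<omega> + \<alpha> * avgZ N Z n \<omega>)"
    and Zlim_meas: "Zlim \<in> borel_measurable M"
    and Zlim_lim: "AE \<omega> in M. (\<lambda>n. avgZ N Z n \<omega>) \<longlonglongrightarrow> Zlim \<omega>"
begin

section \<open>Filtration, noise and conditional moments of the increments\<close>

abbreviation A :: "nat \<Rightarrow> 'a \<Rightarrow> real" where "A \<equiv> avgZ N Z"
abbreviation F :: "nat \<Rightarrow> 'a measure" where "F \<equiv> nat_filtration M N Z"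

definition p :: "nat \<Rightarrow> nat \<Rightarrow> 'a \<Rightarrow> real" where
  "p n i \<omega> = (1 - \<alpha>) * Z n i \<omega> + \<alpha> * A n \<omega>"

text \<open>The average conditional variance of the reinforcements, normalised so that the
  conditional second moment of \<open>D n\<close> is
  \<open>(r n)\<^sup>2 / real N * V n\<close>.\<close>

definition V :: "nat \<Rightarrow> 'a \<Rightarrow> real" where
  "V n \<omega> = (\<Sum>i<N. p n i \<omega> * (1 - p n i \<omega>)) / real N"

definition xi :: "nat \<Rightarrow> nat \<Rightarrow> 'a \<Rightarrow> real" where
  "xi n i \<omega> = I (Suc n) i \<omega> - p n i \<omega>"

definition D :: "nat \<Rightarrow> 'a \<Rightarrow> real" where
  "D n \<omega> = A (Suc n) \<omega> - A n \<omega>"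

lemma space_F [simp]: "space (F n) = space M"
  unfolding nat_filtration_def by (rule space_measure_of) auto

lemma sets_F: "sets (F n) = sigma_sets (space M) (\<Union>k\<in>{..n}. \<Union>i\<in>{..<N}. {Z k i -` B \<inter> space M | B. B \<in> sets borel})"
  unfolding nat_filtration_def by (rule sets_measure_of) auto

lemma subalgebra_F: "subalgebra M (F n)"
proof -
  have "sets (F n) \<subseteq> sets M"
    unfolding sets_F
  proof (rule sets.sigma_sets_subset, safe)
    fix k i B assume "i < N" and B: "B \<in> sets (borel :: real measure)"
    show "Z k i -` B \<inter> space M \<in> sets M" using Z_meas[OF \<open>i < N\<close>] B by (rule measurable_sets)
  qed
  then show ?thesis by (simp add: subalgebra_def)
qed

lemma F_mono: "m \<le> n \<Longrightarrow> subalgebra (F n) (F m)"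
proof -
  assume "m \<le> n"
  then have "sets (F m) \<subseteq> sets (F n)"
    unfolding sets_F by (intro sigma_sets_mono' UN_mono) auto
  then show ?thesis by (simp add: subalgebra_def)
qed

sublocale sub: sigma_finite_subalgebra M "F n" for n
  by (rule finite_measure_subalgebra_is_sigma_finite) (unfold_locales, rule subalgebra_F)

lemma Z_measF: "k \<le> n \<Longrightarrow> i < N \<Longrightarrow> Z k i \<in> borel_measurable (F n)"
proof (rule measurableI)
  fix B :: "real set" assume "k \<le> n" "i < N" "B \<in> sets borel"
  then have "Z k i -` B \<inter> space M \<in> (\<Union>k\<in>{..n}. \<Union>i\<in>{..<N}. {Z k i -` B \<inter> space M | B. B \<in> sets borel})"
    by (intro UN_I[of k] UN_I[of i]) auto
  then show "Z k i -` B \<inter> space (F n) \<in> sets (F n)" unfolding sets_F space_F by (rule sigma_sets.Basic)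
qed simp

lemma bdm_F_imp_M: "bdm (F n) f \<Longrightarrow> bdm M f"
  using measurable_from_subalg[OF subalgebra_F[of n]] by (auto simp: bdm_def)

lemma bdm_F_mono: "m \<le> n \<Longrightarrow> bdm (F m) f \<Longrightarrow> bdm (F n) f"
  using measurable_from_subalg[OF F_mono[of m n]] by (auto simp: bdm_def)

lemma bdm_ZF: "k \<le> n \<Longrightarrow> i < N \<Longrightarrow> bdm (F n) (Z k i)"
  using Z_range[of i _ k] by (intro bdmI[where B=1] Z_measF) auto

lemma bdm_AF: "k \<le> n \<Longrightarrow> bdm (F n) (A k)"
  unfolding avgZ_def[abs_def] by (intro bdm_intros bdm_ZF) auto

lemma bdm_pF: "k \<le> n \<Longrightarrow> i < N \<Longrightarrow> bdm (F n) (p k i)"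
  unfolding p_def[abs_def] by (intro bdm_intros bdm_ZF bdm_AF)

lemma bdm_VF: "k \<le> n \<Longrightarrow> bdm (F n) (V k)"
  unfolding V_def[abs_def] by (intro bdm_intros bdm_pF) auto

lemma bdm_DF: "k < n \<Longrightarrow> bdm (F n) (D k)"
  unfolding D_def[abs_def] by (intro bdm_intros bdm_AF) auto

lemma bdm_Z [bdm_intros]: "i < N \<Longrightarrow> bdm M (Z n i)"
  by (rule bdm_F_imp_M[OF bdm_ZF[OF order_refl]])

lemma bdm_A [bdm_intros]: "bdm M (A n)"
  by (rule bdm_F_imp_M[OF bdm_AF[OF order_refl]])

lemma bdm_p [bdm_intros]: "i < N \<Longrightarrow> bdm M (p n i)"
  by (rule bdm_F_imp_M[OF bdm_pF[OF order_refl]])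

lemma bdm_V [bdm_intros]: "bdm M (V n)"
  by (rule bdm_F_imp_M[OF bdm_VF[OF order_refl]])

lemma bdm_D [bdm_intros]: "bdm M (D n)"
  by (rule bdm_F_imp_M[OF bdm_DF[OF lessI]])

lemma bdm_I [bdm_intros]: "i < N \<Longrightarrow> bdm M (I (Suc n) i)"
  using I_range[of i _ n] by (intro bdmI[where B=1] I_meas) fastforce+

lemma bdm_xi [bdm_intros]: "i < N \<Longrightarrow> bdm M (xi n i)"
  unfolding xi_def[abs_def] by (intro bdm_intros)

lemma A_range:
  assumes "\<omega> \<in> space M" shows "0 \<le> A n \<omega>" "A n \<omega> \<le> 1"
proof -
  have "(\<Sum>i<N. Z n i \<omega>) \<le> (\<Sum>i<N. 1)" using Z_range[OF _ assms, of _ n] by (intro sum_mono) auto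
  moreover have "0 \<le> (\<Sum>i<N. Z n i \<omega>)" using Z_range[OF _ assms, of _ n] by (intro sum_nonneg) auto
  ultimately show "0 \<le> A n \<omega>" "A n \<omega> \<le> 1" using N by (auto simp: avgZ_def)
qed

lemma p_range:
  assumes "\<omega> \<in> space M" "i < N" shows "0 \<le> p n i \<omega>" "p n i \<omega> \<le> 1"
proof -
  have "p n i \<omega> \<le> (1 - \<alpha>) * 1 + \<alpha> * 1"
    unfolding p_def using Z_range[OF assms(2,1), of n] A_range[OF assms(1), of n] alpha
    by (intro add_mono mult_left_mono) auto
  then show "p n i \<omega> \<le> 1" by simp
  show "0 \<le> p n i \<omega>"
    unfolding p_def using Z_range[OF assms(2,1), of n] A_range[OF assms(1), of n] alpha by auto
qed

text \<open>The interaction redistributes the probabilities among the urns but preserves their mean;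
  this is the reason why the average is a martingale.\<close>

lemma sum_p: "(\<Sum>i<N. p n i \<omega>) = real N * A n \<omega>"
proof -
  have "(\<Sum>i<N. p n i \<omega>) = (1 - \<alpha>) * (\<Sum>i<N. Z n i \<omega>) + real N * (\<alpha> * A n \<omega>)"
    by (simp add: p_def sum.distrib sum_distrib_left)
  also have "(\<Sum>i<N. Z n i \<omega>) = real N * A n \<omega>" using N by (simp add: avgZ_def)
  finally show ?thesis by (simp add: algebra_simps)
qed

lemma D_eq: "\<omega> \<in> space M \<Longrightarrow> D n \<omega> = r n / real N * (\<Sum>i<N. xi n i \<omega>)"
proof -
  assume w: "\<omega> \<in> space M"
  have "(\<Sum>i<N. Z (Suc n) i \<omega>) = (\<Sum>i<N. Z n i \<omega>) + r n * (\<Sum>i<N. I (Suc n) i \<omega>) - r n * (\<Sum>i<N. Z n i \<omega>)"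
  proof -
    have "(\<Sum>i<N. Z (Suc n) i \<omega>) = (\<Sum>i<N. Z n i \<omega> + r n * I (Suc n) i \<omega> - r n * Z n i \<omega>)"
      using dyn[OF _ w, of _ n] by (intro sum.cong refl) (simp add: algebra_simps)
    then show ?thesis by (simp add: sum.distrib sum_subtractf sum_distrib_left)
  qed
  moreover have "(\<Sum>i<N. Z n i \<omega>) = real N * A n \<omega>" using N by (simp add: avgZ_def)
  moreover have "(\<Sum>i<N. xi n i \<omega>) = (\<Sum>i<N. I (Suc n) i \<omega>) - real N * A n \<omega>"
    by (simp add: xi_def sum_subtractf sum_p)
  ultimately show ?thesis using N
    by (simp add: D_def avgZ_def[of N Z "Suc n"] diff_divide_distrib add_divide_distrib right_diff_distrib)
qed

lemma D_bound: "\<omega> \<in> space M \<Longrightarrow> \<bar>D n \<omega>\<bar> \<le> r n"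
proof -
  assume w: "\<omega> \<in> space M"
  have "\<bar>\<Sum>i<N. xi n i \<omega>\<bar> \<le> (\<Sum>i<N. 1)"
  proof (rule order_trans[OF sum_abs sum_mono])
    fix i assume "i \<in> {..<N}"
    then show "\<bar>xi n i \<omega>\<bar> \<le> 1" using p_range[OF w, of i n] I_range[of i \<omega> n] w by (auto simp: xi_def)
  qed
  then have "r n / real N * \<bar>\<Sum>i<N. xi n i \<omega>\<bar> \<le> r n / real N * real N"
    using r_bounds[of n] by (intro mult_left_mono) auto
  then show ?thesis using N r_bounds[of n] by (simp add: D_eq[OF w] abs_mult)
qed

text \<open>The conditional law in weak form, tested against a bounded function of the past. A
  product of variables with values 0 and 1 is the indicator that all of them are 1, so
  \<open>cond_law\<close> applies; the noise moments are all derived from this identity.\<close>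

lemma expectation_prod_I:
  assumes S: "S \<subseteq> {..<N}" and G: "bdm (F n) G"
  shows "expectation (\<lambda>\<omega>. G \<omega> * (\<Prod>i\<in>S. I (Suc n) i \<omega>)) = expectation (\<lambda>\<omega>. G \<omega> * (\<Prod>i\<in>S. p n i \<omega>))"
proof -
  let ?E = "{\<omega>\<in>space M. \<forall>i\<in>S. I (Suc n) i \<omega> = 1}"
  have finS: "finite S" using S finite_subset by blast
  have [measurable]: "I (Suc n) i \<in> borel_measurable M" if "i \<in> S" for i using S that I_meas by auto
  have E [measurable]: "?E \<in> sets M" using finS by measurable
  have ind: "(\<Prod>i\<in>S. I (Suc n) i \<omega>) = indicator ?E \<omega>" if w: "\<omega> \<in> space M" for \<omega>
  proof (cases "\<omega> \<in> ?E")
    case False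
    then obtain i where "i \<in> S" "I (Suc n) i \<omega> \<noteq> 1" using w by auto
    then have "I (Suc n) i \<omega> = 0" using I_range[of i \<omega> n] S w by auto
    then show ?thesis using False \<open>i \<in> S\<close> finS by (auto intro: prod_zero)
  qed auto
  have "expectation (\<lambda>\<omega>. G \<omega> * (\<Prod>i\<in>S. I (Suc n) i \<omega>)) = expectation (\<lambda>\<omega>. G \<omega> * indicator ?E \<omega>)"
    by (rule Bochner_Integration.integral_cong[OF refl]) (simp add: ind)
  also have "\<dots> = expectation (\<lambda>\<omega>. G \<omega> * real_cond_exp M (F n) (indicator ?E) \<omega>)"
    by (rule sub.real_cond_exp_intg(2)[symmetric])
      (auto intro!: bdm_integrable bdm_intros bdm_F_imp_M[OF G] bdm_measurable[OF G] E)
  also have "\<dots> = expectation (\<lambda>\<omega>. G \<omega> * (\<Prod>i\<in>S. p n i \<omega>))"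
  proof (rule integral_cong_AE)
    show "AE \<omega> in M. G \<omega> * real_cond_exp M (F n) (indicator ?E) \<omega> = G \<omega> * (\<Prod>i\<in>S. p n i \<omega>)"
      using cond_law[OF S, of n] by (auto simp: p_def)
    have [measurable]: "p n i \<in> borel_measurable M" if "i \<in> S" for i
      using bdm_measurable[OF bdm_p[of i n]] S that by auto
    have [measurable]: "G \<in> borel_measurable M" by (rule bdm_measurable[OF bdm_F_imp_M[OF G]])
    show "(\<lambda>\<omega>. G \<omega> * (\<Prod>i\<in>S. p n i \<omega>)) \<in> borel_measurable M" by measurable
    show "(\<lambda>\<omega>. G \<omega> * real_cond_exp M (F n) (indicator ?E) \<omega>) \<in> borel_measurable M"
      using borel_measurable_cond_exp2 by measurable
  qed
  finally show ?thesis .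
qed

lemma expectation_xi:
  assumes G: "bdm (F n) G" and i: "i < N"
  shows "expectation (\<lambda>\<omega>. G \<omega> * xi n i \<omega>) = 0"
proof -
  have "expectation (\<lambda>\<omega>. G \<omega> * xi n i \<omega>) = expectation (\<lambda>\<omega>. G \<omega> * I (Suc n) i \<omega>) - expectation (\<lambda>\<omega>. G \<omega> * p n i \<omega>)"
    unfolding xi_def right_diff_distrib
    by (intro Bochner_Integration.integral_diff bdm_integrable bdm_intros bdm_F_imp_M[OF G] i)
  then show ?thesis using expectation_prod_I[OF _ G, of "{i}"] i by simp
qed

text \<open>Off the diagonal the product formula for two urns makes the noises orthogonal given the
  past; on the diagonal I * I = I gives the Bernoulli variance.\<close>

lemma expectation_xi_xi:
  assumes G: "bdm (F n) G" and i: "i < N" and j: "j < N"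
  shows "expectation (\<lambda>\<omega>. G \<omega> * (xi n i \<omega> * xi n j \<omega>))
     = (if i = j then expectation (\<lambda>\<omega>. G \<omega> * (p n i \<omega> * (1 - p n i \<omega>))) else 0)"
proof -
  note bG = bdm_F_imp_M[OF G]
  have 1: "expectation (\<lambda>\<omega>. (G \<omega> * p n j \<omega>) * xi n i \<omega>) = 0"
    by (rule expectation_xi) (intro bdm_intros G bdm_pF order_refl i j)+
  have pz: "expectation (\<lambda>\<omega>. (G \<omega> * p n i \<omega>) * I (Suc n) j \<omega>) = expectation (\<lambda>\<omega>. (G \<omega> * p n i \<omega>) * p n j \<omega>)"
    using expectation_prod_I[of "{j}" n "\<lambda>\<omega>. G \<omega> * p n i \<omega>"] j i by (simp add: bdm_intros G bdm_pF)
  \<comment> \<open>Only one factor p is expanded: the noise product is I I' - p I' - p' xi, and the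
    last term already has mean 0.\<close>
  have "expectation (\<lambda>\<omega>. G \<omega> * (xi n i \<omega> * xi n j \<omega>))
     = expectation (\<lambda>\<omega>. G \<omega> * (I (Suc n) i \<omega> * I (Suc n) j \<omega>) - (G \<omega> * p n i \<omega>) * I (Suc n) j \<omega> - (G \<omega> * p n j \<omega>) * xi n i \<omega>)"
    by (intro Bochner_Integration.integral_cong refl) (simp add: xi_def algebra_simps)
  also have "\<dots> = expectation (\<lambda>\<omega>. G \<omega> * (I (Suc n) i \<omega> * I (Suc n) j \<omega>)) - expectation (\<lambda>\<omega>. (G \<omega> * p n i \<omega>) * p n j \<omega>)"
  proof -
    have "integrable M (\<lambda>\<omega>. G \<omega> * (I (Suc n) i \<omega> * I (Suc n) j \<omega>))" "integrable M (\<lambda>\<omega>. G \<omega> * p n i \<omega> * I (Suc n) j \<omega>)"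
      "integrable M (\<lambda>\<omega>. G \<omega> * p n j \<omega> * xi n i \<omega>)"
      by (intro bdm_integrable bdm_intros bG i j)+
    then show ?thesis by (simp add: 1 pz)
  qed
  also have "\<dots> = (if i = j then expectation (\<lambda>\<omega>. G \<omega> * (p n i \<omega> * (1 - p n i \<omega>))) else 0)"
  proof (cases "i = j")
    case True
    have "expectation (\<lambda>\<omega>. G \<omega> * (I (Suc n) i \<omega> * I (Suc n) i \<omega>)) = expectation (\<lambda>\<omega>. G \<omega> * I (Suc n) i \<omega>)"
      using I_range[of i _ n] i by (intro Bochner_Integration.integral_cong refl) fastforce
    also have "\<dots> = expectation (\<lambda>\<omega>. G \<omega> * p n i \<omega>)"
      using expectation_prod_I[OF _ G, of "{i}"] i by simp
    finally have II: "expectation (\<lambda>\<omega>. G \<omega> * (I (Suc n) i \<omega> * I (Suc n) i \<omega>)) = expectation (\<lambda>\<omega>. G \<omega> * p n i \<omega>)" .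
    have "integrable M (\<lambda>\<omega>. G \<omega> * p n i \<omega>)" "integrable M (\<lambda>\<omega>. G \<omega> * p n i \<omega> * p n i \<omega>)"
      by (intro bdm_integrable bdm_intros bG i)+
    then have "expectation (\<lambda>\<omega>. G \<omega> * p n i \<omega>) - expectation (\<lambda>\<omega>. G \<omega> * p n i \<omega> * p n i \<omega>)
        = expectation (\<lambda>\<omega>. G \<omega> * (p n i \<omega> * (1 - p n i \<omega>)))"
      by (subst Bochner_Integration.integral_diff[symmetric]) (auto simp: right_diff_distrib mult.assoc)
    then show ?thesis using True II by simp
  next
    case False
    then show ?thesis using expectation_prod_I[OF _ G, of "{i, j}"] i j by (simp add: mult.assoc)
  qed
  finally show ?thesis .
qed

lemma expectation_D:
  assumes G: "bdm (F n) G"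
  shows "expectation (\<lambda>\<omega>. G \<omega> * D n \<omega>) = 0"
proof -
  have "expectation (\<lambda>\<omega>. G \<omega> * D n \<omega>) = expectation (\<lambda>\<omega>. \<Sum>i<N. r n / real N * (G \<omega> * xi n i \<omega>))"
    by (intro Bochner_Integration.integral_cong refl) (simp add: D_eq sum_distrib_left mult_ac)
  also have "\<dots> = (\<Sum>i<N. r n / real N * expectation (\<lambda>\<omega>. G \<omega> * xi n i \<omega>))"
    by (subst Bochner_Integration.integral_sum) (auto intro!: bdm_integrable bdm_intros bdm_F_imp_M[OF G])
  also have "\<dots> = 0" using expectation_xi[OF G] by simp
  finally show ?thesis .
qed

lemma expectation_D2:
  assumes G: "bdm (F n) G"
  shows "expectation (\<lambda>\<omega>. G \<omega> * (D n \<omega>)\<^sup>2) = (r n)\<^sup>2 / real N * expectation (\<lambda>\<omega>. G \<omega> * V n \<omega>)"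
proof -
  have "expectation (\<lambda>\<omega>. G \<omega> * (D n \<omega>)\<^sup>2)
      = expectation (\<lambda>\<omega>. \<Sum>i<N. \<Sum>j<N. (r n / real N)\<^sup>2 * (G \<omega> * (xi n i \<omega> * xi n j \<omega>)))"
  proof (intro Bochner_Integration.integral_cong refl)
    fix \<omega> assume w: "\<omega> \<in> space M"
    have "(D n \<omega>)\<^sup>2 = (r n / real N)\<^sup>2 * (\<Sum>i<N. \<Sum>j<N. xi n i \<omega> * xi n j \<omega>)"
      unfolding D_eq[OF w] power_mult_distrib sum_product[symmetric] by (simp only: power2_eq_square)
    then show "G \<omega> * (D n \<omega>)\<^sup>2 = (\<Sum>i<N. \<Sum>j<N. (r n / real N)\<^sup>2 * (G \<omega> * (xi n i \<omega> * xi n j \<omega>)))"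
      by (simp only: sum_distrib_left mult.left_commute)
  qed
  also have "\<dots> = (\<Sum>i<N. \<Sum>j<N. (r n / real N)\<^sup>2 * expectation (\<lambda>\<omega>. G \<omega> * (xi n i \<omega> * xi n j \<omega>)))"
    by (subst expectation_bdm_sum, (intro bdm_intros bdm_F_imp_M[OF G]; simp), rule sum.cong[OF refl],
        subst expectation_bdm_sum, (intro bdm_intros bdm_F_imp_M[OF G]; simp), simp)
  also have "\<dots> = (\<Sum>i<N. (r n / real N)\<^sup>2 * expectation (\<lambda>\<omega>. G \<omega> * (p n i \<omega> * (1 - p n i \<omega>))))"
  proof (intro sum.cong refl)
    fix i assume i: "i \<in> {..<N}"
    have "(\<Sum>j<N. (r n / real N)\<^sup>2 * expectation (\<lambda>\<omega>. G \<omega> * (xi n i \<omega> * xi n j \<omega>)))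
       = (\<Sum>j<N. if i = j then (r n / real N)\<^sup>2 * expectation (\<lambda>\<omega>. G \<omega> * (p n i \<omega> * (1 - p n i \<omega>))) else 0)"
      using i by (intro sum.cong refl) (simp only: expectation_xi_xi[OF G] lessThan_iff, simp)
    then show "(\<Sum>j<N. (r n / real N)\<^sup>2 * expectation (\<lambda>\<omega>. G \<omega> * (xi n i \<omega> * xi n j \<omega>)))
       = (r n / real N)\<^sup>2 * expectation (\<lambda>\<omega>. G \<omega> * (p n i \<omega> * (1 - p n i \<omega>)))"
      using i by simp
  qed
  also have "\<dots> = (r n / real N)\<^sup>2 * expectation (\<lambda>\<omega>. \<Sum>i<N. G \<omega> * (p n i \<omega> * (1 - p n i \<omega>)))"
    by (subst expectation_bdm_sum, (intro bdm_intros bdm_F_imp_M[OF G]; simp)) (simp add: sum_distrib_left)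
  also have "(\<lambda>\<omega>. \<Sum>i<N. G \<omega> * (p n i \<omega> * (1 - p n i \<omega>))) = (\<lambda>\<omega>. real N * (G \<omega> * V n \<omega>))"
    using N by (simp add: V_def sum_distrib_left[symmetric])
  also have "(r n / real N)\<^sup>2 * expectation (\<lambda>\<omega>. real N * (G \<omega> * V n \<omega>)) = (r n)\<^sup>2 / real N * expectation (\<lambda>\<omega>. G \<omega> * V n \<omega>)"
    using N by (simp only: integral_mult_right_zero) (simp add: power2_eq_square)
  finally show ?thesis .
qed

end

text \<open>Comparison with the telescoping sequence k^(-a) - (k + 1)^(-a), which is asymptotic to a
  * k^(-a-1) and whose tails are exactly m^(-a). The ratio of the terms tends to L / a, and so does
  the ratio of the tails.\<close>

lemma powr_tail_asymptotics:
  fixes x :: "nat \<Rightarrow> real"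
  assumes lim: "(\<lambda>k. real k powr (a + 1) * x k) \<longlonglongrightarrow> L" and a: "0 < a"
  shows "summable x" "(\<lambda>m. real m powr a * (\<Sum>k. x (k + m))) \<longlonglongrightarrow> L / a"
proof -
  define z where "z k = real k powr (- a)" for k :: nat
  define y where "y k = z k - z (Suc k)" for k
  have z_lim: "z \<longlonglongrightarrow> 0" unfolding z_def using a by real_asymp
  have y_lim: "(\<lambda>k. real k powr (a + 1) * y k) \<longlonglongrightarrow> a"
    unfolding y_def z_def using a by real_asymp
  \<comment> \<open>Index 0 is excluded because \<open>0 powr (- a)\<close> is 0, which makes
    \<open>y 0\<close> negative; this is why the thresholds below are kept positive.\<close>
  have y_pos: "0 < y k" if "0 < k" for k
    using that a by (simp add: y_def z_def powr_less_mono2_neg)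
  have y_sums: "(\<lambda>k. y (k + m)) sums z m" for m
    using telescope_sums'[of "\<lambda>k. z (k + m)" 0] LIMSEQ_ignore_initial_segment[OF z_lim, of m] by (simp add: y_def)
  have "(\<lambda>k. (real k powr (a + 1) * x k) / (real k powr (a + 1) * y k)) \<longlonglongrightarrow> L / a"
    using a by (intro tendsto_divide lim y_lim) auto
  then have ratio: "(\<lambda>k. x k / y k) \<longlonglongrightarrow> L / a"
    by (rule Lim_transform_eventually) (rule eventually_sequentiallyI[of 1], simp)
  have ev: "\<exists>m0>0. \<forall>k\<ge>m0. \<bar>x k - L / a * y k\<bar> \<le> e * y k" if e: "0 < e" for e
  proof -
    from LIMSEQ_D[OF ratio e] obtain k0 where k0: "\<And>k. k \<ge> k0 \<Longrightarrow> \<bar>x k / y k - L / a\<bar> < e" by auto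
    have "\<bar>x k - L / a * y k\<bar> \<le> e * y k" if "k \<ge> max 1 k0" for k
    proof -
      have y: "0 < y k" using that by (intro y_pos) auto
      have "\<bar>x k - L / a * y k\<bar> = \<bar>x k / y k - L / a\<bar> * y k"
      proof -
        have "x k - L / a * y k = (x k / y k - L / a) * y k" using y by (simp add: left_diff_distrib)
        then show ?thesis using y by (simp add: abs_mult)
      qed
      also have "\<dots> \<le> e * y k" using k0[of k] that y by (intro mult_right_mono) auto
      finally show ?thesis .
    qed
    then show ?thesis by (intro exI[of _ "max 1 k0"]) auto
  qed
  show sx: "summable x"
  proof -
    obtain m0 where m0: "m0 > 0" "\<And>k. k \<ge> m0 \<Longrightarrow> \<bar>x k - L / a * y k\<bar> \<le> 1 * y k" using ev[of 1] by auto
    have "norm (x k) \<le> (\<bar>L / a\<bar> + 1) * y k" if "k \<ge> m0" for k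
    proof -
      have y: "0 < y k" using that m0(1) by (intro y_pos) auto
      have "\<bar>x k\<bar> \<le> \<bar>L / a * y k\<bar> + 1 * y k" using m0(2)[OF that] by linarith
      then show ?thesis using y by (simp add: abs_mult algebra_simps)
    qed
    moreover have "summable y" using y_sums[of 0] by (simp add: sums_iff)
    ultimately show ?thesis using summable_comparison_test'[of "\<lambda>k. (\<bar>L / a\<bar> + 1) * y k" m0 x] summable_mult by blast
  qed
  show "(\<lambda>m. real m powr a * (\<Sum>k. x (k + m))) \<longlonglongrightarrow> L / a"
  proof (rule LIMSEQ_I)
    fix e :: real assume e: "0 < e"
    then obtain m0 where m0: "m0 > 0" "\<And>k. k \<ge> m0 \<Longrightarrow> \<bar>x k - L / a * y k\<bar> \<le> e / 2 * y k"
      using ev[of "e / 2"] by auto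
    have "norm (real m powr a * (\<Sum>k. x (k + m)) - L / a) < e" if m: "m \<ge> m0" for m
    proof -
      have m1: "0 < real m" using m m0(1) by simp
      have sy: "summable (\<lambda>k. y (k + m))" "(\<Sum>k. y (k + m)) = z m" using y_sums[of m] by (auto simp: sums_iff)
      have sxm: "summable (\<lambda>k. x (k + m))" using sx by (simp add: summable_iff_shift)
      have "\<bar>\<Sum>k. x (k + m) - L / a * y (k + m)\<bar> \<le> (\<Sum>k. e / 2 * y (k + m))"
        using m0(2) m sy by (intro norm_suminf_le[where 'a=real, unfolded real_norm_def] summable_mult) auto
      also have "\<dots> = e / 2 * z m" using sy by (simp only: suminf_mult)
      also have "(\<Sum>k. x (k + m) - L / a * y (k + m)) = (\<Sum>k. x (k + m)) - L / a * z m"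
        using sxm sy by (subst suminf_diff[symmetric]) (simp_all only: suminf_mult summable_mult)
      finally have "real m powr a * \<bar>(\<Sum>k. x (k + m)) - L / a * z m\<bar> \<le> real m powr a * (e / 2 * z m)"
        by (intro mult_left_mono) auto
      moreover have mz: "real m powr a * z m = 1" using m1 by (simp add: z_def powr_minus)
      have "\<bar>real m powr a * (\<Sum>k. x (k + m)) - L / a\<bar> = real m powr a * \<bar>(\<Sum>k. x (k + m)) - L / a * z m\<bar>"
      proof -
        have "real m powr a * (\<Sum>k. x (k + m)) - L / a = real m powr a * ((\<Sum>k. x (k + m)) - L / a * z m)"
          using mz by (simp add: right_diff_distrib mult.left_commute[of _ "L / a"] mult.assoc)
        then show ?thesis by (simp add: abs_mult)
      qed
      moreover have "real m powr a * (e / 2 * z m) = e / 2" using mz by (simp add: mult.left_commute)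
      ultimately show ?thesis unfolding real_norm_def using e by linarith
    qed
    then show "\<exists>m0. \<forall>m\<ge>m0. norm (real m powr a * (\<Sum>k. x (k + m)) - L / a) < e" by blast
  qed
qed

text \<open>Iterating from time m and using 1 - q \<le> exp (- q) leaves an exponential of minus the
  sum of q, which vanishes because q is not summable, plus at most the tail of the perturbations s,
  which is small once m is large.\<close>

lemma contraction_tendsto_zero:
  fixes x q s :: "nat \<Rightarrow> real"
  assumes x: "\<And>n. 0 \<le> x n" "\<And>n. x (Suc n) \<le> (1 - q n) * x n + s n"
    and q: "\<And>n. 0 \<le> q n" "\<And>n. q n \<le> 1" "\<not> summable q"
    and s: "\<And>n. 0 \<le> s n" "summable s"
  shows "x \<longlonglongrightarrow> 0"
proof (rule LIMSEQ_I)
  fix e :: real assume e: "0 < e"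
  have "(\<lambda>m. \<Sum>k. s (k + m)) \<longlonglongrightarrow> 0" by (rule suminf_exist_split2[OF s(2)])
  from LIMSEQ_D[OF this, of "e / 2"] e obtain m where m: "\<bar>\<Sum>k. s (k + m)\<bar> < e / 2" by auto
  have bound: "x (m + n) \<le> exp (- (\<Sum>k<n. q (k + m))) * x m + (\<Sum>k<n. s (k + m))" for n
  proof (induction n)
    case (Suc n)
    have "x (m + Suc n) \<le> (1 - q (n + m)) * x (m + n) + s (n + m)" using x(2)[of "m + n"] by (simp add: add.commute)
    also have "\<dots> \<le> (1 - q (n + m)) * (exp (- (\<Sum>k<n. q (k + m))) * x m + (\<Sum>k<n. s (k + m))) + s (n + m)"
      using Suc q(2) by (intro add_right_mono mult_left_mono) auto
    also have "\<dots> = (1 - q (n + m)) * (exp (- (\<Sum>k<n. q (k + m))) * x m) + (1 - q (n + m)) * (\<Sum>k<n. s (k + m)) + s (n + m)"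
      by (simp add: distrib_left)
    also have "\<dots> \<le> exp (- q (n + m)) * (exp (- (\<Sum>k<n. q (k + m))) * x m) + 1 * (\<Sum>k<n. s (k + m)) + s (n + m)"
      using q(1,2) s(1) x(1) exp_ge_add_one_self[of "- q (n + m)"]
      by (intro add_mono mult_right_mono order_refl sum_nonneg mult_nonneg_nonneg) auto
    also have "\<dots> = exp (- (\<Sum>k<Suc n. q (k + m))) * x m + (\<Sum>k<Suc n. s (k + m))"
      by (simp add: exp_add[symmetric] mult.assoc[symmetric] add.commute)
    finally show ?case .
  qed simp
  have "\<not> summable (\<lambda>k. q (k + m))" using q(3) by (simp add: summable_iff_shift)
  \<comment> \<open>Chosen so that exp (- K) * x m < e / 2; the added 1 covers the case x m =
    0.\<close>
  define K where "K = ln (2 * (x m + 1) / e)"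
  have "\<exists>n. K < (\<Sum>k<n. q (k + m))"
  proof (rule ccontr)
    assume "\<not> ?thesis"
    then have "(\<Sum>k<n. q (k + m)) \<le> K" for n by (simp add: not_less)
    then have "(\<Sum>k\<le>n. q (k + m)) \<le> K" for n by (simp add: lessThan_Suc_atMost[symmetric] del: sum.lessThan_Suc)
    then have "summable (\<lambda>k. q (k + m))" using q(1) by (intro bounded_imp_summable[where B=K]) auto
    with \<open>\<not> summable (\<lambda>k. q (k + m))\<close> show False by simp
  qed
  then obtain n0 where n0: "K < (\<Sum>k<n0. q (k + m))" by blast
  have "norm (x n - 0) < e" if "n \<ge> m + n0" for n
  proof -
    define n' where "n' = n - m"
    have n': "n = m + n'" "n' \<ge> n0" using that by (auto simp: n'_def)
    have "(\<Sum>k<n0. q (k + m)) \<le> (\<Sum>k<n'. q (k + m))" using n' q(1) by (intro sum_mono2) auto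
    then have "exp (- (\<Sum>k<n'. q (k + m))) \<le> exp (- K)" using n0 by simp
    also have "exp (- K) = e / (2 * (x m + 1))"
      using e x(1)[of m] by (simp add: K_def exp_minus)
    finally have "exp (- (\<Sum>k<n'. q (k + m))) * x m \<le> e / (2 * (x m + 1)) * x m"
      using x(1) by (intro mult_right_mono)
    also have "\<dots> < e / 2" using e x(1)[of m] by (simp add: field_simps)
    finally have 1: "exp (- (\<Sum>k<n'. q (k + m))) * x m < e / 2" .
    have "(\<Sum>k<n'. s (k + m)) \<le> (\<Sum>k. s (k + m))"
      using s by (intro sum_le_suminf) (auto simp: summable_iff_shift)
    then show ?thesis using bound[of n'] 1 m x(1)[of n] unfolding n'(1) by simp
  qed
  then show "\<exists>n0. \<forall>n\<ge>n0. norm (x n - 0) < e" by blast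
qed


section \<open>Sums of squared steps, synchronisation of the urns and the limiting variance\<close>

context urns
begin

abbreviation a :: real where "a \<equiv> 2 * \<gamma> - 1"

lemma a_bounds: "0 < a" "a \<le> 1"
  using gamma by auto

lemma r2_lim: "(\<lambda>k. real k powr (a + 1) * (r k)\<^sup>2) \<longlonglongrightarrow> c\<^sup>2"
proof -
  have "(\<lambda>k. (real k powr \<gamma> * r k)\<^sup>2) \<longlonglongrightarrow> c\<^sup>2" by (intro tendsto_intros r_lim)
  moreover have "(real k powr \<gamma> * r k)\<^sup>2 = real k powr (a + 1) * (r k)\<^sup>2" for k
  proof -
    have "(real k powr \<gamma>)\<^sup>2 = real k powr (\<gamma> + \<gamma>)" by (simp only: powr_add power2_eq_square)
    then show ?thesis by (simp add: power_mult_distrib)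
  qed
  ultimately show ?thesis by simp
qed

text \<open>The total of the squared steps still to come after time m. Its order m^(-a) fixes the
  scaling n^(\<gamma> - 1/2) of the tails, and all moment bounds are expressed through it.\<close>

definition R :: "nat \<Rightarrow> real" where
  "R m = (\<Sum>k. (r (k + m))\<^sup>2)"

lemma summable_r2: "summable (\<lambda>k. (r k)\<^sup>2)"
  by (rule powr_tail_asymptotics(1)[OF r2_lim a_bounds(1)])

lemma R_lim: "(\<lambda>m. real m powr a * R m) \<longlonglongrightarrow> c\<^sup>2 / a"
  unfolding R_def by (rule powr_tail_asymptotics(2)[OF r2_lim a_bounds(1)])

lemma R_tendsto_zero: "R \<longlonglongrightarrow> 0"
  unfolding R_def[abs_def] by (rule suminf_exist_split2[OF summable_r2])

lemma R_nonneg: "0 \<le> R m"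
  unfolding R_def using summable_r2 by (intro suminf_nonneg) (auto simp: summable_iff_shift[of "\<lambda>k. (r k)\<^sup>2"])

lemma sum_r2_le_R: "(\<Sum>k\<in>{m..<n}. (r k)\<^sup>2) \<le> R m"
proof (cases "m \<le> n")
  case True
  have "(\<Sum>k\<in>{m..<n}. (r k)\<^sup>2) = (\<Sum>k<n - m. (r (k + m))\<^sup>2)"
    using True sum.shift_bounds_nat_ivl[of "\<lambda>k. (r k)\<^sup>2" 0 m "n - m"] by (simp add: atLeast0LessThan)
  also have "\<dots> \<le> R m"
    unfolding R_def using summable_r2 by (intro sum_le_suminf) (auto simp: summable_iff_shift[of "\<lambda>k. (r k)\<^sup>2"])
  finally show ?thesis .
qed (simp add: R_nonneg)

lemma r_upper: "\<exists>C>0. \<forall>n\<ge>1. r n \<le> C * real n powr (- \<gamma>)"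
proof -
  have "Bseq (\<lambda>n. real n powr \<gamma> * r n)" using r_lim by (rule convergent_imp_Bseq[OF convergentI])
  then obtain C where C: "C > 0" "\<And>n. norm (real n powr \<gamma> * r n) \<le> C" by (rule BseqE) blast
  have "r n \<le> C * real n powr (- \<gamma>)" if "n \<ge> 1" for n
  proof -
    have "real n powr \<gamma> * r n \<le> C" using C(2)[of n] by simp
    then show ?thesis using that by (simp add: powr_minus field_simps)
  qed
  with C(1) show ?thesis by blast
qed

lemma R_upper: "\<exists>C>0. \<forall>n\<ge>1. R n \<le> C * real n powr (- a)"
proof -
  have "Bseq (\<lambda>n. real n powr a * R n)" using R_lim by (rule convergent_imp_Bseq[OF convergentI])
  then obtain C where C: "C > 0" "\<And>n. norm (real n powr a * R n) \<le> C" by (rule BseqE) blast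
  have "R n \<le> C * real n powr (- a)" if "n \<ge> 1" for n
  proof -
    have "real n powr a * R n \<le> C" using C(2)[of n] by simp
    then have "R n \<le> C / real n powr a" using that by (simp add: field_simps)
    then show ?thesis by (simp only: powr_minus divide_inverse)
  qed
  with C(1) show ?thesis by blast
qed

text \<open>Because \<gamma> \<le> 1, the steps dominate a multiple of the harmonic series.\<close>

lemma not_summable_r: "\<not> summable r"
proof
  assume r: "summable r"
  have "\<forall>\<^sub>F n in sequentially. norm (real n powr \<gamma> * r n - c) < c / 2"
    using tendstoD[OF r_lim, of "c / 2"] c_pos by (simp add: dist_real_def)
  then have "\<forall>\<^sub>F n in sequentially. norm (inverse (real n)) \<le> 2 / c * r n"
    using eventually_ge_at_top[of 1]
  proof eventually_elim
    case (elim n)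
    have "real n powr \<gamma> \<le> real n powr 1" using elim gamma by (intro powr_mono) auto
    then have "real n powr \<gamma> * r n \<le> real n * r n" using elim r_bounds[of n] by (intro mult_right_mono) auto
    moreover have "c / 2 < real n powr \<gamma> * r n" using elim(1) unfolding real_norm_def by linarith
    ultimately have "c / 2 \<le> real n * r n" by simp
    then show ?case using elim c_pos by (simp add: field_simps)
  qed
  then have "summable (\<lambda>n. inverse (real n))"
    by (rule summable_comparison_test_ev) (intro summable_mult r)
  then show False using not_summable_harmonic[where 'a=real] by simp
qed

lemma expectation_add_bdm: "bdm M f \<Longrightarrow> bdm M g \<Longrightarrow> expectation (\<lambda>\<omega>. f \<omega> + g \<omega>) = expectation f + expectation g"
  by (intro Bochner_Integration.integral_add bdm_integrable)

lemma expectation_diff_bdm: "bdm M f \<Longrightarrow> bdm M g \<Longrightarrow> expectation (\<lambda>\<omega>. f \<omega> - g \<omega>) = expectation f - expectation g"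
  by (intro Bochner_Integration.integral_diff bdm_integrable)

lemma expectation_mono_bdm: "bdm M f \<Longrightarrow> bdm M g \<Longrightarrow> (\<And>\<omega>. \<omega> \<in> space M \<Longrightarrow> f \<omega> \<le> g \<omega>) \<Longrightarrow> expectation f \<le> expectation g"
  by (intro integral_mono bdm_integrable)

lemma expectation_le_const: "bdm M f \<Longrightarrow> (\<And>\<omega>. \<omega> \<in> space M \<Longrightarrow> f \<omega> \<le> B) \<Longrightarrow> expectation f \<le> B"
  using expectation_mono_bdm[of f "\<lambda>_. B"] by (simp add: bdm_const prob_space)

lemma expectation_abs_le_sqrt:
  assumes f: "bdm M f"
  shows "expectation (\<lambda>\<omega>. \<bar>f \<omega>\<bar>) \<le> sqrt (expectation (\<lambda>\<omega>. (f \<omega>)\<^sup>2))"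
proof -
  have "0 \<le> variance (\<lambda>\<omega>. \<bar>f \<omega>\<bar>)" by (rule variance_positive)
  also have "\<dots> = expectation (\<lambda>\<omega>. (f \<omega>)\<^sup>2) - (expectation (\<lambda>\<omega>. \<bar>f \<omega>\<bar>))\<^sup>2"
    using f by (subst variance_eq) (auto intro!: bdm_integrable bdm_intros bdm_power simp: power2_abs)
  finally show ?thesis by (intro real_le_rsqrt) simp
qed

text \<open>The deviation from the average is contracted by 1 - \<alpha> * r n at each step, since
  the conditional mean is pulled towards the average with strength \<alpha>, and it receives a
  conditionally centred noise of size at most 2 * r n. Its second moment thus satisfies a
  contraction with rates that are not summable and perturbations that are.\<close>

lemma sync: "i < N \<Longrightarrow> (\<lambda>n. expectation (\<lambda>\<omega>. (Z n i \<omega> - A n \<omega>)\<^sup>2)) \<longlonglongrightarrow> 0"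
proof (rule contraction_tendsto_zero[where q="\<lambda>n. \<alpha> * r n" and s="\<lambda>n. 4 * (r n)\<^sup>2"])
  fix n assume i: "i < N"
  define U where "U \<omega> = Z n i \<omega> - A n \<omega>" for \<omega>
  define Y where "Y \<omega> = r n * xi n i \<omega> - D n \<omega>" for \<omega>
  have bU: "bdm (F n) U" unfolding U_def[abs_def] by (intro bdm_intros bdm_ZF bdm_AF i order_refl)
  have bU': "bdm M U" by (rule bdm_F_imp_M[OF bU])
  have bY: "bdm M Y" unfolding Y_def[abs_def] by (intro bdm_intros i)
  have step: "Z (Suc n) i \<omega> - A (Suc n) \<omega> = (1 - \<alpha> * r n) * U \<omega> + Y \<omega>" if "\<omega> \<in> space M" for \<omega>
    using dyn[OF i that, of n] by (simp add: U_def Y_def xi_def p_def D_def algebra_simps)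
  have UY: "expectation (\<lambda>\<omega>. U \<omega> * Y \<omega>) = 0"
  proof -
    have "expectation (\<lambda>\<omega>. U \<omega> * Y \<omega>) = expectation (\<lambda>\<omega>. r n * (U \<omega> * xi n i \<omega>) - U \<omega> * D n \<omega>)"
      by (simp add: Y_def algebra_simps)
    also have "\<dots> = r n * expectation (\<lambda>\<omega>. U \<omega> * xi n i \<omega>) - expectation (\<lambda>\<omega>. U \<omega> * D n \<omega>)"
      by (subst expectation_diff_bdm) (intro bdm_intros bU' i | simp)+
    finally show ?thesis using expectation_xi[OF bU i] expectation_D[OF bU] by simp
  qed
  have Y2: "expectation (\<lambda>\<omega>. (Y \<omega>)\<^sup>2) \<le> 4 * (r n)\<^sup>2"
  proof (rule expectation_le_const)
    fix \<omega> assume w: "\<omega> \<in> space M"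
    have "\<bar>xi n i \<omega>\<bar> \<le> 1" using p_range[OF w i, of n] I_range[OF i w, of n] by (auto simp: xi_def)
    then have "\<bar>r n * xi n i \<omega>\<bar> \<le> r n * 1" using r_bounds[of n] unfolding abs_mult by (intro mult_mono) auto
    then have "\<bar>Y \<omega>\<bar> \<le> 2 * r n" using D_bound[OF w, of n] by (simp add: Y_def)
    then have "\<bar>Y \<omega>\<bar>\<^sup>2 \<le> (2 * r n)\<^sup>2" by (intro power_mono) auto
    then show "(Y \<omega>)\<^sup>2 \<le> 4 * (r n)\<^sup>2" by (simp add: power2_eq_square)
  qed (intro bdm_intros bY)
  have "expectation (\<lambda>\<omega>. (Z (Suc n) i \<omega> - A (Suc n) \<omega>)\<^sup>2)
      = expectation (\<lambda>\<omega>. (1 - \<alpha> * r n)\<^sup>2 * (U \<omega>)\<^sup>2 + 2 * (1 - \<alpha> * r n) * (U \<omega> * Y \<omega>) + (Y \<omega>)\<^sup>2)"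
    by (intro Bochner_Integration.integral_cong refl) (simp add: step power2_eq_square algebra_simps)
  also have "\<dots> = (1 - \<alpha> * r n)\<^sup>2 * expectation (\<lambda>\<omega>. (U \<omega>)\<^sup>2) + 2 * (1 - \<alpha> * r n) * expectation (\<lambda>\<omega>. U \<omega> * Y \<omega>) + expectation (\<lambda>\<omega>. (Y \<omega>)\<^sup>2)"
    by (subst expectation_add_bdm, (intro bdm_intros bU' bY)+, subst expectation_add_bdm, (intro bdm_intros bU' bY)+) simp
  also have "\<dots> \<le> (1 - \<alpha> * r n) * expectation (\<lambda>\<omega>. (U \<omega>)\<^sup>2) + 4 * (r n)\<^sup>2"
  proof -
    have "\<alpha> * r n \<le> 1 * 1" using alpha r_bounds[of n] by (intro mult_mono) auto
    moreover have "0 \<le> \<alpha> * r n" using alpha r_bounds[of n] by simp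
    ultimately have "(1 - \<alpha> * r n) * (1 - \<alpha> * r n) \<le> (1 - \<alpha> * r n) * 1" by (intro mult_left_mono) auto
    then have "(1 - \<alpha> * r n)\<^sup>2 * expectation (\<lambda>\<omega>. (U \<omega>)\<^sup>2) \<le> (1 - \<alpha> * r n) * expectation (\<lambda>\<omega>. (U \<omega>)\<^sup>2)"
      by (intro mult_right_mono integral_nonneg) (auto simp: power2_eq_square)
    then show ?thesis using UY Y2 by simp
  qed
  finally show "expectation (\<lambda>\<omega>. (Z (Suc n) i \<omega> - A (Suc n) \<omega>)\<^sup>2)
      \<le> (1 - \<alpha> * r n) * expectation (\<lambda>\<omega>. (Z n i \<omega> - A n \<omega>)\<^sup>2) + 4 * (r n)\<^sup>2" by (simp add: U_def)
next
  show "\<not> summable (\<lambda>n. \<alpha> * r n)" using not_summable_r alpha by (simp add: summable_cmult_iff)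
  show "\<alpha> * r n \<le> 1" for n using mult_mono[of \<alpha> 1 "r n" 1] alpha r_bounds[of n] by simp
  show "summable (\<lambda>n. 4 * (r n)\<^sup>2)" by (intro summable_mult summable_r2)
qed (use alpha r_bounds in auto)

definition vA :: "nat \<Rightarrow> 'a \<Rightarrow> real" where "vA n \<omega> = A n \<omega> * (1 - A n \<omega>)"
definition vlim :: "'a \<Rightarrow> real" where "vlim \<omega> = Zlim \<omega> * (1 - Zlim \<omega>)"

lemma bdm_vAF: "k \<le> n \<Longrightarrow> bdm (F n) (vA k)"
  unfolding vA_def[abs_def] by (intro bdm_intros bdm_AF)

lemma bdm_vA [bdm_intros]: "bdm M (vA n)"
  by (rule bdm_F_imp_M[OF bdm_vAF[OF order_refl]])

lemma vA_range:
  assumes "\<omega> \<in> space M" shows "0 \<le> vA n \<omega>" "vA n \<omega> \<le> 1"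
  using A_range[OF assms, of n] mult_mono[of "A n \<omega>" 1 "1 - A n \<omega>" 1] by (auto simp: vA_def)

lemma Zlim_range: "AE \<omega> in M. 0 \<le> Zlim \<omega> \<and> Zlim \<omega> \<le> 1"
  using Zlim_lim AE_space
proof eventually_elim
  case (elim \<omega>)
  then show ?case using A_range[of \<omega>] LIMSEQ_le_const[OF elim(1)] LIMSEQ_le_const2[OF elim(1)] by blast
qed

lemma vlim_range: "AE \<omega> in M. 0 \<le> vlim \<omega> \<and> vlim \<omega> \<le> 1"
  using Zlim_range
proof eventually_elim
  case (elim \<omega>)
  then show ?case using mult_mono[of "Zlim \<omega>" 1 "1 - Zlim \<omega>" 1] by (simp add: vlim_def)
qed

lemma vlim_measurable [measurable]: "vlim \<in> borel_measurable M"
  unfolding vlim_def[abs_def] using Zlim_meas by measurable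

lemma vA_lim: "AE \<omega> in M. (\<lambda>n. vA n \<omega>) \<longlonglongrightarrow> vlim \<omega>"
  using Zlim_lim unfolding vA_def vlim_def by eventually_elim (intro tendsto_intros)

lemma vA_L1: "(\<lambda>n. expectation (\<lambda>\<omega>. \<bar>vA n \<omega> - vlim \<omega>\<bar>)) \<longlonglongrightarrow> 0"
proof -
  have "(\<lambda>n. expectation (\<lambda>\<omega>. \<bar>vA n \<omega> - vlim \<omega>\<bar>)) \<longlonglongrightarrow> expectation (\<lambda>\<omega>. 0)"
  proof (rule integral_dominated_convergence[where w="\<lambda>_. 1"])
    show "AE \<omega> in M. (\<lambda>n. \<bar>vA n \<omega> - vlim \<omega>\<bar>) \<longlonglongrightarrow> 0"
      using vA_lim
    proof eventually_elim
      case (elim \<omega>)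
      show ?case using tendsto_rabs[OF tendsto_diff[OF elim tendsto_const[of "vlim \<omega>"]]] by simp
    qed
    show "(\<lambda>\<omega>. \<bar>vA n \<omega> - vlim \<omega>\<bar>) \<in> borel_measurable M" for n
      using bdm_measurable[OF bdm_vA[of n]] by measurable
    show "AE \<omega> in M. norm \<bar>vA n \<omega> - vlim \<omega>\<bar> \<le> 1" for n
      using vlim_range AE_space by eventually_elim (use vA_range[of _ n] in force)
  qed auto
  then show ?thesis by simp
qed

text \<open>The function x (1 - x) is 1-Lipschitz on [0, 1] and the probabilities differ from the
  average by (1 - \<alpha>) times the deviation of the urn, so synchronisation brings
  \<open>V n\<close> close to \<open>vA n\<close> in L1.\<close>

lemma V_L1: "(\<lambda>n. expectation (\<lambda>\<omega>. \<bar>V n \<omega> - vlim \<omega>\<bar>)) \<longlonglongrightarrow> 0"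
proof -
  have 1: "expectation (\<lambda>\<omega>. \<bar>V n \<omega> - vA n \<omega>\<bar>) \<le> (\<Sum>i<N. sqrt (expectation (\<lambda>\<omega>. (Z n i \<omega> - A n \<omega>)\<^sup>2)))" for n
  proof -
    have "expectation (\<lambda>\<omega>. \<bar>V n \<omega> - vA n \<omega>\<bar>) \<le> expectation (\<lambda>\<omega>. \<Sum>i<N. \<bar>Z n i \<omega> - A n \<omega>\<bar>)"
    proof (rule expectation_mono_bdm)
      fix \<omega> assume w: "\<omega> \<in> space M"
      have le: "\<bar>p n i \<omega> * (1 - p n i \<omega>) - vA n \<omega>\<bar> \<le> \<bar>Z n i \<omega> - A n \<omega>\<bar>" if i: "i < N" for i
      proof -
        have "p n i \<omega> * (1 - p n i \<omega>) - vA n \<omega> = (1 - \<alpha>) * ((Z n i \<omega> - A n \<omega>) * (1 - p n i \<omega> - A n \<omega>))"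
          by (simp add: vA_def p_def algebra_simps)
        also have "\<bar>\<dots>\<bar> \<le> 1 * (\<bar>Z n i \<omega> - A n \<omega>\<bar> * 1)"
          unfolding abs_mult using p_range[OF w i, of n] A_range[OF w, of n] alpha by (intro mult_mono) auto
        finally show ?thesis by simp
      qed
      have "V n \<omega> - vA n \<omega> = (\<Sum>i<N. p n i \<omega> * (1 - p n i \<omega>) - vA n \<omega>) / real N"
        using N by (simp add: V_def sum_subtractf diff_divide_distrib)
      then have "\<bar>V n \<omega> - vA n \<omega>\<bar> \<le> \<bar>\<Sum>i<N. p n i \<omega> * (1 - p n i \<omega>) - vA n \<omega>\<bar>"
        using N divide_left_mono[of 1 "real N" "\<bar>\<Sum>i<N. p n i \<omega> * (1 - p n i \<omega>) - vA n \<omega>\<bar>"] by simp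
      also have "\<dots> \<le> (\<Sum>i<N. \<bar>p n i \<omega> * (1 - p n i \<omega>) - vA n \<omega>\<bar>)" by (rule sum_abs)
      also have "\<dots> \<le> (\<Sum>i<N. \<bar>Z n i \<omega> - A n \<omega>\<bar>)" by (intro sum_mono le) simp
      finally show "\<bar>V n \<omega> - vA n \<omega>\<bar> \<le> (\<Sum>i<N. \<bar>Z n i \<omega> - A n \<omega>\<bar>)" .
    qed (intro bdm_intros; simp)+
    also have "\<dots> = (\<Sum>i<N. expectation (\<lambda>\<omega>. \<bar>Z n i \<omega> - A n \<omega>\<bar>))"
      by (rule expectation_bdm_sum) (intro bdm_intros; simp)
    also have "\<dots> \<le> (\<Sum>i<N. sqrt (expectation (\<lambda>\<omega>. (Z n i \<omega> - A n \<omega>)\<^sup>2)))"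
      by (intro sum_mono expectation_abs_le_sqrt bdm_intros) simp
    finally show ?thesis .
  qed
  have "(\<lambda>n. \<Sum>i<N. sqrt (expectation (\<lambda>\<omega>. (Z n i \<omega> - A n \<omega>)\<^sup>2))) \<longlonglongrightarrow> (\<Sum>i<N. sqrt 0)"
    by (intro tendsto_sum tendsto_real_sqrt sync) simp
  with vA_L1 have "(\<lambda>n. (\<Sum>i<N. sqrt (expectation (\<lambda>\<omega>. (Z n i \<omega> - A n \<omega>)\<^sup>2))) + expectation (\<lambda>\<omega>. \<bar>vA n \<omega> - vlim \<omega>\<bar>)) \<longlonglongrightarrow> 0"
    using tendsto_add by fastforce
  then show ?thesis
  proof (rule tendsto_sandwich[OF _ _ tendsto_const, rotated 2])
    have i2: "integrable M (\<lambda>\<omega>. \<bar>vA n \<omega> - vlim \<omega>\<bar>)" for n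
    proof (rule integrable_const_bound[where B=1])
      show "AE \<omega> in M. norm \<bar>vA n \<omega> - vlim \<omega>\<bar> \<le> 1"
        using vlim_range AE_space by eventually_elim (use vA_range[of _ n] in force)
    qed (use bdm_measurable[OF bdm_vA[of n]] in measurable)
    have i1: "integrable M (\<lambda>\<omega>. \<bar>V n \<omega> - vA n \<omega>\<bar>)" for n by (intro bdm_integrable bdm_intros)
    have "expectation (\<lambda>\<omega>. \<bar>V n \<omega> - vlim \<omega>\<bar>) \<le> expectation (\<lambda>\<omega>. \<bar>V n \<omega> - vA n \<omega>\<bar> + \<bar>vA n \<omega> - vlim \<omega>\<bar>)" for n
    proof (rule integral_mono_AE')
      show "integrable M (\<lambda>\<omega>. \<bar>V n \<omega> - vA n \<omega>\<bar> + \<bar>vA n \<omega> - vlim \<omega>\<bar>)" using i1 i2 by simp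
    qed auto
    also have "expectation (\<lambda>\<omega>. \<bar>V n \<omega> - vA n \<omega>\<bar> + \<bar>vA n \<omega> - vlim \<omega>\<bar>)
        = expectation (\<lambda>\<omega>. \<bar>V n \<omega> - vA n \<omega>\<bar>) + expectation (\<lambda>\<omega>. \<bar>vA n \<omega> - vlim \<omega>\<bar>)" for n
      using i1 i2 by (rule Bochner_Integration.integral_add)
    finally show "\<forall>\<^sub>F n in sequentially. expectation (\<lambda>\<omega>. \<bar>V n \<omega> - vlim \<omega>\<bar>)
       \<le> (\<Sum>i<N. sqrt (expectation (\<lambda>\<omega>. (Z n i \<omega> - A n \<omega>)\<^sup>2))) + expectation (\<lambda>\<omega>. \<bar>vA n \<omega> - vlim \<omega>\<bar>)"
      using 1 by (intro always_eventually allI) (meson add_right_mono order_trans)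
  qed (auto intro!: always_eventually integral_nonneg)
qed

text \<open>Concavity of x (1 - x): the mean of the p's is the average, and the difference of the
  two sides is the variance of the p's over the urns.\<close>

lemma V_le_vA: "V n \<omega> \<le> vA n \<omega>"
proof -
  have "0 \<le> (\<Sum>i<N. (p n i \<omega> - A n \<omega>)\<^sup>2)" by (intro sum_nonneg) simp
  also have "\<dots> = (\<Sum>i<N. (p n i \<omega>)\<^sup>2) - 2 * A n \<omega> * (\<Sum>i<N. p n i \<omega>) + real N * (A n \<omega>)\<^sup>2"
    by (simp add: power2_diff sum.distrib sum_subtractf sum_distrib_left mult_ac)
  finally have "real N * (A n \<omega>)\<^sup>2 \<le> (\<Sum>i<N. (p n i \<omega>)\<^sup>2)"
    unfolding sum_p by (simp add: power2_eq_square algebra_simps)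
  moreover have "(\<Sum>i<N. p n i \<omega> * (1 - p n i \<omega>)) = real N * A n \<omega> - (\<Sum>i<N. (p n i \<omega>)\<^sup>2)"
    by (simp add: right_diff_distrib sum_subtractf sum_p power2_eq_square)
  ultimately have "(\<Sum>i<N. p n i \<omega> * (1 - p n i \<omega>)) \<le> real N * vA n \<omega>"
    by (simp add: vA_def power2_eq_square algebra_simps)
  then show ?thesis using N by (simp add: V_def field_simps)
qed

text \<open>In the expansion of A (1 - A) the linear term in D has mean 0, so the only loss is the
  second moment of D, which is at most \<open>(r n)\<^sup>2\<close> times the current value by
  \<open>V_le_vA\<close>.\<close>

lemma expectation_vA_Suc: "(1 - (r n)\<^sup>2) * expectation (vA n) \<le> expectation (vA (Suc n))"
proof -
  have "expectation (vA (Suc n)) = expectation (\<lambda>\<omega>. vA n \<omega> + (1 - 2 * A n \<omega>) * D n \<omega> - 1 * (D n \<omega>)\<^sup>2)"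
    by (intro Bochner_Integration.integral_cong refl) (simp add: vA_def D_def power2_eq_square algebra_simps)
  also have "\<dots> = expectation (vA n) + expectation (\<lambda>\<omega>. (1 - 2 * A n \<omega>) * D n \<omega>) - expectation (\<lambda>\<omega>. 1 * (D n \<omega>)\<^sup>2)"
    by (subst expectation_diff_bdm, (intro bdm_intros)+, subst expectation_add_bdm, (intro bdm_intros)+) simp
  also have "expectation (\<lambda>\<omega>. (1 - 2 * A n \<omega>) * D n \<omega>) = 0"
    by (rule expectation_D) (intro bdm_intros bdm_AF order_refl)
  also have "expectation (\<lambda>\<omega>. 1 * (D n \<omega>)\<^sup>2) = (r n)\<^sup>2 / real N * expectation (\<lambda>\<omega>. 1 * V n \<omega>)"
    by (rule expectation_D2) (rule bdm_const)
  finally have 1: "expectation (vA (Suc n)) = expectation (vA n) - (r n)\<^sup>2 / real N * expectation (V n)" by simp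
  have "(r n)\<^sup>2 / real N * expectation (V n) \<le> (r n)\<^sup>2 / real N * expectation (vA n)"
    by (intro mult_left_mono expectation_mono_bdm bdm_intros V_le_vA) simp
  also have "\<dots> \<le> (r n)\<^sup>2 / 1 * expectation (vA n)"
    using N vA_range by (intro mult_right_mono divide_left_mono integral_nonneg) auto
  finally show ?thesis using 1 by (simp add: left_diff_distrib)
qed

text \<open>Positivity survives finitely many steps because r n < 1. From a time m with R m < 1/2
  on, the product of the factors \<open>1 - (r k)\<^sup>2\<close> is at least one minus the sum of
  the squares, hence at least 1/2, and this bound passes to the limit.\<close>

lemma expectation_vlim_pos:
  assumes "0 < expectation (vA 0)"
  shows "0 < expectation vlim"
proof -
  have pos: "0 < expectation (vA n)" for n
  proof (induction n)
    case (Suc n)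
    have "(r n)\<^sup>2 < 1" using r_bounds[of n] by (simp add: power_less_one_iff abs_square_less_1)
    then have "0 < (1 - (r n)\<^sup>2) * expectation (vA n)" using Suc by simp
    then show ?case using expectation_vA_Suc[of n] by simp
  qed (rule assms)
  from LIMSEQ_D[OF R_tendsto_zero, of "1/2"] obtain m where m: "R m < 1/2" using R_nonneg by auto
  have low: "(1 - (\<Sum>k\<in>{m..<m + n}. (r k)\<^sup>2)) * expectation (vA m) \<le> expectation (vA (m + n))" for n
  proof (induction n)
    case (Suc n)
    let ?s = "\<Sum>k\<in>{m..<m + n}. (r k)\<^sup>2"
    have s: "0 \<le> ?s" by (intro sum_nonneg) simp
    have r1: "0 \<le> (r (m + n))\<^sup>2" "(r (m + n))\<^sup>2 \<le> 1" using r_bounds[of "m + n"] by (auto simp: power_le_one_iff)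
    have "(1 - (?s + (r (m + n))\<^sup>2)) * expectation (vA m) \<le> (1 - (r (m + n))\<^sup>2) * ((1 - ?s) * expectation (vA m))"
      unfolding mult.assoc[symmetric] using pos[of m] mult_nonneg_nonneg[OF s r1(1)] by (intro mult_right_mono) (auto simp: algebra_simps)
    also have "\<dots> \<le> (1 - (r (m + n))\<^sup>2) * expectation (vA (m + n))"
      using Suc r1 by (intro mult_left_mono) auto
    also have "\<dots> \<le> expectation (vA (m + Suc n))" using expectation_vA_Suc[of "m + n"] by simp
    finally show ?case by simp
  qed simp
  have low2: "1/2 * expectation (vA m) \<le> expectation (vA n)" if "n \<ge> m" for n
  proof -
    have "1/2 * expectation (vA m) \<le> (1 - (\<Sum>k\<in>{m..<m + (n - m)}. (r k)\<^sup>2)) * expectation (vA m)"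
      using pos[of m] m sum_r2_le_R[of m "m + (n - m)"] by (intro mult_right_mono) auto
    also have "\<dots> \<le> expectation (vA n)" using low[of "n - m"] that by simp
    finally show ?thesis .
  qed
  have "(\<lambda>n. expectation (vA n)) \<longlonglongrightarrow> expectation vlim"
  proof (rule integral_dominated_convergence[where w="\<lambda>_. 1"])
    show "AE \<omega> in M. norm (vA n \<omega>) \<le> 1" for n using vA_range[of _ n] by (intro AE_I2) auto
  qed (use vA_lim bdm_measurable[OF bdm_vA] in auto)
  then have "1/2 * expectation (vA m) \<le> expectation vlim"
    using low2 by (intro LIMSEQ_le_const) auto
  then show ?thesis using pos[of m] by simp
qed

lemma prob_boundary_less_one:
  assumes "0 < expectation (vA 0)"
  shows "prob {\<omega>\<in>space M. Zlim \<omega> \<in> {0, 1}} < 1"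
proof (rule ccontr)
  note [measurable] = Zlim_meas
  have S: "{\<omega>\<in>space M. Zlim \<omega> \<in> {0, 1}} \<in> sets M" by measurable
  assume "\<not> ?thesis"
  then have "prob {\<omega>\<in>space M. Zlim \<omega> \<in> {0, 1}} = 1"
    using prob_le_1[of "{\<omega>\<in>space M. Zlim \<omega> \<in> {0, 1}}"] by linarith
  then have "AE \<omega> in M. Zlim \<omega> \<in> {0, 1}" using prob_Collect_eq_1[OF S] by simp
  then have "AE \<omega> in M. vlim \<omega> = 0" by eventually_elim (auto simp: vlim_def)
  then have "expectation vlim = expectation (\<lambda>_. 0)" by (intro integral_cong_AE) auto
  then show False using expectation_vlim_pos[OF assms] by simp
qed

end

section \<open>Moment bounds and a maximal inequality for the average\<close>

context urns
begin

lemma second_moment: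
  assumes "m \<le> n"
  shows "expectation (\<lambda>\<omega>. (A n \<omega> - A m \<omega>)\<^sup>2) \<le> (\<Sum>k\<in>{m..<n}. (r k)\<^sup>2)"
  using assms
proof (induction n rule: dec_induct)
  case (step n)
  define s where "s \<omega> = A n \<omega> - A m \<omega>" for \<omega>
  have sF: "bdm (F n) s" unfolding s_def[abs_def] using step by (intro bdm_intros bdm_AF) auto
  note s = bdm_F_imp_M[OF sF]
  have "expectation (\<lambda>\<omega>. (A (Suc n) \<omega> - A m \<omega>)\<^sup>2) = expectation (\<lambda>\<omega>. (s \<omega>)\<^sup>2 + (2 * s \<omega>) * D n \<omega> + (D n \<omega>)\<^sup>2)"
    by (intro Bochner_Integration.integral_cong refl) (simp add: s_def D_def power2_eq_square algebra_simps)
  also have "\<dots> = expectation (\<lambda>\<omega>. (s \<omega>)\<^sup>2) + expectation (\<lambda>\<omega>. (2 * s \<omega>) * D n \<omega>) + expectation (\<lambda>\<omega>. (D n \<omega>)\<^sup>2)"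
    by (subst expectation_add_bdm, (intro bdm_intros s)+, subst expectation_add_bdm, (intro bdm_intros s)+) simp
  also have "expectation (\<lambda>\<omega>. (2 * s \<omega>) * D n \<omega>) = 0"
    by (rule expectation_D) (intro bdm_intros sF)
  also have "expectation (\<lambda>\<omega>. (D n \<omega>)\<^sup>2) \<le> (r n)\<^sup>2"
  proof (rule expectation_le_const)
    fix \<omega> assume "\<omega> \<in> space M"
    then show "(D n \<omega>)\<^sup>2 \<le> (r n)\<^sup>2" using D_bound[of \<omega> n] power_mono[of "\<bar>D n \<omega>\<bar>" "r n" 2] by simp
  qed (intro bdm_intros)
  finally show ?case using step by (simp add: s_def)
qed simp

text \<open>In the expansion of (s + d)^4 the term linear in d has mean 0, and the cubic term is
  absorbed by 4 s d^3 \<le> 2 s^2 d^2 + 2 d^4. What remains is 8 r^2 E[s^2] + 3 r^4 with E[s^2]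
  bounded by the sum \<sigma>. A constant C closes the induction as soon as 8 \<le> 2 C and 3 \<le>
  C; 11 = 8 + 3 is such a constant.\<close>

lemma fourth_moment:
  assumes "m \<le> n"
  shows "expectation (\<lambda>\<omega>. (A n \<omega> - A m \<omega>) ^ 4) \<le> 11 * (\<Sum>k\<in>{m..<n}. (r k)\<^sup>2)\<^sup>2"
  using assms
proof (induction n rule: dec_induct)
  case (step n)
  define s where "s \<omega> = A n \<omega> - A m \<omega>" for \<omega>
  define \<sigma> where "\<sigma> = (\<Sum>k\<in>{m..<n}. (r k)\<^sup>2)"
  have \<sigma>: "0 \<le> \<sigma>" unfolding \<sigma>_def by (intro sum_nonneg) simp
  have sF: "bdm (F n) s" unfolding s_def[abs_def] using step by (intro bdm_intros bdm_AF) auto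
  note s = bdm_F_imp_M[OF sF]
  have "expectation (\<lambda>\<omega>. (A (Suc n) \<omega> - A m \<omega>) ^ 4)
      \<le> expectation (\<lambda>\<omega>. (s \<omega>) ^ 4 + (4 * (s \<omega>) ^ 3) * D n \<omega> + (8 * (r n)\<^sup>2 * (s \<omega>)\<^sup>2 + 3 * (r n) ^ 4))"
  proof (rule expectation_mono_bdm)
    fix \<omega> assume w: "\<omega> \<in> space M"
    let ?s = "s \<omega>" and ?d = "D n \<omega>"
    have d2: "?d\<^sup>2 \<le> (r n)\<^sup>2" using D_bound[OF w, of n] power_mono[of "\<bar>?d\<bar>" "r n" 2] by simp
    have d4: "?d ^ 4 \<le> (r n) ^ 4"
      using power_mono[OF d2, of 2] by (simp add: power_mult[symmetric])
    have "(A (Suc n) \<omega> - A m \<omega>) ^ 4 = (?s + ?d) ^ 4" by (simp add: s_def D_def)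
    also have "\<dots> = ?s ^ 4 + 4 * ?s ^ 3 * ?d + 6 * (?s\<^sup>2 * ?d\<^sup>2) + 2 * (2 * (?s * ?d) * ?d\<^sup>2) + ?d ^ 4"
      by (simp add: power4_eq_xxxx power3_eq_cube power2_eq_square algebra_simps)
    also have "2 * (?s * ?d) * ?d\<^sup>2 \<le> (?s * ?d)\<^sup>2 + (?d\<^sup>2)\<^sup>2"
      using sum_squares_bound[of "?s * ?d" "?d\<^sup>2"] by simp
    also have "?s ^ 4 + 4 * ?s ^ 3 * ?d + 6 * (?s\<^sup>2 * ?d\<^sup>2) + 2 * ((?s * ?d)\<^sup>2 + (?d\<^sup>2)\<^sup>2) + ?d ^ 4
        = ?s ^ 4 + 4 * ?s ^ 3 * ?d + (8 * (?d\<^sup>2 * ?s\<^sup>2) + 3 * ?d ^ 4)"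
      by (simp add: power_mult_distrib power_mult[symmetric])
    also have "\<dots> \<le> ?s ^ 4 + 4 * ?s ^ 3 * ?d + (8 * ((r n)\<^sup>2 * ?s\<^sup>2) + 3 * (r n) ^ 4)"
      using d2 d4 by (intro add_mono mult_left_mono mult_right_mono order_refl) auto
    finally show "(A (Suc n) \<omega> - A m \<omega>) ^ 4 \<le> ?s ^ 4 + (4 * ?s ^ 3) * ?d + (8 * (r n)\<^sup>2 * ?s\<^sup>2 + 3 * (r n) ^ 4)"
      by (simp add: mult.assoc)
  qed (intro bdm_intros s)+
  also have "\<dots> = expectation (\<lambda>\<omega>. (s \<omega>) ^ 4) + expectation (\<lambda>\<omega>. (4 * (s \<omega>) ^ 3) * D n \<omega>)
      + expectation (\<lambda>\<omega>. 8 * (r n)\<^sup>2 * (s \<omega>)\<^sup>2 + 3 * (r n) ^ 4)"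
    by (subst expectation_add_bdm, (intro bdm_intros s)+, subst expectation_add_bdm, (intro bdm_intros s)+) simp
  also have "expectation (\<lambda>\<omega>. (4 * (s \<omega>) ^ 3) * D n \<omega>) = 0"
    by (rule expectation_D) (intro bdm_intros sF)
  also have "expectation (\<lambda>\<omega>. 8 * (r n)\<^sup>2 * (s \<omega>)\<^sup>2 + 3 * (r n) ^ 4) = 8 * (r n)\<^sup>2 * expectation (\<lambda>\<omega>. (s \<omega>)\<^sup>2) + 3 * (r n) ^ 4"
    by (subst expectation_add_bdm) (simp_all add: bdm_intros s prob_space)
  also have "expectation (\<lambda>\<omega>. (s \<omega>)\<^sup>2) \<le> \<sigma>" unfolding s_def \<sigma>_def using step by (intro second_moment) auto
  finally have "expectation (\<lambda>\<omega>. (A (Suc n) \<omega> - A m \<omega>) ^ 4) \<le> 11 * \<sigma>\<^sup>2 + 8 * (r n)\<^sup>2 * \<sigma> + 3 * (r n) ^ 4"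
    using step unfolding s_def \<sigma>_def by (simp add: mult_left_mono)
  also have "\<dots> \<le> 11 * (\<sigma> + (r n)\<^sup>2)\<^sup>2"
    using \<sigma> by (simp add: power2_sum power_mult[symmetric])
  finally show ?case using step by (simp add: \<sigma>_def)
qed simp

lemma fourth_moment_R: "m \<le> n \<Longrightarrow> expectation (\<lambda>\<omega>. (A n \<omega> - A m \<omega>) ^ 4) \<le> 11 * (R m)\<^sup>2"
  by (rule order_trans[OF fourth_moment]) (auto intro!: power_mono sum_r2_le_R sum_nonneg)

lemma fourth_moment_lim: "expectation (\<lambda>\<omega>. (Zlim \<omega> - A m \<omega>) ^ 4) \<le> 11 * (R m)\<^sup>2"
proof -
  note [measurable] = Zlim_meas bdm_measurable[OF bdm_A]
  have "(\<lambda>n. expectation (\<lambda>\<omega>. (A n \<omega> - A m \<omega>) ^ 4)) \<longlonglongrightarrow> expectation (\<lambda>\<omega>. (Zlim \<omega> - A m \<omega>) ^ 4)"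
  proof (rule integral_dominated_convergence[where w="\<lambda>_. 1"])
    show "AE \<omega> in M. (\<lambda>n. (A n \<omega> - A m \<omega>) ^ 4) \<longlonglongrightarrow> (Zlim \<omega> - A m \<omega>) ^ 4"
      using Zlim_lim by eventually_elim (intro tendsto_intros)
    show "AE \<omega> in M. norm ((A n \<omega> - A m \<omega>) ^ 4) \<le> 1" for n
    proof (rule AE_I2)
      fix \<omega> assume "\<omega> \<in> space M"
      then have "\<bar>A n \<omega> - A m \<omega>\<bar> \<le> 1" using A_range[of \<omega> n] A_range[of \<omega> m] by auto
      then show "norm ((A n \<omega> - A m \<omega>) ^ 4) \<le> 1" using power_le_one[of "\<bar>A n \<omega> - A m \<omega>\<bar>" 4] by (simp add: power_even_abs)
    qed
  qed auto
  then show ?thesis using fourth_moment_R by (intro LIMSEQ_le_const2) auto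
qed

lemma markov_lim:
  assumes x: "0 < x"
  shows "prob {\<omega>\<in>space M. x \<le> \<bar>Zlim \<omega> - A m \<omega>\<bar>} \<le> 11 * (R m)\<^sup>2 / x ^ 4"
proof -
  note [measurable] = Zlim_meas bdm_measurable[OF bdm_A]
  let ?E = "{\<omega>\<in>space M. x \<le> \<bar>Zlim \<omega> - A m \<omega>\<bar>}"
  have E: "?E \<in> sets M" by measurable
  have int: "integrable M (\<lambda>\<omega>. (Zlim \<omega> - A m \<omega>) ^ 4)"
  proof (rule integrable_const_bound[where B=1])
    show "AE \<omega> in M. norm ((Zlim \<omega> - A m \<omega>) ^ 4) \<le> 1"
      using Zlim_range AE_space
    proof eventually_elim
      case (elim \<omega>)
      then have "\<bar>Zlim \<omega> - A m \<omega>\<bar> \<le> 1" using A_range[of \<omega> m] by auto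
      then show ?case using power_le_one[of "\<bar>Zlim \<omega> - A m \<omega>\<bar>" 4] by (simp add: power_even_abs)
    qed
  qed measurable
  have "x ^ 4 * prob ?E = expectation (\<lambda>\<omega>. x ^ 4 * indicator ?E \<omega>)" using E by simp
  also have "\<dots> \<le> expectation (\<lambda>\<omega>. (Zlim \<omega> - A m \<omega>) ^ 4)"
  proof (rule integral_mono[OF _ int])
    show "integrable M (\<lambda>\<omega>. x ^ 4 * indicator ?E \<omega>)" by (intro bdm_integrable bdm_intros E)
    fix \<omega> assume "\<omega> \<in> space M"
    show "x ^ 4 * indicator ?E \<omega> \<le> (Zlim \<omega> - A m \<omega>) ^ 4"
      using power_mono[of x "\<bar>Zlim \<omega> - A m \<omega>\<bar>" 4] x by (auto simp: indicator_def power_even_abs)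
  qed
  also have "\<dots> \<le> 11 * (R m)\<^sup>2" by (rule fourth_moment_lim)
  finally show ?thesis using x by (simp add: field_simps)
qed

text \<open>Doob's inequality, by induction on the end of the time interval; no stopping times are needed.\<close>

lemma maximal_inequality:
  assumes mn: "m \<le> n" and x: "0 < x"
  shows "prob {\<omega>\<in>space M. \<exists>k\<in>{m..n}. x \<le> \<bar>A k \<omega> - A m \<omega>\<bar>} \<le> 11 * (\<Sum>k\<in>{m..<n}. (r k)\<^sup>2)\<^sup>2 / x ^ 4"
proof -
  define C where "C n = {\<omega>\<in>space M. \<exists>k\<in>{m..n}. x \<le> \<bar>A k \<omega> - A m \<omega>\<bar>}" for n
  have CF: "C n \<in> sets (F n)" if "m \<le> n" for n
  proof -
    have [measurable]: "A k \<in> borel_measurable (F n)" if "k \<le> n" for k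
      by (rule bdm_measurable[OF bdm_AF[OF that]])
    have "C n = {\<omega>\<in>space (F n). \<exists>k\<in>{m..n}. x \<le> \<bar>A k \<omega> - A m \<omega>\<bar>}" by (simp add: C_def)
    also have "\<dots> \<in> sets (F n)" using that by measurable
    finally show ?thesis .
  qed
  have CM: "C n \<in> sets M" if "m \<le> n" for n
    using CF[OF that] subalgebra_F[of n] by (auto simp: subalgebra_def)
  have "x ^ 4 * prob (C n) \<le> expectation (\<lambda>\<omega>. indicator (C n) \<omega> * (A n \<omega> - A m \<omega>) ^ 4)"
    using mn
  proof (induction n rule: dec_induct)
    case base
    have "C m = {}" using x by (auto simp: C_def)
    then show ?case by simp
  next
    case (step n)
    \<comment> \<open>The event that the level is reached for the first time at step n + 1; its
      indicator is multiplied by the value at that very step.\<close>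
    define E where "E = C (Suc n) - C n"
    have sub: "C n \<subseteq> C (Suc n)" unfolding C_def by fastforce
    note CM' = CM[OF step(1)] CM[OF le_SucI[OF step(1)]]
    have EM: "E \<in> sets M" unfolding E_def using CM' by auto
    have Eb: "x \<le> \<bar>A (Suc n) \<omega> - A m \<omega>\<bar>" if wE: "\<omega> \<in> E" for \<omega>
    proof -
      obtain k where "k \<in> {m..Suc n}" "x \<le> \<bar>A k \<omega> - A m \<omega>\<bar>" using wE by (auto simp: E_def C_def)
      moreover have "k \<notin> {m..n}" using wE calculation by (auto simp: E_def C_def)
      ultimately show ?thesis by (auto simp: le_Suc_eq)
    qed
    have ind: "indicator (C (Suc n)) \<omega> = indicator (C n) \<omega> + (indicator E \<omega> :: real)" for \<omega>
      using sub by (auto simp: indicator_def E_def)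
    have "x ^ 4 * prob (C (Suc n)) = x ^ 4 * prob (C n) + x ^ 4 * prob E"
    proof -
      have "prob (C (Suc n)) = prob (C n) + prob E"
        using finite_measure_Union[OF CM'(1) EM] sub by (simp add: E_def Un_absorb1 Un_Diff_cancel)
      then show ?thesis by (simp add: distrib_left)
    qed
    also have "\<dots> \<le> expectation (\<lambda>\<omega>. indicator (C n) \<omega> * (A (Suc n) \<omega> - A m \<omega>) ^ 4)
        + expectation (\<lambda>\<omega>. indicator E \<omega> * (A (Suc n) \<omega> - A m \<omega>) ^ 4)"
    proof (rule add_mono)
      let ?s = "\<lambda>\<omega>. A n \<omega> - A m \<omega>"
      have sF: "bdm (F n) ?s" using step by (intro bdm_intros bdm_AF) auto
      note s = bdm_F_imp_M[OF sF]
      have "x ^ 4 * prob (C n) \<le> expectation (\<lambda>\<omega>. indicator (C n) \<omega> * ?s \<omega> ^ 4)" by (rule step.IH)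
      \<comment> \<open>A term of mean 0 is added, since C n and the increment up to n belong to the
        past. Together with the fourth power it forms the tangent line of the convex function u^4,
        which lies below (u + d)^4.\<close>
      also have "\<dots> = expectation (\<lambda>\<omega>. indicator (C n) \<omega> * ?s \<omega> ^ 4) + expectation (\<lambda>\<omega>. (4 * (indicator (C n) \<omega> * ?s \<omega> ^ 3)) * D n \<omega>)"
        by (subst expectation_D) (intro bdm_intros sF CF step(1), simp)
      also have "\<dots> = expectation (\<lambda>\<omega>. indicator (C n) \<omega> * ?s \<omega> ^ 4 + (4 * (indicator (C n) \<omega> * ?s \<omega> ^ 3)) * D n \<omega>)"
        by (rule expectation_add_bdm[symmetric]) (intro bdm_intros s CM')+
      also have "\<dots> \<le> expectation (\<lambda>\<omega>. indicator (C n) \<omega> * (A (Suc n) \<omega> - A m \<omega>) ^ 4)"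
      proof (rule expectation_mono_bdm)
        fix \<omega>
        have conv: "u ^ 4 + 4 * u ^ 3 * d \<le> (u + d) ^ 4" for u d :: real
        proof -
          have "(u + d) ^ 4 - (u ^ 4 + 4 * u ^ 3 * d) = d\<^sup>2 * (2 * u\<^sup>2 + (2 * u + d)\<^sup>2)"
            by (simp add: power4_eq_xxxx power3_eq_cube power2_eq_square algebra_simps)
          then show ?thesis by (smt (verit) mult_nonneg_nonneg zero_le_power2)
        qed
        show "indicator (C n) \<omega> * ?s \<omega> ^ 4 + (4 * (indicator (C n) \<omega> * ?s \<omega> ^ 3)) * D n \<omega>
            \<le> indicator (C n) \<omega> * (A (Suc n) \<omega> - A m \<omega>) ^ 4"
          using conv[of "?s \<omega>" "D n \<omega>"] by (simp add: indicator_def D_def)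
      qed (intro bdm_intros s CM')+
      finally show "x ^ 4 * prob (C n) \<le> expectation (\<lambda>\<omega>. indicator (C n) \<omega> * (A (Suc n) \<omega> - A m \<omega>) ^ 4)" .
      have "x ^ 4 * prob E = expectation (\<lambda>\<omega>. x ^ 4 * indicator E \<omega>)" using EM by simp
      also have "\<dots> \<le> expectation (\<lambda>\<omega>. indicator E \<omega> * (A (Suc n) \<omega> - A m \<omega>) ^ 4)"
      proof (rule expectation_mono_bdm)
        fix \<omega>
        show "x ^ 4 * indicator E \<omega> \<le> indicator E \<omega> * (A (Suc n) \<omega> - A m \<omega>) ^ 4"
          using power_mono[OF Eb, of \<omega> 4] x by (auto simp: indicator_def power_even_abs)
      qed (intro bdm_intros EM)+
      finally show "x ^ 4 * prob E \<le> expectation (\<lambda>\<omega>. indicator E \<omega> * (A (Suc n) \<omega> - A m \<omega>) ^ 4)" .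
    qed
    also have "\<dots> = expectation (\<lambda>\<omega>. indicator (C (Suc n)) \<omega> * (A (Suc n) \<omega> - A m \<omega>) ^ 4)"
      unfolding ind distrib_right by (rule expectation_add_bdm[symmetric]) (intro bdm_intros EM CM')+
    finally show ?case .
  qed
  also have "\<dots> \<le> expectation (\<lambda>\<omega>. (A n \<omega> - A m \<omega>) ^ 4)"
  proof (rule expectation_mono_bdm)
    show "indicator (C n) \<omega> * (A n \<omega> - A m \<omega>) ^ 4 \<le> (A n \<omega> - A m \<omega>) ^ 4" for \<omega>
      by (simp add: indicator_def)
  qed (intro bdm_intros CM mn)+
  also have "\<dots> \<le> 11 * (\<Sum>k\<in>{m..<n}. (r k)\<^sup>2)\<^sup>2" by (rule fourth_moment[OF mn])
  finally show ?thesis using x by (simp add: C_def field_simps)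
qed

end

section \<open>The central limit theorem for the martingale tails\<close>

lemma cos_taylor2: "\<bar>cos (x + d) - (cos x - d * sin x - d\<^sup>2 / 2 * cos x)\<bar> \<le> \<bar>d\<bar> ^ 3 / 6" for x d :: real
proof -
  have "cmod (iexp d - (\<Sum>k\<le>2. (\<i> * d) ^ k / fact k)) \<le> \<bar>d\<bar> ^ Suc 2 / fact (Suc 2)" by (rule iexp_approx1)
  then have 1: "cmod (iexp d - (1 + \<i> * d - d\<^sup>2 / 2)) \<le> \<bar>d\<bar> ^ 3 / 6"
    by (simp add: numeral_2_eq_2 numeral_3_eq_3 fact_numeral power2_eq_square algebra_simps)
  have "cos (x + d) - (cos x - d * sin x - d\<^sup>2 / 2 * cos x) = Re (iexp x * (iexp d - (1 + \<i> * d - d\<^sup>2 / 2)))"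
    by (simp add: Re_exp Im_exp cos_add algebra_simps power2_eq_square)
  also have "\<bar>\<dots>\<bar> \<le> cmod (iexp x * (iexp d - (1 + \<i> * d - d\<^sup>2 / 2)))" by (rule abs_Re_le_cmod)
  also have "\<dots> = cmod (iexp d - (1 + \<i> * d - d\<^sup>2 / 2))" by (simp add: norm_mult)
  finally show ?thesis using 1 by linarith
qed

lemma exp_minus_taylor1: "0 \<le> y \<Longrightarrow> \<bar>exp (- y) - (1 - y)\<bar> \<le> y\<^sup>2 / 2" for y :: real
proof -
  assume y: "0 \<le> y"
  have 1: "1 - y \<le> exp (- y)" using exp_ge_add_one_self[of "- y"] by simp
  have "1 + y + y\<^sup>2 / 2 \<le> exp y" by (rule exp_lower_Taylor_quadratic[OF y])
  then have "exp (- y) \<le> 1 / (1 + y + y\<^sup>2 / 2)" using y by (simp add: exp_minus inverse_eq_divide frac_le add_pos_nonneg)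
  \<comment> \<open>The product (1 - y + y^2/2) (1 + y + y^2/2) equals 1 + y^4/4.\<close>
  also have "\<dots> \<le> 1 - y + y\<^sup>2 / 2"
  proof -
    have "1 \<le> (1 - y + y\<^sup>2 / 2) * (1 + y + y\<^sup>2 / 2)"
      using y by (simp add: power2_eq_square algebra_simps)
    moreover have "0 < 1 + y + y\<^sup>2 / 2" using y by (simp add: add_pos_nonneg)
    ultimately show ?thesis by (simp add: divide_le_eq)
  qed
  finally show ?thesis using 1 by simp
qed

lemma exp_minus_lipschitz: "0 \<le> x \<Longrightarrow> 0 \<le> y \<Longrightarrow> \<bar>exp (- x) - exp (- y)\<bar> \<le> \<bar>x - y\<bar>" for x y :: real
proof (induction x y rule: linorder_wlog)
  case (le x y)
  have "exp (- y) = exp (- x) * exp (- (y - x))" by (simp add: exp_add[symmetric])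
  then have "exp (- x) - exp (- y) = exp (- x) * (1 - exp (- (y - x)))" by (simp add: algebra_simps)
  also have "\<dots> \<le> 1 * (y - x)"
  proof (rule mult_mono)
    show "1 - exp (- (y - x)) \<le> y - x" using exp_ge_add_one_self[of "- (y - x)"] by linarith
  qed (use le in auto)
  finally show ?case using le by simp
next
  case (sym x y)
  then show ?case by (simp add: abs_minus_commute)
qed

context urns
begin

text \<open>One Lindeberg exchange: the increment b * D n inside the cosine is traded for the
  damping factor of a centred Gaussian with conditional variance v * b^2 r^2 / N. First-order terms
  vanish by the martingale property, second-order terms differ by V n - v, and the Taylor remainders
  give the third and fourth powers.\<close>

lemma cos_telescope_step:
  assumes g: "bdm (F n) g" "\<And>\<omega>. \<omega> \<in> space M \<Longrightarrow> \<bar>g \<omega>\<bar> \<le> 1" and x: "x \<in> borel_measurable (F n)"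
    and v: "bdm (F n) v" "\<And>\<omega>. \<omega> \<in> space M \<Longrightarrow> 0 \<le> v \<omega>" "\<And>\<omega>. \<omega> \<in> space M \<Longrightarrow> v \<omega> \<le> 1"
  shows "\<bar>expectation (\<lambda>\<omega>. g \<omega> * cos (x \<omega> + b * D n \<omega>)) - expectation (\<lambda>\<omega>. g \<omega> * (cos (x \<omega>) * exp (- (v \<omega> * (b\<^sup>2 * (r n)\<^sup>2 / real N) / 2))))\<bar>
    \<le> b\<^sup>2 * (r n)\<^sup>2 / 2 * expectation (\<lambda>\<omega>. \<bar>V n \<omega> - v \<omega>\<bar>) + (\<bar>b\<bar> * r n) ^ 3 / 6 + (\<bar>b\<bar> * r n) ^ 4 / 8"
proof -
  let ?q = "b\<^sup>2 * (r n)\<^sup>2 / real N"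
  have q: "0 \<le> ?q" "?q \<le> b\<^sup>2 * (r n)\<^sup>2"
    using N divide_left_mono[of 1 "real N" "b\<^sup>2 * (r n)\<^sup>2"] by auto
  note bg = bdm_F_imp_M[OF g(1)] and bv = bdm_F_imp_M[OF v(1)]
  have xM: "x \<in> borel_measurable M" by (rule measurable_from_subalg[OF subalgebra_F x])
  have bc: "bdm M (\<lambda>\<omega>. cos (x \<omega>))" "bdm M (\<lambda>\<omega>. sin (x \<omega>))" by (intro bdm_intros xM)+
  have bcF: "bdm (F n) (\<lambda>\<omega>. cos (x \<omega>))" "bdm (F n) (\<lambda>\<omega>. sin (x \<omega>))" by (intro bdm_intros x)+
  have bcd: "bdm M (\<lambda>\<omega>. cos (x \<omega> + b * D n \<omega>))"
    by (intro bdm_cos borel_measurable_add borel_measurable_times borel_measurable_const xM bdm_measurable[OF bdm_D])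
  have be: "bdm M (\<lambda>\<omega>. exp (- (v \<omega> * ?q / 2)))"
    using bdm_measurable[OF bv] v(2) q(1) by (intro bdm_exp_minus) auto
  define W where "W \<omega> = g \<omega> * cos (x \<omega> + b * D n \<omega>) - g \<omega> * (cos (x \<omega>) * exp (- (v \<omega> * ?q / 2)))" for \<omega>
  \<comment> \<open>\<open>W\<close> with the cosine and the exponential replaced by their Taylor
    polynomials; every term of it can be integrated by the conditional moment identities.\<close>
  define W' where "W' \<omega> = ((- b) * (g \<omega> * sin (x \<omega>))) * D n \<omega> + ((- (b\<^sup>2 / 2)) * (g \<omega> * cos (x \<omega>))) * (D n \<omega>)\<^sup>2
      + ?q / 2 * (g \<omega> * cos (x \<omega>) * v \<omega>)" for \<omega>
  have bW: "bdm M W" unfolding W_def[abs_def] by (intro bdm_mult bdm_diff bg bcd be bc)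
  have bW': "bdm M W'" unfolding W'_def[abs_def] by (intro bdm_mult bdm_add bdm_const bdm_power bdm_D bg bc bv)
  have close: "\<bar>W \<omega> - W' \<omega>\<bar> \<le> (\<bar>b\<bar> * r n) ^ 3 / 6 + (\<bar>b\<bar> * r n) ^ 4 / 8" if w: "\<omega> \<in> space M" for \<omega>
  proof -
    let ?d = "b * D n \<omega>" and ?y = "v \<omega> * ?q / 2"
    have y0: "0 \<le> ?y" using v(2)[OF w] q(1) by simp
    have d: "\<bar>?d\<bar> \<le> \<bar>b\<bar> * r n" unfolding abs_mult using D_bound[OF w, of n] by (intro mult_left_mono) auto
    have y: "?y \<le> (\<bar>b\<bar> * r n)\<^sup>2 / 2"
      using mult_mono[OF v(3)[OF w] q(2)] q(1) by (simp add: power_mult_distrib)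
    have "W \<omega> - W' \<omega> = g \<omega> * ((cos (x \<omega> + ?d) - (cos (x \<omega>) - ?d * sin (x \<omega>) - ?d\<^sup>2 / 2 * cos (x \<omega>)))
        - cos (x \<omega>) * (exp (- ?y) - (1 - ?y)))"
      by (simp add: W_def W'_def algebra_simps power2_eq_square)
    also have "\<bar>\<dots>\<bar> \<le> 1 * (\<bar>?d\<bar> ^ 3 / 6 + 1 * (?y\<^sup>2 / 2))"
      unfolding abs_mult[of "g \<omega>"]
    proof (rule mult_mono[OF g(2)[OF w]])
      have "\<bar>cos (x \<omega>) * (exp (- ?y) - (1 - ?y))\<bar> \<le> 1 * (?y\<^sup>2 / 2)"
        unfolding abs_mult by (rule mult_mono[OF _ exp_minus_taylor1[OF y0]]) auto
      then show "\<bar>(cos (x \<omega> + ?d) - (cos (x \<omega>) - ?d * sin (x \<omega>) - ?d\<^sup>2 / 2 * cos (x \<omega>)))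
        - cos (x \<omega>) * (exp (- ?y) - (1 - ?y))\<bar> \<le> \<bar>?d\<bar> ^ 3 / 6 + 1 * (?y\<^sup>2 / 2)"
        using cos_taylor2[of "x \<omega>" ?d] by linarith
    qed auto
    also have "\<dots> \<le> (\<bar>b\<bar> * r n) ^ 3 / 6 + ((\<bar>b\<bar> * r n)\<^sup>2 / 2)\<^sup>2 / 2"
      using power_mono[OF d, of 3] power_mono[OF y y0, of 2] by simp
    also have "((\<bar>b\<bar> * r n)\<^sup>2 / 2)\<^sup>2 / 2 = (\<bar>b\<bar> * r n) ^ 4 / 8"
      by (simp add: power_divide power_mult[symmetric])
    finally show ?thesis .
  qed
  have EW': "expectation W' = ?q / 2 * expectation (\<lambda>\<omega>. g \<omega> * cos (x \<omega>) * (v \<omega> - V n \<omega>))"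
  proof -
    have "expectation W' = expectation (\<lambda>\<omega>. ((- b) * (g \<omega> * sin (x \<omega>))) * D n \<omega>)
        + expectation (\<lambda>\<omega>. ((- (b\<^sup>2 / 2)) * (g \<omega> * cos (x \<omega>))) * (D n \<omega>)\<^sup>2) + expectation (\<lambda>\<omega>. ?q / 2 * (g \<omega> * cos (x \<omega>) * v \<omega>))"
      unfolding W'_def[abs_def]
      by (subst expectation_add_bdm, (intro bdm_mult bdm_add bdm_const bdm_power bdm_D bg bc bv)+,
          subst expectation_add_bdm, (intro bdm_mult bdm_add bdm_const bdm_power bdm_D bg bc bv)+) simp
    also have "expectation (\<lambda>\<omega>. ((- b) * (g \<omega> * sin (x \<omega>))) * D n \<omega>) = 0"
      by (rule expectation_D) (intro bdm_mult bdm_const g bcF)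
    also have "expectation (\<lambda>\<omega>. ((- (b\<^sup>2 / 2)) * (g \<omega> * cos (x \<omega>))) * (D n \<omega>)\<^sup>2)
       = (r n)\<^sup>2 / real N * expectation (\<lambda>\<omega>. ((- (b\<^sup>2 / 2)) * (g \<omega> * cos (x \<omega>))) * V n \<omega>)"
      by (rule expectation_D2) (intro bdm_mult bdm_const g bcF)
    also have "\<dots> = expectation (\<lambda>\<omega>. (- (?q / 2)) * (g \<omega> * cos (x \<omega>) * V n \<omega>))"
      by (simp add: mult.assoc)
    also have "0 + expectation (\<lambda>\<omega>. (- (?q / 2)) * (g \<omega> * cos (x \<omega>) * V n \<omega>)) + expectation (\<lambda>\<omega>. ?q / 2 * (g \<omega> * cos (x \<omega>) * v \<omega>))
      = expectation (\<lambda>\<omega>. (- (?q / 2)) * (g \<omega> * cos (x \<omega>) * V n \<omega>) + ?q / 2 * (g \<omega> * cos (x \<omega>) * v \<omega>))"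
      by (subst expectation_add_bdm, (intro bdm_mult bdm_const bdm_V bg bc bv)+) simp
    also have "\<dots> = expectation (\<lambda>\<omega>. ?q / 2 * (g \<omega> * cos (x \<omega>) * (v \<omega> - V n \<omega>)))"
      by (rule Bochner_Integration.integral_cong[OF refl]) (simp add: right_diff_distrib)
    finally show ?thesis by simp
  qed
  have "\<bar>expectation (\<lambda>\<omega>. g \<omega> * cos (x \<omega>) * (v \<omega> - V n \<omega>))\<bar> \<le> expectation (\<lambda>\<omega>. \<bar>g \<omega> * cos (x \<omega>) * (v \<omega> - V n \<omega>)\<bar>)"
    by (rule integral_abs_bound)
  also have "\<dots> \<le> expectation (\<lambda>\<omega>. \<bar>V n \<omega> - v \<omega>\<bar>)"
  proof (rule expectation_mono_bdm)
    fix \<omega> assume w: "\<omega> \<in> space M"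
    have "\<bar>g \<omega> * cos (x \<omega>) * (v \<omega> - V n \<omega>)\<bar> \<le> (1 * 1) * \<bar>v \<omega> - V n \<omega>\<bar>"
      unfolding abs_mult using g(2)[OF w] by (intro mult_right_mono mult_mono) auto
    then show "\<bar>g \<omega> * cos (x \<omega>) * (v \<omega> - V n \<omega>)\<bar> \<le> \<bar>V n \<omega> - v \<omega>\<bar>" by (simp add: abs_minus_commute)
  qed (intro bdm_abs bdm_mult bdm_diff bdm_V bg bc bv)+
  finally have "?q / 2 * \<bar>expectation (\<lambda>\<omega>. g \<omega> * cos (x \<omega>) * (v \<omega> - V n \<omega>))\<bar> \<le> ?q / 2 * expectation (\<lambda>\<omega>. \<bar>V n \<omega> - v \<omega>\<bar>)"
    by (rule mult_left_mono) simp
  moreover have "\<bar>expectation W'\<bar> = ?q / 2 * \<bar>expectation (\<lambda>\<omega>. g \<omega> * cos (x \<omega>) * (v \<omega> - V n \<omega>))\<bar>"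
    unfolding EW' abs_mult[of "?q / 2"] by simp
  ultimately have "\<bar>expectation W'\<bar> \<le> ?q / 2 * expectation (\<lambda>\<omega>. \<bar>V n \<omega> - v \<omega>\<bar>)" by (simp only:)
  also have "\<dots> \<le> b\<^sup>2 * (r n)\<^sup>2 / 2 * expectation (\<lambda>\<omega>. \<bar>V n \<omega> - v \<omega>\<bar>)"
    using q(2) by (intro mult_right_mono divide_right_mono integral_nonneg) auto
  finally have 1: "\<bar>expectation W'\<bar> \<le> b\<^sup>2 * (r n)\<^sup>2 / 2 * expectation (\<lambda>\<omega>. \<bar>V n \<omega> - v \<omega>\<bar>)" .
  have 2: "\<bar>expectation W - expectation W'\<bar> \<le> (\<bar>b\<bar> * r n) ^ 3 / 6 + (\<bar>b\<bar> * r n) ^ 4 / 8"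
  proof -
    have "expectation W - expectation W' = expectation (\<lambda>\<omega>. W \<omega> - W' \<omega>)"
      by (rule expectation_diff_bdm[symmetric, OF bW bW'])
    then show ?thesis using expectation_bounded[of "\<lambda>\<omega>. W \<omega> - W' \<omega>", OF close] r_bounds[of n] by simp
  qed
  have "expectation W = expectation (\<lambda>\<omega>. g \<omega> * cos (x \<omega> + b * D n \<omega>)) - expectation (\<lambda>\<omega>. g \<omega> * (cos (x \<omega>) * exp (- (v \<omega> * ?q / 2))))"
    unfolding W_def[abs_def] by (intro expectation_diff_bdm bdm_mult bg bcd be bc)
  then show ?thesis using 1 2 by linarith
qed

text \<open>
  The variance is frozen at the value \<open>vA m\<close> known at time \<open>m\<close>; the Gaussian factors are then exchanged for
  the martingale increments one by one.
\<close>

lemma cos_telescope: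
  assumes mn: "m \<le> n" and h: "bdm (F m) h" "\<And>\<omega>. \<omega> \<in> space M \<Longrightarrow> \<bar>h \<omega>\<bar> \<le> 1" and psi: "\<psi> \<in> borel_measurable (F m)"
  shows "\<bar>expectation (\<lambda>\<omega>. h \<omega> * cos (\<psi> \<omega> + (\<Sum>k\<in>{m..<n}. b k * D k \<omega>)))
      - expectation (\<lambda>\<omega>. h \<omega> * (cos (\<psi> \<omega>) * exp (- (vA m \<omega> * (\<Sum>k\<in>{m..<n}. (b k)\<^sup>2 * (r k)\<^sup>2 / real N) / 2))))\<bar>
    \<le> (\<Sum>k\<in>{m..<n}. (b k)\<^sup>2 * (r k)\<^sup>2 / 2 * expectation (\<lambda>\<omega>. \<bar>V k \<omega> - vA m \<omega>\<bar>) + (\<bar>b k\<bar> * r k) ^ 3 / 6 + (\<bar>b k\<bar> * r k) ^ 4 / 8)"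
proof -
  define Q where "Q j = (\<Sum>k\<in>{j..<n}. (b k)\<^sup>2 * (r k)\<^sup>2 / real N)" for j
  define S where "S j \<omega> = \<psi> \<omega> + (\<Sum>k\<in>{m..<j}. b k * D k \<omega>)" for j \<omega>
  \<comment> \<open>The hybrid quantity: increments before j are genuine, those from j on are
    represented by their Gaussian damping.\<close>
  define T where "T j = expectation (\<lambda>\<omega>. h \<omega> * (cos (S j \<omega>) * exp (- (vA m \<omega> * Q j / 2))))" for j
  define err where "err k = (b k)\<^sup>2 * (r k)\<^sup>2 / 2 * expectation (\<lambda>\<omega>. \<bar>V k \<omega> - vA m \<omega>\<bar>) + (\<bar>b k\<bar> * r k) ^ 3 / 6 + (\<bar>b k\<bar> * r k) ^ 4 / 8" for k
  have Q0: "0 \<le> Q j" for j unfolding Q_def by (intro sum_nonneg) simp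
  have "\<bar>T j - T m\<bar> \<le> (\<Sum>k\<in>{m..<j}. err k)" if "m \<le> j" "j \<le> n" for j
    using that
  proof (induction j rule: dec_induct)
    case (step j)
    \<comment> \<open>The damping of the later steps involves only the variance frozen at time m, so
      it belongs to the past at time j and can serve as weight in the exchange.\<close>
    define g where "g \<omega> = h \<omega> * exp (- (vA m \<omega> * Q (Suc j) / 2))" for \<omega>
    have ex: "bdm (F j) (\<lambda>\<omega>. exp (- (vA m \<omega> * Q (Suc j) / 2)))"
      using bdm_measurable[OF bdm_vAF[OF step(1)]] vA_range(1)[of _ m] Q0[of "Suc j"] by (intro bdm_exp_minus) auto
    have g: "bdm (F j) g"
      unfolding g_def[abs_def] by (intro bdm_mult ex bdm_F_mono[OF step(1) h(1)])
    have g1: "\<bar>g \<omega>\<bar> \<le> 1" if w: "\<omega> \<in> space M" for \<omega>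
    proof -
      have "\<bar>g \<omega>\<bar> \<le> 1 * 1" unfolding g_def abs_mult
        using h(2)[OF w] vA_range(1)[OF w, of m] Q0[of "Suc j"] by (intro mult_mono) auto
      then show ?thesis by simp
    qed
    have Sm: "S j \<in> borel_measurable (F j)"
    proof -
      have "D k \<in> borel_measurable (F j)" if "k \<in> {m..<j}" for k
        using that by (intro bdm_measurable[OF bdm_DF]) auto
      moreover have "\<psi> \<in> borel_measurable (F j)" by (rule measurable_from_subalg[OF F_mono[OF step(1)] psi])
      ultimately show ?thesis unfolding S_def[abs_def] by (intro borel_measurable_add borel_measurable_sum borel_measurable_times) auto
    qed
    have Qs: "Q j = (b j)\<^sup>2 * (r j)\<^sup>2 / real N + Q (Suc j)"
      unfolding Q_def using step by (subst sum.atLeast_Suc_lessThan) auto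
    have "T (Suc j) = expectation (\<lambda>\<omega>. g \<omega> * cos (S j \<omega> + b j * D j \<omega>))"
      unfolding T_def g_def S_def using step by (simp add: mult_ac add_ac)
    moreover have "T j = expectation (\<lambda>\<omega>. g \<omega> * (cos (S j \<omega>) * exp (- (vA m \<omega> * ((b j)\<^sup>2 * (r j)\<^sup>2 / real N) / 2))))"
      unfolding T_def g_def Qs by (intro Bochner_Integration.integral_cong refl)
        (simp add: exp_add[symmetric] mult.assoc mult.left_commute distrib_left add_divide_distrib)
    moreover have "\<bar>expectation (\<lambda>\<omega>. g \<omega> * cos (S j \<omega> + b j * D j \<omega>))
       - expectation (\<lambda>\<omega>. g \<omega> * (cos (S j \<omega>) * exp (- (vA m \<omega> * ((b j)\<^sup>2 * (r j)\<^sup>2 / real N) / 2))))\<bar> \<le> err j"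
      unfolding err_def by (rule cos_telescope_step[OF g g1 Sm bdm_vAF[OF step(1)] vA_range])
    ultimately have "\<bar>T (Suc j) - T j\<bar> \<le> err j" by simp
    moreover have "\<bar>T j - T m\<bar> \<le> (\<Sum>k\<in>{m..<j}. err k)" using step by simp
    ultimately show ?case using step by simp
  qed simp
  from this[OF mn order_refl] show ?thesis
    by (simp add: T_def S_def Q_def err_def)
qed


lemma integrable_vlim: "integrable M vlim"
  using vlim_range by (intro integrable_const_bound[where B=1]) auto

lemma expectation_vA_V_close:
  assumes m: "filterlim m at_top sequentially" and e: "0 < e"
  shows "\<forall>\<^sub>F n in sequentially. expectation (\<lambda>\<omega>. \<bar>vA (m n) \<omega> - vlim \<omega>\<bar>) \<le> e \<and>
    (\<forall>k\<ge>m n. expectation (\<lambda>\<omega>. \<bar>V k \<omega> - vA (m n) \<omega>\<bar>) \<le> e)"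
proof -
  have iA: "integrable M (\<lambda>\<omega>. \<bar>vA n \<omega> - vlim \<omega>\<bar>)" and iV: "integrable M (\<lambda>\<omega>. \<bar>V n \<omega> - vlim \<omega>\<bar>)" for n
    by (intro integrable_abs Bochner_Integration.integrable_diff integrable_vlim bdm_integrable bdm_vA bdm_V)+
  have ev: "\<forall>\<^sub>F k in sequentially. expectation (\<lambda>\<omega>. \<bar>V k \<omega> - vlim \<omega>\<bar>) < e / 2"
    using order_tendstoD(2)[OF V_L1, of "e / 2"] e by simp
  have ev': "\<forall>\<^sub>F k in sequentially. expectation (\<lambda>\<omega>. \<bar>vA k \<omega> - vlim \<omega>\<bar>) < e / 2"
    using order_tendstoD(2)[OF vA_L1, of "e / 2"] e by simp
  obtain k0 where k0: "\<And>k. k \<ge> k0 \<Longrightarrow> expectation (\<lambda>\<omega>. \<bar>V k \<omega> - vlim \<omega>\<bar>) < e / 2"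
    "\<And>k. k \<ge> k0 \<Longrightarrow> expectation (\<lambda>\<omega>. \<bar>vA k \<omega> - vlim \<omega>\<bar>) < e / 2"
    using eventually_conj[OF ev ev'] unfolding eventually_sequentially by blast
  have "\<forall>\<^sub>F n in sequentially. k0 \<le> m n" using m by (simp add: filterlim_at_top)
  then show ?thesis
  proof eventually_elim
    case (elim n)
    have "expectation (\<lambda>\<omega>. \<bar>V k \<omega> - vA (m n) \<omega>\<bar>) \<le> e" if "k \<ge> m n" for k
    proof -
      have "expectation (\<lambda>\<omega>. \<bar>V k \<omega> - vA (m n) \<omega>\<bar>) \<le> expectation (\<lambda>\<omega>. \<bar>V k \<omega> - vlim \<omega>\<bar> + \<bar>vA (m n) \<omega> - vlim \<omega>\<bar>)"
        by (rule integral_mono[OF bdm_integrable[OF bdm_abs[OF bdm_diff[OF bdm_V bdm_vA]]]])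
          (use iA iV in auto)
      also have "\<dots> = expectation (\<lambda>\<omega>. \<bar>V k \<omega> - vlim \<omega>\<bar>) + expectation (\<lambda>\<omega>. \<bar>vA (m n) \<omega> - vlim \<omega>\<bar>)"
        using iA iV by simp
      also have "\<dots> \<le> e" using k0(1)[of k] k0(2)[of "m n"] elim that by simp
      finally show ?thesis .
    qed
    then show ?case using k0(2)[OF elim] e by auto
  qed
qed

text \<open>The factors \<open>h n\<close> and \<open>\<psi> n\<close> may vary with n and need not
  converge, so the statement compares two expectations instead of naming a limit. Smallness of the
  individual increments is the uniform bound \<open>\<beta> n\<close>. The cosine telescope is
  applied to partial sums, which then run to infinity before n does.\<close>

proposition martingale_clt:
  assumes m: "filterlim m at_top sequentially"
    and h: "\<And>n. bdm (F (m n)) (h n)" "\<And>n \<omega>. \<omega> \<in> space M \<Longrightarrow> \<bar>h n \<omega>\<bar> \<le> 1"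
    and psi: "\<And>n. \<psi> n \<in> borel_measurable (F (m n))"
    and S: "\<And>n. S n \<in> borel_measurable M" "\<And>n. AE \<omega> in M. (\<lambda>j. \<Sum>k\<in>{m n..<j}. b n k * D k \<omega>) \<longlonglongrightarrow> S n \<omega>"
    and Q: "\<And>n. (\<lambda>j. \<Sum>k\<in>{m n..<j}. (b n k)\<^sup>2 * (r k)\<^sup>2) \<longlonglongrightarrow> Q n" "Q \<longlonglongrightarrow> q"
    and small: "\<And>n k. k \<ge> m n \<Longrightarrow> \<bar>b n k\<bar> * r k \<le> \<beta> n" "\<beta> \<longlonglongrightarrow> 0"
  shows "(\<lambda>n. expectation (\<lambda>\<omega>. h n \<omega> * cos (\<psi> n \<omega> + S n \<omega>))
       - expectation (\<lambda>\<omega>. h n \<omega> * (cos (\<psi> n \<omega>) * exp (- (vlim \<omega> * (q / real N) / 2))))) \<longlonglongrightarrow> 0"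
proof -
  define X where "X n = expectation (\<lambda>\<omega>. h n \<omega> * cos (\<psi> n \<omega> + S n \<omega>))" for n
  define Y where "Y n = expectation (\<lambda>\<omega>. h n \<omega> * (cos (\<psi> n \<omega>) * exp (- (vA (m n) \<omega> * (Q n / real N) / 2))))" for n
  define Y' where "Y' n = expectation (\<lambda>\<omega>. h n \<omega> * (cos (\<psi> n \<omega>) * exp (- (vlim \<omega> * (q / real N) / 2))))" for n
  have psiM: "\<psi> n \<in> borel_measurable M" for n by (rule measurable_from_subalg[OF subalgebra_F psi])
  have hM: "h n \<in> borel_measurable M" for n by (rule bdm_measurable[OF bdm_F_imp_M[OF h(1)]])
  note [measurable] = psiM hM S(1) bdm_measurable[OF bdm_vA] bdm_measurable[OF bdm_D]
  have Qn0: "0 \<le> Q n" for n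
    by (rule LIMSEQ_le_const[OF Q(1)]) (auto intro!: sum_nonneg)
  have q0: "0 \<le> q" by (rule LIMSEQ_le_const[OF Q(2)]) (auto simp: Qn0)
  have prod1: "\<bar>h n \<omega> * (cos u * e)\<bar> \<le> \<bar>e\<bar>" if "\<omega> \<in> space M" for n \<omega> u e
  proof -
    have "\<bar>h n \<omega> * (cos u * e)\<bar> \<le> 1 * (1 * \<bar>e\<bar>)"
      unfolding abs_mult using h(2)[OF that, of n] by (intro mult_mono) auto
    then show ?thesis by simp
  qed
  have prod2: "norm (h n \<omega> * (cos u * exp (- y))) \<le> 1" if "\<omega> \<in> space M" "0 \<le> y" for n \<omega> u y
    using prod1[OF that(1), of n u "exp (- y)"] exp_le_one_iff[of "- y"] that(2)
    unfolding real_norm_def abs_exp_cancel by linarith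
  have XY: "\<bar>X n - Y n\<bar> \<le> Q n / 2 * e + Q n * \<beta> n / 6 + Q n * (\<beta> n)\<^sup>2 / 8"
    if e: "\<And>k. k \<ge> m n \<Longrightarrow> expectation (\<lambda>\<omega>. \<bar>V k \<omega> - vA (m n) \<omega>\<bar>) \<le> e" for n e
  proof -
    define Qj where "Qj j = (\<Sum>k\<in>{m n..<j}. (b n k)\<^sup>2 * (r k)\<^sup>2)" for j
    define Xj where "Xj j = expectation (\<lambda>\<omega>. h n \<omega> * cos (\<psi> n \<omega> + (\<Sum>k\<in>{m n..<j}. b n k * D k \<omega>)))" for j
    define Yj where "Yj j = expectation (\<lambda>\<omega>. h n \<omega> * (cos (\<psi> n \<omega>) * exp (- (vA (m n) \<omega> * (Qj j / real N) / 2))))" for j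
    have Qj0: "0 \<le> Qj j" for j unfolding Qj_def by (intro sum_nonneg) simp
    have 1: "Xj \<longlonglongrightarrow> X n"
      unfolding Xj_def X_def
    proof (rule integral_dominated_convergence[where w="\<lambda>_. 1"])
      show "AE \<omega> in M. (\<lambda>j. h n \<omega> * cos (\<psi> n \<omega> + (\<Sum>k\<in>{m n..<j}. b n k * D k \<omega>))) \<longlonglongrightarrow> h n \<omega> * cos (\<psi> n \<omega> + S n \<omega>)"
        using S(2)[of n] by eventually_elim (intro tendsto_intros)
      show "AE \<omega> in M. norm (h n \<omega> * cos (\<psi> n \<omega> + (\<Sum>k\<in>{m n..<j}. b n k * D k \<omega>))) \<le> 1" for j
        using prod1[of _ n _ 1] by (intro AE_I2) auto
    qed auto
    have 2: "Yj \<longlonglongrightarrow> Y n"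
      unfolding Yj_def Y_def
    proof (rule integral_dominated_convergence[where w="\<lambda>_. 1"])
      show "AE \<omega> in M. (\<lambda>j. h n \<omega> * (cos (\<psi> n \<omega>) * exp (- (vA (m n) \<omega> * (Qj j / real N) / 2))))
          \<longlonglongrightarrow> h n \<omega> * (cos (\<psi> n \<omega>) * exp (- (vA (m n) \<omega> * (Q n / real N) / 2)))"
        using Q(1)[of n] N unfolding Qj_def by (intro AE_I2 tendsto_intros) auto
      show "AE \<omega> in M. norm (h n \<omega> * (cos (\<psi> n \<omega>) * exp (- (vA (m n) \<omega> * (Qj j / real N) / 2)))) \<le> 1" for j
      proof (rule AE_I2)
        fix \<omega> assume w: "\<omega> \<in> space M"
        have "0 \<le> vA (m n) \<omega> * (Qj j / real N) / 2" using vA_range(1)[OF w, of "m n"] Qj0[of j] by simp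
        then show "norm (h n \<omega> * (cos (\<psi> n \<omega>) * exp (- (vA (m n) \<omega> * (Qj j / real N) / 2)))) \<le> 1"
          by (rule prod2[OF w])
      qed
    qed auto
    have 3: "\<bar>Xj j - Yj j\<bar> \<le> Qj j / 2 * e + Qj j * \<beta> n / 6 + Qj j * (\<beta> n)\<^sup>2 / 8" if j: "j \<ge> m n" for j
    proof -
      have "\<bar>Xj j - Yj j\<bar> \<le> (\<Sum>k\<in>{m n..<j}. (b n k)\<^sup>2 * (r k)\<^sup>2 / 2 * expectation (\<lambda>\<omega>. \<bar>V k \<omega> - vA (m n) \<omega>\<bar>)
          + (\<bar>b n k\<bar> * r k) ^ 3 / 6 + (\<bar>b n k\<bar> * r k) ^ 4 / 8)"
        using cos_telescope[OF j h(1) h(2) psi, of "b n"] unfolding Xj_def Yj_def Qj_def sum_divide_distrib by simp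
      also have "\<dots> \<le> (\<Sum>k\<in>{m n..<j}. (b n k)\<^sup>2 * (r k)\<^sup>2 / 2 * e + (b n k)\<^sup>2 * (r k)\<^sup>2 * \<beta> n / 6 + (b n k)\<^sup>2 * (r k)\<^sup>2 * (\<beta> n)\<^sup>2 / 8)"
      proof (rule sum_mono)
        fix k assume "k \<in> {m n..<j}"
        then have k: "k \<ge> m n" by simp
        let ?t = "\<bar>b n k\<bar> * r k"
        have t: "0 \<le> ?t" "?t \<le> \<beta> n" using r_bounds[of k] small(1)[OF k] by auto
        have t2: "?t\<^sup>2 = (b n k)\<^sup>2 * (r k)\<^sup>2" by (simp add: power_mult_distrib)
        \<comment> \<open>One factor of the increment bound is traded for \<open>\<beta> n\<close>,
          leaving squares that add up to at most the variance; the fourth power is treated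
          alike.\<close>
        have t3: "?t ^ 3 \<le> ?t\<^sup>2 * \<beta> n" using mult_left_mono[OF t(2), of "?t\<^sup>2"] by (simp only: power3_eq_cube power2_eq_square) simp
        have "?t ^ 4 = ?t\<^sup>2 * ?t\<^sup>2" by (simp add: power4_eq_xxxx power2_eq_square)
        also have "\<dots> \<le> ?t\<^sup>2 * (\<beta> n)\<^sup>2" using t by (intro mult_left_mono power_mono) auto
        finally have t4: "?t ^ 4 \<le> ?t\<^sup>2 * (\<beta> n)\<^sup>2" .
        show "(b n k)\<^sup>2 * (r k)\<^sup>2 / 2 * expectation (\<lambda>\<omega>. \<bar>V k \<omega> - vA (m n) \<omega>\<bar>) + ?t ^ 3 / 6 + ?t ^ 4 / 8
          \<le> (b n k)\<^sup>2 * (r k)\<^sup>2 / 2 * e + (b n k)\<^sup>2 * (r k)\<^sup>2 * \<beta> n / 6 + (b n k)\<^sup>2 * (r k)\<^sup>2 * (\<beta> n)\<^sup>2 / 8"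
          using e[OF k] t3 t4 unfolding t2 by (intro add_mono mult_left_mono divide_right_mono) auto
      qed
      also have "\<dots> = Qj j / 2 * e + Qj j * \<beta> n / 6 + Qj j * (\<beta> n)\<^sup>2 / 8"
        unfolding Qj_def by (simp add: sum.distrib sum_distrib_right sum_divide_distrib)
      finally show ?thesis .
    qed
    have "(\<lambda>j. \<bar>Xj j - Yj j\<bar>) \<longlonglongrightarrow> \<bar>X n - Y n\<bar>" by (intro tendsto_intros 1 2)
    moreover have "(\<lambda>j. Qj j / 2 * e + Qj j * \<beta> n / 6 + Qj j * (\<beta> n)\<^sup>2 / 8) \<longlonglongrightarrow> Q n / 2 * e + Q n * \<beta> n / 6 + Q n * (\<beta> n)\<^sup>2 / 8"
      using Q(1)[of n] unfolding Qj_def by (intro tendsto_intros) auto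
    ultimately show ?thesis by (rule LIMSEQ_le) (use 3 in blast)
  qed
  have YY': "\<bar>Y n - Y' n\<bar> \<le> \<bar>Q n - q\<bar> + q * expectation (\<lambda>\<omega>. \<bar>vA (m n) \<omega> - vlim \<omega>\<bar>)" for n
  proof -
    have iA: "integrable M (\<lambda>\<omega>. \<bar>vA (m n) \<omega> - vlim \<omega>\<bar>)"
      by (intro integrable_abs Bochner_Integration.integrable_diff integrable_vlim bdm_integrable bdm_vA)
    have i1: "integrable M (\<lambda>\<omega>. h n \<omega> * (cos (\<psi> n \<omega>) * exp (- (vA (m n) \<omega> * (Q n / real N) / 2))))"
    proof (rule integrable_const_bound[where B=1])
      show "AE \<omega> in M. norm (h n \<omega> * (cos (\<psi> n \<omega>) * exp (- (vA (m n) \<omega> * (Q n / real N) / 2)))) \<le> 1"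
        using AE_space
      proof eventually_elim
        case (elim \<omega>)
        have "0 \<le> vA (m n) \<omega> * (Q n / real N) / 2" using vA_range(1)[OF elim, of "m n"] Qn0[of n] by simp
        then show ?case by (rule prod2[OF elim])
      qed
    qed measurable
    have i2: "integrable M (\<lambda>\<omega>. h n \<omega> * (cos (\<psi> n \<omega>) * exp (- (vlim \<omega> * (q / real N) / 2))))"
    proof (rule integrable_const_bound[where B=1])
      show "AE \<omega> in M. norm (h n \<omega> * (cos (\<psi> n \<omega>) * exp (- (vlim \<omega> * (q / real N) / 2)))) \<le> 1"
        using AE_space vlim_range
      proof eventually_elim
        case (elim \<omega>)
        have "0 \<le> vlim \<omega> * (q / real N) / 2" using elim(2) q0 by simp
        then show ?case by (rule prod2[OF elim(1)])
      qed
    qed measurable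
    have ptw: "\<bar>h n \<omega> * (cos (\<psi> n \<omega>) * exp (- (vA (m n) \<omega> * (Q n / real N) / 2)))
        - h n \<omega> * (cos (\<psi> n \<omega>) * exp (- (vlim \<omega> * (q / real N) / 2)))\<bar> \<le> \<bar>Q n - q\<bar> + q * \<bar>vA (m n) \<omega> - vlim \<omega>\<bar>"
      if w: "\<omega> \<in> space M" and vl: "0 \<le> vlim \<omega> \<and> vlim \<omega> \<le> 1" for \<omega>
    proof -
      define x where "x = vA (m n) \<omega> * (Q n / real N) / 2"
      define y where "y = vlim \<omega> * (q / real N) / 2"
      have x: "0 \<le> x" using vA_range(1)[OF w, of "m n"] Qn0[of n] by (simp add: x_def)
      have y: "0 \<le> y" using vl q0 by (simp add: y_def)
      have "\<bar>h n \<omega> * (cos (\<psi> n \<omega>) * exp (- x)) - h n \<omega> * (cos (\<psi> n \<omega>) * exp (- y))\<bar> \<le> \<bar>exp (- x) - exp (- y)\<bar>"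
        using prod1[OF w, of n "\<psi> n \<omega>" "exp (- x) - exp (- y)"] by (simp add: right_diff_distrib)
      also have "\<dots> \<le> \<bar>x - y\<bar>" by (rule exp_minus_lipschitz[OF x y])
      also have "x - y = (vA (m n) \<omega> * (Q n - q) + q * (vA (m n) \<omega> - vlim \<omega>)) / (2 * real N)"
        using N by (simp add: x_def y_def field_simps)
      also have "\<bar>\<dots>\<bar> \<le> \<bar>vA (m n) \<omega> * (Q n - q) + q * (vA (m n) \<omega> - vlim \<omega>)\<bar> / 1"
        unfolding abs_divide using N by (intro divide_left_mono) auto
      also have "\<dots> \<le> 1 * \<bar>Q n - q\<bar> + q * \<bar>vA (m n) \<omega> - vlim \<omega>\<bar>"
      proof -
        have "\<bar>vA (m n) \<omega> * (Q n - q)\<bar> \<le> 1 * \<bar>Q n - q\<bar>"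
          unfolding abs_mult using vA_range[OF w, of "m n"] by (intro mult_right_mono) auto
        moreover have "\<bar>q * (vA (m n) \<omega> - vlim \<omega>)\<bar> = q * \<bar>vA (m n) \<omega> - vlim \<omega>\<bar>" using q0 by (simp add: abs_mult)
        ultimately show ?thesis using abs_triangle_ineq[of "vA (m n) \<omega> * (Q n - q)" "q * (vA (m n) \<omega> - vlim \<omega>)"] by simp
      qed
      finally show ?thesis by (simp add: x_def y_def)
    qed
    have AEb: "AE \<omega> in M. \<bar>h n \<omega> * (cos (\<psi> n \<omega>) * exp (- (vA (m n) \<omega> * (Q n / real N) / 2)))
        - h n \<omega> * (cos (\<psi> n \<omega>) * exp (- (vlim \<omega> * (q / real N) / 2)))\<bar> \<le> \<bar>Q n - q\<bar> + q * \<bar>vA (m n) \<omega> - vlim \<omega>\<bar>"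
      using AE_space vlim_range by eventually_elim (rule ptw)
    have "Y n - Y' n = expectation (\<lambda>\<omega>. h n \<omega> * (cos (\<psi> n \<omega>) * exp (- (vA (m n) \<omega> * (Q n / real N) / 2)))
        - h n \<omega> * (cos (\<psi> n \<omega>) * exp (- (vlim \<omega> * (q / real N) / 2))))"
      unfolding Y_def Y'_def by (rule Bochner_Integration.integral_diff[OF i1 i2, symmetric])
    then have "\<bar>Y n - Y' n\<bar> \<le> expectation (\<lambda>\<omega>. \<bar>h n \<omega> * (cos (\<psi> n \<omega>) * exp (- (vA (m n) \<omega> * (Q n / real N) / 2)))
        - h n \<omega> * (cos (\<psi> n \<omega>) * exp (- (vlim \<omega> * (q / real N) / 2)))\<bar>)" by (simp only: integral_abs_bound)
    also have "\<dots> \<le> expectation (\<lambda>\<omega>. \<bar>Q n - q\<bar> + q * \<bar>vA (m n) \<omega> - vlim \<omega>\<bar>)"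
      by (rule integral_mono_AE[OF integrable_abs[OF Bochner_Integration.integrable_diff[OF i1 i2]] _ AEb])
        (intro Bochner_Integration.integrable_add integrable_mult_right iA, simp)
    also have "\<dots> = \<bar>Q n - q\<bar> + q * expectation (\<lambda>\<omega>. \<bar>vA (m n) \<omega> - vlim \<omega>\<bar>)" using iA by (simp add: prob_space)
    finally show ?thesis .
  qed
  have "(\<lambda>n. X n - Y' n) \<longlonglongrightarrow> 0"
  proof (rule LIMSEQ_approx)
    fix \<epsilon> :: real assume eps: "0 < \<epsilon>"
    \<comment> \<open>The limiting error is q / 2 * e + q * e, that is 3 / 2 times q * e; the added
      1 in the denominator covers q = 0.\<close>
    define e where "e = \<epsilon> / (2 * q + 1)"
    have e0: "0 < e" using eps q0 by (simp add: e_def)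
    have "e * (2 * q + 1) = \<epsilon>" using q0 by (simp add: e_def add_nonneg_eq_0_iff)
    moreover have "0 \<le> e * q" using e0 q0 by simp
    moreover have "q / 2 * e + q * e = 3 / 2 * (e * q)" "e * (2 * q + 1) = 2 * (e * q) + e" by (simp_all add: algebra_simps)
    ultimately have e: "0 < e" "q / 2 * e + q * e \<le> \<epsilon>" using e0 by linarith+
    have ev: "\<forall>\<^sub>F n in sequentially. \<bar>X n - Y' n - 0\<bar> \<le> Q n / 2 * e + Q n * \<beta> n / 6 + Q n * (\<beta> n)\<^sup>2 / 8 + (\<bar>Q n - q\<bar> + q * e)"
      using expectation_vA_V_close[OF m e(1)]
    proof eventually_elim
      case (elim n)
      have "q * expectation (\<lambda>\<omega>. \<bar>vA (m n) \<omega> - vlim \<omega>\<bar>) \<le> q * e" using elim q0 by (intro mult_left_mono) auto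
      then show ?case using XY[of n e] YY'[of n] elim by fastforce
    qed
    have "(\<lambda>n. Q n / 2 * e + Q n * \<beta> n / 6 + Q n * (\<beta> n)\<^sup>2 / 8 + (\<bar>Q n - q\<bar> + q * e))
       \<longlonglongrightarrow> q / 2 * e + q * 0 / 6 + q * 0\<^sup>2 / 8 + (\<bar>q - q\<bar> + q * e)"
      by (intro tendsto_intros Q small) auto
    then show "\<exists>b b' e e'. (\<forall>\<^sub>F n in sequentially. \<bar>X n - Y' n - b n\<bar> \<le> e n) \<and> \<bar>0 - b'\<bar> \<le> e' \<and> b \<longlonglongrightarrow> b' \<and> e \<longlonglongrightarrow> e' \<and> e' \<le> \<epsilon>"
      using ev e q0 by (intro exI[of _ "\<lambda>_. 0"] exI[of _ 0]
          exI[of _ "\<lambda>n. Q n / 2 * e + Q n * \<beta> n / 6 + Q n * (\<beta> n)\<^sup>2 / 8 + (\<bar>Q n - q\<bar> + q * e)"]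
          exI[of _ "q / 2 * e + q * 0 / 6 + q * 0\<^sup>2 / 8 + (\<bar>q - q\<bar> + q * e)"]) auto
  qed
  then show ?thesis by (simp add: X_def Y'_def)
qed

end

lemma floor_ratio_tendsto:
  assumes t: "0 < t"
  shows "(\<lambda>n. real (nat \<lfloor>real n * t\<rfloor>) / real n) \<longlonglongrightarrow> t"
proof (rule tendsto_sandwich[where f="\<lambda>n. t - 1 / real n" and h="\<lambda>_. t"])
  show "\<forall>\<^sub>F n in sequentially. t - 1 / real n \<le> real (nat \<lfloor>real n * t\<rfloor>) / real n"
  proof (rule eventually_sequentiallyI[of 1])
    fix n :: nat assume n: "1 \<le> n"
    have "real n * t - 1 \<le> real (nat \<lfloor>real n * t\<rfloor>)" using t by linarith
    then have "(real n * t - 1) / real n \<le> real (nat \<lfloor>real n * t\<rfloor>) / real n" by (rule divide_right_mono) simp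
    then show "t - 1 / real n \<le> real (nat \<lfloor>real n * t\<rfloor>) / real n" using n by (simp add: diff_divide_distrib)
  qed
  show "\<forall>\<^sub>F n in sequentially. real (nat \<lfloor>real n * t\<rfloor>) / real n \<le> t"
  proof (rule eventually_sequentiallyI[of 1])
    fix n :: nat assume n: "1 \<le> n"
    have "real (nat \<lfloor>real n * t\<rfloor>) \<le> real n * t" using t by simp
    then have "real (nat \<lfloor>real n * t\<rfloor>) / real n \<le> real n * t / real n" by (rule divide_right_mono) simp
    then show "real (nat \<lfloor>real n * t\<rfloor>) / real n \<le> t" using n by simp
  qed
  have "(\<lambda>n. t - 1 / real n) \<longlonglongrightarrow> t - 0" by (intro tendsto_intros lim_1_over_n)
  then show "(\<lambda>n. t - 1 / real n) \<longlonglongrightarrow> t" by simp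
qed simp

lemma floor_at_top:
  assumes t: "0 < t"
  shows "filterlim (\<lambda>n. nat \<lfloor>real n * t\<rfloor>) at_top sequentially"
  unfolding filterlim_at_top
proof
  fix K :: nat
  obtain n0 :: nat where n0: "(real K + 1) / t \<le> n0" using real_arch_simple by blast
  show "\<forall>\<^sub>F n in sequentially. K \<le> nat \<lfloor>real n * t\<rfloor>"
  proof (rule eventually_sequentiallyI[of n0])
    fix n assume "n0 \<le> n"
    then have "(real K + 1) / t \<le> real n" using n0 by linarith
    then have "real K + 1 \<le> real n * t" using t by (simp add: divide_le_eq)
    then show "K \<le> nat \<lfloor>real n * t\<rfloor>" by linarith
  qed
qed

section \<open>The rescaled paths and their finite-dimensional limits\<close>

context urns
begin

lemma sum_D: "m \<le> j \<Longrightarrow> (\<Sum>k\<in>{m..<j}. D k \<omega>) = A j \<omega> - A m \<omega>"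
  by (induction j rule: dec_induct) (auto simp: D_def)

lemma sum_r2_tendsto: "(\<lambda>j. \<Sum>k\<in>{m..<j}. (r k)\<^sup>2) \<longlonglongrightarrow> R m"
proof -
  have "(\<lambda>j. \<Sum>k<j. (r (k + m))\<^sup>2) \<longlonglongrightarrow> R m"
    unfolding R_def using summable_r2 by (intro summable_LIMSEQ) (simp add: summable_iff_shift[of "\<lambda>k. (r k)\<^sup>2"])
  moreover have "(\<Sum>k<j. (r (k + m))\<^sup>2) = (\<Sum>k\<in>{m..<j + m}. (r k)\<^sup>2)" for j
    using sum.shift_bounds_nat_ivl[of "\<lambda>k. (r k)\<^sup>2" 0 m j] by (simp add: atLeast0LessThan)
  ultimately have "(\<lambda>j. \<Sum>k\<in>{m..<j + m}. (r k)\<^sup>2) \<longlonglongrightarrow> R m" by simp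
  then show ?thesis by (rule LIMSEQ_offset)
qed

lemma R_floor_tendsto:
  assumes t: "0 < t"
  shows "(\<lambda>n. real n powr a * R (nat \<lfloor>real n * t\<rfloor>)) \<longlonglongrightarrow> c\<^sup>2 / a * t powr (- a)"
proof -
  let ?f = "\<lambda>n. nat \<lfloor>real n * t\<rfloor>"
  have "(\<lambda>n. real (?f n) powr a * R (?f n)) \<longlonglongrightarrow> c\<^sup>2 / a"
    by (rule filterlim_compose[OF R_lim floor_at_top[OF t]])
  moreover have "(\<lambda>n. (real (?f n) / real n) powr (- a)) \<longlonglongrightarrow> t powr (- a)"
    using t by (intro tendsto_intros floor_ratio_tendsto) auto
  ultimately have "(\<lambda>n. (real (?f n) powr a * R (?f n)) * (real (?f n) / real n) powr (- a)) \<longlonglongrightarrow> c\<^sup>2 / a * t powr (- a)"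
    by (rule tendsto_mult)
  moreover have "\<forall>\<^sub>F n in sequentially. (real (?f n) powr a * R (?f n)) * (real (?f n) / real n) powr (- a) = real n powr a * R (?f n)"
  proof -
    have "\<forall>\<^sub>F n in sequentially. 1 \<le> ?f n" using floor_at_top[OF t] unfolding filterlim_at_top by blast
    then show ?thesis
    proof eventually_elim
      case (elim n)
      then have n: "0 < real n" by (cases n) auto
      have "(real (?f n) / real n) powr (- a) = real n powr a / real (?f n) powr a"
        using n elim by (simp only: powr_minus powr_divide of_nat_0_le_iff) simp
      moreover have "real (?f n) powr a \<noteq> 0" using elim by (simp only: powr_eq_0_iff)
      moreover have "x * y * (z / x) = z * y" if "x \<noteq> 0" for x y z :: real using that by simp
      ultimately show ?case by (simp only:)
    qed
  qed
  ultimately show ?thesis by (rule Lim_transform_eventually)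
qed

lemma powr_half_a: "(real n powr (\<gamma> - 1/2))\<^sup>2 = real n powr a"
proof -
  have "(real n powr (\<gamma> - 1/2))\<^sup>2 = real n powr ((\<gamma> - 1/2) + (\<gamma> - 1/2))" by (simp only: powr_add power2_eq_square)
  then show ?thesis by (simp add: algebra_simps)
qed

lemma r_upper_tail:
  obtains C where "0 < C" "\<And>m k. 1 \<le> m \<Longrightarrow> m \<le> k \<Longrightarrow> r k \<le> C * real m powr (- \<gamma>)"
proof -
  obtain C where C: "0 < C" "\<And>n. n \<ge> 1 \<Longrightarrow> r n \<le> C * real n powr (- \<gamma>)" using r_upper by auto
  have "r k \<le> C * real m powr (- \<gamma>)" if "1 \<le> m" "m \<le> k" for m k
  proof -
    have "r k \<le> C * real k powr (- \<gamma>)" using that by (intro C(2)) auto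
    also have "\<dots> \<le> C * real m powr (- \<gamma>)"
      using that C(1) gamma by (intro mult_left_mono powr_mono2') auto
    finally show ?thesis .
  qed
  with C(1) show thesis by (rule that)
qed

definition X :: "nat \<Rightarrow> 'a \<Rightarrow> real \<Rightarrow> real" where
  "X n \<omega> t = t powr a * real n powr (\<gamma> - 1/2) * (A (nat \<lfloor>real n * t\<rfloor>) \<omega> - Zlim \<omega>)"

lemma X_measurable [measurable]: "(\<lambda>\<omega>. X n \<omega> t) \<in> borel_measurable M"
  unfolding X_def using Zlim_meas bdm_measurable[OF bdm_A] by measurable

text \<open>A linear combination of path values is a combination of martingale tails, hence one
  weighted series of increments to which \<open>martingale_clt\<close> applies with h = 1. Two tails
  share the increments after the later of their starting times, so the variance contains R at the
  maximum of the two indices.\<close>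

proposition fdd_lim:
  assumes K: "0 < K"
  defines "u \<equiv> \<lambda>j. (real j / real K) powr a"
  shows "(\<lambda>n. expectation (\<lambda>\<omega>. cos ((\<Sum>j<J. \<theta> j * X n \<omega> (real j / real K)) + \<phi>)))
     \<longlonglongrightarrow> expectation (\<lambda>\<omega>. cos \<phi> * exp (- (vlim \<omega> * (c\<^sup>2 / (real N * a) * (\<Sum>i<J. \<Sum>j<J. \<theta> i * \<theta> j * u (min i j))) / 2)))"
proof -
  define f where "f j n = nat \<lfloor>real n * (real j / real K)\<rfloor>" for j n
  \<comment> \<open>The starting index of the smallest positive grid time. The time j = 0 starts
    earlier but has coefficient u 0 = 0, so no increment before m n is needed.\<close>
  define m where "m n = nat \<lfloor>real n * (1 / real K)\<rfloor>" for n
  define g where "g n = real n powr (\<gamma> - 1/2)" for n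
  \<comment> \<open>The increment \<open>D k\<close> occurs in exactly those tails that have started
    by time k; the minus sign arises because the path involves the average minus its limit.\<close>
  define b where "b n k = - (\<Sum>j<J. g n * (\<theta> j * u j) * of_bool (f j n \<le> k))" for n k
  define S where "S n \<omega> = (\<Sum>j<J. \<theta> j * X n \<omega> (real j / real K))" for n \<omega>
  define q where "q = (\<Sum>i<J. \<Sum>j<J. \<theta> i * u i * (\<theta> j * u j) * (c\<^sup>2 / a * (real (max i j) / real K) powr (- a)))"
  define Q where "Q n = (\<Sum>i<J. \<Sum>j<J. \<theta> i * u i * (\<theta> j * u j) * (real n powr a * R (max (f i n) (f j n))))" for n
  have u0: "u 0 = 0" using a_bounds by (simp add: u_def)
  have g2: "(g n)\<^sup>2 = real n powr a" for n unfolding g_def by (rule powr_half_a)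
  have m_top: "filterlim m at_top sequentially" unfolding m_def[abs_def] using K by (intro floor_at_top) simp
  have f_mono: "i \<le> j \<Longrightarrow> f i n \<le> f j n" for i j n
    unfolding f_def by (intro nat_mono floor_mono mult_left_mono divide_right_mono) auto
  have f_max: "max (f i n) (f j n) = f (max i j) n" for i j n
    using f_mono[of i j n] f_mono[of j i n] by (auto simp: max_def)
  have mf: "m n \<le> f j n" if "0 < j" for n j
    using f_mono[of 1 j n] that by (simp add: m_def f_def)
  have of_bool_mult: "of_bool (x \<le> k) * of_bool (y \<le> k) = (of_bool (max x y \<le> k) :: real)" for x y k :: nat by auto
  obtain C where C: "0 < C" "\<And>m k. 1 \<le> m \<Longrightarrow> m \<le> k \<Longrightarrow> r k \<le> C * real m powr (- \<gamma>)" by (rule r_upper_tail) blast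
  define C1 where "C1 = (\<Sum>j<J. \<bar>\<theta> j * u j\<bar>)"
  have C1: "0 \<le> C1" unfolding C1_def by (intro sum_nonneg) simp
  define \<beta> where "\<beta> n = C1 * (g n * (if m n = 0 then 1 else C * real (m n) powr (- \<gamma>)))" for n
  have clt: "(\<lambda>n. expectation (\<lambda>\<omega>. 1 * cos (\<phi> + S n \<omega>)) - expectation (\<lambda>\<omega>. 1 * (cos \<phi> * exp (- (vlim \<omega> * (q / real N) / 2))))) \<longlonglongrightarrow> 0"
  proof (rule martingale_clt[OF m_top, where b=b and Q=Q and \<beta>=\<beta>])
    fix n
    show "S n \<in> borel_measurable M" unfolding S_def[abs_def] by measurable
    show "AE \<omega> in M. (\<lambda>i. \<Sum>k\<in>{m n..<i}. b n k * D k \<omega>) \<longlonglongrightarrow> S n \<omega>"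
      using Zlim_lim
    proof eventually_elim
      case (elim \<omega>)
      have S_eq: "S n \<omega> = (\<Sum>j<J. - (g n * (\<theta> j * u j)) * (Zlim \<omega> - A (f j n) \<omega>))"
        unfolding S_def X_def g_def u_def f_def by (intro sum.cong refl) (simp add: algebra_simps)
      have "(\<lambda>i. \<Sum>j<J. - (g n * (\<theta> j * u j)) * (A i \<omega> - A (f j n) \<omega>)) \<longlonglongrightarrow> S n \<omega>"
        unfolding S_eq by (intro tendsto_intros elim)
      moreover have "\<forall>\<^sub>F i in sequentially. (\<Sum>j<J. - (g n * (\<theta> j * u j)) * (A i \<omega> - A (f j n) \<omega>)) = (\<Sum>k\<in>{m n..<i}. b n k * D k \<omega>)"
      proof (rule eventually_sequentiallyI[of "f J n"])
        fix i assume i: "f J n \<le> i"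
        have "(\<Sum>k\<in>{m n..<i}. b n k * D k \<omega>) = (\<Sum>j<J. \<Sum>k\<in>{m n..<i}. - (g n * (\<theta> j * u j)) * (of_bool (f j n \<le> k) * D k \<omega>))"
          unfolding b_def by (subst sum.swap) (simp add: sum_distrib_right sum_negf mult.assoc)
        also have "\<dots> = (\<Sum>j<J. - (g n * (\<theta> j * u j)) * (A i \<omega> - A (f j n) \<omega>))"
        proof (intro sum.cong refl)
          fix j assume j: "j \<in> {..<J}"
          show "(\<Sum>k\<in>{m n..<i}. - (g n * (\<theta> j * u j)) * (of_bool (f j n \<le> k) * D k \<omega>)) = - (g n * (\<theta> j * u j)) * (A i \<omega> - A (f j n) \<omega>)"
          proof (cases "j = 0")
            case False
            have "(\<Sum>k\<in>{m n..<i}. of_bool (f j n \<le> k) * D k \<omega>) = (\<Sum>k\<in>{f j n..<i}. D k \<omega>)"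
              using mf[of j n] False by (intro sum.mono_neutral_cong_right) auto
            also have "\<dots> = A i \<omega> - A (f j n) \<omega>"
              using i f_mono[of j J n] j by (intro sum_D) auto
            finally show ?thesis by (simp add: sum_distrib_left[symmetric] sum_negf)
          qed (simp add: u0)
        qed
        finally show "(\<Sum>j<J. - (g n * (\<theta> j * u j)) * (A i \<omega> - A (f j n) \<omega>)) = (\<Sum>k\<in>{m n..<i}. b n k * D k \<omega>)" by simp
      qed
      ultimately show ?case by (rule Lim_transform_eventually)
    qed
    show "(\<lambda>i. \<Sum>k\<in>{m n..<i}. (b n k)\<^sup>2 * (r k)\<^sup>2) \<longlonglongrightarrow> Q n"
    proof -
      have b2: "(b n k)\<^sup>2 * (r k)\<^sup>2 = (\<Sum>i<J. \<Sum>j<J. (g n)\<^sup>2 * (\<theta> i * u i * (\<theta> j * u j)) * (of_bool (max (f i n) (f j n) \<le> k) * (r k)\<^sup>2))" for k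
      proof -
        have "(b n k)\<^sup>2 = (\<Sum>j<J. g n * (\<theta> j * u j) * of_bool (f j n \<le> k)) * (\<Sum>j<J. g n * (\<theta> j * u j) * of_bool (f j n \<le> k))"
          by (simp add: b_def power2_eq_square)
        also have "\<dots> = (\<Sum>i<J. \<Sum>j<J. (g n)\<^sup>2 * (\<theta> i * u i * (\<theta> j * u j)) * of_bool (max (f i n) (f j n) \<le> k))"
          unfolding sum_product by (intro sum.cong refl) (simp add: of_bool_mult[symmetric] power2_eq_square mult_ac del: max.bounded_iff)
        finally show ?thesis by (simp add: sum_distrib_right mult.assoc)
      qed
      have lim1: "(\<lambda>l. \<Sum>k\<in>{m n..<l}. (g n)\<^sup>2 * (\<theta> i * u i * (\<theta> j * u j)) * (of_bool (max (f i n) (f j n) \<le> k) * (r k)\<^sup>2))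
          \<longlonglongrightarrow> \<theta> i * u i * (\<theta> j * u j) * (real n powr a * R (max (f i n) (f j n)))" for i j
      proof (cases "i = 0 \<or> j = 0")
        case False
        then have mm: "m n \<le> max (f i n) (f j n)" using mf[of i n] by auto
        have "(\<Sum>k\<in>{m n..<l}. of_bool (max (f i n) (f j n) \<le> k) * (r k)\<^sup>2) = (\<Sum>k\<in>{max (f i n) (f j n)..<l}. (r k)\<^sup>2)" for l
          using mm by (intro sum.mono_neutral_cong_right) auto
        then have eq: "(\<Sum>k\<in>{m n..<l}. (g n)\<^sup>2 * (\<theta> i * u i * (\<theta> j * u j)) * (of_bool (max (f i n) (f j n) \<le> k) * (r k)\<^sup>2))
           = \<theta> i * u i * (\<theta> j * u j) * (real n powr a * (\<Sum>k\<in>{max (f i n) (f j n)..<l}. (r k)\<^sup>2))" for l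
          by (simp only: sum_distrib_left[symmetric] g2) (simp only: mult_ac)
        show ?thesis unfolding eq by (intro tendsto_mult_left sum_r2_tendsto)
      qed (auto simp: u0)
      show ?thesis unfolding b2 Q_def
        by (subst sum.swap, rule tendsto_sum, subst sum.swap, rule tendsto_sum, rule lim1)
    qed
  next
    show "Q \<longlonglongrightarrow> q"
      unfolding Q_def[abs_def] q_def
    proof (intro tendsto_sum)
      fix i j
      show "(\<lambda>n. \<theta> i * u i * (\<theta> j * u j) * (real n powr a * R (max (f i n) (f j n))))
         \<longlonglongrightarrow> \<theta> i * u i * (\<theta> j * u j) * (c\<^sup>2 / a * (real (max i j) / real K) powr (- a))"
      proof (cases "i = 0 \<or> j = 0")
        case False
        then have "0 < real (max i j) / real K" using K by (simp add: max_def)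
        from R_floor_tendsto[OF this] show ?thesis
          unfolding f_max unfolding f_def by (rule tendsto_mult_left)
      qed (auto simp: u0)
    qed
  next
    fix n k assume k: "m n \<le> k"
    have g0: "0 \<le> g n" by (simp add: g_def)
    have "\<bar>b n k\<bar> \<le> (\<Sum>j<J. \<bar>g n * (\<theta> j * u j) * of_bool (f j n \<le> k)\<bar>)"
      unfolding b_def abs_minus_cancel by (rule sum_abs)
    also have "\<dots> \<le> (\<Sum>j<J. g n * \<bar>\<theta> j * u j\<bar>)"
      using g0 by (intro sum_mono) (auto simp: abs_mult)
    also have "\<dots> = C1 * g n" by (simp add: C1_def sum_distrib_left mult.commute)
    finally have "\<bar>b n k\<bar> * r k \<le> (C1 * g n) * r k" using r_bounds[of k] by (intro mult_right_mono) auto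
    also have "\<dots> \<le> (C1 * g n) * (if m n = 0 then 1 else C * real (m n) powr (- \<gamma>))"
      using r_bounds[of k] C(2)[of "m n" k] k C1 g0 by (intro mult_left_mono) auto
    finally show "\<bar>b n k\<bar> * r k \<le> \<beta> n" by (simp only: \<beta>_def mult.assoc)
  next
    \<comment> \<open>The index m n is proportional to n, so the scaling n^(\<gamma> - 1/2) against
      steps of order n^(-\<gamma>) leaves n^(-1/2).\<close>
    have "(\<lambda>n. C1 * C * real n powr (- (1/2)) * (real (m n) / real n) powr (- \<gamma>)) \<longlonglongrightarrow> C1 * C * 0 * (1 / real K) powr (- \<gamma>)"
    proof (intro tendsto_mult tendsto_const)
      show "(\<lambda>n. real n powr (- (1/2))) \<longlonglongrightarrow> 0" by real_asymp
      show "(\<lambda>n. (real (m n) / real n) powr (- \<gamma>)) \<longlonglongrightarrow> (1 / real K) powr (- \<gamma>)"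
        unfolding m_def using K by (intro tendsto_intros floor_ratio_tendsto) auto
    qed
    moreover have "\<forall>\<^sub>F n in sequentially. C1 * C * real n powr (- (1/2)) * (real (m n) / real n) powr (- \<gamma>) = \<beta> n"
    proof -
      have "\<forall>\<^sub>F n in sequentially. 1 \<le> m n" using m_top unfolding filterlim_at_top by blast
      then show ?thesis
      proof eventually_elim
        case (elim n)
        then have n: "0 < real n" by (cases n) (auto simp: m_def)
        have "real n powr (- (1/2)) * (real (m n) / real n) powr (- \<gamma>) = real n powr (- (1/2)) * real n powr \<gamma> * real (m n) powr (- \<gamma>)"
          using n elim by (simp add: powr_divide powr_minus field_simps)
        also have "real n powr (- (1/2)) * real n powr \<gamma> = g n" by (simp add: g_def powr_add[symmetric])
        finally show ?case using elim by (simp add: \<beta>_def mult_ac)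
      qed
    qed
    ultimately have "\<beta> \<longlonglongrightarrow> C1 * C * 0 * (1 / real K) powr (- \<gamma>)" by (rule Lim_transform_eventually)
    then show "\<beta> \<longlonglongrightarrow> 0" by simp
  qed (auto intro: bdm_const)
  have qN: "q / real N = c\<^sup>2 / (real N * a) * (\<Sum>i<J. \<Sum>j<J. \<theta> i * \<theta> j * u (min i j))"
  proof -
    \<comment> \<open>The time inversion: the product of the prefactors at i and j, divided by the
      one at max i j, is the prefactor at min i j.\<close>
    have each: "\<theta> i * u i * (\<theta> j * u j) * (c\<^sup>2 / a * (real (max i j) / real K) powr (- a)) = c\<^sup>2 / a * (\<theta> i * \<theta> j * u (min i j))" for i j
    proof (cases "i = 0 \<or> j = 0")
      case False
      have "u (max i j) \<noteq> 0" unfolding u_def using False K by (auto simp: max_def)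
      moreover have "(real (max i j) / real K) powr (- a) = inverse (u (max i j))" unfolding u_def by (rule powr_minus)
      moreover have "u i * u j = u (min i j) * u (max i j)" by (simp add: min_def max_def)
      ultimately show ?thesis by (simp add: field_simps)
    qed (auto simp: u0 min_def)
    have "q = c\<^sup>2 / a * (\<Sum>i<J. \<Sum>j<J. \<theta> i * \<theta> j * u (min i j))"
      unfolding q_def each by (simp only: sum_distrib_left)
    then show ?thesis by simp
  qed
  have "(\<lambda>n. expectation (\<lambda>\<omega>. cos (S n \<omega> + \<phi>))) \<longlonglongrightarrow> expectation (\<lambda>\<omega>. cos \<phi> * exp (- (vlim \<omega> * (q / real N) / 2)))"
    using Lim_transform[OF tendsto_const clt] by (simp add: add.commute)
  then show ?thesis unfolding S_def qN .
qed


section \<open>Absence of atoms in the open interval\<close>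

lemma x_exp_bound: "0 < K \<Longrightarrow> x * exp (- (x * K)) \<le> 1 / K" for x K :: real
proof -
  assume K: "0 < K"
  have "x * K \<le> exp (x * K)" using exp_ge_add_one_self[of "x * K"] by linarith
  then have "x * K * exp (- (x * K)) \<le> exp (x * K) * exp (- (x * K))" by (intro mult_right_mono) auto
  then show ?thesis using K by (simp add: exp_minus field_simps)
qed

text \<open>Conditionally on the past the cosine is damped by about exp (- vlim * K), which gives
  nothing where the variance vanishes. With a weight close to \<open>vlim\<close> the product is x *
  exp (- x * K) \<le> 1 / K uniformly in x, and 1 / K decays like \<theta>^(-2).\<close>

lemma oscillating_expectation_small:
  assumes \<theta>: "\<theta> \<noteq> 0" and e: "0 < e"
  shows "\<forall>\<^sub>F n in sequentially. expectation (\<lambda>\<omega>. vA n \<omega> * cos (\<theta> * (real n powr (\<gamma> - 1/2) * (z - Zlim \<omega>))))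
     \<le> 2 * real N * a / (\<theta>\<^sup>2 * c\<^sup>2) + e"
proof -
  define g where "g n = real n powr (\<gamma> - 1/2)" for n
  define K where "K = \<theta>\<^sup>2 * c\<^sup>2 / a / real N / 2"
  have K: "0 < K" using \<theta> c_pos a_bounds N by (simp add: K_def)
  obtain C where C: "0 < C" "\<And>m k. 1 \<le> m \<Longrightarrow> m \<le> k \<Longrightarrow> r k \<le> C * real m powr (- \<gamma>)" by (rule r_upper_tail) blast
  \<comment> \<open>The argument z - Zlim is split at \<open>A n\<close>: the part z - A n is known
    at time n and becomes the phase, the rest is the martingale tail.\<close>
  have clt: "(\<lambda>n. expectation (\<lambda>\<omega>. vA n \<omega> * cos (\<theta> * g n * (z - A n \<omega>) + - (\<theta> * g n) * (Zlim \<omega> - A n \<omega>)))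
      - expectation (\<lambda>\<omega>. vA n \<omega> * (cos (\<theta> * g n * (z - A n \<omega>)) * exp (- (vlim \<omega> * (\<theta>\<^sup>2 * c\<^sup>2 / a / real N) / 2))))) \<longlonglongrightarrow> 0"
  proof (rule martingale_clt[where m="\<lambda>n. n" and b="\<lambda>n k. - (\<theta> * g n)" and Q="\<lambda>n. \<theta>\<^sup>2 * (real n powr a * R n)"
        and \<beta>="\<lambda>n. \<bar>\<theta>\<bar> * C * real n powr (- (1/2))" and h=vA])
    fix n
    show "bdm (F n) (vA n)" by (rule bdm_vAF) simp
    show "\<bar>vA n \<omega>\<bar> \<le> 1" if "\<omega> \<in> space M" for \<omega> using vA_range[OF that, of n] by simp
    show "(\<lambda>\<omega>. \<theta> * g n * (z - A n \<omega>)) \<in> borel_measurable (F n)"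
      using bdm_measurable[OF bdm_AF[OF order_refl, of n]] by measurable
    show "(\<lambda>\<omega>. - (\<theta> * g n) * (Zlim \<omega> - A n \<omega>)) \<in> borel_measurable M"
      using bdm_measurable[OF bdm_A[of n]] Zlim_meas by measurable
    show "AE \<omega> in M. (\<lambda>j. \<Sum>k\<in>{n..<j}. - (\<theta> * g n) * D k \<omega>) \<longlonglongrightarrow> - (\<theta> * g n) * (Zlim \<omega> - A n \<omega>)"
      using Zlim_lim
    proof eventually_elim
      case (elim \<omega>)
      have "(\<lambda>j. - (\<theta> * g n) * (A j \<omega> - A n \<omega>)) \<longlonglongrightarrow> - (\<theta> * g n) * (Zlim \<omega> - A n \<omega>)"
        by (intro tendsto_intros elim)
      moreover have "\<forall>\<^sub>F j in sequentially. - (\<theta> * g n) * (A j \<omega> - A n \<omega>) = (\<Sum>k\<in>{n..<j}. - (\<theta> * g n) * D k \<omega>)"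
        by (rule eventually_sequentiallyI[of n]) (simp only: sum_D sum_distrib_left[symmetric])
      ultimately show ?case by (rule Lim_transform_eventually)
    qed
    have "(\<lambda>j. (\<theta> * g n)\<^sup>2 * (\<Sum>k\<in>{n..<j}. (r k)\<^sup>2)) \<longlonglongrightarrow> (\<theta> * g n)\<^sup>2 * R n"
      by (intro tendsto_mult_left sum_r2_tendsto)
    then show "(\<lambda>j. \<Sum>k\<in>{n..<j}. (- (\<theta> * g n))\<^sup>2 * (r k)\<^sup>2) \<longlonglongrightarrow> \<theta>\<^sup>2 * (real n powr a * R n)"
      by (simp add: sum_distrib_left power_mult_distrib g_def powr_half_a mult.assoc)
  next
    have "(\<lambda>n. \<theta>\<^sup>2 * (real n powr a * R n)) \<longlonglongrightarrow> \<theta>\<^sup>2 * (c\<^sup>2 / a)" by (intro tendsto_mult_left R_lim)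
    then show "(\<lambda>n. \<theta>\<^sup>2 * (real n powr a * R n)) \<longlonglongrightarrow> \<theta>\<^sup>2 * c\<^sup>2 / a" by simp
  next
    fix n k :: nat assume k: "n \<le> k"
    show "\<bar>- (\<theta> * g n)\<bar> * r k \<le> \<bar>\<theta>\<bar> * C * real n powr (- (1/2))"
    proof (cases "n = 0")
      case False
      have "g n * r k \<le> g n * (C * real n powr (- \<gamma>))"
        using C(2)[of n k] False k by (intro mult_left_mono) (auto simp: g_def)
      also have "\<dots> = C * real n powr (- (1/2))"
        by (simp add: g_def powr_add[symmetric])
      finally have "\<bar>\<theta>\<bar> * (g n * r k) \<le> \<bar>\<theta>\<bar> * (C * real n powr (- (1/2)))" by (intro mult_left_mono) auto
      then show ?thesis by (simp add: abs_mult g_def mult_ac)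
    qed (simp add: g_def)
  next
    have "(\<lambda>n. \<bar>\<theta>\<bar> * C * real n powr (- (1/2))) \<longlonglongrightarrow> \<bar>\<theta>\<bar> * C * 0"
      by (intro tendsto_mult_left) real_asymp
    then show "(\<lambda>n. \<bar>\<theta>\<bar> * C * real n powr (- (1/2))) \<longlonglongrightarrow> 0" by simp
  qed (rule filterlim_ident)
  have second: "expectation (\<lambda>\<omega>. vA n \<omega> * (cos (\<theta> * g n * (z - A n \<omega>)) * exp (- (vlim \<omega> * (\<theta>\<^sup>2 * c\<^sup>2 / a / real N) / 2))))
      \<le> expectation (\<lambda>\<omega>. \<bar>vA n \<omega> - vlim \<omega>\<bar>) + 1 / K" for n
  proof -
    have iA: "integrable M (\<lambda>\<omega>. \<bar>vA n \<omega> - vlim \<omega>\<bar>)"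
      by (intro integrable_abs Bochner_Integration.integrable_diff integrable_vlim bdm_integrable bdm_vA)
    have "expectation (\<lambda>\<omega>. vA n \<omega> * (cos (\<theta> * g n * (z - A n \<omega>)) * exp (- (vlim \<omega> * (\<theta>\<^sup>2 * c\<^sup>2 / a / real N) / 2))))
      \<le> expectation (\<lambda>\<omega>. \<bar>vA n \<omega> - vlim \<omega>\<bar> + 1 / K)"
    proof (rule integral_mono_AE')
      show "integrable M (\<lambda>\<omega>. \<bar>vA n \<omega> - vlim \<omega>\<bar> + 1 / K)" using iA by simp
      show "AE \<omega> in M. vA n \<omega> * (cos (\<theta> * g n * (z - A n \<omega>)) * exp (- (vlim \<omega> * (\<theta>\<^sup>2 * c\<^sup>2 / a / real N) / 2)))
          \<le> \<bar>vA n \<omega> - vlim \<omega>\<bar> + 1 / K"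
        using AE_space vlim_range
      proof eventually_elim
        case (elim \<omega>)
        define y where "y = exp (- (vlim \<omega> * K))"
        have y: "0 \<le> y" "y \<le> 1" using elim(2) K by (auto simp: y_def)
        have "vA n \<omega> * (cos (\<theta> * g n * (z - A n \<omega>)) * y) \<le> vA n \<omega> * (1 * y)"
          using vA_range[OF elim(1), of n] y by (intro mult_left_mono mult_right_mono) auto
        also have "\<dots> = (vA n \<omega> - vlim \<omega>) * y + vlim \<omega> * y" by (simp add: algebra_simps)
        also have "\<dots> \<le> \<bar>vA n \<omega> - vlim \<omega>\<bar> * 1 + 1 / K"
        proof (rule add_mono)
          have "(vA n \<omega> - vlim \<omega>) * y \<le> \<bar>vA n \<omega> - vlim \<omega>\<bar> * y" using y by (intro mult_right_mono) auto
          also have "\<dots> \<le> \<bar>vA n \<omega> - vlim \<omega>\<bar> * 1" using y by (intro mult_left_mono) auto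
          finally show "(vA n \<omega> - vlim \<omega>) * y \<le> \<bar>vA n \<omega> - vlim \<omega>\<bar> * 1" .
          show "vlim \<omega> * y \<le> 1 / K" unfolding y_def by (rule x_exp_bound[OF K])
        qed
        finally show ?case by (simp add: y_def K_def)
      qed
      show "AE \<omega> in M. 0 \<le> \<bar>vA n \<omega> - vlim \<omega>\<bar> + 1 / K" using K by (intro AE_I2) simp
    qed
    also have "\<dots> = expectation (\<lambda>\<omega>. \<bar>vA n \<omega> - vlim \<omega>\<bar>) + 1 / K" using iA by (simp add: prob_space)
    finally show ?thesis .
  qed
  have K1: "1 / K = 2 * real N * a / (\<theta>\<^sup>2 * c\<^sup>2)" by (simp add: K_def)
  have eq: "\<theta> * g n * (z - A n \<omega>) + - (\<theta> * g n) * (Zlim \<omega> - A n \<omega>) = \<theta> * (real n powr (\<gamma> - 1/2) * (z - Zlim \<omega>))" for n \<omega>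
    by (simp add: g_def algebra_simps)
  have "\<forall>\<^sub>F n in sequentially. expectation (\<lambda>\<omega>. vA n \<omega> * cos (\<theta> * (real n powr (\<gamma> - 1/2) * (z - Zlim \<omega>))))
      - expectation (\<lambda>\<omega>. vA n \<omega> * (cos (\<theta> * g n * (z - A n \<omega>)) * exp (- (vlim \<omega> * (\<theta>\<^sup>2 * c\<^sup>2 / a / real N) / 2)))) < e / 2"
    using order_tendstoD(2)[OF clt, of "e / 2"] e unfolding eq by simp
  moreover have "\<forall>\<^sub>F n in sequentially. expectation (\<lambda>\<omega>. \<bar>vA n \<omega> - vlim \<omega>\<bar>) < e / 2"
    using order_tendstoD(2)[OF vA_L1, of "e / 2"] e by simp
  ultimately show ?thesis
  proof eventually_elim
    case (elim n)
    then show ?case using second[of n] unfolding K1 by linarith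
  qed
qed

lemma fejer_identity:
  "(\<Sum>l<L. \<Sum>l'<L. cos ((real l - real l') * y)) = (\<Sum>l<L. cos (real l * y))\<^sup>2 + (\<Sum>l<L. sin (real l * y))\<^sup>2"
  by (simp add: power2_eq_square sum_product sum.distrib[symmetric] left_diff_distrib cos_diff)

text \<open>
  The Fejer kernel dominates the indicator of \<open>Zlim = z\<close>, and the central limit theorem makes all its
  off-diagonal terms small. The weight \<open>vA n\<close> removes the degenerate part where the variance vanishes.
\<close>

theorem no_atoms:
  assumes z: "0 < z" "z < 1"
  shows "prob {\<omega>\<in>space M. Zlim \<omega> = z} = 0"
proof -
  note [measurable] = Zlim_meas bdm_measurable[OF bdm_vA]
  let ?E = "{\<omega>\<in>space M. Zlim \<omega> = z}"
  have E [measurable]: "?E \<in> sets M" by measurable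
  have key: "z * (1 - z) * prob ?E \<le> 3 / real L" if L: "0 < L" for L :: nat
  proof -
    \<comment> \<open>This spacing of the frequencies makes the bound for the pair l, l' equal to 1
      / (L * (l - l')^2), hence at most 1 / L; with tolerance 1 / L this becomes 2 / L off the
      diagonal.\<close>
    define \<tau> where "\<tau> = sqrt (2 * real N * a * real L / c\<^sup>2)"
    have tau2: "\<tau>\<^sup>2 = 2 * real N * a * real L / c\<^sup>2" using a_bounds by (simp add: \<tau>_def)
    have tau: "0 < \<tau>" unfolding \<tau>_def using a_bounds N L c_pos by simp
    define Ec where "Ec n \<theta> = expectation (\<lambda>\<omega>. vA n \<omega> * cos (\<theta> * (real n powr (\<gamma> - 1/2) * (z - Zlim \<omega>))))" for n \<theta>
    have bc: "bdm M (\<lambda>\<omega>. vA n \<omega> * cos (\<theta> * (real n powr (\<gamma> - 1/2) * (z - Zlim \<omega>))))" for n \<theta>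
      by (intro bdm_mult bdm_vA bdm_cos) measurable
    have fej: "(real L)\<^sup>2 * expectation (\<lambda>\<omega>. vA n \<omega> * indicator ?E \<omega>) \<le> (\<Sum>l<L. \<Sum>l'<L. Ec n ((real l - real l') * \<tau>))" for n
    proof -
      define y where "y \<omega> = \<tau> * (real n powr (\<gamma> - 1/2) * (z - Zlim \<omega>))" for \<omega>
      have "(real L)\<^sup>2 * expectation (\<lambda>\<omega>. vA n \<omega> * indicator ?E \<omega>) = expectation (\<lambda>\<omega>. (real L)\<^sup>2 * (vA n \<omega> * indicator ?E \<omega>))" by simp
      also have "\<dots> \<le> expectation (\<lambda>\<omega>. \<Sum>l<L. \<Sum>l'<L. vA n \<omega> * cos (((real l - real l') * \<tau>) * (real n powr (\<gamma> - 1/2) * (z - Zlim \<omega>))))"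
      proof (rule expectation_mono_bdm)
        fix \<omega> assume w: "\<omega> \<in> space M"
        have "(\<Sum>l<L. \<Sum>l'<L. vA n \<omega> * cos (((real l - real l') * \<tau>) * (real n powr (\<gamma> - 1/2) * (z - Zlim \<omega>))))
          = vA n \<omega> * (\<Sum>l<L. \<Sum>l'<L. cos ((real l - real l') * y \<omega>))"
          by (simp only: y_def sum_distrib_left mult.assoc)
        also have "\<dots> = vA n \<omega> * ((\<Sum>l<L. cos (real l * y \<omega>))\<^sup>2 + (\<Sum>l<L. sin (real l * y \<omega>))\<^sup>2)" by (simp only: fejer_identity)
        also have "\<dots> \<ge> vA n \<omega> * ((real L)\<^sup>2 * indicator ?E \<omega>)"
        proof (rule mult_left_mono)
          show "(real L)\<^sup>2 * indicator ?E \<omega> \<le> (\<Sum>l<L. cos (real l * y \<omega>))\<^sup>2 + (\<Sum>l<L. sin (real l * y \<omega>))\<^sup>2"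
          proof (cases "\<omega> \<in> ?E")
            case True
            then have "y \<omega> = 0" by (simp add: y_def)
            then show ?thesis using True by simp
          qed simp
        qed (rule vA_range(1)[OF w])
        finally show "(real L)\<^sup>2 * (vA n \<omega> * indicator ?E \<omega>) \<le> (\<Sum>l<L. \<Sum>l'<L. vA n \<omega> * cos (((real l - real l') * \<tau>) * (real n powr (\<gamma> - 1/2) * (z - Zlim \<omega>))))"
          by (simp add: mult_ac)
      qed (intro bdm_mult bdm_const bdm_vA bdm_indicator E bdm_sum bc)+
      also have "\<dots> = (\<Sum>l<L. \<Sum>l'<L. Ec n ((real l - real l') * \<tau>))"
        unfolding Ec_def by (subst expectation_bdm_sum, intro bdm_sum bc, rule sum.cong[OF refl], rule expectation_bdm_sum, rule bc)
      finally show ?thesis .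
    qed
    have off: "\<forall>\<^sub>F n in sequentially. Ec n ((real l - real l') * \<tau>) \<le> 2 / real L" if "l \<noteq> l'" for l l'
    proof -
      have ne: "(real l - real l') * \<tau> \<noteq> 0" using that tau by simp
      have "1 \<le> (real l - real l')\<^sup>2"
      proof -
        have "1 \<le> \<bar>real l - real l'\<bar>" using that by linarith
        then show ?thesis using power_mono[of 1 "\<bar>real l - real l'\<bar>" 2] by simp
      qed
      then have "1 / L / (real l - real l')\<^sup>2 \<le> 1 / L / 1" using L by (intro divide_left_mono) auto
      moreover have "2 * real N * a / (((real l - real l') * \<tau>)\<^sup>2 * c\<^sup>2) = 1 / L / (real l - real l')\<^sup>2"
      proof -
        have "((real l - real l') * \<tau>)\<^sup>2 * c\<^sup>2 = (real l - real l')\<^sup>2 * (2 * real N * a) * real L"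
          unfolding power_mult_distrib tau2 using c_pos by simp
        moreover have "P / (d * P * x) = 1 / x / d" if "P \<noteq> 0" for P d x :: real using that by simp
        moreover have "2 * real N * a \<noteq> 0" using a_bounds N by simp
        ultimately show ?thesis by (simp only:)
      qed
      ultimately have le: "2 * real N * a / (((real l - real l') * \<tau>)\<^sup>2 * c\<^sup>2) \<le> 1 / L" by simp
      have "\<forall>\<^sub>F n in sequentially. Ec n ((real l - real l') * \<tau>) \<le> 2 * real N * a / (((real l - real l') * \<tau>)\<^sup>2 * c\<^sup>2) + 1 / L"
        unfolding Ec_def by (rule oscillating_expectation_small[OF ne]) (use L in simp)
      then show ?thesis by eventually_elim (use le in simp)
    qed
    have "\<forall>\<^sub>F n in sequentially. \<forall>l\<in>{..<L}. \<forall>l'\<in>{..<L}. Ec n ((real l - real l') * \<tau>) \<le> (if l = l' then 1 else 2 / real L)"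
    proof (intro eventually_ball_finite ballI finite_lessThan)
      fix l l'
      show "\<forall>\<^sub>F n in sequentially. Ec n ((real l - real l') * \<tau>) \<le> (if l = l' then 1 else 2 / real L)"
      proof (cases "l = l'")
        case True
        have "Ec n 0 \<le> 1" for n unfolding Ec_def using vA_range(2) by (intro expectation_le_const bc) auto
        then show ?thesis using True by simp
      qed (use off in simp)
    qed
    then have ev: "\<forall>\<^sub>F n in sequentially. expectation (\<lambda>\<omega>. vA n \<omega> * indicator ?E \<omega>) \<le> 3 / real L"
    proof eventually_elim
      case (elim n)
      have "(real L)\<^sup>2 * expectation (\<lambda>\<omega>. vA n \<omega> * indicator ?E \<omega>) \<le> (\<Sum>l<L. \<Sum>l'<L. Ec n ((real l - real l') * \<tau>))" by (rule fej)
      also have "\<dots> \<le> (\<Sum>l<L. \<Sum>l'<L. (if l = l' then 1 else 0) + 2 / real L)"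
      proof (intro sum_mono)
        fix l l' assume "l \<in> {..<L}" "l' \<in> {..<L}"
        with elim have "Ec n ((real l - real l') * \<tau>) \<le> (if l = l' then 1 else 2 / real L)" by blast
        also have "\<dots> \<le> (if l = l' then 1 else 0) + 2 / real L" by simp
        finally show "Ec n ((real l - real l') * \<tau>) \<le> (if l = l' then 1 else 0) + 2 / real L" .
      qed
      \<comment> \<open>The diagonal contributes L and the off-diagonal bound, summed over all
        pairs, 2 * L; dividing by L^2 leaves 3 / L.\<close>
      also have "\<dots> = 3 * real L" using L by (simp add: sum.distrib)
      finally show ?case using L by (simp add: power2_eq_square field_simps)
    qed
    \<comment> \<open>Letting n grow turns the weight into \<open>vlim\<close>, which is the
      constant z * (1 - z) on the event.\<close>
    have "(\<lambda>n. expectation (\<lambda>\<omega>. vA n \<omega> * indicator ?E \<omega>)) \<longlonglongrightarrow> expectation (\<lambda>\<omega>. vlim \<omega> * indicator ?E \<omega>)"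
    proof (rule integral_dominated_convergence[where w="\<lambda>_. 1"])
      show "AE \<omega> in M. (\<lambda>n. vA n \<omega> * indicator ?E \<omega>) \<longlonglongrightarrow> vlim \<omega> * indicator ?E \<omega>"
        using vA_lim by eventually_elim (intro tendsto_intros)
      show "AE \<omega> in M. norm (vA n \<omega> * indicator ?E \<omega>) \<le> 1" for n
        using vA_range[of _ n] by (intro AE_I2) (auto simp: indicator_def)
    qed auto
    then have "expectation (\<lambda>\<omega>. vlim \<omega> * indicator ?E \<omega>) \<le> 3 / real L"
      by (rule tendsto_upperbound[OF _ ev]) simp
    moreover have "expectation (\<lambda>\<omega>. vlim \<omega> * indicator ?E \<omega>) = expectation (\<lambda>\<omega>. z * (1 - z) * indicator ?E \<omega>)"
      by (intro Bochner_Integration.integral_cong refl) (auto simp: indicator_def vlim_def)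
    ultimately show ?thesis using E by simp
  qed
  have "z * (1 - z) * prob ?E \<le> 0"
  proof (rule LIMSEQ_le_const)
    show "(\<lambda>L. 3 / real L) \<longlonglongrightarrow> 0" by real_asymp
    show "\<exists>L0. \<forall>L\<ge>L0. z * (1 - z) * prob ?E \<le> 3 / real L"
      using key by (intro exI[of _ 1]) auto
  qed
  then show ?thesis using z by (simp add: mult_le_0_iff measure_le_0_iff)
qed

end

context urns
begin

section \<open>Oscillation of the rescaled paths\<close>

text \<open>A distance y to the limit forces distance y / 2 either between A k and A m or between A
  m and the limit. Each case costs 11 times 2^4, and 352 = 2 * 11 * 16.\<close>

lemma block_prob:
  assumes m: "m \<le> m'" and y: "0 < y"
  shows "prob {\<omega>\<in>space M. \<exists>k\<in>{m..m'}. y \<le> \<bar>A k \<omega> - Zlim \<omega>\<bar>} \<le> 352 * (R m)\<^sup>2 / y ^ 4"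
proof -
  note [measurable] = Zlim_meas bdm_measurable[OF bdm_A]
  let ?E1 = "{\<omega>\<in>space M. \<exists>k\<in>{m..m'}. y / 2 \<le> \<bar>A k \<omega> - A m \<omega>\<bar>}"
  let ?E2 = "{\<omega>\<in>space M. y / 2 \<le> \<bar>Zlim \<omega> - A m \<omega>\<bar>}"
  have "prob {\<omega>\<in>space M. \<exists>k\<in>{m..m'}. y \<le> \<bar>A k \<omega> - Zlim \<omega>\<bar>} \<le> prob (?E1 \<union> ?E2)"
  proof (rule finite_measure_mono)
    show "?E1 \<union> ?E2 \<in> sets M" by measurable
    show "{\<omega>\<in>space M. \<exists>k\<in>{m..m'}. y \<le> \<bar>A k \<omega> - Zlim \<omega>\<bar>} \<subseteq> ?E1 \<union> ?E2"
    proof safe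
      fix \<omega> k assume w: "\<omega> \<in> space M" "k \<in> {m..m'}" "y \<le> \<bar>A k \<omega> - Zlim \<omega>\<bar>" and n: "\<not> y / 2 \<le> \<bar>Zlim \<omega> - A m \<omega>\<bar>"
      have "y / 2 \<le> \<bar>A k \<omega> - A m \<omega>\<bar>" using w(3) n by linarith
      then show "\<exists>k\<in>{m..m'}. y / 2 \<le> \<bar>A k \<omega> - A m \<omega>\<bar>" using w(2) by blast
    qed
  qed
  also have "\<dots> \<le> prob ?E1 + prob ?E2" by (rule measure_Un_le) measurable
  also have "\<dots> \<le> 11 * (R m)\<^sup>2 / (y / 2) ^ 4 + 11 * (R m)\<^sup>2 / (y / 2) ^ 4"
  proof (rule add_mono)
    have "prob ?E1 \<le> 11 * (\<Sum>k\<in>{m..<m'}. (r k)\<^sup>2)\<^sup>2 / (y / 2) ^ 4" using y by (intro maximal_inequality[OF m]) simp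
    also have "\<dots> \<le> 11 * (R m)\<^sup>2 / (y / 2) ^ 4"
      by (intro divide_right_mono mult_left_mono power_mono sum_r2_le_R sum_nonneg) auto
    finally show "prob ?E1 \<le> 11 * (R m)\<^sup>2 / (y / 2) ^ 4" .
    show "prob ?E2 \<le> 11 * (R m)\<^sup>2 / (y / 2) ^ 4" using y by (intro markov_lim) simp
  qed
  also have "\<dots> = 352 * (R m)\<^sup>2 / y ^ 4" by (simp add: power_divide)
  finally show ?thesis .
qed

lemma powr_pow2: "(2 ^ i) powr a = (2 powr a) ^ i"
  by (simp add: powr_powr powr_realpow[symmetric] mult.commute)

text \<open>The limit lies in [0, 1] only almost surely, whereas the path bounds must hold at every
  point outside an explicit event; this null set is added to that event.\<close>

definition N0 :: "'a set" where
  "N0 = {\<omega>\<in>space M. \<not> (0 \<le> Zlim \<omega> \<and> Zlim \<omega> \<le> 1)}"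

lemma N0: "N0 \<in> sets M" "prob N0 = 0"
proof -
  note [measurable] = Zlim_meas
  show "N0 \<in> sets M" unfolding N0_def by measurable
  have "prob {\<omega>\<in>space M. 0 \<le> Zlim \<omega> \<and> Zlim \<omega> \<le> 1} = 1"
    using Zlim_range by (subst prob_Collect_eq_1) auto
  then show "prob N0 = 0" unfolding N0_def by (subst prob_neg) auto
qed

text \<open>
  Near time \<open>0\<close> the index range is cut into dyadic blocks, whose contributions form a geometric series.
\<close>

lemma small_time:
  obtains C where "0 < C" "\<And>\<eta> \<delta>. 0 < \<eta> \<Longrightarrow> 0 < \<delta> \<Longrightarrow> \<forall>\<^sub>F n in sequentially. \<exists>B\<in>sets M.
     prob B \<le> C * (\<delta> powr a)\<^sup>2 / \<eta> ^ 4 \<and> (\<forall>\<omega>\<in>space M - B. \<forall>t. 0 \<le> t \<and> t \<le> \<delta> \<longrightarrow> \<bar>X n \<omega> t\<bar> \<le> \<eta>)"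
proof -
  note [measurable] = Zlim_meas bdm_measurable[OF bdm_A]
  obtain CR where CR: "0 < CR" "\<And>n. n \<ge> 1 \<Longrightarrow> R n \<le> CR * real n powr (- a)" using R_upper by auto
  define b where "b = (2::real) powr a"
  have b1: "1 < b" unfolding b_def using a_bounds by simp
  have b2: "1 < b\<^sup>2" using b1 by (simp add: one_less_power)
  \<comment> \<open>The factor 352 * CR^2 * b^8 comes from a single block, b^8 being the fourth
    power of the b^2 in the threshold; the remaining b^2 / (b^2 - 1) comes from summing the
    geometric series.\<close>
  define C where "C = 352 * CR\<^sup>2 * b ^ 10 / (b\<^sup>2 - 1)"
  have C: "0 < C" unfolding C_def using CR(1) b1 b2 by simp
  have "\<forall>\<^sub>F n in sequentially. \<exists>B\<in>sets M.
     prob B \<le> C * (\<delta> powr a)\<^sup>2 / \<eta> ^ 4 \<and> (\<forall>\<omega>\<in>space M - B. \<forall>t. 0 \<le> t \<and> t \<le> \<delta> \<longrightarrow> \<bar>X n \<omega> t\<bar> \<le> \<eta>)"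
    if \<eta>: "0 < \<eta>" and \<delta>: "0 < \<delta>" for \<eta> \<delta>
  proof -
    have "(\<lambda>n. real n powr (- (\<gamma> - 1/2))) \<longlonglongrightarrow> 0" using gamma by real_asymp
    then have "\<forall>\<^sub>F n in sequentially. real n powr (- (\<gamma> - 1/2)) < \<eta>" using \<eta> by (rule order_tendstoD(2))
    moreover have "\<forall>\<^sub>F n in sequentially. 1 \<le> nat \<lfloor>real n * \<delta>\<rfloor>"
      using floor_at_top[OF \<delta>] unfolding filterlim_at_top by blast
    ultimately show ?thesis
    proof eventually_elim
      case (elim n)
      define g where "g = real n powr (\<gamma> - 1/2)"
      have n: "0 < real n" using elim(2) by (cases n) auto
      have g: "0 < g" using n by (simp add: g_def)
      have g2: "g\<^sup>2 = real n powr a" unfolding g_def by (rule powr_half_a)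
      obtain I where I: "2 ^ I \<le> nat \<lfloor>real n * \<delta>\<rfloor>" "nat \<lfloor>real n * \<delta>\<rfloor> < 2 ^ (I + 1)"
        using ex_power_ivl1[of 2, OF _ elim(2)] by auto
      \<comment> \<open>On block i the time satisfies t \<le> 2^(i + 2) / n, so the prefactor times
        g is at most b^(i + 2) / g; this threshold therefore bounds the path by \<eta>.\<close>
      define y where "y i = \<eta> * g / b ^ (i + 2)" for i
      have y: "0 < y i" for i unfolding y_def using \<eta> g b1 by simp
      define E where "E i = {\<omega>\<in>space M. \<exists>k\<in>{2 ^ i..2 ^ (i + 1)}. y i \<le> \<bar>A k \<omega> - Zlim \<omega>\<bar>}" for i :: nat
      have E: "E i \<in> sets M" for i unfolding E_def by measurable
      \<comment> \<open>R contributes b^(-2 i) and the threshold b^(4 i), so the bounds grow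
        geometrically and the sum is governed by the last block, near n * \<delta>. Its size is of
        order n^(2 a) * \<delta>^(2 a), and the power of n cancels against g^4.\<close>
      have PE: "prob (E i) \<le> 352 * CR\<^sup>2 * b ^ 8 / (\<eta> ^ 4 * g ^ 4) * (b\<^sup>2) ^ i" for i
      proof -
        have "prob (E i) \<le> 352 * (R (2 ^ i))\<^sup>2 / y i ^ 4"
          unfolding E_def by (rule block_prob[OF _ y]) simp
        also have "\<dots> \<le> 352 * (CR / b ^ i)\<^sup>2 / y i ^ 4"
        proof -
          have "R (2 ^ i) \<le> CR * (2 ^ i) powr (- a)" using CR(2)[of "2 ^ i"] by simp
          also have "\<dots> = CR / b ^ i" by (simp only: powr_minus powr_pow2 b_def divide_inverse)
          finally have "R (2 ^ i) \<le> CR / b ^ i" .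
          then show ?thesis by (intro divide_right_mono mult_left_mono power_mono R_nonneg) auto
        qed
        also have "\<dots> = 352 * CR\<^sup>2 * b ^ 8 / (\<eta> ^ 4 * g ^ 4) * (b\<^sup>2) ^ i"
        proof -
          have "(b ^ (i + 2)) ^ 4 = b ^ 8 * ((b ^ i)\<^sup>2 * (b ^ i)\<^sup>2)" by (simp add: power_add[symmetric] power_mult[symmetric] mult_2_right[symmetric] algebra_simps)
          moreover have "(b\<^sup>2) ^ i = (b ^ i)\<^sup>2" by (simp add: power_mult[symmetric] mult.commute)
          moreover have "(b ^ i)\<^sup>2 \<noteq> 0" using b1 by simp
          moreover have "352 * (P / x) / (Q / (d * (x * x))) = 352 * P * d / Q * x" if "x \<noteq> 0" for P x Q d :: real
            using that by simp
          ultimately show ?thesis unfolding y_def power_divide power_mult_distrib by (simp only:)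
        qed
        finally show ?thesis .
      qed
      define B where "B = N0 \<union> (\<Union>i\<le>I. E i)"
      have B: "B \<in> sets M" unfolding B_def using E N0 by auto
      have "prob B \<le> prob N0 + prob (\<Union>i\<le>I. E i)"
        unfolding B_def using E N0 by (intro measure_Un_le) auto
      also have "prob (\<Union>i\<le>I. E i) \<le> (\<Sum>i\<le>I. prob (E i))"
        using E by (intro measure_UNION_le) auto
      also have "\<dots> \<le> (\<Sum>i\<le>I. 352 * CR\<^sup>2 * b ^ 8 / (\<eta> ^ 4 * g ^ 4) * (b\<^sup>2) ^ i)" by (intro sum_mono PE)
      also have "\<dots> = 352 * CR\<^sup>2 * b ^ 8 / (\<eta> ^ 4 * g ^ 4) * (\<Sum>i<Suc I. (b\<^sup>2) ^ i)"
        by (simp only: sum_distrib_left lessThan_Suc_atMost)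
      also have "\<dots> \<le> 352 * CR\<^sup>2 * b ^ 8 / (\<eta> ^ 4 * g ^ 4) * (b\<^sup>2 * ((real n powr a)\<^sup>2 * (\<delta> powr a)\<^sup>2) / (b\<^sup>2 - 1))"
      proof (rule mult_left_mono)
        have "(\<Sum>i<Suc I. (b\<^sup>2) ^ i) = ((b\<^sup>2) ^ Suc I - 1) / (b\<^sup>2 - 1)"
          using b2 by (intro geometric_sum) simp
        also have "\<dots> \<le> (b\<^sup>2 * (b\<^sup>2) ^ I) / (b\<^sup>2 - 1)" using b2 by (intro divide_right_mono) auto
        also have "(b\<^sup>2) ^ I = ((2 ^ I) powr a)\<^sup>2" unfolding powr_pow2 b_def power_mult[symmetric] by (simp only: mult.commute[of 2 I])
        also have "b\<^sup>2 * ((2 ^ I) powr a)\<^sup>2 / (b\<^sup>2 - 1) \<le> b\<^sup>2 * ((real n powr a)\<^sup>2 * (\<delta> powr a)\<^sup>2) / (b\<^sup>2 - 1)"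
        proof (intro divide_right_mono mult_left_mono)
          have "real (2 ^ I) \<le> real (nat \<lfloor>real n * \<delta>\<rfloor>)" using I(1) by (simp only: of_nat_le_iff)
          moreover have "real (nat \<lfloor>real n * \<delta>\<rfloor>) \<le> real n * \<delta>" using \<delta> by simp
          ultimately have "2 ^ I \<le> real n * \<delta>" by (simp only: of_nat_power of_nat_numeral)
          then have "(2 ^ I) powr a \<le> (real n * \<delta>) powr a" using a_bounds by (intro powr_mono2) auto
          also have "\<dots> = real n powr a * \<delta> powr a" using \<delta> by (simp add: powr_mult)
          finally have "((2 ^ I) powr a)\<^sup>2 \<le> (real n powr a * \<delta> powr a)\<^sup>2" by (intro power_mono) auto
          then show "((2 ^ I) powr a)\<^sup>2 \<le> (real n powr a)\<^sup>2 * (\<delta> powr a)\<^sup>2" by (simp only: power_mult_distrib)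
        qed (use b2 in auto)
        finally show "(\<Sum>i<Suc I. (b\<^sup>2) ^ i) \<le> b\<^sup>2 * ((real n powr a)\<^sup>2 * (\<delta> powr a)\<^sup>2) / (b\<^sup>2 - 1)" .
      qed (use \<eta> g b1 in auto)
      also have "\<dots> = C * (\<delta> powr a)\<^sup>2 / \<eta> ^ 4"
      proof -
        have "g ^ 4 = (real n powr a)\<^sup>2" unfolding g2[symmetric] by (simp add: power_mult[symmetric])
        moreover have "real n powr a \<noteq> 0" using n by simp
        moreover have "b ^ 10 = b ^ 8 * b\<^sup>2" by (simp add: power_add[symmetric])
        ultimately show ?thesis unfolding C_def by simp (simp only: mult_ac)
      qed
      finally have "prob B \<le> C * (\<delta> powr a)\<^sup>2 / \<eta> ^ 4" using N0 by simp
      moreover have "\<bar>X n \<omega> t\<bar> \<le> \<eta>" if w: "\<omega> \<in> space M - B" and t: "0 \<le> t" "t \<le> \<delta>" for \<omega> t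
      proof -
        define k where "k = nat \<lfloor>real n * t\<rfloor>"
        have kt: "real k \<le> real n * t" "real n * t < real k + 1" using n t by (auto simp: k_def)
        have X_eq: "\<bar>X n \<omega> t\<bar> = t powr a * g * \<bar>A k \<omega> - Zlim \<omega>\<bar>" by (simp add: X_def g_def k_def abs_mult)
        show ?thesis
        proof (cases "k = 0")
          \<comment> \<open>Index 0 belongs to no dyadic block. Here t < 1 / n, and the trivial
            bound 1 on the difference already gives n^(-(\<gamma> - 1/2)).\<close>
          case True
          have "t \<le> 1 / real n" using kt True n by (simp add: field_simps)
          then have "t powr a \<le> (1 / real n) powr a" using t a_bounds by (intro powr_mono2) auto
          also have "\<dots> = 1 / g\<^sup>2" using n by (simp add: powr_divide g2)
          finally have ta: "t powr a \<le> 1 / g\<^sup>2" .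
          have "\<bar>A k \<omega> - Zlim \<omega>\<bar> \<le> 1" using w A_range[of \<omega> k] by (auto simp: B_def N0_def)
          then have "\<bar>X n \<omega> t\<bar> \<le> (1 / g\<^sup>2) * g * 1"
            unfolding X_eq using ta g by (intro mult_mono mult_nonneg_nonneg) auto
          also have "\<dots> = real n powr (- (\<gamma> - 1/2))" using g unfolding powr_minus g_def[symmetric] by (simp add: power2_eq_square divide_inverse)
          finally show ?thesis using elim(1) by simp
        next
          case False
          then obtain i where i: "2 ^ i \<le> k" "k < 2 ^ (i + 1)" using ex_power_ivl1[of 2 k] by auto
          have "real n * t \<le> real n * \<delta>" using t by (intro mult_left_mono) auto
          then have "k \<le> nat \<lfloor>real n * \<delta>\<rfloor>" unfolding k_def by (intro nat_mono floor_mono)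
          then have "(2::nat) ^ i < 2 ^ (I + 1)" using i I by linarith
          then have "i < I + 1" by (rule power_less_imp_less_exp[rotated]) simp
          then have "\<omega> \<notin> E i" using w by (auto simp: B_def)
          moreover have "k \<in> {2 ^ i..2 ^ (i + 1)}" using i by simp
          ultimately have "\<bar>A k \<omega> - Zlim \<omega>\<bar> < y i" using w unfolding E_def by force
          moreover have "t powr a \<le> b ^ (i + 2) / g\<^sup>2"
          proof -
            have "real k + 1 \<le> 2 ^ (i + 1)" using i(2) by (metis add.commute of_nat_1 of_nat_add of_nat_le_iff of_nat_numeral of_nat_power plus_1_eq_Suc Suc_leI)
            then have "real n * t \<le> 2 ^ (i + 2)" using kt by simp
            then have "t \<le> 2 ^ (i + 2) / real n" using n by (simp add: field_simps)
            then have "t powr a \<le> (2 ^ (i + 2) / real n) powr a" using t a_bounds by (intro powr_mono2) auto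
            also have "\<dots> = (2 ^ (i + 2)) powr a / real n powr a" by (rule powr_divide)
            also have "\<dots> = b ^ (i + 2) / g\<^sup>2" by (simp only: powr_pow2 b_def g2)
            finally show ?thesis .
          qed
          ultimately have "\<bar>X n \<omega> t\<bar> \<le> b ^ (i + 2) / g\<^sup>2 * g * y i"
            unfolding X_eq using g b1 by (intro mult_mono mult_nonneg_nonneg) auto
          also have "\<dots> = \<eta>"
          proof -
            have "b ^ (i + 2) \<noteq> 0" using b1 by simp
            then show ?thesis unfolding y_def power2_eq_square using g by (simp del: power_Suc power_add add: field_simps)
          qed
          finally show ?thesis .
        qed
      qed
      ultimately show ?case using B by blast
    qed
  qed
  with C show thesis by (rule that)
qed


text \<open>The difference of path values at t and at the grid point below splits into the change of
  the prefactor, which is Lipschitz away from 0, times a tail, and the prefactor times the movement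
  of the average over a window of about n / K steps. Fourth moments make both bad events of
  probability O(1 / K^2) per cell, and there are at most K * T + 1 cells.\<close>

lemma large_time:
  assumes \<delta>: "0 < \<delta>" and T: "0 < T" and \<eta>: "0 < \<eta>"
  obtains C where "0 < C" "\<And>K. 2 / \<delta> \<le> real K \<Longrightarrow> \<forall>\<^sub>F n in sequentially. \<exists>B\<in>sets M.
     prob B \<le> (real K * T + 1) * (C / (real K)\<^sup>2) \<and> (\<forall>\<omega>\<in>space M - B. \<forall>t. \<delta> \<le> t \<and> t < T \<longrightarrow>
        \<bar>X n \<omega> t - X n \<omega> (real (nat \<lfloor>real K * t\<rfloor>) / real K)\<bar> \<le> \<eta>)"
proof -
  note [measurable] = Zlim_meas bdm_measurable[OF bdm_A]
  obtain CR where CR: "0 < CR" "\<And>n. n \<ge> 1 \<Longrightarrow> R n \<le> CR * real n powr (- a)" using R_upper by auto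
  obtain Cr where Cr: "0 < Cr" "\<And>m k. 1 \<le> m \<Longrightarrow> m \<le> k \<Longrightarrow> r k \<le> Cr * real m powr (- \<gamma>)" by (rule r_upper_tail) blast
  \<comment> \<open>B0 / K bounds the change of the prefactor over one cell: T^a times the relative
    time change, whose denominator is at least \<delta> / 2.\<close>
  define B0 where "B0 = T powr a * (2 / \<delta>)"
  have B0: "0 < B0" unfolding B0_def using T \<delta> by simp
  define d where "d = \<delta> / 4"
  have d: "0 < d" using \<delta> by (simp add: d_def)
  define C2 where "C2 = 11 * (CR * d powr (- a))\<^sup>2 / (\<eta> / (2 * B0)) ^ 4"
  define C3 where "C3 = 11 * (2 * (Cr * d powr (- \<gamma>))\<^sup>2)\<^sup>2 / (\<eta> / (2 * T powr a)) ^ 4"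
  have C2: "0 < C2" unfolding C2_def using CR(1) d \<eta> B0 by (intro divide_pos_pos mult_pos_pos zero_less_power) auto
  have C3: "0 < C3" unfolding C3_def using Cr(1) d \<eta> T by (intro divide_pos_pos mult_pos_pos zero_less_power) auto
  have "\<forall>\<^sub>F n in sequentially. \<exists>B\<in>sets M.
     prob B \<le> (real K * T + 1) * ((C2 + C3) / (real K)\<^sup>2) \<and> (\<forall>\<omega>\<in>space M - B. \<forall>t. \<delta> \<le> t \<and> t < T \<longrightarrow>
        \<bar>X n \<omega> t - X n \<omega> (real (nat \<lfloor>real K * t\<rfloor>) / real K)\<bar> \<le> \<eta>)" if K: "2 / \<delta> \<le> real K" for K
  proof -
    have Kpos: "0 < real K" using K \<delta> by (meson divide_pos_pos less_le_trans zero_less_numeral)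
    then have K1: "1 \<le> real K" "0 < K" by auto
    \<comment> \<open>K \<le> n keeps the window length below 2 * n / K, and 4 / \<delta> \<le> n
      makes every starting index positive and at least n * \<delta> / 4.\<close>
    define n0 where "n0 = max K (nat \<lceil>4 / \<delta>\<rceil>)"
    show ?thesis
    proof (rule eventually_sequentiallyI[of n0])
      fix n assume "n0 \<le> n"
      then have nK: "K \<le> n" and n4: "4 / \<delta> \<le> real n" by (auto simp: n0_def)
      have n: "0 < real n" using nK Kpos by simp
      define g where "g = real n powr (\<gamma> - 1/2)"
      have g: "0 < g" using n by (simp add: g_def)
      have g2: "g\<^sup>2 = real n powr a" unfolding g_def by (rule powr_half_a)
      \<comment> \<open>The grid point below some t \<ge> \<delta> can lie below \<delta>, but not
        below \<delta> / 2, because 1 / K \<le> \<delta> / 2.\<close>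
      define J where "J = {j::nat. \<delta> / 2 \<le> real j / real K \<and> real j / real K < T}"
      have J_sub: "J \<subseteq> {..nat \<lfloor>real K * T\<rfloor>}"
      proof
        fix j assume "j \<in> J"
        then have "real j < real K * T" using Kpos by (simp add: J_def field_simps)
        then show "j \<in> {..nat \<lfloor>real K * T\<rfloor>}" by simp linarith
      qed
      then have finJ: "finite J" by (rule finite_subset) simp
      have cardJ: "real (card J) \<le> real K * T + 1"
      proof -
        have "card J \<le> card {..nat \<lfloor>real K * T\<rfloor>}" using J_sub by (intro card_mono) auto
        then have "real (card J) \<le> real (nat \<lfloor>real K * T\<rfloor>) + 1" by simp
        also have "\<dots> \<le> real K * T + 1" using T by simp
        finally show ?thesis .
      qed
      define f where "f j = nat \<lfloor>real n * (real j / real K)\<rfloor>" for j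
      \<comment> \<open>The added 1 absorbs the rounding when the floor of a sum is compared with
        the sum of the floors.\<close>
      define w where "w = nat \<lfloor>real n / real K\<rfloor> + 1"
      have w: "real w \<le> 2 * real n / real K"
      proof -
        have "real w \<le> real n / real K + 1" by (simp add: w_def)
        also have "1 \<le> real n / real K" using nK Kpos by simp
        finally show ?thesis by simp
      qed
      have fd: "real n * d \<le> real (f j)" "1 \<le> f j" if "j \<in> J" for j
      proof -
        have n4': "4 \<le> real n * \<delta>" using n4 \<delta> by (simp add: field_simps)
        have "real n * (\<delta> / 2) \<le> real n * (real j / real K)" using that by (intro mult_left_mono) (auto simp: J_def)
        then have "real n * (\<delta> / 2) - 1 \<le> real (f j)" unfolding f_def by linarith
        moreover have "real n * (\<delta> / 2) = 2 * (real n * d)" "4 * (real n * d) = real n * \<delta>" by (simp_all add: d_def)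
        ultimately show "real n * d \<le> real (f j)" "1 \<le> f j" using n4' by linarith+
      qed
      \<comment> \<open>The two thresholds are chosen so that each of the two contributions to the
        oscillation is exactly \<eta> / 2.\<close>
      define y2 where "y2 = \<eta> * real K / (2 * g * B0)"
      define y3 where "y3 = \<eta> / (2 * g * T powr a)"
      have y2: "0 < y2" unfolding y2_def using \<eta> g B0 Kpos by simp
      have y3: "0 < y3" unfolding y3_def using \<eta> g T by simp
      define E2 where "E2 j = {\<omega>\<in>space M. y2 \<le> \<bar>Zlim \<omega> - A (f j) \<omega>\<bar>}" for j
      define E3 where "E3 j = {\<omega>\<in>space M. \<exists>k\<in>{f j..f j + w}. y3 \<le> \<bar>A k \<omega> - A (f j) \<omega>\<bar>}" for j
      have E: "E2 j \<in> sets M" "E3 j \<in> sets M" for j unfolding E2_def E3_def by measurable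
      have P2: "prob (E2 j) \<le> C2 / (real K)\<^sup>2" if j: "j \<in> J" for j
      proof -
        have nd: "0 < real n * d" using n d by simp
        have "R (f j) \<le> CR * real (f j) powr (- a)" using fd[OF j] by (intro CR(2))
        also have "\<dots> \<le> CR * (real n * d) powr (- a)"
          using fd[OF j] nd CR(1) a_bounds by (intro mult_left_mono powr_mono2') auto
        also have "\<dots> = CR * d powr (- a) / g\<^sup>2"
        proof -
          have "(real n * d) powr (- a) = real n powr (- a) * d powr (- a)" by (rule powr_mult)
          also have "real n powr (- a) = inverse (g\<^sup>2)" by (simp only: powr_minus g2)
          finally show ?thesis by (simp add: divide_inverse)
        qed
        finally have R: "R (f j) \<le> CR * d powr (- a) / g\<^sup>2" .
        have "prob (E2 j) \<le> 11 * (R (f j))\<^sup>2 / y2 ^ 4" unfolding E2_def by (rule markov_lim[OF y2])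
        also have "\<dots> \<le> 11 * (CR * d powr (- a) / g\<^sup>2)\<^sup>2 / y2 ^ 4"
          by (intro divide_right_mono mult_left_mono power_mono R R_nonneg) auto
        also have "\<dots> = C2 / real K ^ 4"
        proof -
          have "y2 = \<eta> / (2 * B0) * (real K / g)" by (simp add: y2_def)
          then have y4: "y2 ^ 4 = (\<eta> / (2 * B0)) ^ 4 * (real K ^ 4 / g ^ 4)" by (simp add: power_mult_distrib power_divide)
          have "(CR * d powr (- a) / g\<^sup>2)\<^sup>2 = (CR * d powr (- a))\<^sup>2 / g ^ 4" by (simp add: power_divide power_mult[symmetric])
          moreover have "11 * (P / q) / (y * (k / q)) = 11 * P / y / k" if "q \<noteq> 0" for P q y k :: real using that by simp
          ultimately show ?thesis unfolding C2_def y4 using g by simp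
        qed
        \<comment> \<open>The prefactor part is even of order K^(-4); it is weakened to match the
          bound for the window part.\<close>
        also have "\<dots> \<le> C2 / (real K)\<^sup>2"
          using C2 K1 by (intro divide_left_mono power_increasing) auto
        finally show ?thesis .
      qed
      have P3: "prob (E3 j) \<le> C3 / (real K)\<^sup>2" if j: "j \<in> J" for j
      proof -
        have nd: "0 < real n * d" using n d by simp
        define \<rho> where "\<rho> = Cr * d powr (- \<gamma>)"
        have rk: "(r k)\<^sup>2 \<le> \<rho>\<^sup>2 / (real n * g\<^sup>2)" if k: "f j \<le> k" for k
        proof -
          have "r k \<le> Cr * real (f j) powr (- \<gamma>)" using fd(2)[OF j] k by (intro Cr(2))
          also have "\<dots> \<le> Cr * (real n * d) powr (- \<gamma>)"
            using fd[OF j] nd Cr(1) gamma by (intro mult_left_mono powr_mono2') auto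
          also have "\<dots> = \<rho> * real n powr (- \<gamma>)"
          proof -
            have "(real n * d) powr (- \<gamma>) = real n powr (- \<gamma>) * d powr (- \<gamma>)" by (rule powr_mult)
            then show ?thesis by (simp add: \<rho>_def)
          qed
          finally have "(r k)\<^sup>2 \<le> (\<rho> * real n powr (- \<gamma>))\<^sup>2" using r_bounds[of k] by (intro power_mono) auto
          also have "\<dots> = \<rho>\<^sup>2 / (real n powr \<gamma>)\<^sup>2" by (simp only: power_mult_distrib powr_minus power_inverse divide_inverse)
          also have "(real n powr \<gamma>)\<^sup>2 = real n * g\<^sup>2"
          proof -
            have "real n powr (1 + a) = real n powr 1 * real n powr a" by (rule powr_add)
            moreover have "(real n powr \<gamma>)\<^sup>2 = real n powr (\<gamma> + \<gamma>)" by (simp only: powr_add power2_eq_square)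
            moreover have "real n powr 1 = real n" "\<gamma> + \<gamma> = 1 + a" by simp_all
            ultimately show ?thesis by (simp only: g2)
          qed
          finally show ?thesis .
        qed
        have "(\<Sum>k\<in>{f j..<f j + w}. (r k)\<^sup>2) \<le> (\<Sum>k\<in>{f j..<f j + w}. \<rho>\<^sup>2 / (real n * g\<^sup>2))"
          by (intro sum_mono rk) auto
        also have "\<dots> = real w * (\<rho>\<^sup>2 / (real n * g\<^sup>2))" by simp
        also have "\<dots> \<le> (2 * real n / real K) * (\<rho>\<^sup>2 / (real n * g\<^sup>2))"
          using w n by (intro mult_right_mono) auto
        also have "\<dots> = 2 * \<rho>\<^sup>2 / (real K * g\<^sup>2)" using n by simp
        finally have S: "(\<Sum>k\<in>{f j..<f j + w}. (r k)\<^sup>2) \<le> 2 * \<rho>\<^sup>2 / (real K * g\<^sup>2)" .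
        have "prob (E3 j) \<le> 11 * (\<Sum>k\<in>{f j..<f j + w}. (r k)\<^sup>2)\<^sup>2 / y3 ^ 4"
          unfolding E3_def by (rule maximal_inequality[OF _ y3]) simp
        also have "\<dots> \<le> 11 * (2 * \<rho>\<^sup>2 / (real K * g\<^sup>2))\<^sup>2 / y3 ^ 4"
          by (intro divide_right_mono mult_left_mono power_mono S sum_nonneg) auto
        also have "\<dots> = C3 / (real K)\<^sup>2"
        proof -
          have "y3 = \<eta> / (2 * T powr a) / g" by (simp add: y3_def)
          then have y4: "y3 ^ 4 = (\<eta> / (2 * T powr a)) ^ 4 / g ^ 4" by (simp only: power_divide)
          have "(2 * \<rho>\<^sup>2 / (real K * g\<^sup>2))\<^sup>2 = (2 * \<rho>\<^sup>2)\<^sup>2 / ((real K)\<^sup>2 * g ^ 4)"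
            by (simp add: power_divide power_mult_distrib power_mult[symmetric])
          moreover have "11 * (P / (k * q)) / (y / q) = 11 * P / y / k" if "q \<noteq> 0" for P q y k :: real using that by simp
          moreover have "g ^ 4 \<noteq> 0" using g by simp
          ultimately show ?thesis unfolding C3_def y4 \<rho>_def by (simp only:)
        qed
        finally show ?thesis .
      qed
      define B where "B = (\<Union>j\<in>J. E2 j) \<union> (\<Union>j\<in>J. E3 j)"
      have B: "B \<in> sets M" unfolding B_def using E finJ by auto
      have "prob B \<le> prob (\<Union>j\<in>J. E2 j) + prob (\<Union>j\<in>J. E3 j)"
        unfolding B_def using E finJ by (intro measure_Un_le) auto
      also have "\<dots> \<le> (\<Sum>j\<in>J. prob (E2 j)) + (\<Sum>j\<in>J. prob (E3 j))"
        using E finJ by (intro add_mono measure_UNION_le) auto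
      also have "\<dots> \<le> (\<Sum>j\<in>J. C2 / (real K)\<^sup>2) + (\<Sum>j\<in>J. C3 / (real K)\<^sup>2)"
        by (intro add_mono sum_mono P2 P3)
      also have "\<dots> = real (card J) * ((C2 + C3) / (real K)\<^sup>2)" by (simp add: add_divide_distrib distrib_left)
      also have "\<dots> \<le> (real K * T + 1) * ((C2 + C3) / (real K)\<^sup>2)"
        using C2 C3 by (intro mult_right_mono cardJ) auto
      finally have PB: "prob B \<le> (real K * T + 1) * ((C2 + C3) / (real K)\<^sup>2)" .
      have "\<bar>X n \<omega> t - X n \<omega> (real (nat \<lfloor>real K * t\<rfloor>) / real K)\<bar> \<le> \<eta>"
        if w': "\<omega> \<in> space M - B" and t: "\<delta> \<le> t" "t < T" for \<omega> t
      proof -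
        define j where "j = nat \<lfloor>real K * t\<rfloor>"
        define s where "s = real j / real K"
        have t0: "0 < t" using t \<delta> by simp
        have s: "s \<le> t" "t < s + 1 / real K"
          using grid_point_bounds[OF K1(2), of t] t0 by (auto simp: s_def j_def)
        have "1 / real K \<le> \<delta> / 2" using K \<delta> Kpos by (simp add: field_simps)
        then have s\<delta>: "\<delta> / 2 \<le> s" using s t by linarith
        have s0: "0 < s" using s\<delta> \<delta> by linarith
        have jJ: "j \<in> J" unfolding J_def using s\<delta> s t by (auto simp: s_def)
        define k where "k = nat \<lfloor>real n * t\<rfloor>"
        have fs: "f j = nat \<lfloor>real n * s\<rfloor>" by (simp add: f_def s_def)
        have k1: "f j \<le> k" unfolding fs k_def using s by (intro nat_mono floor_mono mult_left_mono) auto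
        have k2: "k \<le> f j + w"
        proof -
          have "real n * t \<le> real n * (s + 1 / real K)" using s by (intro mult_left_mono) auto
          then have "real n * t \<le> real n * s + real n / real K" by (simp add: distrib_left)
          moreover have "0 \<le> real n * s" "0 \<le> real n / real K" using s0 by auto
          ultimately show ?thesis unfolding k_def fs w_def by linarith
        qed
        have a2: "\<bar>A (f j) \<omega> - Zlim \<omega>\<bar> \<le> y2" using w' jJ by (auto simp: B_def E2_def abs_minus_commute not_le intro: less_imp_le)
        have a3: "\<bar>A k \<omega> - A (f j) \<omega>\<bar> \<le> y3"
        proof (rule ccontr)
          assume "\<not> ?thesis"
          then have "\<omega> \<in> E3 j" unfolding E3_def using w' k1 k2 by (auto intro!: bexI[of _ k])
          then show False using w' jJ by (auto simp: B_def)
        qed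
        have tT: "t powr a \<le> T powr a" using t t0 a_bounds by (intro powr_mono2) auto
        have ts: "\<bar>t powr a - s powr a\<bar> \<le> B0 / real K"
        proof -
          have mono: "s powr a \<le> t powr a" using s s0 a_bounds by (intro powr_mono2) auto
          have "t powr a = (s * (t / s)) powr a" using s0 by simp
          also have "\<dots> = s powr a * (t / s) powr a" by (rule powr_mult)
          \<comment> \<open>Since t / s \<ge> 1 and a \<le> 1, the power is at most the ratio
            itself, which makes the estimate linear in t - s.\<close>
          also have "(t / s) powr a \<le> (t / s) powr 1" using s s0 a_bounds by (intro powr_mono) auto
          finally have "t powr a \<le> s powr a * (t / s)" using s0 t0 by simp
          then have "t powr a - s powr a \<le> s powr a * ((t - s) / s)" using s0 by (simp add: diff_divide_distrib right_diff_distrib)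
          also have "\<dots> \<le> T powr a * ((1 / real K) / (\<delta> / 2))"
          proof (rule mult_mono)
            show "s powr a \<le> T powr a" using s t s0 a_bounds by (intro powr_mono2) auto
            show "(t - s) / s \<le> (1 / real K) / (\<delta> / 2)" using s s\<delta> s0 \<delta> by (intro frac_le) auto
          qed (use s s0 in auto)
          also have "\<dots> = B0 / real K" by (simp add: B0_def)
          finally show ?thesis using mono by simp
        qed
        have "X n \<omega> t - X n \<omega> s = (t powr a - s powr a) * g * (A (f j) \<omega> - Zlim \<omega>) + t powr a * g * (A k \<omega> - A (f j) \<omega>)"
          unfolding X_def k_def fs g_def by (simp add: algebra_simps)
        also have "\<bar>\<dots>\<bar> \<le> \<bar>t powr a - s powr a\<bar> * g * \<bar>A (f j) \<omega> - Zlim \<omega>\<bar> + t powr a * g * \<bar>A k \<omega> - A (f j) \<omega>\<bar>"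
          using g by (intro order_trans[OF abs_triangle_ineq]) (simp add: abs_mult)
        also have "\<dots> \<le> B0 / real K * g * y2 + T powr a * g * y3"
          using ts a2 a3 tT g B0 Kpos by (intro add_mono mult_mono mult_nonneg_nonneg) auto
        also have "B0 / real K * g * y2 = \<eta> / 2" unfolding y2_def using B0 Kpos g by simp
        also have "T powr a * g * y3 = \<eta> / 2" unfolding y3_def using T g by simp
        finally show ?thesis by (simp add: s_def j_def)
      qed
      with PB B show "\<exists>B\<in>sets M. prob B \<le> (real K * T + 1) * ((C2 + C3) / (real K)\<^sup>2) \<and> (\<forall>\<omega>\<in>space M - B. \<forall>t. \<delta> \<le> t \<and> t < T \<longrightarrow>
        \<bar>X n \<omega> t - X n \<omega> (real (nat \<lfloor>real K * t\<rfloor>) / real K)\<bar> \<le> \<eta>)" by blast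
    qed
  qed
  moreover have "0 < C2 + C3" using C2 C3 by simp
  ultimately show thesis using that by blast
qed

text \<open>The initial interval [0, \<delta>] is chosen first, independently of K: there both the
  value at t and that at the grid point are at most \<eta> / 2. Then K is taken large enough for the
  cell bound on [\<delta>, T).\<close>

proposition oscillation:
  assumes T: "0 < T" and \<eta>: "0 < \<eta>" and \<epsilon>: "0 < \<epsilon>"
  shows "\<forall>\<^sub>F K in sequentially. \<forall>\<^sub>F n in sequentially.
        \<exists>B\<in>sets M. prob B \<le> \<epsilon> \<and> (\<forall>\<omega>\<in>space M - B. \<forall>t. 0 \<le> t \<and> t < T \<longrightarrow>
           \<bar>X n \<omega> t - X n \<omega> (real (nat \<lfloor>real K * t\<rfloor>) / real K)\<bar> \<le> \<eta>)"
proof -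
  obtain C where C: "0 < C" "\<And>\<eta> \<delta>. 0 < \<eta> \<Longrightarrow> 0 < \<delta> \<Longrightarrow> \<forall>\<^sub>F n in sequentially. \<exists>B\<in>sets M.
     prob B \<le> C * (\<delta> powr a)\<^sup>2 / \<eta> ^ 4 \<and> (\<forall>\<omega>\<in>space M - B. \<forall>t. 0 \<le> t \<and> t \<le> \<delta> \<longrightarrow> \<bar>X n \<omega> t\<bar> \<le> \<eta>)"
    by (rule small_time) blast
  \<comment> \<open>The value of \<delta>^a for which the small-time bound equals \<epsilon> / 2;
    \<delta> is recovered as its power 1 / a.\<close>
  define s where "s = sqrt (\<epsilon> / 2 * (\<eta> / 2) ^ 4 / C)"
  have s: "0 < s" "s\<^sup>2 = \<epsilon> / 2 * (\<eta> / 2) ^ 4 / C" unfolding s_def using \<epsilon> \<eta> C(1) by auto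
  define \<delta> where "\<delta> = s powr (1 / a)"
  have \<delta>: "0 < \<delta>" using s by (simp add: \<delta>_def)
  have \<delta>a: "\<delta> powr a = s" unfolding \<delta>_def powr_powr using s a_bounds by simp
  have C\<delta>: "C * (\<delta> powr a)\<^sup>2 / (\<eta> / 2) ^ 4 = \<epsilon> / 2" unfolding \<delta>a s(2) using C(1) \<eta> by simp
  obtain C' where C': "0 < C'" "\<And>K. 2 / \<delta> \<le> real K \<Longrightarrow> \<forall>\<^sub>F n in sequentially. \<exists>B\<in>sets M.
     prob B \<le> (real K * T + 1) * (C' / (real K)\<^sup>2) \<and> (\<forall>\<omega>\<in>space M - B. \<forall>t. \<delta> \<le> t \<and> t < T \<longrightarrow>
        \<bar>X n \<omega> t - X n \<omega> (real (nat \<lfloor>real K * t\<rfloor>) / real K)\<bar> \<le> \<eta>)"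
    by (rule large_time[OF \<delta> T \<eta>]) blast
  have "(\<lambda>K. (real K * T + 1) * (C' / (real K)\<^sup>2)) \<longlonglongrightarrow> 0" by real_asymp
  then have "\<forall>\<^sub>F K in sequentially. (real K * T + 1) * (C' / (real K)\<^sup>2) < \<epsilon> / 2"
    using \<epsilon> by (intro order_tendstoD(2)) auto
  moreover have "\<forall>\<^sub>F K in sequentially. 2 / \<delta> + 1 \<le> real K"
    using eventually_ge_at_top[of "nat \<lceil>2 / \<delta> + 1\<rceil>"] by eventually_elim linarith
  ultimately show ?thesis
  proof eventually_elim
    case (elim K)
    have "0 < 2 / \<delta>" using \<delta> by simp
    then have K: "0 < K" "2 / \<delta> \<le> real K" using elim(2) by linarith+
    have "0 < \<eta> / 2" using \<eta> by simp
    from C'(2)[OF K(2)] C(2)[OF this \<delta>] show ?case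
    proof eventually_elim
      case (elim n)
      obtain B1 where B1: "B1 \<in> sets M" "prob B1 \<le> C * (\<delta> powr a)\<^sup>2 / (\<eta> / 2) ^ 4"
        "\<And>\<omega> t. \<omega> \<in> space M - B1 \<Longrightarrow> 0 \<le> t \<Longrightarrow> t \<le> \<delta> \<Longrightarrow> \<bar>X n \<omega> t\<bar> \<le> \<eta> / 2" using elim(2) by blast
      obtain B2 where B2: "B2 \<in> sets M" "prob B2 \<le> (real K * T + 1) * (C' / (real K)\<^sup>2)"
        "\<And>\<omega> t. \<omega> \<in> space M - B2 \<Longrightarrow> \<delta> \<le> t \<Longrightarrow> t < T \<Longrightarrow> \<bar>X n \<omega> t - X n \<omega> (real (nat \<lfloor>real K * t\<rfloor>) / real K)\<bar> \<le> \<eta>"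
        using elim(1) by blast
      have "prob (B1 \<union> B2) \<le> prob B1 + prob B2" using B1 B2 by (intro measure_Un_le)
      also have "\<dots> \<le> \<epsilon>" using B1(2) B2(2) C\<delta> \<open>(real K * T + 1) * (C' / (real K)\<^sup>2) < \<epsilon> / 2\<close> by linarith
      finally have P: "prob (B1 \<union> B2) \<le> \<epsilon>" .
      have "\<bar>X n \<omega> t - X n \<omega> (real (nat \<lfloor>real K * t\<rfloor>) / real K)\<bar> \<le> \<eta>"
        if w: "\<omega> \<in> space M - (B1 \<union> B2)" and t: "0 \<le> t" "t < T" for \<omega> t
      proof (cases "t \<le> \<delta>")
        case True
        have "real (nat \<lfloor>real K * t\<rfloor>) / real K \<le> t" by (rule grid_point_bounds[OF K(1) t(1)])
        then have "\<bar>X n \<omega> t\<bar> \<le> \<eta> / 2" "\<bar>X n \<omega> (real (nat \<lfloor>real K * t\<rfloor>) / real K)\<bar> \<le> \<eta> / 2"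
          using B1(3)[of \<omega> t] B1(3)[of \<omega> "real (nat \<lfloor>real K * t\<rfloor>) / real K"] w t True by auto
        then show ?thesis by linarith
      next
        case False
        then show ?thesis using w t by (intro B2(3)) auto
      qed
      with P B1(1) B2(1) show ?case by (intro bexI[of _ "B1 \<union> B2"]) auto
    qed
  qed
qed

end

section \<open>The limit process\<close>

lemma (in prob_space) char_normal:
  assumes D: "distributed M lborel X (\<lambda>x. ennreal (normal_density 0 \<sigma> x))" and \<sigma>: "0 < \<sigma>"
  shows "char (distr M borel (\<lambda>\<omega>. \<theta> * X \<omega>)) 1 = complex_of_real (exp (- (\<theta>\<^sup>2 * \<sigma>\<^sup>2) / 2))"
proof -
  have D': "distributed M lborel (\<lambda>\<omega>. (X \<omega> - 0) / \<sigma>) std_normal_density"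
    using D normal_standard_normal_convert[OF \<sigma>, of X 0] by simp
  have [measurable]: "X \<in> borel_measurable M" using distributed_measurable[OF D] by simp
  have "distr M lborel (\<lambda>\<omega>. (X \<omega> - 0) / \<sigma>) = std_normal_distribution"
    using D' by (simp add: distributed_def)
  moreover have "distr M lborel (\<lambda>\<omega>. (X \<omega> - 0) / \<sigma>) = distr M borel (\<lambda>\<omega>. X \<omega> / \<sigma>)"
    by (rule distr_cong) auto
  ultimately have std: "distr M borel (\<lambda>\<omega>. X \<omega> / \<sigma>) = std_normal_distribution" by simp
  have "char (distr M borel (\<lambda>\<omega>. \<theta> * X \<omega>)) 1 = (CLINT \<omega>|M. iexp ((\<theta> * \<sigma>) * (X \<omega> / \<sigma>)))"
    unfolding char_def using \<sigma> by (subst integral_distr) auto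
  also have "\<dots> = char (distr M borel (\<lambda>\<omega>. X \<omega> / \<sigma>)) (\<theta> * \<sigma>)"
    unfolding char_def by (subst integral_distr) auto
  also have "\<dots> = complex_of_real (exp (- ((\<theta> * \<sigma>)\<^sup>2) / 2))"
    unfolding std char_std_normal_distribution ..
  finally show ?thesis by (simp add: power_mult_distrib)
qed

text \<open>A real characteristic function means that the sine has mean 0, so in the addition
  formula only the cosine term survives.\<close>

lemma (in prob_space) expectation_cos_of_char:
  assumes [measurable]: "S \<in> borel_measurable M" and ch: "char (distr M borel S) 1 = complex_of_real x"
  shows "expectation (\<lambda>\<omega>. cos (S \<omega> + \<phi>)) = cos \<phi> * x"
proof -
  have int: "integrable M (\<lambda>\<omega>. cos (S \<omega>))" "integrable M (\<lambda>\<omega>. sin (S \<omega>))"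
    by (auto intro!: integrable_bounded[where B=1])
  have "char (distr M borel S) 1 = Complex (expectation (\<lambda>\<omega>. 1 * cos (1 * S \<omega> + 0))) (expectation (\<lambda>\<omega>. 1 * cos (1 * S \<omega> + - (pi / 2))))"
    using char_weighted[of S "\<lambda>_. 1" 1 1] by (simp add: density_1)
  then have "expectation (\<lambda>\<omega>. cos (S \<omega>)) = x" "expectation (\<lambda>\<omega>. sin (S \<omega>)) = 0"
    unfolding ch by (auto simp: complex_eq_iff cos_diff)
  moreover have "expectation (\<lambda>\<omega>. cos (S \<omega> + \<phi>)) = expectation (\<lambda>\<omega>. cos (S \<omega>) * cos \<phi> - sin (S \<omega>) * sin \<phi>)"
    by (simp add: cos_add)
  moreover have "\<dots> = expectation (\<lambda>\<omega>. cos (S \<omega>)) * cos \<phi> - expectation (\<lambda>\<omega>. sin (S \<omega>)) * sin \<phi>"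
    using int by simp
  ultimately show ?thesis by simp
qed

lemma wiener_measurable: "wiener_process M W \<Longrightarrow> W t \<in> borel_measurable M"
  by (simp add: wiener_process_def)

lemma wiener_zero: "wiener_process M W \<Longrightarrow> \<omega> \<in> space M \<Longrightarrow> W 0 \<omega> = 0"
  by (simp add: wiener_process_def)

lemma wiener_continuous: "wiener_process M W \<Longrightarrow> \<omega> \<in> space M \<Longrightarrow> continuous_on {0..} (\<lambda>t. W t \<omega>)"
  by (simp add: wiener_process_def)

lemma wiener_indep_increments:
  assumes "wiener_process M W" "\<And>j. j < k \<Longrightarrow> 0 \<le> ts j" "\<And>j. j < k \<Longrightarrow> ts j < ts (Suc j)"
  shows "prob_space.indep_vars M (\<lambda>_. borel) (\<lambda>j \<omega>. W (ts (Suc j)) \<omega> - W (ts j) \<omega>) {..<k}"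
proof -
  have "\<forall>(k::nat) ts. (\<forall>j<k. 0 \<le> ts j \<and> ts j < ts (Suc j)) \<longrightarrow>
        prob_space.indep_vars M (\<lambda>_. borel) (\<lambda>j \<omega>. W (ts (Suc j)) \<omega> - W (ts j) \<omega>) {..<k}"
    using assms(1) unfolding wiener_process_def by (elim conjE)
  from this[rule_format, of k ts] show ?thesis using assms(2,3) by simp
qed

text \<open>Summation by parts for the Brownian covariance: u (min i j) is the sum of the increments
  common to both times. The left side exhibits the quadratic form as nonnegative when u increases,
  which is used later too.\<close>

lemma sum_min_increments:
  fixes u \<theta> :: "nat \<Rightarrow> real"
  assumes "u 0 = 0"
  shows "(\<Sum>l<J. (\<Sum>j\<in>{l<..<J}. \<theta> j)\<^sup>2 * (u (Suc l) - u l)) = (\<Sum>i<J. \<Sum>j<J. \<theta> i * \<theta> j * u (min i j))"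
proof -
  have tail: "(\<Sum>j\<in>{l<..<J}. \<theta> j) = (\<Sum>j<J. of_bool (l < j) * \<theta> j)" for l
    by (intro sum.mono_neutral_cong_left) auto
  have u: "(\<Sum>l<J. of_bool (l < i) * (u (Suc l) - u l)) = u i" if "i \<le> J" for i
  proof -
    have "(\<Sum>l<J. of_bool (l < i) * (u (Suc l) - u l)) = (\<Sum>l<i. u (Suc l) - u l)"
      using that by (intro sum.mono_neutral_cong_right) auto
    then show ?thesis using assms by (simp add: sum_lessThan_telescope)
  qed
  have "(\<Sum>l<J. (\<Sum>j\<in>{l<..<J}. \<theta> j)\<^sup>2 * (u (Suc l) - u l))
     = (\<Sum>l<J. \<Sum>i<J. \<Sum>j<J. \<theta> i * \<theta> j * (of_bool (l < min i j) * (u (Suc l) - u l)))"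
  proof (rule sum.cong[OF refl])
    fix l
    have "(\<Sum>j\<in>{l<..<J}. \<theta> j)\<^sup>2 = (\<Sum>i<J. \<Sum>j<J. \<theta> i * \<theta> j * of_bool (l < min i j))"
      unfolding tail power2_eq_square sum_product by (intro sum.cong refl) (auto simp: of_bool_def)
    then show "(\<Sum>j\<in>{l<..<J}. \<theta> j)\<^sup>2 * (u (Suc l) - u l) = (\<Sum>i<J. \<Sum>j<J. \<theta> i * \<theta> j * (of_bool (l < min i j) * (u (Suc l) - u l)))"
      by (simp only: sum_distrib_right mult.assoc)
  qed
  also have "\<dots> = (\<Sum>i<J. \<Sum>j<J. \<Sum>l<J. \<theta> i * \<theta> j * (of_bool (l < min i j) * (u (Suc l) - u l)))"
    by (subst sum.swap, rule sum.cong[OF refl], rule sum.swap)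
  also have "\<dots> = (\<Sum>i<J. \<Sum>j<J. \<theta> i * \<theta> j * u (min i j))"
    by (intro sum.cong refl) (simp only: sum_distrib_left[symmetric], subst u, auto)
  finally show ?thesis .
qed

text \<open>The linear combination is rewritten in independent increments: the increment after time
  l carries the sum of all coefficients with index above l. The case s = 0 is separate because the
  times s * u j are then not strictly increasing.\<close>

lemma wiener_fdd_fixed:
  assumes "prob_space M" and W: "wiener_process M W" and s: "0 \<le> s"
    and u: "u 0 = 0" "\<And>j. u j < u (Suc j)"
  shows "integral\<^sup>L M (\<lambda>\<omega>. cos ((\<Sum>j<J. \<theta> j * W (s * u j) \<omega>) + \<phi>))
     = cos \<phi> * exp (- (s * (\<Sum>i<J. \<Sum>j<J. \<theta> i * \<theta> j * u (min i j)) / 2))"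
proof -
  interpret prob_space M by fact
  note [measurable] = wiener_measurable[OF W]
  show ?thesis
  proof (cases "s = 0")
    case True
    have "integral\<^sup>L M (\<lambda>\<omega>. cos ((\<Sum>j<J. \<theta> j * W (s * u j) \<omega>) + \<phi>)) = integral\<^sup>L M (\<lambda>\<omega>. cos \<phi>)"
      using True wiener_zero[OF W] by (intro Bochner_Integration.integral_cong refl) simp
    then show ?thesis using True by (simp add: prob_space)
  next
    case False
    then have s: "0 < s" using s by simp
    have u0: "0 \<le> u j" for j
    proof (induction j)
      case (Suc j)
      then show ?case using u(2)[of j] by simp
    qed (simp add: u(1))
    define Y where "Y l \<omega> = W (s * u (Suc l)) \<omega> - W (s * u l) \<omega>" for l \<omega>
    define \<Theta> where "\<Theta> l = (\<Sum>j\<in>{l<..<J}. \<theta> j)" for l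
    define \<sigma> where "\<sigma> l = sqrt (s * u (Suc l) - s * u l)" for l
    have mono: "s * u l < s * u (Suc l)" for l using s u(2)[of l] by simp
    have \<sigma>: "0 < \<sigma> l" "(\<sigma> l)\<^sup>2 = s * (u (Suc l) - u l)" for l
      using mono[of l] by (auto simp: \<sigma>_def right_diff_distrib)
    have [measurable]: "Y l \<in> borel_measurable M" for l unfolding Y_def[abs_def] by measurable
    have dist: "distributed M lborel (Y l) (\<lambda>x. ennreal (normal_density 0 (\<sigma> l) x))" for l
      using W mono[of l] u0[of l] s unfolding wiener_process_def Y_def[abs_def] \<sigma>_def by auto
    have ind: "indep_vars (\<lambda>_. borel) Y {..<J}"
      unfolding Y_def[abs_def] using mono u0 s by (intro wiener_indep_increments[OF W, where ts="\<lambda>j. s * u j"]) auto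
    have ind2: "indep_vars (\<lambda>_. borel) (\<lambda>l \<omega>. \<Theta> l * Y l \<omega>) {..<J}"
      using indep_vars_compose2[OF ind, of "\<lambda>l x. \<Theta> l * x" "\<lambda>_. borel"] by simp
    define S where "S \<omega> = (\<Sum>l<J. \<Theta> l * Y l \<omega>)" for \<omega>
    have "char (distr M borel S) 1 = (\<Prod>l<J. char (distr M borel (\<lambda>\<omega>. \<Theta> l * Y l \<omega>)) 1)"
      unfolding S_def[abs_def] by (rule char_distr_sum[OF ind2])
    also have "\<dots> = (\<Prod>l<J. complex_of_real (exp (- ((\<Theta> l)\<^sup>2 * (\<sigma> l)\<^sup>2) / 2)))"
      by (intro prod.cong refl char_normal dist \<sigma>)
    also have "\<dots> = complex_of_real (exp (\<Sum>l<J. - ((\<Theta> l)\<^sup>2 * (\<sigma> l)\<^sup>2) / 2))"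
      by (simp add: exp_sum)
    also have "(\<Sum>l<J. - ((\<Theta> l)\<^sup>2 * (\<sigma> l)\<^sup>2) / 2) = - (s * (\<Sum>l<J. (\<Theta> l)\<^sup>2 * (u (Suc l) - u l)) / 2)"
      by (simp add: \<sigma>(2) sum_distrib_left sum_divide_distrib sum_negf mult_ac)
    also have "(\<Sum>l<J. (\<Theta> l)\<^sup>2 * (u (Suc l) - u l)) = (\<Sum>i<J. \<Sum>j<J. \<theta> i * \<theta> j * u (min i j))"
      unfolding \<Theta>_def by (rule sum_min_increments) (rule u(1))
    finally have ch: "char (distr M borel S) 1 = complex_of_real (exp (- (s * (\<Sum>i<J. \<Sum>j<J. \<theta> i * \<theta> j * u (min i j)) / 2)))" .
    have S_eq: "S \<omega> = (\<Sum>j<J. \<theta> j * W (s * u j) \<omega>)" if w: "\<omega> \<in> space M" for \<omega>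
    proof -
      have Wj: "W (s * u j) \<omega> = (\<Sum>l<J. of_bool (l < j) * Y l \<omega>)" if "j < J" for j
      proof -
        have "(\<Sum>l<J. of_bool (l < j) * Y l \<omega>) = (\<Sum>l<j. Y l \<omega>)"
          using that by (intro sum.mono_neutral_cong_right) auto
        also have "\<dots> = W (s * u j) \<omega> - W (s * u 0) \<omega>"
          unfolding Y_def by (rule sum_lessThan_telescope)
        finally show ?thesis using wiener_zero[OF W w] u(1) by simp
      qed
      have "S \<omega> = (\<Sum>l<J. \<Sum>j<J. \<theta> j * (of_bool (l < j) * Y l \<omega>))"
      proof -
        have "\<Theta> l = (\<Sum>j<J. of_bool (l < j) * \<theta> j)" for l
          unfolding \<Theta>_def by (intro sum.mono_neutral_cong_left) auto
        then show ?thesis unfolding S_def by (simp only: sum_distrib_right mult.assoc mult.left_commute)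
      qed
      also have "\<dots> = (\<Sum>j<J. \<Sum>l<J. \<theta> j * (of_bool (l < j) * Y l \<omega>))" by (rule sum.swap)
      also have "\<dots> = (\<Sum>j<J. \<theta> j * W (s * u j) \<omega>)"
        by (intro sum.cong refl) (simp only: Wj sum_distrib_left[symmetric] lessThan_iff)
      finally show ?thesis .
    qed
    have "expectation (\<lambda>\<omega>. cos (S \<omega> + \<phi>)) = cos \<phi> * exp (- (s * (\<Sum>i<J. \<Sum>j<J. \<theta> i * \<theta> j * u (min i j)) / 2))"
      by (rule expectation_cos_of_char[OF _ ch]) (simp add: S_def[abs_def])
    moreover have "expectation (\<lambda>\<omega>. cos (S \<omega> + \<phi>)) = expectation (\<lambda>\<omega>. cos ((\<Sum>j<J. \<theta> j * W (s * u j) \<omega>) + \<phi>))"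
      by (intro Bochner_Integration.integral_cong refl) (simp only: S_eq)
    ultimately show ?thesis by simp
  qed
qed

lemma floor_grid_tendsto:
  assumes "0 \<le> v"
  shows "(\<lambda>k. real (nat \<lfloor>real k * v\<rfloor>) / real k) \<longlonglongrightarrow> v"
  using assms floor_ratio_tendsto[of v] by (cases "v = 0") auto

text \<open>After rounding, the time takes countably many values, each giving a measurable value of
  W; path continuity removes the rounding.\<close>

lemma wiener_random_time_measurable:
  assumes "prob_space M" and W: "wiener_process M W" and v [measurable]: "v \<in> borel_measurable M"
    and v0: "\<And>\<omega>. \<omega> \<in> space M \<Longrightarrow> 0 \<le> v \<omega>" and s: "0 \<le> s"
  shows "(\<lambda>\<omega>. W (s * v \<omega>) \<omega>) \<in> borel_measurable M"
proof (rule borel_measurable_LIMSEQ_real)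
  fix k :: nat
  show "(\<lambda>\<omega>. W (s * (real (nat \<lfloor>real k * v \<omega>\<rfloor>) / real k)) \<omega>) \<in> borel_measurable M"
  proof (rule measurable_compose_countable'[where f="\<lambda>l \<omega>. W (s * (real l / real k)) \<omega>" and g="\<lambda>\<omega>. nat \<lfloor>real k * v \<omega>\<rfloor>" and I=UNIV])
    show "(\<lambda>\<omega>. nat \<lfloor>real k * v \<omega>\<rfloor>) \<in> measurable M (count_space UNIV)" by measurable
  qed (auto intro: wiener_measurable[OF W])
next
  fix \<omega> assume w: "\<omega> \<in> space M"
  have "(\<lambda>k. s * (real (nat \<lfloor>real k * v \<omega>\<rfloor>) / real k)) \<longlonglongrightarrow> s * v \<omega>"
    by (intro tendsto_intros floor_grid_tendsto v0 w)
  then show "(\<lambda>k. W (s * (real (nat \<lfloor>real k * v \<omega>\<rfloor>) / real k)) \<omega>) \<longlonglongrightarrow> W (s * v \<omega>) \<omega>"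
    using s v0[OF w] by (intro continuous_on_tendsto_compose[OF wiener_continuous[OF W w]]) auto
qed

text \<open>
  Evaluation at a random time is not measurable on the product space of all paths, so the random time is
  first discretised.
\<close>

lemma wiener_fdd_random:
  assumes "prob_space M" and W: "wiener_process M W"
    and Z [measurable]: "Z \<in> borel_measurable M" and h [measurable]: "h \<in> borel_measurable borel"
    and hb: "\<And>z. 0 \<le> h z" "\<And>z. h z \<le> 1"
    and ind: "prob_space.indep_var M (PiM UNIV (\<lambda>_. borel)) (\<lambda>\<omega> t. W t \<omega>) (PiM UNIV (\<lambda>_. borel)) (\<lambda>\<omega> (_::real). Z \<omega>)"
    and u: "u 0 = 0" "\<And>j. u j < u (Suc j)" and Q: "0 \<le> (\<Sum>i<J. \<Sum>j<J. \<theta> i * \<theta> j * u (min i j))"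
    and s: "0 \<le> s"
  shows "integral\<^sup>L M (\<lambda>\<omega>. cos ((\<Sum>j<J. \<theta> j * W (s * u j * h (Z \<omega>)) \<omega>) + \<phi>))
     = integral\<^sup>L M (\<lambda>\<omega>. cos \<phi> * exp (- (h (Z \<omega>) * (s * (\<Sum>i<J. \<Sum>j<J. \<theta> i * \<theta> j * u (min i j))) / 2)))"
proof -
  interpret prob_space M by fact
  note [measurable] = wiener_measurable[OF W]
  define q where "q = (\<Sum>i<J. \<Sum>j<J. \<theta> i * \<theta> j * u (min i j))"
  have u0: "0 \<le> u j" for j
  proof (induction j)
    case (Suc j)
    then show ?case using u(2)[of j] by simp
  qed (simp add: u(1))
  \<comment> \<open>The rounded speed is L / k. Since h \<le> 1, L has at most k + 1 values, and on
    each event L = l the times are deterministic, so independence factorises the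
    expectation.\<close>
  define L where "L k \<omega> = nat \<lfloor>real k * h (Z \<omega>)\<rfloor>" for k \<omega>
  have L_meas [measurable]: "L k \<in> measurable M (count_space UNIV)" for k unfolding L_def[abs_def] by measurable
  have L_le: "L k \<omega> \<le> k" for k \<omega>
  proof -
    have "real k * h (Z \<omega>) \<le> real k * 1" by (intro mult_left_mono hb) simp
    then show ?thesis unfolding L_def by linarith
  qed
  have L_lim: "(\<lambda>k. real (L k \<omega>) / real k) \<longlonglongrightarrow> h (Z \<omega>)" for \<omega>
    unfolding L_def by (intro floor_grid_tendsto hb)
  define f where "f k l \<omega> = cos ((\<Sum>j<J. \<theta> j * W (s * (real l / real k) * u j) \<omega>) + \<phi>)" for k l \<omega>
  have f_meas [measurable]: "f k l \<in> borel_measurable M" for k l unfolding f_def[abs_def] by measurable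
  have f_le: "\<bar>f k l \<omega>\<bar> \<le> 1" for k l \<omega> by (simp add: f_def)
  have f_exp: "expectation (f k l) = cos \<phi> * exp (- (s * (real l / real k) * q / 2))" for k l
    unfolding f_def[abs_def] q_def using s by (intro wiener_fdd_fixed[OF \<open>prob_space M\<close> W _ u]) auto
  have indep: "expectation (\<lambda>\<omega>. f k l \<omega> * of_bool (L k \<omega> = l)) = expectation (f k l) * expectation (\<lambda>\<omega>. of_bool (L k \<omega> = l))" for k l
  proof (rule indep_var_lebesgue_integral)
    \<comment> \<open>For fixed l only finitely many coordinates of the path are read, which makes
      this functional measurable for the product sigma-algebra; the constant path is read at
      0.\<close>
    have fm: "(\<lambda>w. cos ((\<Sum>j<J. \<theta> j * w (s * (real l / real k) * u j)) + \<phi>)) \<in> borel_measurable (PiM UNIV (\<lambda>_. borel))" by measurable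
    have gm: "(\<lambda>w. of_bool (nat \<lfloor>real k * h (w (0::real))\<rfloor> = l) :: real) \<in> borel_measurable (PiM UNIV (\<lambda>_. borel))" by measurable
    have "indep_var borel ((\<lambda>w. cos ((\<Sum>j<J. \<theta> j * w (s * (real l / real k) * u j)) + \<phi>)) \<circ> (\<lambda>\<omega> t. W t \<omega>))
       borel ((\<lambda>w. of_bool (nat \<lfloor>real k * h (w (0::real))\<rfloor> = l) :: real) \<circ> (\<lambda>\<omega> _. Z \<omega>))"
      by (rule indep_var_compose[OF ind fm gm])
    then show "indep_var borel (f k l) borel (\<lambda>\<omega>. of_bool (L k \<omega> = l) :: real)"
      by (simp add: comp_def f_def[abs_def] L_def)
    show "integrable M (f k l)" by (rule integrable_bounded[of _ 1]) (auto simp: f_le)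
    show "integrable M (\<lambda>\<omega>. of_bool (L k \<omega> = l) :: real)" by (rule integrable_bounded[of _ 1]) auto
  qed
  have split: "g (L k \<omega>) \<omega> = (\<Sum>l\<le>k. g l \<omega> * of_bool (L k \<omega> = l))" for g :: "nat \<Rightarrow> 'a \<Rightarrow> real" and k \<omega>
  proof -
    have "(\<Sum>l\<le>k. g l \<omega> * of_bool (L k \<omega> = l)) = (\<Sum>l\<le>k. if L k \<omega> = l then g l \<omega> else 0)"
      by (intro sum.cong) auto
    then show ?thesis using L_le[of k \<omega>] by simp
  qed
  have step: "expectation (\<lambda>\<omega>. f k (L k \<omega>) \<omega>) = expectation (\<lambda>\<omega>. cos \<phi> * exp (- (s * (real (L k \<omega>) / real k) * q / 2)))" for k
  proof -
    have i1: "integrable M (\<lambda>\<omega>. f k l \<omega> * of_bool (L k \<omega> = l))" for l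
      by (rule integrable_bounded[of _ 1]) (use f_le in auto)
    have i2: "integrable M (\<lambda>\<omega>. of_bool (L k \<omega> = l) :: real)" for l
      by (rule integrable_bounded[of _ 1]) auto
    have "expectation (\<lambda>\<omega>. f k (L k \<omega>) \<omega>) = (\<Sum>l\<le>k. expectation (\<lambda>\<omega>. f k l \<omega> * of_bool (L k \<omega> = l)))"
      unfolding split[of "f k"] by (rule Bochner_Integration.integral_sum) (rule i1)
    also have "\<dots> = (\<Sum>l\<le>k. expectation (\<lambda>\<omega>. cos \<phi> * exp (- (s * (real l / real k) * q / 2)) * of_bool (L k \<omega> = l)))"
      unfolding indep f_exp by simp
    also have "\<dots> = expectation (\<lambda>\<omega>. \<Sum>l\<le>k. cos \<phi> * exp (- (s * (real l / real k) * q / 2)) * of_bool (L k \<omega> = l))"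
      by (rule Bochner_Integration.integral_sum[symmetric]) (intro integrable_mult_right i2)
    also have "\<dots> = expectation (\<lambda>\<omega>. cos \<phi> * exp (- (s * (real (L k \<omega>) / real k) * q / 2)))"
      unfolding split[of "\<lambda>l _. cos \<phi> * exp (- (s * (real l / real k) * q / 2))"] ..
    finally show ?thesis .
  qed
  have fL_meas: "(\<lambda>\<omega>. f k (L k \<omega>) \<omega>) \<in> borel_measurable M" for k
    by (rule measurable_compose_countable'[where f="f k" and g="L k" and I=UNIV]) auto
  have lim_meas: "(\<lambda>\<omega>. W (s * u j * h (Z \<omega>)) \<omega>) \<in> borel_measurable M" for j
    using s u0 by (intro wiener_random_time_measurable[OF \<open>prob_space M\<close> W]) (auto simp: hb)
  have 1: "(\<lambda>k. expectation (\<lambda>\<omega>. f k (L k \<omega>) \<omega>)) \<longlonglongrightarrow> expectation (\<lambda>\<omega>. cos ((\<Sum>j<J. \<theta> j * W (s * u j * h (Z \<omega>)) \<omega>) + \<phi>))"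
  proof (rule integral_dominated_convergence[where w="\<lambda>_. 1"])
    show "(\<lambda>\<omega>. cos ((\<Sum>j<J. \<theta> j * W (s * u j * h (Z \<omega>)) \<omega>) + \<phi>)) \<in> borel_measurable M"
      using lim_meas by measurable
    show "AE \<omega> in M. (\<lambda>k. f k (L k \<omega>) \<omega>) \<longlonglongrightarrow> cos ((\<Sum>j<J. \<theta> j * W (s * u j * h (Z \<omega>)) \<omega>) + \<phi>)"
    proof (rule AE_I2)
      fix \<omega> assume w: "\<omega> \<in> space M"
      have "(\<lambda>k. W (s * (real (L k \<omega>) / real k) * u j) \<omega>) \<longlonglongrightarrow> W (s * u j * h (Z \<omega>)) \<omega>" for j
      proof (rule continuous_on_tendsto_compose[OF wiener_continuous[OF W w]])
        have "(\<lambda>k. s * (real (L k \<omega>) / real k) * u j) \<longlonglongrightarrow> s * h (Z \<omega>) * u j" by (intro tendsto_intros L_lim)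
        then show "(\<lambda>k. s * (real (L k \<omega>) / real k) * u j) \<longlonglongrightarrow> s * u j * h (Z \<omega>)" by (simp add: mult_ac)
      qed (use s u0 hb in auto)
      then show "(\<lambda>k. f k (L k \<omega>) \<omega>) \<longlonglongrightarrow> cos ((\<Sum>j<J. \<theta> j * W (s * u j * h (Z \<omega>)) \<omega>) + \<phi>)"
        unfolding f_def by (intro tendsto_intros)
    qed
  qed (use f_le fL_meas in auto)
  have 2: "(\<lambda>k. expectation (\<lambda>\<omega>. cos \<phi> * exp (- (s * (real (L k \<omega>) / real k) * q / 2))))
      \<longlonglongrightarrow> expectation (\<lambda>\<omega>. cos \<phi> * exp (- (s * h (Z \<omega>) * q / 2)))"
  proof (rule integral_dominated_convergence[where w="\<lambda>_. 1"])
    show "AE \<omega> in M. (\<lambda>k. cos \<phi> * exp (- (s * (real (L k \<omega>) / real k) * q / 2))) \<longlonglongrightarrow> cos \<phi> * exp (- (s * h (Z \<omega>) * q / 2))"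
      by (intro AE_I2 tendsto_intros L_lim) auto
    show "AE \<omega> in M. norm (cos \<phi> * exp (- (s * (real (L k \<omega>) / real k) * q / 2))) \<le> 1" for k
    proof (rule AE_I2)
      fix \<omega>
      have "0 \<le> s * (real (L k \<omega>) / real k) * q / 2" using s Q by (simp add: q_def)
      then have "\<bar>cos \<phi>\<bar> * exp (- (s * (real (L k \<omega>) / real k) * q / 2)) \<le> 1 * 1" by (intro mult_mono) auto
      then show "norm (cos \<phi> * exp (- (s * (real (L k \<omega>) / real k) * q / 2))) \<le> 1" by (simp add: abs_mult)
    qed
  qed auto
  show ?thesis using LIMSEQ_unique[OF 1 2[folded step]] by (simp add: q_def mult_ac)
qed

section \<open>The rescaled paths as elements of the path space, and their convergence\<close>

lemma cadlag_local:
  assumes "\<And>T. 0 < T \<Longrightarrow> \<exists>y. cadlag y \<and> (\<forall>t. 0 \<le> t \<and> t < T \<longrightarrow> x t = y t)"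
  shows "cadlag x"
  unfolding cadlag_def
proof (intro conjI allI impI)
  fix t :: real assume t: "0 \<le> t"
  obtain y where y: "cadlag y" "\<And>s. 0 \<le> s \<Longrightarrow> s < t + 1 \<Longrightarrow> x s = y s" using assms[of "t + 1"] t by auto
  have "(y \<longlongrightarrow> y t) (at_right t)" using y(1) t by (simp add: cadlag_def continuous_within)
  moreover have "\<forall>\<^sub>F s in at_right t. y s = x s"
    using t y(2) by (auto simp: eventually_at_right_field intro!: exI[of _ "t + 1"])
  ultimately have "(x \<longlongrightarrow> y t) (at_right t)" by (rule Lim_transform_eventually)
  then show "continuous (at_right t) x" using y(2)[of t] t by (simp add: continuous_within)
next
  fix t :: real assume t: "0 < t"
  obtain y where y: "cadlag y" "\<And>s. 0 \<le> s \<Longrightarrow> s < t + 1 \<Longrightarrow> x s = y s" using assms[of "t + 1"] t by auto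
  obtain l where "(y \<longlongrightarrow> l) (at_left t)" using y(1) t by (auto simp: cadlag_def)
  moreover have "\<forall>\<^sub>F s in at_left t. y s = x s"
    using t y(2) by (auto simp: eventually_at_left_field intro!: exI[of _ 0])
  ultimately show "\<exists>l. (x \<longlongrightarrow> l) (at_left t)" using Lim_transform_eventually by blast
qed

lemma continuous_on_powr_atLeast: "0 < a \<Longrightarrow> continuous_on {0..} (\<lambda>t::real. t powr a)"
  by (intro continuous_on_powr') (auto intro: continuous_intros)

context urns
begin

lemma X_stepwise:
  assumes "0 < n" "0 \<le> t" "t < real m / real n"
  shows "X n \<omega> t = (\<Sum>k<m. (t powr a * indicator {real k / real n..<real (Suc k) / real n} t) * (real n powr (\<gamma> - 1/2) * (A k \<omega> - Zlim \<omega>)))"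
proof -
  have "X n \<omega> t = t powr a * step_path n m (\<lambda>k. real n powr (\<gamma> - 1/2) * (A k \<omega> - Zlim \<omega>)) t"
    unfolding X_def by (subst step_eq[OF assms]) (simp add: mult.assoc)
  then show ?thesis unfolding step_path_def sum_distrib_left mult.assoc .
qed

lemma cadlag_powr_indicator: "cadlag (\<lambda>t. t powr a * indicator {s..<s'} t)"
  using a_bounds by (intro cadlag_mult cadlag_indicator cadlag_continuous continuous_on_powr_atLeast)

lemma X_zero: "X 0 \<omega> = (\<lambda>_. 0)"
  by (simp add: X_def fun_eq_iff)

lemma X_in_skD: "X n \<omega> \<in> skD"
proof (cases "n = 0")
  case False
  have "cadlag (X n \<omega>)"
  proof (rule cadlag_local)
    fix T :: real assume "0 < T"
    define m where "m = nat \<lceil>T * real n\<rceil>"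
    have "T * real n \<le> real m" unfolding m_def by linarith
    then have m: "T \<le> real m / real n" using False by (simp add: field_simps)
    show "\<exists>y. cadlag y \<and> (\<forall>t. 0 \<le> t \<and> t < T \<longrightarrow> X n \<omega> t = y t)"
    proof (intro exI conjI allI impI)
      fix t assume "0 \<le> t \<and> t < T"
      then show "X n \<omega> t = (\<Sum>k<m. (t powr a * indicator {real k / real n..<real (Suc k) / real n} t) * (real n powr (\<gamma> - 1/2) * (A k \<omega> - Zlim \<omega>)))"
        using m False by (intro X_stepwise) auto
    qed (intro cadlag_sum cadlag_mult[OF cadlag_powr_indicator cadlag_const])
  qed
  then show ?thesis by (simp add: skD_def)
qed (simp add: X_zero zero_in_skD)

text \<open>Up to time m / n the path is a combination of m deterministic profiles with random
  coefficients. The indicators bound the profiles on the whole half-line, and the truncated paths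
  approximate with error exp (- m / n).\<close>

lemma ud_continuous_X_measurable:
  assumes G: "ud_continuous G"
  shows "(\<lambda>\<omega>. G (X n \<omega>)) \<in> borel_measurable M"
proof (cases "n = 0")
  case False
  define Y where "Y m \<omega> = (\<lambda>t. \<Sum>k<m. (t powr a * indicator {real k / real n..<real (Suc k) / real n} t) * (real n powr (\<gamma> - 1/2) * (A k \<omega> - Zlim \<omega>)))" for m \<omega>
  show ?thesis
  proof (rule ud_continuous_measurable_lim[OF G])
    show "X n \<omega> \<in> skD" for \<omega> by (rule X_in_skD)
    show "Y m \<omega> \<in> skD" for m \<omega>
      unfolding skD_def Y_def by (rule CollectI) (intro cadlag_sum cadlag_mult[OF cadlag_powr_indicator cadlag_const])
    show "(\<lambda>\<omega>. G (Y m \<omega>)) \<in> borel_measurable M" for m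
      unfolding Y_def
    proof (rule ud_continuous_finite_measurable[OF G, where C="(real m / real n) powr a"])
      show "cadlag (\<lambda>t. t powr a * indicator {real k / real n..<real (Suc k) / real n} t)" for k by (rule cadlag_powr_indicator)
      show "\<bar>t powr a * indicator {real k / real n..<real (Suc k) / real n} t\<bar> \<le> (real m / real n) powr a" if "k < m" "0 \<le> t" for k t
      proof (cases "t \<in> {real k / real n..<real (Suc k) / real n}")
        case True
        have "real (Suc k) / real n \<le> real m / real n" using that by (intro divide_right_mono) auto
        then have "t \<le> real m / real n" using True by auto
        then have "t powr a \<le> (real m / real n) powr a" using that a_bounds by (intro powr_mono2) auto
        then show ?thesis using True by simp
      qed simp
      show "(\<lambda>\<omega>. real n powr (\<gamma> - 1/2) * (A k \<omega> - Zlim \<omega>)) \<in> borel_measurable M" for k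
        using Zlim_meas bdm_measurable[OF bdm_A] by measurable
    qed
    show "(\<lambda>m. ud (X n \<omega>) (Y m \<omega>)) \<longlonglongrightarrow> 0" for \<omega>
    proof (rule tendsto_sandwich[where f="\<lambda>_. 0" and h="\<lambda>m. exp (- (real m / real n))"])
      show "\<forall>\<^sub>F m in sequentially. ud (X n \<omega>) (Y m \<omega>) \<le> exp (- (real m / real n))"
      proof (rule always_eventually, rule allI)
        fix m
        have "ud (X n \<omega>) (Y m \<omega>) \<le> 0 + exp (- (real m / real n))"
        proof (rule ud_le_uniform)
          fix t assume "0 \<le> t" "t < real m / real n"
          then have "X n \<omega> t = Y m \<omega> t" unfolding Y_def using False by (intro X_stepwise) auto
          then show "\<bar>X n \<omega> t - Y m \<omega> t\<bar> \<le> 0" by simp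
        qed simp
        then show "ud (X n \<omega>) (Y m \<omega>) \<le> exp (- (real m / real n))" by simp
      qed
      have "0 < real n" using False by simp
      then show "(\<lambda>m. exp (- (real m / real n))) \<longlonglongrightarrow> 0" by real_asymp
    qed (auto simp: ud_nonneg)
  qed
qed (simp add: X_zero)

theorem X_conv_distr:
  fixes M' :: "'b measure"
  assumes "prob_space M'" and W: "wiener_process M' W"
    and Z': "Z' \<in> borel_measurable M'" "\<And>\<omega>. \<omega> \<in> space M' \<Longrightarrow> Z' \<omega> \<in> {0..1}"
    and distr: "distr M' borel Z' = distr M borel Zlim"
    and ind: "prob_space.indep_var M' (PiM UNIV (\<lambda>_. borel)) (\<lambda>\<omega> t. W t \<omega>) (PiM UNIV (\<lambda>_. borel)) (\<lambda>\<omega> (_::real). Z' \<omega>)"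
  shows "conv_distr_skorohod M X M' (\<lambda>\<omega> t. W (c\<^sup>2 / (real N * a) * Z' \<omega> * (1 - Z' \<omega>) * t powr a) \<omega>)"
proof -
  interpret M': prob_space M' by fact
  note [measurable] = Z'(1) Zlim_meas
  define \<kappa> where "\<kappa> = c\<^sup>2 / (real N * a)"
  have \<kappa>: "0 < \<kappa>" using c_pos N a_bounds by (simp add: \<kappa>_def)
  \<comment> \<open>Agrees with z * (1 - z) on [0, 1] and is clamped elsewhere, so that the bounds
    required of the random speed hold for every real argument.\<close>
  define h where "h z = max 0 (min 1 (z * (1 - z)))" for z :: real
  have h [measurable]: "h \<in> borel_measurable borel" unfolding h_def[abs_def] by measurable
  have hb: "0 \<le> h z" "h z \<le> 1" for z by (auto simp: h_def)
  have h_eq: "h z = z * (1 - z)" if "0 \<le> z" "z \<le> 1" for z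
    using that mult_mono[of z 1 "1 - z" 1] by (simp add: h_def)
  define Y where "Y \<omega> t = W (\<kappa> * t powr a * h (Z' \<omega>)) \<omega>" for \<omega> t
  have Y_eq: "(\<lambda>t. W (c\<^sup>2 / (real N * a) * Z' \<omega> * (1 - Z' \<omega>) * t powr a) \<omega>) = Y \<omega>" if "\<omega> \<in> space M'" for \<omega>
    using Z'(2)[OF that] by (simp add: fun_eq_iff Y_def h_eq \<kappa>_def mult_ac)
  have "conv_distr_skorohod M X M' Y"
  proof (rule conv_distr_skorohod_criterion[OF prob_space_axioms \<open>prob_space M'\<close>])
    show "X n \<omega> \<in> skD" for n \<omega> by (rule X_in_skD)
    show "(\<lambda>\<omega>. X n \<omega> t) \<in> borel_measurable M" for n t by (rule X_measurable)
    show "(\<lambda>\<omega>. G (X n \<omega>)) \<in> borel_measurable M" if "ud_continuous G" for G n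
      by (rule ud_continuous_X_measurable[OF that])
    show "continuous_on {0..} (Y \<omega>)" if w: "\<omega> \<in> space M'" for \<omega>
      unfolding Y_def
    proof (rule continuous_on_compose2[OF wiener_continuous[OF W w]])
      show "continuous_on {0..} (\<lambda>t. \<kappa> * t powr a * h (Z' \<omega>))"
        using a_bounds by (intro continuous_on_mult continuous_on_const continuous_on_powr_atLeast)
    qed (use \<kappa> hb in auto)
    show "(\<lambda>\<omega>. Y \<omega> t) \<in> borel_measurable M'" for t
      unfolding Y_def using \<kappa> hb by (intro wiener_random_time_measurable[OF \<open>prob_space M'\<close> W]) auto
    show "\<forall>\<^sub>F K in sequentially. \<forall>\<^sub>F n in sequentially.
        \<exists>B\<in>sets M. measure M B \<le> \<epsilon> \<and> (\<forall>\<omega>\<in>space M - B. \<forall>t. 0 \<le> t \<and> t < T \<longrightarrow>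
           \<bar>X n \<omega> t - X n \<omega> (real (nat \<lfloor>real K * t\<rfloor>) / real K)\<bar> \<le> \<eta>)" if "0 < T" "0 < \<eta>" "0 < \<epsilon>" for T \<eta> \<epsilon>
      using that by (rule oscillation)
    fix K J \<theta> \<phi> assume K: "0 < (K::nat)"
    define u where "u j = (real j / real K) powr a" for j :: nat
    define q where "q = (\<Sum>i<J. \<Sum>j<J. \<theta> i * \<theta> j * u (min i j))"
    have u: "u 0 = 0" "u j < u (Suc j)" for j
      using a_bounds K by (auto simp: u_def intro!: powr_less_mono2 divide_strict_right_mono)
    have q: "0 \<le> q"
      unfolding q_def by (subst sum_min_increments[symmetric, of u]) (auto intro!: sum_nonneg simp: u less_imp_le)
    have "(\<integral>\<omega>. cos ((\<Sum>j<J. \<theta> j * Y \<omega> (real j / real K)) + \<phi>) \<partial>M') = (\<integral>\<omega>. cos \<phi> * exp (- (h (Z' \<omega>) * (\<kappa> * q) / 2)) \<partial>M')"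
      unfolding Y_def q_def u_def[symmetric]
      using \<kappa> q by (intro wiener_fdd_random[OF \<open>prob_space M'\<close> W Z'(1) h hb ind u]) (auto simp: q_def)
    \<comment> \<open>The expression depends on Z' through its law alone, so it can be moved to the
      space of the urns, where it is the limit found in \<open>fdd_lim\<close>.\<close>
    also have "\<dots> = (\<integral>z. cos \<phi> * exp (- (h z * (\<kappa> * q) / 2)) \<partial>distr M' borel Z')"
      by (rule integral_distr[symmetric]) auto
    also have "\<dots> = (\<integral>\<omega>. cos \<phi> * exp (- (h (Zlim \<omega>) * (\<kappa> * q) / 2)) \<partial>M)"
      unfolding distr by (rule integral_distr) auto
    also have "\<dots> = (\<integral>\<omega>. cos \<phi> * exp (- (vlim \<omega> * (\<kappa> * q) / 2)) \<partial>M)"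
    proof (rule integral_cong_AE)
      show "AE \<omega> in M. cos \<phi> * exp (- (h (Zlim \<omega>) * (\<kappa> * q) / 2)) = cos \<phi> * exp (- (vlim \<omega> * (\<kappa> * q) / 2))"
        using Zlim_range by eventually_elim (simp add: h_eq vlim_def)
    qed measurable
    finally show "(\<lambda>n. \<integral>\<omega>. cos ((\<Sum>j<J. \<theta> j * X n \<omega> (real j / real K)) + \<phi>) \<partial>M)
        \<longlonglongrightarrow> (\<integral>\<omega>. cos ((\<Sum>j<J. \<theta> j * Y \<omega> (real j / real K)) + \<phi>) \<partial>M')"
      using fdd_lim[OF K, where J=J and \<theta>=\<theta> and \<phi>=\<phi>] by (simp only: \<kappa>_def q_def u_def)
  qed
  moreover have "(\<integral>\<omega>. f (Y \<omega>) \<partial>M') = (\<integral>\<omega>. f (\<lambda>t. W (c\<^sup>2 / (real N * a) * Z' \<omega> * (1 - Z' \<omega>) * t powr a) \<omega>) \<partial>M')" for f :: "(real \<Rightarrow> real) \<Rightarrow> real"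
    by (intro Bochner_Integration.integral_cong refl) (simp only: Y_eq)
  ultimately show ?thesis unfolding conv_distr_skorohod_def by simp
qed

end

text \<open>Convergence in distribution concerns laws only, so the limit is represented by any
  Wiener process W and any independent Z' with the law of the limit, on a common space; V is then a
  function of Z'. In the independence hypothesis Z' enters as a constant path because both arguments
  of \<open>indep_var\<close> have the same type.\<close>

theorem theorem2p5:
  fixes M :: "'a measure" and N :: nat and \<alpha> \<gamma> c :: real and r :: "nat \<Rightarrow> real"
    and Z :: "nat \<Rightarrow> nat \<Rightarrow> 'a \<Rightarrow> real" and I :: "nat \<Rightarrow> nat \<Rightarrow> 'a \<Rightarrow> real"
    and Zlim :: "'a \<Rightarrow> real"
  assumes prob: "prob_space M"
    and N: "N \<ge> 1"
    and alpha: "0 < \<alpha>" "\<alpha> \<le> 1"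
    and gamma: "1/2 < \<gamma>" "\<gamma> \<le> 1"
    and r_bounds: "\<And>n. 0 \<le> r n \<and> r n < 1"
    and r_lim: "(\<lambda>n. real n powr \<gamma> * r n) \<longlonglongrightarrow> c" and c_pos: "c > 0"
    and Z_meas: "\<And>n i. i < N \<Longrightarrow> Z n i \<in> borel_measurable M"
    and I_meas: "\<And>n i. i < N \<Longrightarrow> I n i \<in> borel_measurable M"
    and Z_range: "\<And>n i \<omega>. i < N \<Longrightarrow> \<omega> \<in> space M \<Longrightarrow> Z n i \<omega> \<in> {0..1}"
    and I_range: "\<And>n i \<omega>. i < N \<Longrightarrow> \<omega> \<in> space M \<Longrightarrow> I (Suc n) i \<omega> \<in> {0, 1}"
    and dyn: "\<And>n i \<omega>. i < N \<Longrightarrow> \<omega> \<in> space M \<Longrightarrow>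
                Z (Suc n) i \<omega> = (1 - r n) * Z n i \<omega> + r n * I (Suc n) i \<omega>"
    and cond_law: "\<And>n S. S \<subseteq> {..<N} \<Longrightarrow>
          AE \<omega> in M. real_cond_exp M (nat_filtration M N Z n)
                 (indicator {\<omega>\<in>space M. \<forall>i\<in>S. I (Suc n) i \<omega> = 1}) \<omega>
               = (\<Prod>i\<in>S. (1 - \<alpha>) * Z n i \<omega> + \<alpha> * avgZ N Z n \<omega>)"
    and exch: "\<And>\<pi>. \<pi> permutes {..<N} \<Longrightarrow>
          distr M (PiM {..<N} (\<lambda>_. borel)) (\<lambda>\<omega>. \<lambda>i\<in>{..<N}. Z 0 (\<pi> i) \<omega>)
        = distr M (PiM {..<N} (\<lambda>_. borel)) (\<lambda>\<omega>. \<lambda>i\<in>{..<N}. Z 0 i \<omega>)"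
    and mean0: "\<And>i. i < N \<Longrightarrow> integral\<^sup>L M (Z 0 i) = 1/2"
    and var0: "integral\<^sup>L M (\<lambda>\<omega>. avgZ N Z 0 \<omega> * (1 - avgZ N Z 0 \<omega>)) > 0"
    and Zlim_meas: "Zlim \<in> borel_measurable M"
    and Zlim_lim: "AE \<omega> in M. (\<lambda>n. avgZ N Z n \<omega>) \<longlonglongrightarrow> Zlim \<omega>"
  shows "measure M {\<omega>\<in>space M. Zlim \<omega> \<in> {0, 1}} < 1
    \<and> (\<forall>z\<in>{0<..<1}. measure M {\<omega>\<in>space M. Zlim \<omega> = z} = 0)
    \<and> (\<forall>(M' :: 'b measure) W Z'. prob_space M' \<and> wiener_process M' W
          \<and> Z' \<in> borel_measurable M' \<and> (\<forall>\<omega>\<in>space M'. Z' \<omega> \<in> {0..1})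
          \<and> distr M' borel Z' = distr M borel Zlim
          \<and> prob_space.indep_var M' (PiM UNIV (\<lambda>_. borel)) (\<lambda>\<omega> t. W t \<omega>) (PiM UNIV (\<lambda>_. borel)) (\<lambda>\<omega> (_::real). Z' \<omega>)
        \<longrightarrow> conv_distr_skorohod M
              (\<lambda>n \<omega> t. t powr (2 * \<gamma> - 1) * real n powr (\<gamma> - 1/2)
                        * (avgZ N Z (nat \<lfloor>real n * t\<rfloor>) \<omega> - Zlim \<omega>))
              M'
              (\<lambda>\<omega> t. W (c\<^sup>2 / (real N * (2 * \<gamma> - 1)) * Z' \<omega> * (1 - Z' \<omega>) * t powr (2 * \<gamma> - 1)) \<omega>))"
proof -
  interpret urns M N \<alpha> \<gamma> c r Z I Zlim
    by (rule urns.intro[OF prob], unfold_locales) (fact assms)+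
  have "expectation (vA 0) = integral\<^sup>L M (\<lambda>\<omega>. avgZ N Z 0 \<omega> * (1 - avgZ N Z 0 \<omega>))"
    by (simp add: vA_def[abs_def])
  then have pos: "0 < expectation (vA 0)" using var0 by simp
  show ?thesis
  proof (intro conjI ballI allI impI)
    show "measure M {\<omega>\<in>space M. Zlim \<omega> \<in> {0, 1}} < 1" by (rule prob_boundary_less_one[OF pos])
    show "measure M {\<omega>\<in>space M. Zlim \<omega> = z} = 0" if "z \<in> {0<..<1}" for z
      using that by (intro no_atoms) auto
  next
    fix M' :: "'b measure" and W Z'
    assume "prob_space M' \<and> wiener_process M' W
          \<and> Z' \<in> borel_measurable M' \<and> (\<forall>\<omega>\<in>space M'. Z' \<omega> \<in> {0..1})
          \<and> distr M' borel Z' = distr M borel Zlim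
          \<and> prob_space.indep_var M' (PiM UNIV (\<lambda>_. borel)) (\<lambda>\<omega> t. W t \<omega>) (PiM UNIV (\<lambda>_. borel)) (\<lambda>\<omega> (_::real). Z' \<omega>)"
    then have "conv_distr_skorohod M X M' (\<lambda>\<omega> t. W (c\<^sup>2 / (real N * (2 * \<gamma> - 1)) * Z' \<omega> * (1 - Z' \<omega>) * t powr (2 * \<gamma> - 1)) \<omega>)"
      by (intro X_conv_distr) auto
    then show "conv_distr_skorohod M
              (\<lambda>n \<omega> t. t powr (2 * \<gamma> - 1) * real n powr (\<gamma> - 1/2)
                        * (avgZ N Z (nat \<lfloor>real n * t\<rfloor>) \<omega> - Zlim \<omega>))
              M'
              (\<lambda>\<omega> t. W (c\<^sup>2 / (real N * (2 * \<gamma> - 1)) * Z' \<omega> * (1 - Z' \<omega>) * t powr (2 * \<gamma> - 1)) \<omega>)"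
      unfolding X_def[abs_def] .
  qed
qed

end
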